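(* Let $a\le b\le c$ be positive integers and consider the $(a,b,c)$ bootstrap percolation model on the cube $[0,L]^3\cap\mathbb Z^3$ with initial density $p$. There exist constants $\gamma_{a,b,c}$ and $\Gamma_{a,b,c}$ such that, as $p\to 0$, \[ \mathbb P([0,L]^3 \text{ internally spanned}) \to 0 \quad\text{for } L < e^{e^{\gamma_{a,b,c} f_{a,b}(1/p)}}, \] \[ \mathbb P([0,L]^3 \text{ internally spanned}) \to 1 \quad\text{for } L > e^{e^{\Gamma_{a,b,c} f_{a,b}(1/p)}}, \] where if $a=b$ then $f_{a,a}(1/p) = p^{-a} + o(p^{-a})$, and if $a<b$ then $f_{a,b}(1/p) = p^{-a}\ln^2 p + o(p^{-a}\ln^2 p)$.
   Context: The $(a,b,c)$ model: the neighborhood of a site $(x,y,z)\in\mathbb Z^3$ consists of the sites $(x\pm i,y,z)$ for $1\le i\le a$, $(x,y\pm j,z)$ for $1\le j\le b$, and $(x,y,z\pm k)$ for $1\le k\le c$ (so $2(a+b+c)$ sites). Initially each site of the finite cube $[0,L]^3$ is occupied independently with probability $p$, and empty otherwise (sites outside the cube are never occupied). The configuration evolves by the bootstrap rule: an empty site with at least $a+b+c$ occupied sites in its neighborhood becomes occupied, and occupied sites stay occupied; this is repeated until no new site becomes occupied. The cube is internally spanned (i.s.) if in the final configuration all its sites are occupied. Here $L=L(p)$ and limits are as $p\to 0$; $\ln^2 p=(\ln p)^2$. *)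

theory Defs
  imports "HOL-Analysis.Analysis" "HOL-Library.Landau_Symbols"
begin

type_synonym site = "int \<times> int \<times> int"

definition cube :: "nat \<Rightarrow> site set" where
  "cube L = {0..int L} \<times> {0..int L} \<times> {0..int L}"

definition nbhd :: "nat \<Rightarrow> nat \<Rightarrow> nat \<Rightarrow> site \<Rightarrow> site set" where
  "nbhd a b c s = (case s of (x, y, z) \<Rightarrow>
      {(x + i, y, z) | i. 1 \<le> \<bar>i\<bar> \<and> \<bar>i\<bar> \<le> int a}
    \<union> {(x, y + j, z) | j. 1 \<le> \<bar>j\<bar> \<and> \<bar>j\<bar> \<le> int b}
    \<union> {(x, y, z + k) | k. 1 \<le> \<bar>k\<bar> \<and> \<bar>k\<bar> \<le> int c})"

definition bp_step :: "nat \<Rightarrow> nat \<Rightarrow> nat \<Rightarrow> nat \<Rightarrow> site set \<Rightarrow> site set" where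
  "bp_step a b c L S =
     S \<union> {s \<in> cube L. card (nbhd a b c s \<inter> S) \<ge> a + b + c}"

definition bp_closure :: "nat \<Rightarrow> nat \<Rightarrow> nat \<Rightarrow> nat \<Rightarrow> site set \<Rightarrow> site set" where
  "bp_closure a b c L A = (\<Union>n. (bp_step a b c L ^^ n) A)"

definition internally_spanned :: "nat \<Rightarrow> nat \<Rightarrow> nat \<Rightarrow> nat \<Rightarrow> site set \<Rightarrow> bool" where
  "internally_spanned a b c L A \<longleftrightarrow> cube L \<subseteq> bp_closure a b c L A"

text \<open>Probability, under the product Bernoulli(p) measure on the sites of the cube,
  that the cube is internally spanned.\<close>
definition span_prob :: "nat \<Rightarrow> nat \<Rightarrow> nat \<Rightarrow> nat \<Rightarrow> real \<Rightarrow> real" where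
  "span_prob a b c L p =
     (\<Sum>A \<in> {A. A \<subseteq> cube L \<and> internally_spanned a b c L A}.
        p ^ card A * (1 - p) ^ (card (cube L) - card A))"

end

theory Submission
  imports Defs "HOL-Real_Asymp.Real_Asymp"
begin

text \<open>Lower bound: cut the cube into blocks of layers orthogonal to an axis.  Projecting a block along
  that axis leaves two-dimensional dynamics with the other two weights, and the projection of the
  closure is contained in the closure of the projection.  If the cube is spanned then, by the
  argument of Aizenman and Lebowitz, there is a connected cluster whose diameter is at most about
  \<open>exp (c F)\<close>, where \<open>F\<close> is \<open>p ^ (- a)\<close>, times \<open>(ln p)\<^sup>2\<close> if \<open>a < b\<close>.  It crosses
  many blocks in some direction, so it contains either a large two-dimensional cluster, which costs
  \<open>exp (- c F)\<close>, or a long chain of small clusters using disjoint sets of initial sites, whose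
  probability is bounded by the van den Berg--Kesten inequality.

  Upper bound: a full box helps a site next to a face orthogonal to axis \<open>i\<close> by \<open>r i\<close>, so the
  face evolves with the two remaining weights.  On a \<open>z\<close>-face the weights are \<open>a\<close> and \<open>b\<close>, and
  it fills as soon as a square on it does, with probability \<open>exp (- C F)\<close>, so it fills
  if its side exceeds a power of \<open>Y\<close>, where \<open>Y\<close> is about \<open>exp (C F)\<close>.  A nucleus whose side is a power of
  \<open>Y\<close> has probability at least \<open>exp (- Y ^ 22)\<close> and grows first along \<open>z\<close>, then along \<open>y\<close>, then along
  \<open>x\<close>; a cube with \<open>ln L\<close> at least \<open>Y ^ 24\<close> contains one.\<close>

section \<open>Bernoulli subsets of a finite set\<close>

text \<open>The double exponential comes from comparing two costs. A cluster of diameter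
  \<open>k = exp (c F)\<close> has to cross about \<open>k / F\<close> disjoint slabs, each with
  probability at most 1/2, so it costs about \<open>exp (- k / F)\<close>, and only a cube with
  \<open>ln L\<close> of that order can pay for it. The obstacle inside a slab is that its layers do
  not interact after projection, while a three-dimensional cluster may still step from one layer to
  the next for free. Hence the chains of clusters; their positions are not fixed in advance, so
  plain independence has to be replaced by an inequality for disjoint occurrence. The same
  projection, applied a second time, reduces two-dimensional clusters to lines. To serve all stages
  the dynamics lives on functions from a finite type of axes, and an axis that has been projected
  away gets weight 0. In the upper bound \<open>L\<close> may be arbitrarily large above the
  threshold, and all squares of side \<open>2 ^ Y\<close> in the cube have to fill. Therefore the
  scale \<open>Y\<close> is computed from \<open>L\<close> and not from \<open>p\<close>.\<close>

definition Pr :: "'a set \<Rightarrow> real \<Rightarrow> ('a set \<Rightarrow> bool) \<Rightarrow> real" where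
  "Pr V p E = (\<Sum>A\<in>{A. A \<subseteq> V \<and> E A}. p ^ card A * (1 - p) ^ card (V - A))"

lemma Pr_alt: "finite V \<Longrightarrow> Pr V p E = (\<Sum>A\<in>Pow V. if E A then p ^ card A * (1 - p) ^ card (V - A) else 0)"
  unfolding Pr_def by (subst sum.inter_filter [symmetric]) (auto simp: Pow_def)

lemma Pr_cong: "(\<And>A. A \<subseteq> V \<Longrightarrow> E A = E' A) \<Longrightarrow> Pr V p E = Pr V p E'"
  unfolding Pr_def by (rule sum.cong) auto

lemma Pr_empty [simp]: "Pr {} p E = (if E {} then 1 else 0)"
  by (simp add: Pr_alt)

text \<open>Conditioning on the state of the site \<open>e\<close>. This recursion drives the
  inductions behind the correlation inequalities.\<close>

lemma Pr_insert:
  assumes "finite V" "e \<notin> V"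
  shows "Pr (insert e V) p E = (1 - p) * Pr V p E + p * Pr V p (\<lambda>A. E (insert e A))"
proof -
  let ?f = "\<lambda>A. if E A then p ^ card A * (1 - p) ^ card (insert e V - A) else 0"
  have inj: "inj_on (insert e) (Pow V)"
    using assms(2) by (auto simp: inj_on_def)
  have "Pr (insert e V) p E = sum ?f (Pow V) + sum ?f (insert e ` Pow V)"
    unfolding Pr_alt[OF finite.insertI[OF assms(1)]] Pow_insert
    using assms by (intro sum.union_disjoint) auto
  also have "sum ?f (Pow V) = (1 - p) * Pr V p E"
    unfolding Pr_alt[OF assms(1)] sum_distrib_left
  proof (rule sum.cong, simp)
    fix A assume "A \<in> Pow V"
    then have "insert e V - A = insert e (V - A)" "e \<notin> V - A" "finite (V - A)" using assms by auto
    then show "?f A = (1 - p) * (if E A then p ^ card A * (1 - p) ^ card (V - A) else 0)" by simp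
  qed
  also have "sum ?f (insert e ` Pow V) = p * Pr V p (\<lambda>A. E (insert e A))"
    unfolding Pr_alt[OF assms(1)] sum_distrib_left sum.reindex[OF inj] comp_def
  proof (rule sum.cong, simp)
    fix A assume "A \<in> Pow V"
    then have "insert e V - insert e A = V - A" "e \<notin> A" "finite A" using assms by (auto intro: finite_subset)
    then show "?f (insert e A) = p * (if E (insert e A) then p ^ card A * (1 - p) ^ card (V - A) else 0)" by simp
  qed
  finally show ?thesis .
qed

lemma Pr_True: "finite V \<Longrightarrow> Pr V p (\<lambda>_. True) = 1"
  by (induction V rule: finite_induct) (auto simp: Pr_insert)

lemma Pr_add: 
  assumes "finite V" "\<And>A. A \<subseteq> V \<Longrightarrow> \<not> (E A \<and> E' A)"
  shows "Pr V p (\<lambda>A. E A \<or> E' A) = Pr V p E + Pr V p E'"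
  unfolding Pr_alt[OF assms(1)] sum.distrib[symmetric] using assms(2)
  by (intro sum.cong) auto

lemma Pr_Not: "finite V \<Longrightarrow> Pr V p (\<lambda>A. \<not> E A) = 1 - Pr V p E"
  using Pr_add[of V "\<lambda>A. \<not> E A" E p] Pr_True[of V p] by (simp add: excluded_middle)

lemma Pr_inclusion_exclusion:
  assumes "finite V"
  shows "Pr V p (\<lambda>A. E A \<or> E' A) = Pr V p E + Pr V p E' - Pr V p (\<lambda>A. E A \<and> E' A)"
  unfolding Pr_alt[OF assms(1)] sum.distrib[symmetric] sum_subtractf[symmetric]
  by (intro sum.cong) auto

lemma Pr_nonneg: "0 \<le> p \<Longrightarrow> p \<le> 1 \<Longrightarrow> 0 \<le> Pr V p E"
  unfolding Pr_def by (intro sum_nonneg) auto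

lemma Pr_mono:
  assumes "finite V" "0 \<le> p" "p \<le> 1" "\<And>A. A \<subseteq> V \<Longrightarrow> E A \<Longrightarrow> E' A"
  shows "Pr V p E \<le> Pr V p E'"
  unfolding Pr_alt[OF assms(1)] using assms by (intro sum_mono) auto

lemma Pr_le_1: "finite V \<Longrightarrow> 0 \<le> p \<Longrightarrow> p \<le> 1 \<Longrightarrow> Pr V p E \<le> 1"
  using Pr_mono[of V p E "\<lambda>_. True"] Pr_True[of V p] by simp

lemma Pr_disj_le:
  "finite V \<Longrightarrow> 0 \<le> p \<Longrightarrow> p \<le> 1 \<Longrightarrow> Pr V p (\<lambda>A. E A \<or> E' A) \<le> Pr V p E + Pr V p E'"
  using Pr_inclusion_exclusion[of V p E E'] Pr_nonneg[of p V "\<lambda>A. E A \<and> E' A"] by simp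

lemma Pr_union_bound:
  assumes "finite V" "0 \<le> p" "p \<le> 1" "finite I"
  shows "Pr V p (\<lambda>A. \<exists>i\<in>I. E i A) \<le> (\<Sum>i\<in>I. Pr V p (E i))"
  using assms(4)
proof (induction I rule: finite_induct)
  case empty
  then show ?case by (simp add: Pr_def)
next
  case (insert i I)
  then show ?case
    using Pr_disj_le[OF assms(1-3), of "E i" "\<lambda>A. \<exists>i\<in>I. E i A"] by simp
qed

lemma Pr_union_bound_card:
  assumes "finite V" "0 \<le> p" "p \<le> 1" "finite I" "\<And>i. i \<in> I \<Longrightarrow> Pr V p (E i) \<le> c"
  shows "Pr V p (\<lambda>A. \<exists>i\<in>I. E i A) \<le> real (card I) * c"
  using Pr_union_bound[OF assms(1-4), of E] sum_bounded_above[of I "\<lambda>i. Pr V p (E i)" c] assms(5)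
  by simp

lemma Pr_Un:
  assumes "finite V1" "finite V2" "V1 \<inter> V2 = {}"
  shows "Pr (V1 \<union> V2) p (\<lambda>A. E1 (A \<inter> V1) \<and> E2 (A \<inter> V2)) = Pr V1 p E1 * Pr V2 p E2"
proof -
  let ?w = "\<lambda>V E A. if E A then p ^ card A * (1 - p) ^ card (V - A) else 0"
  have "Pr V1 p E1 * Pr V2 p E2 = (\<Sum>(A, B)\<in>Pow V1 \<times> Pow V2. ?w V1 E1 A * ?w V2 E2 B)"
    unfolding Pr_alt[OF assms(1)] Pr_alt[OF assms(2)] sum_product by (simp add: sum.cartesian_product)
  also have "\<dots> = (\<Sum>A\<in>Pow (V1 \<union> V2). ?w (V1 \<union> V2) (\<lambda>A. E1 (A \<inter> V1) \<and> E2 (A \<inter> V2)) A)"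
  proof (rule sum.reindex_bij_witness[where j = "\<lambda>(A, B). A \<union> B" and i = "\<lambda>A. (A \<inter> V1, A \<inter> V2)"])
    fix x assume "x \<in> Pow V1 \<times> Pow V2"
    then obtain A B where x: "x = (A, B)" "A \<subseteq> V1" "B \<subseteq> V2" by auto
    then have *: "(A \<union> B) \<inter> V1 = A" "(A \<union> B) \<inter> V2 = B" "finite A" "finite B" "A \<inter> B = {}"
      using assms by (auto intro: finite_subset)
    have "V1 \<union> V2 - (A \<union> B) = (V1 - A) \<union> (V2 - B)" using x assms(3) by auto
    moreover have "card ((V1 - A) \<union> (V2 - B)) = card (V1 - A) + card (V2 - B)"
      using assms by (intro card_Un_disjoint) auto
    ultimately have "card (V1 \<union> V2 - (A \<union> B)) = card (V1 - A) + card (V2 - B)" by simp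
    moreover have "card (A \<union> B) = card A + card B" using * by (simp add: card_Un_disjoint)
    ultimately show "?w (V1 \<union> V2) (\<lambda>A. E1 (A \<inter> V1) \<and> E2 (A \<inter> V2)) (case x of (A, B) \<Rightarrow> A \<union> B)
        = (case x of (A, B) \<Rightarrow> ?w V1 E1 A * ?w V2 E2 B)"
      using * by (simp add: x power_add)
  qed (use assms(3) in auto)
  also have "\<dots> = Pr (V1 \<union> V2) p (\<lambda>A. E1 (A \<inter> V1) \<and> E2 (A \<inter> V2))"
    using assms by (simp add: Pr_alt)
  finally show ?thesis by simp
qed

lemma Pr_restrict:
  assumes "finite V" "U \<subseteq> V"
  shows "Pr V p (\<lambda>A. E (A \<inter> U)) = Pr U p E"
proof -
  have "Pr (U \<union> (V - U)) p (\<lambda>A. E (A \<inter> U) \<and> True) = Pr U p E * Pr (V - U) p (\<lambda>_. True)"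
    using Pr_Un[of U "V - U" p E "\<lambda>_. True"] assms finite_subset by auto
  moreover have "U \<union> (V - U) = V" using assms by auto
  ultimately show ?thesis using assms Pr_True[of "V - U"] by simp
qed

lemma Pr_indep2:
  assumes "finite V" "U1 \<subseteq> V" "U2 \<subseteq> V" "U1 \<inter> U2 = {}"
  shows "Pr V p (\<lambda>A. E1 (A \<inter> U1) \<and> E2 (A \<inter> U2)) =
    Pr V p (\<lambda>A. E1 (A \<inter> U1)) * Pr V p (\<lambda>A. E2 (A \<inter> U2))"
proof -
  let ?E = "\<lambda>A. E1 (A \<inter> U1) \<and> E2 (A \<inter> U2)"
  have fin: "finite U1" "finite U2" using assms by (auto intro: finite_subset)
  have "Pr V p (\<lambda>A. ?E (A \<inter> (U1 \<union> U2))) = Pr (U1 \<union> U2) p ?E"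
    using assms by (intro Pr_restrict) auto
  moreover have "(\<lambda>A. ?E (A \<inter> (U1 \<union> U2))) = ?E"
    by (rule ext) (simp add: Int_assoc Int_absorb1 Int_absorb2)
  ultimately show ?thesis
    using Pr_Un[OF fin assms(4), of p E1 E2] Pr_restrict[OF assms(1,2), of p E1]
      Pr_restrict[OF assms(1,3), of p E2] by simp
qed

text \<open>An event that depends only on the sites of \<open>U\<close> is written
  \<open>E (A \<inter> U)\<close>. With this convention independence needs no sigma-algebras and
  follows from the product formula for disjoint regions.\<close>

lemma Pr_indep:
  assumes "finite V" "finite I" "\<And>i. i \<in> I \<Longrightarrow> U i \<subseteq> V" "disjoint_family_on U I"
  shows "Pr V p (\<lambda>A. \<forall>i\<in>I. E i (A \<inter> U i)) = (\<Prod>i\<in>I. Pr V p (\<lambda>A. E i (A \<inter> U i)))"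
  using assms(2-)
proof (induction I rule: finite_induct)
  case empty
  then show ?case using assms(1) by (simp add: Pr_True)
next
  case (insert i I)
  let ?U = "\<Union>j\<in>I. U j"
  have disj: "U i \<inter> ?U = {}" using insert.prems(2) insert.hyps(2) by (fastforce simp: disjoint_family_on_def)
  have IH: "Pr V p (\<lambda>A. \<forall>i\<in>I. E i (A \<inter> U i)) = (\<Prod>i\<in>I. Pr V p (\<lambda>A. E i (A \<inter> U i)))"
    using insert by (auto simp: disjoint_family_on_def)
  have eq: "(\<forall>j\<in>I. E j ((A \<inter> ?U) \<inter> U j)) = (\<forall>j\<in>I. E j (A \<inter> U j))" for A
  proof (rule ball_cong[OF refl])
    fix j assume "j \<in> I" 
    then have "(A \<inter> ?U) \<inter> U j = A \<inter> U j" by auto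
    then show "E j ((A \<inter> ?U) \<inter> U j) = E j (A \<inter> U j)" by simp
  qed
  have "Pr V p (\<lambda>A. E i (A \<inter> U i) \<and> (\<forall>j\<in>I. E j ((A \<inter> ?U) \<inter> U j)))
     = Pr V p (\<lambda>A. E i (A \<inter> U i)) * Pr V p (\<lambda>A. \<forall>j\<in>I. E j ((A \<inter> ?U) \<inter> U j))"
    using insert.prems disj by (intro Pr_indep2[OF assms(1), of "U i" ?U p "E i" "\<lambda>B. \<forall>j\<in>I. E j (B \<inter> U j)"]) auto
  then show ?case using insert.hyps IH by (simp only: eq) simp
qed

lemma Pr_superset:
  assumes "finite V" "W \<subseteq> V"
  shows "Pr V p (\<lambda>A. W \<subseteq> A) = p ^ card W"
proof -
  have "Pr V p (\<lambda>A. W \<subseteq> A) = Pr V p (\<lambda>A. W \<subseteq> A \<inter> W)" by (rule Pr_cong) auto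
  also have "\<dots> = Pr W p (\<lambda>A. W \<subseteq> A)" using Pr_restrict[OF assms, of p "\<lambda>A. W \<subseteq> A"] .
  also have "\<dots> = (\<Sum>A\<in>{W}. p ^ card A * (1 - p) ^ card (W - A))"
    unfolding Pr_def by (rule sum.cong) auto
  finally show ?thesis by simp
qed

lemma Pr_image:
  assumes "inj_on f V" "finite V"
  shows "Pr (f ` V) p E = Pr V p (\<lambda>A. E (f ` A))"
  unfolding Pr_def
proof (rule sum.reindex_bij_witness[where i = "\<lambda>A. f ` A" and j = "\<lambda>B. V \<inter> f -` B"])
  fix B assume "B \<in> {B. B \<subseteq> f ` V \<and> E B}"
  then have B: "f ` (V \<inter> f -` B) = B" and EB: "E B" by auto
  show "f ` (V \<inter> f -` B) = B" by fact
  show "V \<inter> f -` B \<in> {A. A \<subseteq> V \<and> E (f ` A)}" using B EB by auto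
  have "card B = card (V \<inter> f -` B)" using B assms(1)
    by (metis (no_types, lifting) card_image inf_le1 inj_on_subset)
  moreover have "f ` V - B = f ` (V - V \<inter> f -` B)" using B by auto
  then have "card (f ` V - B) = card (V - V \<inter> f -` B)"
    by (metis (no_types, lifting) Diff_subset assms(1) card_image inj_on_subset)
  ultimately show "p ^ card (V \<inter> f -` B) * (1 - p) ^ card (V - V \<inter> f -` B) = p ^ card B * (1 - p) ^ card (f ` V - B)"
    by simp
next
  fix A assume "A \<in> {A. A \<subseteq> V \<and> E (f ` A)}"
  then have A: "A \<subseteq> V" "E (f ` A)" by auto
  show "V \<inter> f -` (f ` A) = A" using A assms(1) by (auto simp: inj_on_def)
  show "f ` A \<in> {B. B \<subseteq> f ` V \<and> E B}" using A by auto
qed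

section \<open>Increasing events and correlation inequalities\<close>

definition increasing :: "('a set \<Rightarrow> bool) \<Rightarrow> bool" where
  "increasing E \<longleftrightarrow> (\<forall>A B. A \<subseteq> B \<longrightarrow> E A \<longrightarrow> E B)"

lemma increasingD: "increasing E \<Longrightarrow> A \<subseteq> B \<Longrightarrow> E A \<Longrightarrow> E B"
  by (auto simp: increasing_def)

lemma increasing_insert: "increasing E \<Longrightarrow> increasing (\<lambda>A. E (insert e A))"
  unfolding increasing_def by (meson insert_mono)

lemma increasing_le_insert: "increasing E \<Longrightarrow> E A \<Longrightarrow> E (insert e A)"
  by (rule increasingD) auto

text \<open>The increment of an increasing event at a new site is nonnegative; for two such increments
  this is exactly the defect in both correlation inequalities.\<close>

lemma Harris_increasing:
  fixes E1 E2 :: "'a set \<Rightarrow> bool"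
  assumes "finite V" "0 \<le> p" "p \<le> 1" "increasing E1" "increasing E2"
  shows "Pr V p E1 * Pr V p E2 \<le> Pr V p (\<lambda>A. E1 A \<and> E2 A)"
  using assms(1,4,5)
proof (induction V arbitrary: E1 E2 rule: finite_induct)
  case empty
  then show ?case by simp
next
  case (insert e V)
  define x0 y0 x1 y1 where "x0 = Pr V p E1" and "y0 = Pr V p E2"
    and "x1 = Pr V p (\<lambda>A. E1 (insert e A))" and "y1 = Pr V p (\<lambda>A. E2 (insert e A))"
  have "x0 \<le> x1" "y0 \<le> y1" unfolding x0_def x1_def y0_def y1_def
    using insert.prems
    by (auto intro: Pr_mono[OF insert.hyps(1) assms(2,3)] increasing_le_insert)
  then have "0 \<le> p * (1 - p) * ((x1 - x0) * (y1 - y0))" using assms by auto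
  then have "((1 - p) * x0 + p * x1) * ((1 - p) * y0 + p * y1) \<le> (1 - p) * (x0 * y0) + p * (x1 * y1)"
    by (simp add: algebra_simps)
  also have "\<dots> \<le> (1 - p) * Pr V p (\<lambda>A. E1 A \<and> E2 A) + p * Pr V p (\<lambda>A. E1 (insert e A) \<and> E2 (insert e A))"
    using insert.IH[OF insert.prems] insert.IH[OF increasing_insert increasing_insert, OF insert.prems] assms(2,3)
    unfolding x0_def x1_def y0_def y1_def by (intro add_mono mult_left_mono) auto
  finally show ?case using insert.hyps by (simp add: Pr_insert x0_def x1_def y0_def y1_def)
qed

lemma Harris_decreasing:
  fixes E1 E2 :: "'a set \<Rightarrow> bool"
  assumes "finite V" "0 \<le> p" "p \<le> 1" "increasing E1" "increasing E2"
  shows "Pr V p (\<lambda>A. \<not> E1 A) * Pr V p (\<lambda>A. \<not> E2 A) \<le> Pr V p (\<lambda>A. \<not> E1 A \<and> \<not> E2 A)"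
proof -
  have "Pr V p (\<lambda>A. \<not> E1 A \<and> \<not> E2 A) = 1 - Pr V p E1 - Pr V p E2 + Pr V p (\<lambda>A. E1 A \<and> E2 A)"
    using Pr_Not[OF assms(1), of p "\<lambda>A. E1 A \<or> E2 A"] Pr_inclusion_exclusion[OF assms(1), of p E1 E2] by simp
  with Harris_increasing[OF assms] show ?thesis by (simp add: Pr_Not[OF assms(1)] algebra_simps)
qed

lemma Harris_decreasing_family:
  fixes E :: "'i \<Rightarrow> 'a set \<Rightarrow> bool"
  assumes "finite V" "0 \<le> p" "p \<le> 1" "finite I" "\<And>i. i \<in> I \<Longrightarrow> increasing (E i)"
  shows "(\<Prod>i\<in>I. Pr V p (\<lambda>A. \<not> E i A)) \<le> Pr V p (\<lambda>A. \<forall>i\<in>I. \<not> E i A)"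
  using assms(4,5)
proof (induction I rule: finite_induct)
  case empty
  then show ?case using assms(1) by (simp add: Pr_True)
next
  case (insert i I)
  have "increasing (\<lambda>A. \<exists>i\<in>I. E i A)"
    using insert.prems unfolding increasing_def by (meson insertCI)
  then have "Pr V p (\<lambda>A. \<not> E i A) * Pr V p (\<lambda>A. \<not> (\<exists>i\<in>I. E i A)) \<le> Pr V p (\<lambda>A. \<not> E i A \<and> \<not> (\<exists>i\<in>I. E i A))"
    using insert.prems by (intro Harris_decreasing assms(1-3)) auto
  moreover have "Pr V p (\<lambda>A. \<not> E i A) * (\<Prod>i\<in>I. Pr V p (\<lambda>A. \<not> E i A)) \<le> Pr V p (\<lambda>A. \<not> E i A) * Pr V p (\<lambda>A. \<not> (\<exists>i\<in>I. E i A))"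
    using insert Pr_nonneg[OF assms(2,3)] by (intro mult_left_mono) auto
  ultimately show ?case using insert.hyps by simp
qed

text \<open>For increasing events a set satisfying the event is itself a certificate for it, so this
  is the usual disjoint occurrence, stated without cylinder sets.\<close>

definition disj_occ :: "('a set \<Rightarrow> bool) \<Rightarrow> ('a set \<Rightarrow> bool) \<Rightarrow> 'a set \<Rightarrow> bool" where
  "disj_occ E1 E2 A \<longleftrightarrow> (\<exists>W1 W2. W1 \<inter> W2 = {} \<and> W1 \<union> W2 \<subseteq> A \<and> E1 W1 \<and> E2 W2)"

text \<open>Induction on the sites. A new site \<open>e\<close> can serve only one of the two
  witness sets, so on \<open>insert e A\<close> one of \<open>disj_occ F1 E2\<close> and
  \<open>disj_occ E1 F2\<close> holds. Both of them hold wherever \<open>disj_occ E1 E2\<close>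
  does, and this overlap \<open>z\<close> is subtracted by inclusion-exclusion. Afterwards
  \<open>z\<close> has the coefficient \<open>1 - 2 * p\<close>, which is nonnegative for
  \<open>p \<le> 1/2\<close>, a range that suffices for \<open>p\<close> tending to 0. What remains
  is \<open>p * p * ((x1 - x0) * (y1 - y0)) \<ge> 0\<close>.\<close>

theorem BK_inequality:
  fixes E1 E2 :: "'a set \<Rightarrow> bool"
  assumes "finite V" "0 \<le> p" "p \<le> 1/2" "increasing E1" "increasing E2"
  shows "Pr V p (disj_occ E1 E2) \<le> Pr V p E1 * Pr V p E2"
  using assms(1,4,5)
proof (induction V arbitrary: E1 E2 rule: finite_induct)
  case empty
  then show ?case by (auto simp: disj_occ_def)
next
  case (insert e V)
  have p1: "p \<le> 1" using assms(3) by simp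
  define F1 F2 where "F1 = (\<lambda>A. E1 (insert e A))" and "F2 = (\<lambda>A. E2 (insert e A))"
  have mF: "increasing F1" "increasing F2" unfolding F1_def F2_def using insert.prems by (auto intro: increasing_insert)
  define x0 y0 x1 y1 where "x0 = Pr V p E1" and "y0 = Pr V p E2"
    and "x1 = Pr V p F1" and "y1 = Pr V p F2"
  have le: "x0 \<le> x1" "y0 \<le> y1" unfolding x0_def x1_def y0_def y1_def F1_def F2_def
    using insert.prems
    by (auto intro: Pr_mono[OF insert.hyps(1) assms(2) p1] increasing_le_insert)
  have sub1: "E1 A \<Longrightarrow> F1 A" and sub2: "E2 A \<Longrightarrow> F2 A" for A
    unfolding F1_def F2_def using insert.prems by (auto intro: increasing_le_insert)
  define z where "z = Pr V p (disj_occ E1 E2)"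
  have "Pr V p (\<lambda>A. disj_occ E1 E2 (insert e A)) \<le> Pr V p (\<lambda>A. disj_occ F1 E2 A \<or> disj_occ E1 F2 A)"
  proof (rule Pr_mono[OF insert.hyps(1) assms(2) p1])
    fix A assume A: "A \<subseteq> V" "disj_occ E1 E2 (insert e A)"
    then obtain W1 W2 where W: "W1 \<inter> W2 = {}" "W1 \<union> W2 \<subseteq> insert e A" "E1 W1" "E2 W2"
      unfolding disj_occ_def by auto
    show "disj_occ F1 E2 A \<or> disj_occ E1 F2 A"
    proof (cases "e \<in> W2")
      case True
      have "E1 (W1)" "F2 (W2 - {e})" "W1 \<inter> (W2 - {e}) = {}" "W1 \<union> (W2 - {e}) \<subseteq> A"
        using W True by (auto simp: F2_def insert_absorb)
      then show ?thesis unfolding disj_occ_def by blast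
    next
      case False
      have "E1 (insert e (W1 - {e}))" by (rule increasingD[OF insert.prems(1) _ W(3)]) auto
      then have "F1 (W1 - {e})" "E2 W2" "(W1 - {e}) \<inter> W2 = {}" "(W1 - {e}) \<union> W2 \<subseteq> A"
        using W False by (auto simp: F1_def)
      then show ?thesis unfolding disj_occ_def by blast
    qed
  qed
  also have "\<dots> = Pr V p (disj_occ F1 E2) + Pr V p (disj_occ E1 F2) - Pr V p (\<lambda>A. disj_occ F1 E2 A \<and> disj_occ E1 F2 A)"
    by (rule Pr_inclusion_exclusion[OF insert.hyps(1)])
  also have "\<dots> \<le> x1 * y0 + x0 * y1 - z"
  proof -
    have "z \<le> Pr V p (\<lambda>A. disj_occ F1 E2 A \<and> disj_occ E1 F2 A)" unfolding z_def
      using sub1 sub2 by (intro Pr_mono[OF insert.hyps(1) assms(2) p1]) (auto simp: disj_occ_def; blast)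
    then show ?thesis using insert.IH[OF mF(1) insert.prems(2)] insert.IH[OF insert.prems(1) mF(2)]
      by (simp add: x0_def x1_def y0_def y1_def)
  qed
  finally have *: "Pr V p (\<lambda>A. disj_occ E1 E2 (insert e A)) \<le> x1 * y0 + x0 * y1 - z" .
  have "z \<le> x0 * y0" unfolding z_def x0_def y0_def by (rule insert.IH[OF insert.prems])
  then have "(1 - 2 * p) * z \<le> (1 - 2 * p) * (x0 * y0)"
    using assms(3) by (intro mult_left_mono) auto
  moreover have "0 \<le> p * p * ((x1 - x0) * (y1 - y0))" using le assms(2) by auto
  moreover have "p * Pr V p (\<lambda>A. disj_occ E1 E2 (insert e A)) \<le> p * (x1 * y0 + x0 * y1 - z)"
    using * assms(2) by (intro mult_left_mono)
  ultimately have "(1 - p) * z + p * Pr V p (\<lambda>A. disj_occ E1 E2 (insert e A)) \<le> ((1 - p) * x0 + p * x1) * ((1 - p) * y0 + p * y1)"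
    by (simp add: algebra_simps)
  then show ?case using insert.hyps
    by (simp add: Pr_insert x0_def x1_def y0_def y1_def z_def F1_def F2_def)
qed

section \<open>Threshold dynamics with axis weights\<close>

text \<open>A weight 0 removes an axis from the dynamics without changing the ambient space. The
  model and its projections to two and one dimensions therefore share all lemmas.\<close>

definition cnt :: "('d::finite \<Rightarrow> nat) \<Rightarrow> ('d \<Rightarrow> int) set \<Rightarrow> ('d \<Rightarrow> int) \<Rightarrow> nat" where
  "cnt r S s = (\<Sum>i\<in>UNIV. card {k. k \<noteq> 0 \<and> \<bar>k\<bar> \<le> int (r i) \<and> s(i := s i + k) \<in> S})"

definition closed_in :: "('d::finite \<Rightarrow> nat) \<Rightarrow> ('d \<Rightarrow> int) set \<Rightarrow> ('d \<Rightarrow> int) set \<Rightarrow> bool" where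
  "closed_in r V S \<longleftrightarrow> (\<forall>s\<in>V. sum r UNIV \<le> cnt r S s \<longrightarrow> s \<in> S)"

text \<open>Growth in the whole lattice. It dominates growth inside the cube, which is the right
  direction for bounding the spanning probability from above; bounds from below use
  \<open>fills\<close>, which is relative to a region.\<close>

definition cl :: "('d::finite \<Rightarrow> nat) \<Rightarrow> ('d \<Rightarrow> int) set \<Rightarrow> ('d \<Rightarrow> int) set" where
  "cl r A = \<Inter>{S. A \<subseteq> S \<and> closed_in r UNIV S}"

lemma finite_abs_le: "finite {k::int. \<bar>k\<bar> \<le> n}"
proof -
  have "{k::int. \<bar>k\<bar> \<le> n} = {-n..n}" by auto
  then show ?thesis by simp
qed

lemma finite_steps [simp]: "finite {k::int. k \<noteq> 0 \<and> \<bar>k\<bar> \<le> n \<and> P k}"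
  by (rule finite_subset[OF _ finite_abs_le[of n]]) auto

lemma cnt_mono: "S \<subseteq> T \<Longrightarrow> cnt r S s \<le> cnt r T s"
  unfolding cnt_def by (intro sum_mono card_mono finite_steps) auto

lemma closed_inD: "closed_in r V S \<Longrightarrow> s \<in> V \<Longrightarrow> sum r UNIV \<le> cnt r S s \<Longrightarrow> s \<in> S"
  by (auto simp: closed_in_def)

lemma cl_superset: "A \<subseteq> cl r A"
  by (auto simp: cl_def)

lemma cl_least: "A \<subseteq> S \<Longrightarrow> closed_in r UNIV S \<Longrightarrow> cl r A \<subseteq> S"
  by (auto simp: cl_def)

lemma cl_closed: "closed_in r UNIV (cl r A)"
  unfolding closed_in_def
proof (intro ballI impI)
  fix s assume s: "sum r UNIV \<le> cnt r (cl r A) s"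
  show "s \<in> cl r A" unfolding cl_def
  proof (intro InterI, clarify)
    fix S assume S: "A \<subseteq> S" "closed_in r UNIV S"
    then have "cnt r (cl r A) s \<le> cnt r S s" by (intro cnt_mono cl_least)
    with s S(2) show "s \<in> S" by (auto intro: closed_inD)
  qed
qed

lemma cl_mono: "A \<subseteq> B \<Longrightarrow> cl r A \<subseteq> cl r B"
  by (meson cl_closed cl_least cl_superset dual_order.trans)

lemma cnt_pos_imp:
  assumes "0 < cnt r S s"
  obtains i k where "k \<noteq> 0" "\<bar>k\<bar> \<le> int (r i)" "s(i := s i + k) \<in> S"
proof -
  obtain i where "card {k. k \<noteq> 0 \<and> \<bar>k\<bar> \<le> int (r i) \<and> s(i := s i + k) \<in> S} \<noteq> 0"
    using assms unfolding cnt_def by (metis (no_types, lifting) less_numeral_extra(3) sum.neutral)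
  then have "{k. k \<noteq> 0 \<and> \<bar>k\<bar> \<le> int (r i) \<and> s(i := s i + k) \<in> S} \<noteq> {}" by fastforce
  then show ?thesis using that by auto
qed

lemma sum_upd_zero:
  fixes r :: "'d::finite \<Rightarrow> nat"
  shows "sum r UNIV = r i + sum (r(i := 0)) UNIV"
proof -
  have "sum r UNIV = r i + sum r (UNIV - {i})" by (rule sum.remove) auto
  also have "sum r (UNIV - {i}) = sum (r(i := 0)) (UNIV - {i})" by (rule sum.cong) auto
  also have "\<dots> = sum (r(i := 0)) UNIV" using sum.remove[of UNIV i "r(i := 0)"] by simp
  finally show ?thesis .
qed

lemma cnt_remove:
  "cnt r S s = card {k. k \<noteq> 0 \<and> \<bar>k\<bar> \<le> int (r i) \<and> s(i := s i + k) \<in> S} + cnt (r(i := 0)) S s"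
proof -
  let ?f = "\<lambda>r i. card {k. k \<noteq> 0 \<and> \<bar>k\<bar> \<le> int (r i) \<and> s(i := s i + k) \<in> S}"
  have "cnt r S s = ?f r i + sum (?f r) (UNIV - {i})" unfolding cnt_def by (rule sum.remove) auto
  also have "sum (?f r) (UNIV - {i}) = sum (?f (r(i := 0))) (UNIV - {i})" by (rule sum.cong) auto
  also have "\<dots> = cnt (r(i := 0)) S s" unfolding cnt_def
    by (subst sum.remove[of UNIV i]) (auto intro!: card_eq_0_iff[THEN iffD2])
  finally show ?thesis .
qed

section \<open>Projection onto block layers\<close>

definition proj :: "'d \<Rightarrow> int \<Rightarrow> ('d \<Rightarrow> int) \<Rightarrow> ('d \<Rightarrow> int)" where
  "proj i t s = s(i := s i div t)"

text \<open>A site whose block column is empty sees at most \<open>r i\<close> occupied sites along axis \<open>i\<close>, since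
  of the two neighbours at distance \<open>k\<close> at least one lies in the same block.\<close>

lemma card_steps_block:
  fixes x t :: int
  assumes "2 * int n + 1 \<le> t"
  shows "card {k. k \<noteq> 0 \<and> \<bar>k\<bar> \<le> int n \<and> (x + k) div t \<noteq> x div t} \<le> n"
proof -
  let ?D = "{k. k \<noteq> 0 \<and> \<bar>k\<bar> \<le> int n \<and> (x + k) div t \<noteq> x div t}"
  have t: "t > 0" using assms by linarith
  have aux: "(x + k) div t = x div t" if "0 \<le> x mod t + k" "x mod t + k < t" for k
  proof -
    have "x + k = t * (x div t) + (x mod t + k)" by simp
    then have "(x + k) div t = x div t + (x mod t + k) div t"
      using t by (metis div_mult_self4 less_numeral_extra(3))
    then show ?thesis using that by (simp add: div_pos_pos_trivial)
  qed
  have b: "0 \<le> x mod t" "x mod t < t" using t by auto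
  have "inj_on (\<lambda>k. nat \<bar>k\<bar>) ?D"
  proof (rule inj_onI)
    fix k l assume k: "k \<in> ?D" and l: "l \<in> ?D" and eq: "nat \<bar>k\<bar> = nat \<bar>l\<bar>"
    have o: "\<not> (0 \<le> x mod t + k \<and> x mod t + k < t)" "\<not> (0 \<le> x mod t + l \<and> x mod t + l < t)"
      using aux k l by blast+
    have "\<bar>k\<bar> \<le> int n" "\<bar>l\<bar> \<le> int n" "\<bar>k\<bar> = \<bar>l\<bar>" using k l eq by auto
    with o b assms show "k = l" by linarith
  qed
  moreover have "(\<lambda>k. nat \<bar>k\<bar>) ` ?D \<subseteq> {1..n}" by auto
  ultimately have "card ?D \<le> card {1..n}" by (intro card_inj_on_le) auto
  then show ?thesis by simp
qed

text \<open>The preimage of the projected closure is closed. A site outside it gets at most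
  \<open>r i\<close> from axis \<open>i\<close>, because its own block column is empty, so the other
  axes would have to supply the full threshold of the dynamics without axis \<open>i\<close>, and
  then its projection would belong to the projected closure.\<close>

lemma cl_proj:
  assumes t: "2 * int (r i) + 1 \<le> t"
  shows "cl r A \<subseteq> proj i t -` cl (r(i := 0)) (proj i t ` A)"
proof (rule cl_least)
  let ?C = "cl (r(i := 0)) (proj i t ` A)"
  show "A \<subseteq> proj i t -` ?C" using cl_superset by fastforce
  show "closed_in r UNIV (proj i t -` ?C)"
    unfolding closed_in_def
  proof (intro ballI impI, rule ccontr)
    fix s assume s: "sum r UNIV \<le> cnt r (proj i t -` ?C) s" and n: "s \<notin> proj i t -` ?C"
    have "card {k. k \<noteq> 0 \<and> \<bar>k\<bar> \<le> int (r i) \<and> s(i := s i + k) \<in> proj i t -` ?C}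
      \<le> card {k. k \<noteq> 0 \<and> \<bar>k\<bar> \<le> int (r i) \<and> (s i + k) div t \<noteq> s i div t}"
      using n by (intro card_mono finite_steps) (auto simp: proj_def)
    also have "\<dots> \<le> r i" by (rule card_steps_block[OF t])
    moreover have "cnt (r(i := 0)) (proj i t -` ?C) s \<le> cnt (r(i := 0)) ?C (proj i t s)"
      unfolding cnt_def
    proof (intro sum_mono card_mono finite_steps, clarify)
      fix j k assume k: "k \<noteq> 0" "\<bar>k\<bar> \<le> int ((r(i := 0)) j)" "proj i t (s(j := s j + k)) \<in> ?C"
      then have "j \<noteq> i" by auto
      then have "proj i t (s(j := s j + k)) = (proj i t s)(j := proj i t s j + k)"
        by (auto simp: proj_def fun_eq_iff)
      with k show "(proj i t s)(j := proj i t s j + k) \<in> ?C" by simp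
    qed
    ultimately have "sum (r(i := 0)) UNIV \<le> cnt (r(i := 0)) ?C (proj i t s)"
      using s sum_upd_zero[of r i] cnt_remove[of r "proj i t -` ?C" s i] by linarith
    then have "proj i t s \<in> ?C" by (rule closed_inD[OF cl_closed UNIV_I])
    with n show False by simp
  qed
qed

section \<open>Half-spaces and bounding boxes\<close>

lemma card_pos_steps: "card {k::int. 0 < k \<and> k \<le> int n} = n"
proof -
  have "{k::int. 0 < k \<and> k \<le> int n} = {1..int n}" by auto
  then show ?thesis by simp
qed

lemma card_neg_steps: "card {k::int. k < 0 \<and> - k \<le> int n} = n"
proof -
  have "{k::int. k < 0 \<and> - k \<le> int n} = {- int n..-1}" by auto
  then show ?thesis by simp
qed

text \<open>With a single positive weight, that many consecutive sites fill a whole line. A second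
  positive weight lifts the threshold above each \<open>r i\<close>; then half-spaces are closed and
  closures stay within the bounding boxes of their initial sets.\<close>

definition two_pos :: "('d \<Rightarrow> nat) \<Rightarrow> bool" where
  "two_pos r \<longleftrightarrow> (\<exists>i j. i \<noteq> j \<and> 0 < r i \<and> 0 < r j)"

lemma two_pos_sum:
  fixes r :: "'d::finite \<Rightarrow> nat"
  assumes "two_pos r"
  shows "r i < sum r UNIV"
proof -
  obtain j where "j \<noteq> i" "0 < r j" using assms unfolding two_pos_def by metis
  then have "0 < (r(i := 0)) j" by simp
  also have "\<dots> \<le> sum (r(i := 0)) UNIV" by (rule member_le_sum) auto
  finally have "0 < sum (r(i := 0)) UNIV" .
  then show ?thesis using sum_upd_zero[of r i] by simp
qed

lemma closed_half_ge:
  assumes "two_pos r"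
  shows "closed_in r UNIV {s. c \<le> s i}"
  unfolding closed_in_def
proof (intro ballI impI, rule ccontr)
  fix s assume s: "sum r UNIV \<le> cnt r {s. c \<le> s i} s" "s \<notin> {s. c \<le> s i}"
  have "card {k. k \<noteq> 0 \<and> \<bar>k\<bar> \<le> int (r i) \<and> s(i := s i + k) \<in> {s. c \<le> s i}}
      \<le> card {k::int. 0 < k \<and> k \<le> int (r i)}"
    using s(2) by (intro card_mono finite_subset[OF _ finite_abs_le[of "int (r i)"]]) auto
  moreover have "cnt (r(i := 0)) {s. c \<le> s i} s = 0" unfolding cnt_def
    using s(2) by (auto intro!: sum.neutral card_eq_0_iff[THEN iffD2])
  ultimately have "cnt r {s. c \<le> s i} s \<le> r i" using cnt_remove[of r "{s. c \<le> s i}" s i] card_pos_steps[of "r i"] by linarith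
  with s(1) two_pos_sum[OF assms, of i] show False by simp
qed

lemma closed_half_le:
  assumes "two_pos r"
  shows "closed_in r UNIV {s. s i \<le> c}"
  unfolding closed_in_def
proof (intro ballI impI, rule ccontr)
  fix s assume s: "sum r UNIV \<le> cnt r {s. s i \<le> c} s" "s \<notin> {s. s i \<le> c}"
  have "card {k. k \<noteq> 0 \<and> \<bar>k\<bar> \<le> int (r i) \<and> s(i := s i + k) \<in> {s. s i \<le> c}}
      \<le> card {k::int. k < 0 \<and> - k \<le> int (r i)}"
    using s(2) by (intro card_mono finite_subset[OF _ finite_abs_le[of "int (r i)"]]) auto
  moreover have "cnt (r(i := 0)) {s. s i \<le> c} s = 0" unfolding cnt_def
    using s(2) by (auto intro!: sum.neutral card_eq_0_iff[THEN iffD2])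
  ultimately have "cnt r {s. s i \<le> c} s \<le> r i" using cnt_remove[of r "{s. s i \<le> c}" s i] card_neg_steps[of "r i"] by linarith
  with s(1) two_pos_sum[OF assms, of i] show False by simp
qed

lemma cl_ge:
  assumes "two_pos r" "\<And>w. w \<in> W \<Longrightarrow> c \<le> w i" "s \<in> cl r W" shows "c \<le> s i"
  using cl_least[of W "{s. c \<le> s i}" r] closed_half_ge[OF assms(1)] assms by auto

lemma cl_le:
  assumes "two_pos r" "\<And>w. w \<in> W \<Longrightarrow> w i \<le> c" "s \<in> cl r W" shows "s i \<le> c"
  using cl_least[of W "{s. s i \<le> c}" r] closed_half_le[OF assms(1)] assms by auto

lemma cl_singleton:
  assumes "two_pos r"
  shows "cl r {s} = {s}"
proof -
  have "x i = s i" if "x \<in> cl r {s}" for x i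
    using cl_ge[OF assms, of "{s}" "s i" i x] cl_le[OF assms, of "{s}" i "s i" x] that by simp
  then have "x = s" if "x \<in> cl r {s}" for x using that by blast
  then show ?thesis using cl_superset[of "{s}" r] by auto
qed

section \<open>Connected closures and the Aizenman--Lebowitz argument\<close>

text \<open>\<open>K\<close> will be at least twice every weight, so two occupied sites seen from a
  common site are adjacent. On an axis of weight 0 the allowed distance is 0: layers that do not
  interact are kept apart, and a connected cluster of a projected dynamics lies in one
  layer.\<close>

definition adj :: "('d \<Rightarrow> nat) \<Rightarrow> int \<Rightarrow> ('d \<Rightarrow> int) \<Rightarrow> ('d \<Rightarrow> int) \<Rightarrow> bool" where
  "adj r K s s' \<longleftrightarrow> (\<forall>i. \<bar>s i - s' i\<bar> \<le> (if r i = 0 then 0 else K))"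

definition lnk :: "('d \<Rightarrow> nat) \<Rightarrow> int \<Rightarrow> ('d \<Rightarrow> int) set \<Rightarrow> (('d \<Rightarrow> int) \<times> ('d \<Rightarrow> int)) set" where
  "lnk r K S = {(u, v). u \<in> S \<and> v \<in> S \<and> adj r K u v}"

definition conn :: "('d \<Rightarrow> nat) \<Rightarrow> int \<Rightarrow> ('d \<Rightarrow> int) set \<Rightarrow> bool" where
  "conn r K S \<longleftrightarrow> (\<forall>x\<in>S. \<forall>y\<in>S. (x, y) \<in> (lnk r K S)\<^sup>*)"

lemma adj_sym: "adj r K s s' = adj r K s' s"
  by (simp add: adj_def abs_minus_commute)

lemma lnk_mono: "S \<subseteq> T \<Longrightarrow> lnk r K S \<subseteq> lnk r K T"
  by (auto simp: lnk_def)

lemma lnk_rtrancl_sym: "(x, y) \<in> (lnk r K S)\<^sup>* \<Longrightarrow> (y, x) \<in> (lnk r K S)\<^sup>*"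
proof -
  have "sym (lnk r K S)" by (auto simp: sym_def lnk_def adj_sym)
  then show "(x, y) \<in> (lnk r K S)\<^sup>* \<Longrightarrow> (y, x) \<in> (lnk r K S)\<^sup>*" by (meson sym_rtrancl symD)
qed

text \<open>The sites of the closure reachable from \<open>u\<close> contain \<open>W\<close> and
  form a closed set, since a site that meets the threshold has at least one neighbour among them and
  is linked to it.\<close>

lemma conn_closure:
  assumes K: "\<And>i. int (r i) \<le> K" and pos: "0 < sum r UNIV"
    and u: "u \<in> cl r W" and W: "\<And>x. x \<in> W \<Longrightarrow> (u, x) \<in> (lnk r K (cl r W))\<^sup>*"
  shows "conn r K (cl r W)"
proof -
  let ?S = "cl r W" and ?C = "{x. x \<in> cl r W \<and> (u, x) \<in> (lnk r K (cl r W))\<^sup>*}"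
  have "cl r W \<subseteq> ?C"
  proof (rule cl_least)
    show "W \<subseteq> ?C" using W cl_superset by auto
    show "closed_in r UNIV ?C" unfolding closed_in_def
    proof (intro ballI impI)
      fix s assume s: "sum r UNIV \<le> cnt r ?C s"
      have "cnt r ?C s \<le> cnt r ?S s" by (rule cnt_mono) auto
      then have sS: "s \<in> ?S" using s by (intro closed_inD[OF cl_closed]) auto
      obtain i k where ik: "k \<noteq> 0" "\<bar>k\<bar> \<le> int (r i)" "s(i := s i + k) \<in> ?C"
        using s pos cnt_pos_imp by (metis (no_types, lifting) less_le_trans)
      then have "adj r K (s(i := s i + k)) s"
        using K[of i] by (auto simp: adj_def)
      then have "(s(i := s i + k), s) \<in> lnk r K ?S" using ik sS by (auto simp: lnk_def)
      then show "s \<in> ?C" using ik sS by (auto intro: rtrancl_into_rtrancl)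
    qed
  qed
  then have u: "(u, x) \<in> (lnk r K (cl r W))\<^sup>*" if "x \<in> cl r W" for x
    using that by blast
  show ?thesis unfolding conn_def
  proof (intro ballI)
    fix x y assume "x \<in> cl r W" "y \<in> cl r W"
    then show "(x, y) \<in> (lnk r K (cl r W))\<^sup>*"
      using rtrancl_trans[OF lnk_rtrancl_sym[OF u] u] by simp
  qed
qed

lemma conn_merge:
  assumes K: "\<And>i. int (r i) \<le> K" and pos: "0 < sum r UNIV"
    and "conn r K (cl r W1)" "conn r K (cl r W2)"
    and uv: "u \<in> cl r W1" "v \<in> cl r W2" "adj r K u v"
  shows "conn r K (cl r (W1 \<union> W2))"
proof (rule conn_closure[OF K pos])
  let ?S = "cl r (W1 \<union> W2)"
  have sub: "cl r W1 \<subseteq> ?S" "cl r W2 \<subseteq> ?S" by (rule cl_mono, simp)+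
  then show "u \<in> ?S" using uv by auto
  fix x assume x: "x \<in> W1 \<union> W2"
  have m: "(lnk r K (cl r W1))\<^sup>* \<subseteq> (lnk r K ?S)\<^sup>*" "(lnk r K (cl r W2))\<^sup>* \<subseteq> (lnk r K ?S)\<^sup>*"
    using sub by (auto intro!: rtrancl_mono lnk_mono)
  have "(u, v) \<in> lnk r K ?S" using uv sub by (auto simp: lnk_def)
  note uv' = this
  from x show "(u, x) \<in> (lnk r K ?S)\<^sup>*"
  proof
    assume "x \<in> W1"
    then have "x \<in> cl r W1" using cl_superset by blast
    then have "(u, x) \<in> (lnk r K (cl r W1))\<^sup>*" using assms(3) uv(1) by (simp add: conn_def)
    then show ?thesis using m(1) by blast
  next
    assume "x \<in> W2"
    then have "x \<in> cl r W2" using cl_superset by blast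
    then have "(v, x) \<in> (lnk r K (cl r W2))\<^sup>*" using assms(4) uv(2) by (simp add: conn_def)
    then have "(v, x) \<in> (lnk r K ?S)\<^sup>*" using m(2) by blast
    with uv' show ?thesis by (rule converse_rtrancl_into_rtrancl)
  qed
qed

text \<open>Two sites seen from the same site differ by at most \<open>K\<close> in every
  coordinate. If the closures are pairwise not adjacent, a site sees only one of them, so their
  union is already closed.\<close>

lemma cl_Union_separated:
  assumes K: "\<And>i. 2 * int (r i) \<le> K" and pos: "0 < sum r UNIV"
    and sep: "\<And>W W' u v. W \<in> P \<Longrightarrow> W' \<in> P \<Longrightarrow> u \<in> cl r W \<Longrightarrow> v \<in> cl r W' \<Longrightarrow> adj r K u v \<Longrightarrow> W = W'"
  shows "cl r (\<Union>P) = (\<Union>W\<in>P. cl r W)"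
proof
  show "(\<Union>W\<in>P. cl r W) \<subseteq> cl r (\<Union>P)" by (auto intro: cl_mono[THEN subsetD])
  show "cl r (\<Union>P) \<subseteq> (\<Union>W\<in>P. cl r W)"
  proof (rule cl_least)
    show "\<Union>P \<subseteq> (\<Union>W\<in>P. cl r W)" using cl_superset by fastforce
    show "closed_in r UNIV (\<Union>W\<in>P. cl r W)" unfolding closed_in_def
    proof (intro ballI impI)
      fix s assume s: "sum r UNIV \<le> cnt r (\<Union>W\<in>P. cl r W) s"
      then have "0 < cnt r (\<Union>W\<in>P. cl r W) s" using pos by simp
      then obtain i k where ik: "k \<noteq> 0" "\<bar>k\<bar> \<le> int (r i)" "s(i := s i + k) \<in> (\<Union>W\<in>P. cl r W)"
        by (rule cnt_pos_imp)
      then obtain W where W: "W \<in> P" "s(i := s i + k) \<in> cl r W" by auto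
      have K0: "0 \<le> K" using K[of i] by linarith
      have "cnt r (\<Union>W\<in>P. cl r W) s \<le> cnt r (cl r W) s"
        unfolding cnt_def
      proof (intro sum_mono card_mono finite_steps, clarify)
        fix j l W' assume l: "l \<noteq> 0" "\<bar>l\<bar> \<le> int (r j)" "W' \<in> P" "s(j := s j + l) \<in> cl r W'"
        have "adj r K (s(i := s i + k)) (s(j := s j + l))"
          using K[of i] K[of j] ik(1,2) l(1,2) K0 by (auto simp: adj_def)
        with l W sep have "W = W'" by blast
        with l show "s(j := s j + l) \<in> cl r W" by simp
      qed
      then show "s \<in> (\<Union>W\<in>P. cl r W)" using s W(1) closed_inD[OF cl_closed, of s r W] by fastforce
    qed
  qed
qed

text \<open>Replaces the usual merging procedure by an extremal choice. The property
  \<open>Q\<close> is a parameter: trivial when only a decomposition into clusters is wanted, and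
  smallness in the Aizenman--Lebowitz argument.\<close>

lemma closure_blocks:
  assumes fin: "finite A" and two: "two_pos r" and K: "\<And>i. 2 * int (r i) \<le> K"
    and single: "\<And>s. s \<in> A \<Longrightarrow> Q {s}"
    and merge: "\<And>W1 W2 u v. W1 \<subseteq> A \<Longrightarrow> W2 \<subseteq> A \<Longrightarrow> Q W1 \<Longrightarrow> Q W2 \<Longrightarrow>
      conn r K (cl r (W1 \<union> W2)) \<Longrightarrow> u \<in> cl r W1 \<Longrightarrow> v \<in> cl r W2 \<Longrightarrow> adj r K u v \<Longrightarrow> Q (W1 \<union> W2)"
  obtains P where "\<Union>P = A" "\<And>W. W \<in> P \<Longrightarrow> W \<noteq> {} \<and> Q W \<and> conn r K (cl r W)"
    "\<And>W W' u v. W \<in> P \<Longrightarrow> W' \<in> P \<Longrightarrow> u \<in> cl r W \<Longrightarrow> v \<in> cl r W' \<Longrightarrow> adj r K u v \<Longrightarrow> W = W'"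
    "cl r A = (\<Union>W\<in>P. cl r W)"
proof -
  define good where "good P \<longleftrightarrow> \<Union>P = A \<and> (\<forall>W\<in>P. W \<noteq> {} \<and> Q W \<and> conn r K (cl r W))" for P
  have K1: "int (r i) \<le> K" for i using K[of i] by simp
  have pos: "0 < sum r UNIV" using two_pos_sum[OF two] by (metis gr_zeroI less_zeroE)
  have "good ((\<lambda>s. {s}) ` A)" unfolding good_def
    using single two by (auto simp: cl_singleton conn_def)
  then have "finite ((\<lambda>s. {s}) ` A) \<and> good ((\<lambda>s. {s}) ` A)" using fin by simp
  \<comment> \<open>A decomposition with the fewest blocks: two adjacent blocks could be merged,
    contradicting minimality.\<close>
  from ex_has_least_nat[where P = "\<lambda>P. finite P \<and> good P" and m = card, OF this]
  obtain P where P: "finite P" "good P" and least: "\<And>P'. finite P' \<Longrightarrow> good P' \<Longrightarrow> card P \<le> card P'"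
    by blast
  have sep: "W = W'" if "W \<in> P" "W' \<in> P" "u \<in> cl r W" "v \<in> cl r W'" "adj r K u v" for W W' u v
  proof (rule ccontr)
    assume ne: "W \<noteq> W'"
    let ?P' = "insert (W \<union> W') (P - {W, W'})"
    have c: "conn r K (cl r (W \<union> W'))"
      using that P(2) by (intro conn_merge[OF K1 pos _ _ that(3-5)]) (auto simp: good_def)
    have "Q (W \<union> W')"
      using that P(2) by (intro merge[OF _ _ _ _ c that(3-5)]) (auto simp: good_def)
    then have "good ?P'" using P(2) that c unfolding good_def by auto
    moreover have "finite ?P'" using P(1) by simp
    ultimately have "card P \<le> card ?P'" by (rule least[rotated])
    also have "\<dots> \<le> Suc (card (P - {W, W'}))" by (rule card_insert_le_m1) auto
    also have "card (P - {W, W'}) = card P - 2" using P(1) that ne by (subst card_Diff_subset) auto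
    also have "Suc (card P - 2) < card P"
    proof -
      have "card {W, W'} \<le> card P" using P(1) that by (intro card_mono) auto
      then show ?thesis using ne by simp
    qed
    finally show False by simp
  qed
  have "cl r (\<Union>P) = (\<Union>W\<in>P. cl r W)" using sep by (intro cl_Union_separated[OF K pos]) blast
  then show ?thesis using that[of P] P(2) sep unfolding good_def by auto
qed

text \<open>The inequality is strict, so \<open>small (Suc m) S\<close> together with
  \<open>\<not> small m S\<close> says that the largest extent is exactly \<open>m\<close>.\<close>

definition small :: "nat \<Rightarrow> ('d \<Rightarrow> int) set \<Rightarrow> bool" where
  "small k S \<longleftrightarrow> (\<forall>i. \<forall>x\<in>S. \<forall>y\<in>S. x i - y i < int k)"

lemma small_mono: "k \<le> l \<Longrightarrow> small k S \<Longrightarrow> small l S"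
  unfolding small_def by (meson less_le_trans of_nat_mono)

lemma small_subset: "S \<subseteq> T \<Longrightarrow> small k T \<Longrightarrow> small k S"
  by (auto simp: small_def)

lemma cl_diff_less:
  assumes "finite W" "two_pos r" "\<And>x y. x \<in> W \<Longrightarrow> y \<in> W \<Longrightarrow> x i - y i < k" "x \<in> cl r W" "y \<in> cl r W"
  shows "x i - y i < k"
proof (cases "W = {}")
  case True
  then have "cl r W \<subseteq> {}" using cl_ge[OF assms(2), of "{}" "x i + 1" i] assms(4) by fastforce
  then show ?thesis using assms(4) by auto
next
  case False
  define c d where "c = Min ((\<lambda>w. w i) ` W)" and "d = Max ((\<lambda>w. w i) ` W)"
  have "c \<in> (\<lambda>w. w i) ` W" "d \<in> (\<lambda>w. w i) ` W" using False assms(1) by (auto simp: c_def d_def)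
  then have "d - c < k" using assms(3) by auto
  moreover have "c \<le> y i" using assms(1) by (intro cl_ge[OF assms(2) _ assms(5)]) (auto simp: c_def)
  moreover have "x i \<le> d" using assms(1) by (intro cl_le[OF assms(2) _ assms(4)]) (auto simp: d_def)
  ultimately show ?thesis by simp
qed

lemma small_cl: "finite W \<Longrightarrow> two_pos r \<Longrightarrow> small k W \<Longrightarrow> small k (cl r W)"
  unfolding small_def using cl_diff_less by blast

text \<open>Merging two adjacent \<open>k\<close>-small clusters yields extent below
  \<open>2 * k + K\<close>: two extents and a gap. If no cluster of intermediate size existed, every
  merger would again be \<open>k\<close>-small, so the decomposition could be carried out with
  \<open>k\<close>-small blocks only, and a connected closure would come from a single such
  block.\<close>

lemma Aizenman_Lebowitz:
  assumes fin: "finite W" and two: "two_pos r" and K: "\<And>i. 2 * int (r i) \<le> int K"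
    and W: "conn r (int K) (cl r W)" "\<not> small k W" and k: "1 \<le> k"
  shows "\<exists>W'\<subseteq>W. conn r (int K) (cl r W') \<and> \<not> small k W' \<and> small (2 * k + K) W'"
proof (rule ccontr)
  assume contra: "\<not> ?thesis"
  obtain P where P: "\<Union>P = W" "\<And>X. X \<in> P \<Longrightarrow> X \<noteq> {} \<and> small k X \<and> conn r (int K) (cl r X)"
    "\<And>X X' u v. X \<in> P \<Longrightarrow> X' \<in> P \<Longrightarrow> u \<in> cl r X \<Longrightarrow> v \<in> cl r X' \<Longrightarrow> adj r (int K) u v \<Longrightarrow> X = X'"
    "cl r W = (\<Union>X\<in>P. cl r X)"
  proof (rule closure_blocks[OF fin two K, of "small k"])
    show "small k {s}" for s using k by (auto simp: small_def)
    fix W1 W2 u v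
    assume a: "W1 \<subseteq> W" "W2 \<subseteq> W" "small k W1" "small k W2" "conn r (int K) (cl r (W1 \<union> W2))"
      "u \<in> cl r W1" "v \<in> cl r W2" "adj r (int K) u v"
    have f: "finite W1" "finite W2" using a fin by (auto intro: finite_subset)
    have s: "small k (cl r W1)" "small k (cl r W2)" using small_cl two a f by auto
    have uv: "\<bar>u i - v i\<bar> \<le> int K" for i
      using spec[OF a(8)[unfolded adj_def], of i] by (cases "r i = 0") auto
    have "x i - y i < int (2 * k + K)" if xy: "x \<in> W1 \<union> W2" "y \<in> W1 \<union> W2" for x y i
    proof -
      have b: "\<bar>z i - u i\<bar> < int k" if "z \<in> W1" for z
        using s(1) a(6) that cl_superset[of W1 r] unfolding small_def by (smt (verit) subsetD)
      have c: "\<bar>z i - v i\<bar> < int k" if "z \<in> W2" for z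
        using s(2) a(7) that cl_superset[of W2 r] unfolding small_def by (smt (verit) subsetD)
      show ?thesis using xy b[of x] b[of y] c[of x] c[of y] uv[of i] by auto
    qed
    then have "small (2 * k + K) (W1 \<union> W2)" by (auto simp: small_def)
    then show "small k (W1 \<union> W2)" using contra a(1,2,5) by blast
  qed blast
  have "W \<noteq> {}" using W(2) by (auto simp: small_def)
  then obtain w X where X: "w \<in> X" "X \<in> P" using P(1) by auto
  \<comment> \<open>A path in the closure cannot leave the closure of its block, because distinct
    blocks are not adjacent. Connectedness then leaves only the block of \<open>w\<close>.\<close>
  have "y \<in> cl r X" if "(w, y) \<in> (lnk r (int K) (cl r W))\<^sup>*" for y
    using that
  proof (induction rule: rtrancl_induct)
    case base
    then show ?case using X cl_superset by auto
  next
    case (step y z)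
    then have "z \<in> (\<Union>X\<in>P. cl r X)" "adj r (int K) y z" using P(4) by (auto simp: lnk_def)
    then show ?case using step.IH X(2) P(3) by blast
  qed
  then have sub: "y \<in> cl r X" if "(w, y) \<in> (lnk r (int K) (cl r W))\<^sup>*" for y
    using that by simp
  have "w \<in> cl r W" using X P(1) cl_superset[of W r] by blast
  then have "cl r W \<subseteq> cl r X" using W(1) sub by (simp add: conn_def subset_iff)
  moreover have "small k (cl r X)"
  proof (rule small_cl[OF _ two])
    show "finite X" using P(1) X(2) fin by (metis Union_upper finite_subset)
    show "small k X" using P(2)[OF X(2)] by simp
  qed
  ultimately have "small k W" by (metis cl_superset small_subset)
  with W(2) show False by contradiction
qed

section \<open>Crossing a block of layers\<close>

text \<open>A discrete intermediate value argument: start from the last visit to height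
  \<open>a\<close> before \<open>b\<close> is reached, so that the rest of the path stays between
  the two heights.\<close>

lemma height_crossing:
  fixes g :: "'a \<Rightarrow> int"
  assumes step: "\<And>u v. (u, v) \<in> R \<Longrightarrow> \<bar>g u - g v\<bar> \<le> 1"
    and xy: "(x, y) \<in> R\<^sup>*" and "g x \<le> a" "b \<le> g y" "a \<le> b"
  shows "\<exists>z w. (x, z) \<in> R\<^sup>* \<and> g z = a \<and> g w = b \<and>
    (z, w) \<in> (R \<inter> {(u, v). g u \<in> {a..b} \<and> g v \<in> {a..b}})\<^sup>*"
proof -
  let ?R = "R \<inter> {(u, v). g u \<in> {a..b} \<and> g v \<in> {a..b}}"
  let ?good = "\<exists>z w. (x, z) \<in> R\<^sup>* \<and> g z = a \<and> g w = b \<and> (z, w) \<in> ?R\<^sup>*"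
  \<comment> \<open>The three states of a path scanned from its start: a crossing is complete, the
    path is below the strip, or it is inside and connected within the strip to a point
    \<open>z\<close> at height \<open>a\<close>.\<close>
  have "?good \<or> g y < a \<or> (a \<le> g y \<and> g y < b \<and> (\<exists>z. (x, z) \<in> R\<^sup>* \<and> g z = a \<and> (z, y) \<in> ?R\<^sup>*))"
    using xy
  proof (induction rule: rtrancl_induct)
    case base
    then show ?case using assms(3,5) by (metis linorder_not_less order_antisym_conv rtrancl.rtrancl_refl)
  next
    case (step y y')
    have d: "\<bar>g y - g y'\<bar> \<le> 1" using assms(1) step by blast
    have xy': "(x, y') \<in> R\<^sup>*" using step by simp
    consider "?good" | "g y < a" | z where "a \<le> g y" "g y < b" "(x, z) \<in> R\<^sup>*" "g z = a" "(z, y) \<in> ?R\<^sup>*"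
      using step.IH by blast
    then show ?case
    proof cases
      case 2
      then show ?thesis using d xy' assms(5) 
        by (cases "g y' < a"; cases "a = b") (force intro: exI[of _ y'])+
    next
      case 3
      show ?thesis
      proof (cases "g y' < a")
        case False
        then have "(y, y') \<in> ?R" using 3 d step by auto
        then have "(z, y') \<in> ?R\<^sup>*" using 3(5) by (rule rtrancl_into_rtrancl[rotated])
        then have "(x, z) \<in> R\<^sup>* \<and> g z = a \<and> (z, y') \<in> ?R\<^sup>*" using 3 by blast
        moreover have "g y' = b \<or> a \<le> g y' \<and> g y' < b" using 3 False d by auto
        ultimately show ?thesis by blast
      qed auto
    qed blast
  qed
  then show ?thesis using assms by auto
qed

lemma heights_attained:
  fixes g :: "'a \<Rightarrow> int"
  assumes step: "\<And>u v. (u, v) \<in> R \<Longrightarrow> \<bar>g u - g v\<bar> \<le> 1"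
    and zw: "(z, w) \<in> R\<^sup>*" and "g z \<le> c" "c \<le> g w"
  shows "\<exists>v. (z, v) \<in> R\<^sup>* \<and> g v = c"
  using zw assms(3-)
proof (induction rule: rtrancl_induct)
  case base
  then show ?case by (auto intro: exI[of _ z])
next
  case (step w w')
  have "\<bar>g w - g w'\<bar> \<le> 1" using assms(1) step by blast
  then show ?case using step by (cases "c \<le> g w") (auto intro!: exI[of _ w'])
qed

lemma rtrancl_exit:
  assumes "(z, s) \<in> R\<^sup>*" "z \<in> Y" "s \<notin> Y"
  shows "\<exists>u\<in>Y. \<exists>v. v \<notin> Y \<and> (u, v) \<in> R \<and> (z, v) \<in> R\<^sup>*"
  using assms
proof (induction rule: rtrancl_induct)
  case base
  then show ?case by simp
next
  case (step y y')
  then show ?case by (cases "y \<in> Y") (auto intro: rtrancl_into_rtrancl)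
qed

text \<open>Attaches one vertex at a time along an edge leaving the current set; each adds at most
  \<open>K\<close> to the distance from \<open>z\<close>. It extracts a tight group of prescribed
  size from a long path.\<close>

lemma grow_connected:
  fixes R :: "(('d \<Rightarrow> int) \<times> ('d \<Rightarrow> int)) set"
  assumes step: "\<And>u v c. (u, v) \<in> R \<Longrightarrow> \<bar>u c - v c\<bar> \<le> int K"
    and fin: "finite (R\<^sup>* `` {z})" and card: "m < card (R\<^sup>* `` {z})"
  shows "\<exists>Y \<subseteq> R\<^sup>* `` {z}. card Y = Suc m \<and> z \<in> Y \<and> (\<forall>y\<in>Y. \<forall>c. \<bar>y c - z c\<bar> \<le> int m * int K)"
  using card
proof (induction m)
  case 0
  show ?case by (rule exI[of _ "{z}"]) auto
next
  case (Suc m)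
  then obtain Y where Y: "Y \<subseteq> R\<^sup>* `` {z}" "card Y = Suc m" "z \<in> Y" "\<forall>y\<in>Y. \<forall>c. \<bar>y c - z c\<bar> \<le> int m * int K"
    by force
  have finY: "finite Y" using Y(1) fin finite_subset by blast
  have "Y \<noteq> R\<^sup>* `` {z}" using Y(2) Suc.prems by auto
  then obtain s where "(z, s) \<in> R\<^sup>*" "s \<notin> Y" using Y(1) by auto
  from rtrancl_exit[OF this(1) Y(3) this(2)] obtain u v where uv: "u \<in> Y" "v \<notin> Y" "(u, v) \<in> R" "(z, v) \<in> R\<^sup>*"
    by blast
  have "\<bar>y c - z c\<bar> \<le> int (Suc m) * int K" if "y \<in> insert v Y" for y c
  proof -
    have "\<bar>u c - z c\<bar> \<le> int m * int K" using Y(4) uv(1) by blast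
    moreover have "y \<in> Y \<Longrightarrow> \<bar>y c - z c\<bar> \<le> int m * int K" using Y(4) by blast
    moreover have "int (Suc m) * int K = int m * int K + int K" by (simp add: algebra_simps)
    ultimately show ?thesis using that step[OF uv(3), of c] by auto
  qed
  then show ?case using Y uv finY by (intro exI[of _ "insert v Y"]) auto
qed

lemma div_diff_le_1:
  fixes x y t :: int
  assumes "\<bar>x - y\<bar> \<le> t" "0 < t"
  shows "\<bar>x div t - y div t\<bar> \<le> 1"
proof -
  have "x div t \<le> (y + t) div t" using assms by (intro zdiv_mono1) auto
  moreover have "y div t \<le> (x + t) div t" using assms by (intro zdiv_mono1) auto
  ultimately show ?thesis using assms(2) by simp
qed

lemma rtrancl_image:
  assumes "(x, y) \<in> R\<^sup>*" "\<And>u v. (u, v) \<in> R \<Longrightarrow> (f u, f v) \<in> R'"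
  shows "(f x, f y) \<in> R'\<^sup>*"
  using assms(1) by (induction rule: rtrancl_induct) (auto intro: rtrancl_into_rtrancl assms(2))

text \<open>If a block of \<open>r l\<close> layers contains no \<open>r l\<close> initial sites close to each other then the
  one-dimensional closure adds nothing there, so it cannot be crossed.\<close>

lemma crossed_block:
  fixes r :: "'d::finite \<Rightarrow> nat"
  assumes axes: "j \<noteq> l" "\<And>c. c \<noteq> j \<Longrightarrow> c \<noteq> l \<Longrightarrow> r c = 0" and rl: "0 < r l"
    and t: "2 * r j + 1 \<le> t" "K \<le> t" and K: "1 \<le> K"
    and fin: "finite B" and con: "conn r (int K) (cl r B)"
    and xy: "x \<in> cl r B" "y \<in> cl r B" "x j div int t \<le> a" "a + int (r l) - 1 \<le> y j div int t"
  shows "\<exists>Y \<subseteq> proj j (int t) ` B. card Y = r l \<and> (\<forall>y\<in>Y. a \<le> y j \<and> y j \<le> a + int (r l) - 1) \<and>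
    (\<forall>y\<in>Y. \<forall>y'\<in>Y. \<forall>c. \<bar>y c - y' c\<bar> \<le> 2 * int (r l) * int K)"
proof (rule ccontr)
  assume no: "\<not> ?thesis"
  let ?b = "a + int (r l) - 1" and ?\<pi> = "proj j (int t)" and ?r = "r(j := 0)"
  let ?I = "{a..?b}"
  define B' where "B' = {s \<in> ?\<pi> ` B. s j \<in> ?I}"
  \<comment> \<open>The candidate for a closed set: the initial sites inside the window of layers
    and everything outside the window. Only a line with \<open>r l\<close> nearby initial sites
    could make it grow, and \<open>no\<close> excludes that.\<close>
  define T where "T = B' \<union> {s. s j \<notin> ?I}"
  have finB': "finite B'" using fin by (simp add: B'_def)
  have noB: False if "Y \<subseteq> B'" "card Y = r l"
    "\<And>y y' c. y \<in> Y \<Longrightarrow> y' \<in> Y \<Longrightarrow> \<bar>y c - y' c\<bar> \<le> 2 * int (r l) * int K" for Y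
  proof -
    have "Y \<subseteq> ?\<pi> ` B" "\<forall>y\<in>Y. a \<le> y j \<and> y j \<le> ?b" using that(1) by (auto simp: B'_def)
    with that(2,3) no show False by blast
  qed
  have sum1: "sum ?r UNIV = r l"
  proof -
    have "sum ?r UNIV = sum ?r {l}" using axes by (intro sum.mono_neutral_right) auto
    then show ?thesis using axes by simp
  qed
  have "cl ?r (?\<pi> ` B) \<subseteq> T"
  proof (rule cl_least)
    show "?\<pi> ` B \<subseteq> T" by (auto simp: T_def B'_def)
    show "closed_in ?r UNIV T" unfolding closed_in_def
    proof (intro ballI impI, rule ccontr)
      fix s assume s: "sum ?r UNIV \<le> cnt ?r T s" and sT: "s \<notin> T"
      let ?S = "{k. k \<noteq> 0 \<and> \<bar>k\<bar> \<le> int (r l) \<and> s(l := s l + k) \<in> T}"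
      have "cnt ?r T s = (\<Sum>c\<in>{l}. card {k. k \<noteq> 0 \<and> \<bar>k\<bar> \<le> int (?r c) \<and> s(c := s c + k) \<in> T})"
        unfolding cnt_def using axes
        by (intro sum.mono_neutral_right) (auto intro!: card_eq_0_iff[THEN iffD2])
      then have "r l \<le> card ?S" using s sum1 axes(1) by simp
      then obtain S where S: "S \<subseteq> ?S" "card S = r l" by (rule obtain_subset_with_card_n)
      have inj: "inj_on (\<lambda>k. s(l := s l + k)) S" by (auto simp: inj_on_def fun_eq_iff)
      show False
      proof (rule noB[of "(\<lambda>k. s(l := s l + k)) ` S"])
        show "(\<lambda>k. s(l := s l + k)) ` S \<subseteq> B'"
          using S(1) sT axes(1) by (auto simp: T_def)
        show "card ((\<lambda>k. s(l := s l + k)) ` S) = r l" using S(2) card_image[OF inj] by simp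
        fix u v c assume "u \<in> (\<lambda>k. s(l := s l + k)) ` S" "v \<in> (\<lambda>k. s(l := s l + k)) ` S"
        then obtain k k' where k: "k \<in> ?S" "k' \<in> ?S" "u = s(l := s l + k)" "v = s(l := s l + k')"
          using S(1) by auto
        have "\<bar>u c - v c\<bar> \<le> \<bar>k - k'\<bar>" using k(3,4) by auto
        also have "\<dots> \<le> 2 * int (r l)" using k(1,2) by auto
        also have "\<dots> \<le> 2 * int (r l) * int K" using K by (simp add: mult_le_cancel_left1)
        finally show "\<bar>u c - v c\<bar> \<le> 2 * int (r l) * int K" .
      qed
    qed
  qed
  then have piT: "?\<pi> u \<in> T" if "u \<in> cl r B" for u
    using cl_proj[of r j "int t" B] t that by auto
  define R where "R = {(u, v). u \<in> T \<and> v \<in> T \<and> \<bar>u j - v j\<bar> \<le> 1 \<and> (\<forall>c. \<bar>u c - v c\<bar> \<le> int K)}"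
  have "(x, y) \<in> (lnk r (int K) (cl r B))\<^sup>*" using con xy(1,2) by (auto simp: conn_def)
  then have "(?\<pi> x, ?\<pi> y) \<in> R\<^sup>*"
  proof (rule rtrancl_image)
    fix u v assume uv: "(u, v) \<in> lnk r (int K) (cl r B)"
    then have d: "\<bar>u c - v c\<bar> \<le> int K" for c 
      by (auto simp: lnk_def adj_def split: if_splits dest!: spec[of _ c])
    have d1: "\<bar>u j div int t - v j div int t\<bar> \<le> 1"
      using d[of j] t by (intro div_diff_le_1) auto
    show "(?\<pi> u, ?\<pi> v) \<in> R" using uv piT d d1 K
      by (auto simp: R_def lnk_def) (auto simp: proj_def)
  qed
  from height_crossing[of R "\<lambda>s. s j", OF _ this, of a ?b]
  obtain z w where zw: "(?\<pi> x, z) \<in> R\<^sup>*" "z j = a" "w j = ?b"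
    "(z, w) \<in> (R \<inter> {(u, v). u j \<in> ?I \<and> v j \<in> ?I})\<^sup>*"
    using xy(3,4) rl by (auto simp: R_def proj_def)
  let ?R = "R \<inter> {(u, v). u j \<in> ?I \<and> v j \<in> ?I}"
  have "z \<in> T" using zw(1) piT[OF xy(1)] by (induction rule: rtrancl_induct) (auto simp: R_def)
  then have zB: "z \<in> B'" using zw(2) rl by (auto simp: T_def)
  have reach: "?R\<^sup>* `` {z} \<subseteq> B'"
  proof
    fix v assume "v \<in> ?R\<^sup>* `` {z}"
    then have "(z, v) \<in> ?R\<^sup>*" by simp
    then show "v \<in> B'" using zB by (induction rule: rtrancl_induct) (auto simp: R_def T_def)
  qed
  then have finR: "finite (?R\<^sup>* `` {z})" using finB' finite_subset by blast
  \<comment> \<open>Inside the window the path runs through initial sites only and visits each of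
    its \<open>r l\<close> heights. So it has at least \<open>r l\<close> sites, and
    \<open>r l\<close> of them near \<open>z\<close> form the forbidden group.\<close>
  have "{a..?b} \<subseteq> (\<lambda>s. s j) ` (?R\<^sup>* `` {z})"
  proof
    fix c assume "c \<in> {a..?b}"
    then have "\<exists>v. (z, v) \<in> ?R\<^sup>* \<and> v j = c"
      using zw(2,3) by (intro heights_attained[of ?R "\<lambda>s. s j", OF _ zw(4)]) (auto simp: R_def)
    then show "c \<in> (\<lambda>s. s j) ` (?R\<^sup>* `` {z})" by auto
  qed
  then have "card {a..?b} \<le> card ((\<lambda>s. s j) ` (?R\<^sup>* `` {z}))" using finR by (intro card_mono) auto
  also have "\<dots> \<le> card (?R\<^sup>* `` {z})" by (rule card_image_le[OF finR])
  finally have "r l - 1 < card (?R\<^sup>* `` {z})" using rl by simp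
  from grow_connected[OF _ finR this, of K] obtain Y where Y: "Y \<subseteq> ?R\<^sup>* `` {z}" "card Y = Suc (r l - 1)"
    "\<forall>y\<in>Y. \<forall>c. \<bar>y c - z c\<bar> \<le> int (r l - 1) * int K"
    by (auto simp: R_def)
  show False
  proof (rule noB)
    show "Y \<subseteq> B'" using Y(1) reach by blast
    show "card Y = r l" using Y(2) rl by simp
    fix u v c assume "u \<in> Y" "v \<in> Y"
    then have "\<bar>u c - z c\<bar> \<le> int (r l - 1) * int K" "\<bar>v c - z c\<bar> \<le> int (r l - 1) * int K" using Y(3) by auto
    moreover have "int (r l - 1) * int K \<le> int (r l) * int K" by (intro mult_right_mono) auto
    ultimately show "\<bar>u c - v c\<bar> \<le> 2 * int (r l) * int K" by (simp add: algebra_simps abs_le_iff) 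
  qed
qed

section \<open>Two-dimensional clusters\<close>

lemma card_preimage_le:
  assumes "finite V" "\<And>s. card {v \<in> V. f v = s} \<le> M" "finite S"
  shows "card {v \<in> V. f v \<in> S} \<le> M * card S"
proof -
  have "{v \<in> V. f v \<in> S} = (\<Union>s\<in>S. {v \<in> V. f v = s})" by auto
  then have "card {v \<in> V. f v \<in> S} \<le> (\<Sum>s\<in>S. card {v \<in> V. f v = s})"
    using card_UN_le[OF assms(3), of "\<lambda>s. {v \<in> V. f v = s}"] by simp
  also have "\<dots> \<le> (\<Sum>s\<in>S. M)" by (intro sum_mono assms(2))
  finally show ?thesis by (simp add: mult.commute)
qed

lemma box_eq_PiE: "{s. \<forall>c. s c \<in> I c} = PiE UNIV I"
  by (auto simp: PiE_UNIV_domain)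

lemma card_fun_box:
  fixes I :: "'d::finite \<Rightarrow> 'b set"
  shows "card {s. \<forall>c. s c \<in> I c} = (\<Prod>c\<in>UNIV. card (I c))"
  by (simp add: box_eq_PiE card_PiE)

lemma finite_fun_box:
  fixes I :: "'d::finite \<Rightarrow> 'b set"
  assumes "\<And>c. finite (I c)" shows "finite {s. \<forall>c. s c \<in> I c}"
  unfolding box_eq_PiE using assms by (intro finite_PiE) auto

text \<open>\<open>d c\<close> is a difference of coordinates, so the tight box has
  \<open>d c + 1\<close> layers along axis \<open>c\<close>.\<close>

definition bbox :: "('d \<Rightarrow> int) \<Rightarrow> ('d \<Rightarrow> nat) \<Rightarrow> ('d \<Rightarrow> int) set \<Rightarrow> bool" where
  "bbox lo d B \<longleftrightarrow> (\<forall>s\<in>B. \<forall>c. lo c \<le> s c \<and> s c \<le> lo c + int (d c)) \<and>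
     (\<forall>c. \<exists>s\<in>B. s c = lo c) \<and> (\<forall>c. \<exists>s\<in>B. s c = lo c + int (d c))"

text \<open>\<open>f\<close> maps the random sites to a lattice in which blocks of layers are
  collapsed. It need not be injective, so the randomness stays with the original sites, where
  independence is available.\<close>

definition spanned :: "('d::finite \<Rightarrow> nat) \<Rightarrow> nat \<Rightarrow> ('a \<Rightarrow> 'd \<Rightarrow> int) \<Rightarrow> ('d \<Rightarrow> int) \<Rightarrow> ('d \<Rightarrow> nat) \<Rightarrow> 'a set \<Rightarrow> bool" where
  "spanned r K f lo d A \<longleftrightarrow> (\<exists>W\<subseteq>A. finite W \<and> bbox lo d (f ` W) \<and> conn r (int K) (cl r (f ` W)))"

text \<open>Not containing a given set is a decreasing event, so Harris bounds the probability of
  avoiding all of them from below by a product. A union bound would say nothing once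
  \<open>N * p ^ n\<close> exceeds 1, which happens for wide clusters.\<close>

lemma Pr_some_subset_le:
  assumes "finite V" "0 \<le> p" "p \<le> 1" "finite Z" "\<And>W. W \<in> Z \<Longrightarrow> W \<subseteq> V \<and> card W = n" "card Z \<le> N"
  shows "Pr V p (\<lambda>A. \<exists>W\<in>Z. W \<subseteq> A) \<le> 1 - (1 - p ^ n) ^ N"
proof -
  have "(1 - p ^ n) ^ N \<le> (1 - p ^ n) ^ card Z"
    using assms by (intro power_decreasing) (auto simp: power_le_one)
  also have "\<dots> = (\<Prod>W\<in>Z. Pr V p (\<lambda>A. \<not> W \<subseteq> A))"
    using assms(5) by (simp add: Pr_Not[OF assms(1)] Pr_superset[OF assms(1)])
  also have "\<dots> \<le> Pr V p (\<lambda>A. \<forall>W\<in>Z. \<not> W \<subseteq> A)"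
    by (intro Harris_decreasing_family assms(1-4)) (auto simp: increasing_def)
  also have "\<dots> = 1 - Pr V p (\<lambda>A. \<exists>W\<in>Z. W \<subseteq> A)"
    using Pr_Not[OF assms(1), of p "\<lambda>A. \<exists>W\<in>Z. W \<subseteq> A"] by simp
  finally show ?thesis by simp
qed

text \<open>Bounds, per unit of length, the number of groups of \<open>n\<close> nearby sites in a
  window. \<open>M\<close> is the multiplicity of the projection, \<open>M * n\<close> counts the
  sites a group may start from, and the power of 2 counts all subsets of the neighbourhood of radius
  \<open>2 * n * K\<close>.\<close>

definition block_const :: "'d::finite itself \<Rightarrow> nat \<Rightarrow> nat \<Rightarrow> nat \<Rightarrow> nat" where
  "block_const _ M K n = M * n * 2 ^ (M * (4 * n * K + 1) ^ CARD('d))"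

text \<open>The cluster crosses every window of \<open>r l\<close> block layers inside its extent
  along \<open>j\<close>. Distinct windows use disjoint sets of sites, so the probabilities
  multiply, and each window must contain a tight group of \<open>r l\<close> occupied sites
  somewhere along its length \<open>d l + 1\<close>.\<close>

lemma spanned_bound:
  fixes r :: "'d::finite \<Rightarrow> nat" and f :: "'a \<Rightarrow> 'd \<Rightarrow> int"
  assumes p: "finite V" "0 \<le> p" "p \<le> 1"
    and axes: "j \<noteq> l" "\<And>c. c \<noteq> j \<Longrightarrow> c \<noteq> l \<Longrightarrow> r c = 0" and rl: "0 < r l"
    and t: "2 * r j + 1 \<le> t" "K \<le> t" and K: "1 \<le> K"
    and M: "\<And>s. card {v \<in> V. proj j (int t) (f v) = s} \<le> M"
    and d: "\<And>c. c \<noteq> j \<Longrightarrow> c \<noteq> l \<Longrightarrow> d c = 0"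
  shows "Pr V p (spanned r K f lo d) \<le>
    (1 - (1 - p ^ r l) ^ (block_const TYPE('d) M K (r l) * (d l + 1))) ^ (d j div (t * r l) - 1)"
proof -
  \<comment> \<open>Window \<open>q\<close> covers the coordinates from \<open>q * T\<close> to
    \<open>(q + 1) * T - 1\<close>. Windows are aligned to multiples of \<open>T\<close>, so the one
    containing \<open>lo j\<close> is skipped, and the next \<open>N\<close> windows certainly lie
    inside the box.\<close>
  define n T N where "n = r l" and "T = t * n" and "N = d j div T - 1"
  define f2 where "f2 = (\<lambda>v. proj j (int t) (f v))"
  define q0 where "q0 = lo j div int T"
  define I where "I q c = (if c = j then {q * int n..q * int n + int n - 1} else {lo c..lo c + int (d c)})" for q c
  define U where "U q = {v \<in> V. f2 v \<in> {s. \<forall>c. s c \<in> I q c}}" for q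
  define Z where "Z q = {W. W \<subseteq> U q \<and> card W = n \<and> (\<forall>v\<in>W. \<forall>v'\<in>W. \<forall>c. \<bar>f2 v c - f2 v' c\<bar> \<le> 2 * int n * int K)}" for q
  define C where "C = block_const TYPE('d) M K n * (d l + 1)"
  have n0: "0 < n" and t0: "0 < t" and T0: "0 < T" using rl t by (auto simp: n_def T_def)
  have finU: "finite (U q)" for q using p(1) by (simp add: U_def)
  have finZ: "finite (Z q)" for q unfolding Z_def by (rule finite_subset[of _ "Pow (U q)"]) (auto simp: finU)
  have M2: "card {v \<in> V. f2 v = s} \<le> M" for s using M by (simp add: f2_def)
  have finI: "finite (I q c)" for q c by (simp add: I_def)
  have cardU: "card (U q) \<le> M * (n * (d l + 1))" for q
  proof -
    have "card {s. \<forall>c. s c \<in> I q c} = (\<Prod>c\<in>UNIV. card (I q c))" by (rule card_fun_box)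
    also have "\<dots> = (\<Prod>c\<in>{j, l}. card (I q c))" using d by (intro prod.mono_neutral_right) (auto simp: I_def)
    also have "\<dots> = n * (d l + 1)" using axes(1) by (simp add: I_def nat_add_distrib)
    finally show ?thesis unfolding U_def using card_preimage_le[OF p(1) M2 finite_fun_box, of "I q"] finI by simp
  qed
  have cardZ: "card (Z q) \<le> C" for q
  proof -
    define D where "D v = {v' \<in> V. f2 v' \<in> {s. \<forall>c. s c \<in> {f2 v c - 2 * int n * int K..f2 v c + 2 * int n * int K}}}" for v
    have cardD: "card (D v) \<le> M * (4 * n * K + 1) ^ CARD('d)" for v
    proof -
      have "card {x - 2 * int n * int K..x + 2 * int n * int K} = 4 * n * K + 1" for x :: int
      proof -
        have "x + 2 * int n * int K + 1 - (x - 2 * int n * int K) = int (4 * n * K + 1)" by simp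
        then show ?thesis by (simp only: card_atLeastAtMost_int nat_int)
      qed
      then have "card {s. \<forall>c. s c \<in> {f2 v c - 2 * int n * int K..f2 v c + 2 * int n * int K}} = (4 * n * K + 1) ^ CARD('d)"
        unfolding card_fun_box by simp
      then show ?thesis
        unfolding D_def using card_preimage_le[OF p(1) M2 finite_fun_box[of "\<lambda>c. {f2 v c - 2 * int n * int K..f2 v c + 2 * int n * int K}"]] by simp
    qed
    have "Z q \<subseteq> (\<Union>v\<in>U q. Pow (D v))"
    proof
      fix W assume W: "W \<in> Z q"
      then have "W \<noteq> {}" using n0 by (auto simp: Z_def)
      then obtain v where v: "v \<in> W" by auto
      have "W \<subseteq> D v"
      proof
        fix v' assume v': "v' \<in> W"
        then have "\<bar>f2 v c - f2 v' c\<bar> \<le> 2 * int n * int K" for c using W v by (auto simp: Z_def)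
        then have "f2 v c - 2 * int n * int K \<le> f2 v' c \<and> f2 v' c \<le> f2 v c + 2 * int n * int K" for c
          by (simp add: abs_le_iff algebra_simps)
        moreover have "v' \<in> V" using W v' by (auto simp: Z_def U_def)
        ultimately show "v' \<in> D v" by (auto simp: D_def)
      qed
      then show "W \<in> (\<Union>v\<in>U q. Pow (D v))" using v W by (auto simp: Z_def)
    qed
    moreover have finD: "finite (D v)" for v using p(1) by (simp add: D_def)
    ultimately have "card (Z q) \<le> card (\<Union>v\<in>U q. Pow (D v))" using finU by (intro card_mono) auto
    also have "\<dots> \<le> (\<Sum>v\<in>U q. card (Pow (D v)))" by (rule card_UN_le[OF finU])
    also have "\<dots> \<le> (\<Sum>v\<in>U q. 2 ^ (M * (4 * n * K + 1) ^ CARD('d)))"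
      using cardD by (intro sum_mono) (auto simp: card_Pow finD)
    also have "\<dots> \<le> M * (n * (d l + 1)) * 2 ^ (M * (4 * n * K + 1) ^ CARD('d))"
      using cardU[of q] by (simp add: mult_right_mono)
    finally show ?thesis by (simp add: C_def block_const_def algebra_simps)
  qed
  let ?Q = "(\<lambda>k. q0 + 1 + int k) ` {..<N}"
  have "Pr V p (spanned r K f lo d) \<le> Pr V p (\<lambda>A. \<forall>q\<in>?Q. \<exists>W\<in>Z q. W \<subseteq> A \<inter> U q)"
  proof (rule Pr_mono[OF p], rule ballI)
    fix A q assume A: "A \<subseteq> V" "spanned r K f lo d A" and "q \<in> ?Q"
    then obtain k where k: "k < N" "q = q0 + 1 + int k" by auto
    obtain W where W: "W \<subseteq> A" "finite W" "bbox lo d (f ` W)" "conn r (int K) (cl r (f ` W))"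
      using A(2) by (auto simp: spanned_def)
    obtain x y where xy: "x \<in> f ` W" "y \<in> f ` W" "x j = lo j" "y j = lo j + int (d j)"
      using W(3) unfolding bbox_def by blast
    have eq: "lo j = q0 * int T + lo j mod int T" unfolding q0_def by simp
    have mod: "0 \<le> lo j mod int T" "lo j mod int T < int T" using T0 by auto
    have "lo j < (q0 + 1) * int T" using eq mod(2) unfolding distrib_right by linarith
    then have 1: "x j \<le> q * int n * int t"
    proof -
      have "(q0 + 1) * int T \<le> q * int T" using k(2) by (intro mult_right_mono) auto
      then show ?thesis using \<open>lo j < (q0 + 1) * int T\<close> xy(3) by (simp add: T_def algebra_simps)
    qed
    have 2: "(q * int n + int n - 1) * int t \<le> y j"
    proof -
      have "N + 1 \<le> d j div T" using k(1) by (simp add: N_def)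
      then have "(N + 1) * T \<le> d j" using T0 by (simp add: less_eq_div_iff_mult_less_eq)
      then have a: "(int N + 1) * int T \<le> int (d j)" by (metis of_nat_Suc of_nat_le_iff of_nat_mult Suc_eq_plus1 add.commute)
      have b: "q0 * int T \<le> lo j" using eq mod(1) by linarith
      have c: "(q + 1) * int T \<le> (q0 + (int N + 1)) * int T" using k by (intro mult_right_mono) auto
      have "(q * int n + int n - 1) * int t = (q + 1) * int T - int t" by (simp add: T_def algebra_simps)
      also have "\<dots> \<le> q0 * int T + (int N + 1) * int T" using c by (simp add: algebra_simps)
      finally show ?thesis using a b xy(4) by linarith
    qed
    have 3: "x j div int t \<le> q * int n"
      using zdiv_mono1[OF 1, of "int t"] t0 by simp
    have 4: "q * int n + int (r l) - 1 \<le> y j div int t"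
      using zdiv_mono1[OF 2, of "int t"] t0 by (simp add: n_def)
    have sup: "f ` W \<subseteq> cl r (f ` W)" by (rule cl_superset)
    obtain Y where Y: "Y \<subseteq> proj j (int t) ` f ` W" "card Y = n" "\<forall>y\<in>Y. q * int n \<le> y j \<and> y j \<le> q * int n + int n - 1"
      "\<forall>y\<in>Y. \<forall>y'\<in>Y. \<forall>c. \<bar>y c - y' c\<bar> \<le> 2 * int n * int K"
      using crossed_block[OF axes rl t K _ W(4), of x y "q * int n"] 3 4 xy sup W(2)
      unfolding n_def by blast
    have "Y \<subseteq> f2 ` W" using Y(1) by (auto simp: f2_def)
    then obtain X where X: "X \<subseteq> W" "inj_on f2 X" "Y = f2 ` X" by (auto simp: subset_image_inj)
    have "v \<in> U q" if "v \<in> X" for v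
    proof -
      have "lo c \<le> f v c \<and> f v c \<le> lo c + int (d c)" for c
        using W(3) that X(1) unfolding bbox_def by blast
      moreover have "f2 v c = f v c" if "c \<noteq> j" for c using that by (simp add: f2_def proj_def)
      moreover have "q * int n \<le> f2 v j \<and> f2 v j \<le> q * int n + int n - 1" using Y(3) X(3) that by blast
      ultimately show ?thesis using that X(1) W(1) A(1) by (auto simp: U_def I_def)
    qed
    then have XU: "X \<subseteq> U q" by blast
    moreover have "card X = n" using Y(2) X(2,3) card_image by metis
    ultimately have "X \<in> Z q" using Y(4) X(3) by (simp add: Z_def)
    then show "\<exists>W\<in>Z q. W \<subseteq> A \<inter> U q" using XU X(1) W(1) by blast
  qed
  also have "\<dots> = (\<Prod>q\<in>?Q. Pr V p (\<lambda>A. \<exists>W\<in>Z q. W \<subseteq> A \<inter> U q))"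
  proof (rule Pr_indep[OF p(1), where E = "\<lambda>q A. \<exists>W\<in>Z q. W \<subseteq> A"])
    show "disjoint_family_on U ?Q" unfolding disjoint_family_on_def
    proof (intro ballI impI)
      fix q q' :: int assume "q \<noteq> q'"
      have "I q j \<inter> I q' j = {}"
      proof (rule ccontr)
        assume "I q j \<inter> I q' j \<noteq> {}"
        then obtain x where "x \<in> I q j" "x \<in> I q' j" by blast
        then have "q * int n \<le> x" "x \<le> q * int n + int n - 1" "q' * int n \<le> x" "x \<le> q' * int n + int n - 1"
          by (simp_all add: I_def)
        then have "q * int n < (q' + 1) * int n" "q' * int n < (q + 1) * int n"
          unfolding distrib_right by linarith+
        then have "q < q' + 1" "q' < q + 1" using mult_less_cancel_right_pos[of "int n"] n0 by simp_all
        with \<open>q \<noteq> q'\<close> show False by simp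
      qed
      then show "U q \<inter> U q' = {}" by (auto simp: U_def)
    qed
  qed (auto simp: U_def)
  also have "\<dots> \<le> (\<Prod>q\<in>?Q. 1 - (1 - p ^ n) ^ C)"
  proof (intro prod_mono conjI Pr_nonneg[OF p(2,3)])
    fix q
    have "Pr V p (\<lambda>A. \<exists>W\<in>Z q. W \<subseteq> A \<inter> U q) \<le> Pr V p (\<lambda>A. \<exists>W\<in>Z q. W \<subseteq> A)"
      by (rule Pr_mono[OF p]) auto
    also have "\<dots> \<le> 1 - (1 - p ^ n) ^ C"
      by (rule Pr_some_subset_le[OF p finZ _ cardZ]) (auto simp: Z_def U_def)
    finally show "Pr V p (\<lambda>A. \<exists>W\<in>Z q. W \<subseteq> A \<inter> U q) \<le> 1 - (1 - p ^ n) ^ C" .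
  qed
  also have "\<dots> = (1 - (1 - p ^ n) ^ C) ^ N"
  proof -
    have "card ?Q = N" by (subst card_image) (auto simp: inj_on_def)
    then show ?thesis by simp
  qed
  finally show ?thesis by (simp add: C_def N_def T_def n_def)
qed

section \<open>Chains of disjoint clusters\<close>

text \<open>The link of a chain: a connected cluster of extent exactly \<open>m\<close>. The marker
  \<open>u\<close> is the image of one of its initial sites and serves to enumerate
  positions.\<close>

definition seed :: "('d::finite \<Rightarrow> nat) \<Rightarrow> nat \<Rightarrow> ('a \<Rightarrow> 'd \<Rightarrow> int) \<Rightarrow> ('d \<Rightarrow> int) \<Rightarrow> nat \<Rightarrow> 'a set \<Rightarrow> bool" where
  "seed r K f u m A \<longleftrightarrow> (\<exists>W\<subseteq>A. finite W \<and> u \<in> f ` W \<and> conn r (int K) (cl r (f ` W)) \<and>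
     small (Suc m) (f ` W) \<and> \<not> small m (f ` W))"

definition near :: "nat \<Rightarrow> ('d \<Rightarrow> int) \<Rightarrow> ('d \<Rightarrow> int) set" where
  "near n u = {u'. \<forall>c. u' c \<in> {u c - int n..u c + int n}}"

text \<open>The nested \<open>disj_occ\<close> reserves separate initial sites for each of the
  \<open>n\<close> seeds. Markers of two seeds whose closures come within \<open>K\<close> of each
  other differ by at most \<open>m + m' + K\<close>, which limits the choice of the next
  one.\<close>

fun chain :: "('d::finite \<Rightarrow> nat) \<Rightarrow> nat \<Rightarrow> ('a \<Rightarrow> 'd \<Rightarrow> int) \<Rightarrow> nat \<Rightarrow> nat \<Rightarrow> ('d \<Rightarrow> int) \<Rightarrow> nat \<Rightarrow> 'a set \<Rightarrow> bool" where
  "chain r K f mm 0 u m A = True"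
| "chain r K f mm (Suc n) u m A = disj_occ (seed r K f u m)
     (\<lambda>R. n = 0 \<or> (\<exists>m'\<in>{..<mm}. \<exists>u'\<in>near (m + m' + K) u. chain r K f mm n u' m' R)) A"

lemma card_near: "card (near n (u :: 'd::finite \<Rightarrow> int)) = (2 * n + 1) ^ CARD('d)"
proof -
  have "card {x - int n..x + int n} = 2 * n + 1" for x :: int
    by (simp add: nat_eq_iff)
  then show ?thesis unfolding near_def card_fun_box by (simp only: prod_constant)
qed

lemma finite_near [simp]: "finite (near n (u :: 'd::finite \<Rightarrow> int))"
  unfolding near_def by (rule finite_fun_box) auto

lemma disj_occ_increasing: "increasing (disj_occ E1 E2)"
  unfolding increasing_def disj_occ_def by (meson order_trans)

lemma seed_increasing: "increasing (seed r K f u m)"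
  unfolding increasing_def seed_def by (meson order_trans)

lemma chain_increasing: "increasing (chain r K f mm n u m)"
  by (cases n) (use disj_occ_increasing in \<open>auto simp: increasing_def\<close>)

lemma chain_Suc_imp: "chain r K f mm (Suc n) u m A \<Longrightarrow> chain r K f mm n u m A"
proof (induction n arbitrary: u m A)
  case 0
  then show ?case by simp
next
  case (Suc n)
  from Suc.prems obtain W1 W2 m' u' where W: "W1 \<inter> W2 = {}" "W1 \<union> W2 \<subseteq> A" "seed r K f u m W1"
    "m' \<in> {..<mm}" "u' \<in> near (m + m' + K) u" "chain r K f mm (Suc n) u' m' W2"
    unfolding chain.simps(2)[of r K f mm "Suc n"] disj_occ_def
    by (auto simp del: chain.simps)
  have "chain r K f mm n u' m' W2" by (rule Suc.IH[OF W(6)])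
  then show ?case using W(1-5) unfolding chain.simps disj_occ_def by blast
qed

lemma chain_le: "n \<le> n' \<Longrightarrow> chain r K f mm n' u m A \<Longrightarrow> chain r K f mm n u m A"
  by (induction n' rule: dec_induct) (use chain_Suc_imp in blast)+

text \<open>The cost of one more link, summed over its extent. A factor
  \<open>(m + 1) ^ CARD('d)\<close> appears twice because the extent of a seed enters the number of
  markers on the step into the seed and again on the step out of it.\<close>

definition chain_rate :: "'d::finite itself \<Rightarrow> nat \<Rightarrow> (nat \<Rightarrow> real) \<Rightarrow> nat \<Rightarrow> real" where
  "chain_rate _ K g mm = (\<Sum>m<mm. real (2 * K + 3) ^ CARD('d) * real (m + 1) ^ (2 * CARD('d)) * g m)"

lemma chain_bound:
  fixes r :: "'d::finite \<Rightarrow> nat"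
  assumes p: "finite V" "0 \<le> p" "p \<le> 1/2"
    and g: "\<And>u m. m < mm \<Longrightarrow> Pr V p (seed r K f u m) \<le> g m" and m: "m < mm"
  shows "Pr V p (chain r K f mm (Suc n) u m) \<le> g m * real (m + 1) ^ CARD('d) * chain_rate TYPE('d) K g mm ^ n"
  using m
proof (induction n arbitrary: u m)
  case 0
  have "Pr V p (chain r K f mm (Suc 0) u m) \<le> Pr V p (seed r K f u m)"
    using p seed_increasing[of r K f u m] by (intro Pr_mono) (auto simp: disj_occ_def increasing_def)
  also have "\<dots> \<le> g m" by (rule g[OF 0])
  also have "\<dots> \<le> g m * real (m + 1) ^ CARD('d)"
    using order_trans[OF Pr_nonneg g[OF 0]] p by (intro mult_le_cancel_left1[THEN iffD2]) (auto intro!: one_le_power)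
  finally show ?case by (simp only: power_0 mult_1_right)
next
  case (Suc n)
  have p1: "p \<le> 1" using p by simp
  let ?c = "real (2 * K + 3) ^ CARD('d)" and ?e = "chain_rate TYPE('d) K g mm"
  let ?E = "\<lambda>R. \<exists>m'\<in>{..<mm}. \<exists>u'\<in>near (m + m' + K) u. chain r K f mm (Suc n) u' m' R"
  have g0: "0 \<le> g m'" if "m' < mm" for m' using order_trans[OF Pr_nonneg[OF p(2) p1] g[OF that]] .
  have e0: "0 \<le> ?e" unfolding chain_rate_def using g0 by (intro sum_nonneg) auto
  have "Pr V p (chain r K f mm (Suc (Suc n)) u m) = Pr V p (disj_occ (seed r K f u m) ?E)"
    by (rule Pr_cong, subst chain.simps(2)[of r K f mm "Suc n"]) (simp del: chain.simps)
  also have "\<dots> \<le> Pr V p (seed r K f u m) * Pr V p ?E"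
  proof (rule BK_inequality[OF p seed_increasing])
    show "increasing ?E" using chain_increasing[of r K f mm "Suc n"] unfolding increasing_def by blast
  qed
  also have "\<dots> \<le> g m * (real (m + 1) ^ CARD('d) * ?e ^ Suc n)"
  proof (rule mult_mono[OF g[OF Suc.prems]])
    have "Pr V p ?E \<le> (\<Sum>m'\<in>{..<mm}. Pr V p (\<lambda>R. \<exists>u'\<in>near (m + m' + K) u. chain r K f mm (Suc n) u' m' R))"
      by (rule Pr_union_bound[OF p(1,2) p1]) simp
    also have "\<dots> \<le> (\<Sum>m'\<in>{..<mm}. real (card (near (m + m' + K) u)) * (g m' * real (m' + 1) ^ CARD('d) * ?e ^ n))"
      by (rule sum_mono, rule Pr_union_bound_card[OF p(1,2) p1 finite_near], rule Suc.IH) simp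
    also have "\<dots> \<le> (\<Sum>m'\<in>{..<mm}. (?c * real (m + 1) ^ CARD('d) * real (m' + 1) ^ CARD('d)) * (g m' * real (m' + 1) ^ CARD('d) * ?e ^ n))"
    proof (intro sum_mono mult_right_mono)
      fix m' assume m': "m' \<in> {..<mm}"
      \<comment> \<open>Bounding the sum by a product separates the contributions of consecutive
        seeds.\<close>
      have "2 * (m + m' + K) + 1 \<le> (2 * K + 3) * (m + 1) * (m' + 1)" by (simp add: algebra_simps)
      then have "(2 * (m + m' + K) + 1) ^ CARD('d) \<le> ((2 * K + 3) * (m + 1) * (m' + 1)) ^ CARD('d)"
        by (rule power_mono) simp
      then have "real (card (near (m + m' + K) u)) \<le> real (((2 * K + 3) * (m + 1) * (m' + 1)) ^ CARD('d))"
        unfolding card_near of_nat_le_iff .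
      then show "real (card (near (m + m' + K) u)) \<le> ?c * real (m + 1) ^ CARD('d) * real (m' + 1) ^ CARD('d)"
        by (simp only: of_nat_power of_nat_mult power_mult_distrib)
      show "0 \<le> g m' * real (m' + 1) ^ CARD('d) * ?e ^ n" using g0 e0 m' by auto
    qed
    also have "\<dots> = real (m + 1) ^ CARD('d) * ?e ^ Suc n"
      unfolding power_Suc chain_rate_def sum_distrib_left sum_distrib_right
      by (intro sum.cong refl) (simp add: mult_ac power_mult power2_eq_square)
    finally show "Pr V p ?E \<le> real (m + 1) ^ CARD('d) * ?e ^ Suc n" .
  qed (use g0[OF Suc.prems] Pr_nonneg[OF p(2) p1] in auto)
  finally show ?case by (simp only: mult.assoc)
qed

text \<open>Layers orthogonal to axis \<open>i\<close> do not interact in the projected dynamics,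
  and \<open>adj\<close> never leaves a layer. The images of adjacent sites of the original cluster
  may however lie in neighbouring layers; this weaker relation follows them.\<close>

definition steps :: "'d \<Rightarrow> nat \<Rightarrow> ('d \<Rightarrow> int) set \<Rightarrow> (('d \<Rightarrow> int) \<times> ('d \<Rightarrow> int)) set" where
  "steps i K S = {(u, v). u \<in> S \<and> v \<in> S \<and> \<bar>u i - v i\<bar> \<le> 1 \<and> (\<forall>c. \<bar>u c - v c\<bar> \<le> int K)}"

definition crossed :: "('d::finite \<Rightarrow> nat) \<Rightarrow> nat \<Rightarrow> 'd \<Rightarrow> int \<Rightarrow> int \<Rightarrow> ('d \<Rightarrow> int) set \<Rightarrow> bool" where
  "crossed r K i a b B \<longleftrightarrow> (\<exists>z w. z \<in> cl r B \<and> z i = a \<and> w i = b \<and> (z, w) \<in> (steps i K (cl r B))\<^sup>*)"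

lemma small_abs:
  assumes "small (Suc m) S" "x \<in> S" "y \<in> S"
  shows "\<bar>x c - y c\<bar> \<le> int m"
proof -
  have "x c - y c < int (Suc m)" "y c - x c < int (Suc m)" using assms by (auto simp only: small_def)
  then show ?thesis by linarith
qed

lemma exact_small:
  assumes "finite X" "X \<noteq> {}"
  shows "\<exists>m. small (Suc m) X \<and> \<not> small m (X :: ('d::finite \<Rightarrow> int) set)"
proof -
  let ?D = "(\<lambda>(i, x, y). nat (x i - y i)) ` (UNIV \<times> X \<times> X)"
  have fin: "finite ?D" using assms by auto
  have "small (Suc (Max ?D)) X" unfolding small_def
  proof (intro allI ballI)
    fix i x y assume "x \<in> X" "y \<in> X"
    then have "nat (x i - y i) \<le> Max ?D" using fin by (intro Max_ge) force+
    then show "x i - y i < int (Suc (Max ?D))" by linarith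
  qed
  moreover have "\<not> small 0 X" using assms(2) by (auto simp: small_def)
  ultimately obtain k where "\<forall>j\<le>k. \<not> small j X" "small (Suc k) X"
    using ex_least_nat_less[of "\<lambda>m. small m X" "Suc (Max ?D)"] by auto
  then show ?thesis by blast
qed

lemma conn_same_layer:
  assumes "conn r (int K) S" "r i = 0" "x \<in> S" "y \<in> S"
  shows "x i = y i"
proof -
  have "(x, y) \<in> (lnk r (int K) S)\<^sup>*" using assms by (auto simp: conn_def)
  then show ?thesis
  proof (induction rule: rtrancl_induct)
    case (step y z)
    then have "\<bar>y i - z i\<bar> \<le> (if r i = 0 then 0 else int K)" by (auto simp: lnk_def adj_def)
    then show ?case using step.IH assms(2) by simp
  qed simp
qed

lemma seed_preimage:
  assumes "X \<subseteq> f ` A" "finite A" "u \<in> X" "conn r (int K) (cl r X)" "small (Suc m) X" "\<not> small m X"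
  shows "seed r K f u m {v \<in> A. f v \<in> X}"
proof -
  have "f ` {v \<in> A. f v \<in> X} = X" using assms(1) by auto
  then show ?thesis unfolding seed_def using assms by (intro exI[of _ "{v \<in> A. f v \<in> X}"]) auto
qed

text \<open>Along a shortest path of blocks the distance to the starting block strictly decreases, so the
  blocks of the path are distinct and their initial sites disjoint.\<close>

lemma chain_of_crossing:
  fixes r :: "'d::finite \<Rightarrow> nat" and f :: "'a \<Rightarrow> 'd \<Rightarrow> int"
  assumes fin: "finite A" and two: "two_pos r" and K: "\<And>c. 2 * r c \<le> K" and ri: "r i = 0"
    and cross: "crossed r K i a b (f ` A)" and ab: "a \<le> b" and mm: "1 \<le> mm"
  shows "(\<exists>u\<in>f ` A. \<exists>m<mm. chain r K f mm (nat (b - a + 1)) u m A) \<or>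
    (\<exists>u\<in>f ` A. \<exists>m\<in>{mm..<2 * mm + K}. seed r K f u m A)"
proof -
  have K': "2 * int (r c) \<le> int K" for c using K[of c] by linarith
  have finB: "finite (f ` A)" using fin by simp
  obtain P where P: "\<Union>P = f ` A" "\<And>X. X \<in> P \<Longrightarrow> X \<noteq> {} \<and> True \<and> conn r (int K) (cl r X)"
    "\<And>X X' u v. X \<in> P \<Longrightarrow> X' \<in> P \<Longrightarrow> u \<in> cl r X \<Longrightarrow> v \<in> cl r X' \<Longrightarrow> adj r (int K) u v \<Longrightarrow> X = X'"
    "cl r (f ` A) = (\<Union>X\<in>P. cl r X)"
    by (rule closure_blocks[OF finB two K', of "\<lambda>_. True"]) blast+
  have sub: "X \<subseteq> f ` A" if "X \<in> P" for X using P(1) that by blast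
  have finX: "finite X" if "X \<in> P" for X using sub[OF that] finB finite_subset by blast
  show ?thesis
  proof (cases "\<forall>X\<in>P. small mm X")
    case False
    then obtain X where X: "X \<in> P" "\<not> small mm X" by blast
    \<comment> \<open>A block that is too large contains a connected cluster of intermediate extent,
      which is the second alternative.\<close>
    from Aizenman_Lebowitz[OF finX[OF X(1)] two K' _ X(2) mm] P(2)[OF X(1)]
    obtain W where W: "W \<subseteq> X" "conn r (int K) (cl r W)" "\<not> small mm W" "small (2 * mm + K) W" by blast
    have Wf: "W \<subseteq> f ` A" "finite W" using W(1) sub[OF X(1)] finX[OF X(1)] finite_subset by auto
    have "W \<noteq> {}" using W(3) by (auto simp: small_def)
    then obtain u where u: "u \<in> W" by blast
    obtain m where m: "small (Suc m) W" "\<not> small m W" using exact_small[OF Wf(2) \<open>W \<noteq> {}\<close>] by blast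
    have "mm \<le> m" using W(3) m(1) small_mono[of "Suc m" mm W] by (metis not_less_eq_eq)
    moreover have "m < 2 * mm + K" using W(4) m(2) small_mono[of "2 * mm + K" m W] by (metis not_less)
    moreover have "seed r K f u m A"
      using seed_preimage[OF Wf(1) fin u W(2) m] by (rule increasingD[OF seed_increasing, rotated]) auto
    ultimately have "\<exists>m\<in>{mm..<2 * mm + K}. seed r K f u m A" by auto
    then show ?thesis using u Wf(1) by blast
  next
    case small: True
    define N where "N = {(X, Y). X \<in> P \<and> Y \<in> P \<and> (\<exists>u\<in>cl r X. \<exists>v\<in>cl r Y. \<bar>u i - v i\<bar> \<le> 1 \<and> (\<forall>c. \<bar>u c - v c\<bar> \<le> int K))}"
    obtain z w where zw: "z \<in> cl r (f ` A)" "z i = a" "w i = b" "(z, w) \<in> (steps i K (cl r (f ` A)))\<^sup>*"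
      using cross by (auto simp: crossed_def)
    obtain Z where Z: "Z \<in> P" "z \<in> cl r Z" using zw(1) P(4) by auto
    have "\<exists>W. W \<in> P \<and> w \<in> cl r W \<and> (Z, W) \<in> N\<^sup>*" using zw(4)
    proof (induction rule: rtrancl_induct)
      case base
      then show ?case using Z by blast
    next
      case (step y y')
      then obtain Y where Y: "Y \<in> P" "y \<in> cl r Y" "(Z, Y) \<in> N\<^sup>*" by blast
      have y': "y' \<in> cl r (f ` A)" "\<bar>y i - y' i\<bar> \<le> 1" "\<forall>c. \<bar>y c - y' c\<bar> \<le> int K"
        using step.hyps(2) by (auto simp: steps_def)
      then obtain Y' where Y': "Y' \<in> P" "y' \<in> cl r Y'" using P(4) by auto
      then have "(Y, Y') \<in> N" using Y y' by (auto simp: N_def)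
      then show ?case using Y Y' by (meson rtrancl_into_rtrancl)
    qed
    then obtain W where W: "W \<in> P" "w \<in> cl r W" "(Z, W) \<in> N\<^sup>*" by blast
    define dst where "dst X = (LEAST k. (Z, X) \<in> N ^^ k)" for X
    \<comment> \<open>The initial sites of all blocks at distance at most \<open>k\<close>. A chain
      built up to distance \<open>k\<close> stays within them, so a block at distance
      \<open>k + 1\<close> brings fresh sites.\<close>
    define A' where "A' k = {v \<in> A. \<exists>Y\<in>P. (Z, Y) \<in> N\<^sup>* \<and> dst Y \<le> k \<and> f v \<in> Y}" for k
    have dst: "(Z, X) \<in> N ^^ dst X" if "(Z, X) \<in> N\<^sup>*" for X
      using that unfolding dst_def by (metis LeastI_ex rtrancl_imp_relpow)
    have layer: "x i = y i" if "X \<in> P" "x \<in> cl r X" "y \<in> cl r X" for X x y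
      using conn_same_layer[of r K "cl r X" i x y] ri that P(2)[OF that(1)] by blast
    have height: "X \<in> P \<Longrightarrow> x \<in> cl r X \<Longrightarrow> x i - a \<le> int k" if "(Z, X) \<in> N ^^ k" for X x k
      using that
    proof (induction k arbitrary: X x)
      case 0
      then show ?case using layer[OF Z(1) Z(2)] zw(2) by auto
    next
      case (Suc k)
      then obtain Y where Y: "(Z, Y) \<in> N ^^ k" "(Y, X) \<in> N" by auto
      then obtain u v where uv: "u \<in> cl r Y" "v \<in> cl r X" "\<bar>u i - v i\<bar> \<le> 1" "Y \<in> P" by (auto simp: N_def)
      have "u i - a \<le> int k" by (rule Suc.IH[OF uv(4,1) Y(1)])
      moreover have "x i = v i" by (rule layer[OF Suc.prems(1,2) uv(2)])
      ultimately show ?case using uv(3) by simp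
    qed
    have disjP: "X = Y" if "X \<in> P" "Y \<in> P" "s \<in> X" "s \<in> Y" for X Y s
      by (rule P(3)[OF that(1,2) subsetD[OF cl_superset that(3)] subsetD[OF cl_superset that(4)]])
        (simp add: adj_def)
    have main: "\<exists>m<mm. small (Suc m) X \<and> chain r K f mm (Suc k) u m (A' k)"
      if "X \<in> P" "(Z, X) \<in> N\<^sup>*" "dst X = k" "u \<in> X" for X k u
      using that
    proof (induction k arbitrary: X u)
      case (0 X u)
      obtain m where m: "small (Suc m) X" "\<not> small m X" using exact_small[OF finX[OF 0(1)]] P(2)[OF 0(1)] by blast
      have mm: "m < mm" using small 0(1) m(2) small_mono by (metis not_le)
      have "seed r K f u m {v \<in> A. f v \<in> X}"
        using seed_preimage[OF sub[OF 0(1)] fin 0(4) _ m] P(2)[OF 0(1)] by blast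
      moreover have "{v \<in> A. f v \<in> X} \<subseteq> A' 0" using 0 by (auto simp: A'_def)
      ultimately have "chain r K f mm (Suc 0) u m (A' 0)"
        unfolding chain.simps disj_occ_def by (intro exI[of _ "{v \<in> A. f v \<in> X}"] exI[of _ "{}"]) auto
      then show ?case using mm m by blast
    next
      case (Suc k X u)
      obtain m where m: "small (Suc m) X" "\<not> small m X" using exact_small[OF finX[OF Suc.prems(1)]] P(2)[OF Suc.prems(1)] by blast
      have mm: "m < mm" using small Suc.prems(1) m(2) small_mono by (metis not_le)
      have "(Z, X) \<in> N ^^ Suc k" using dst[OF Suc.prems(2)] Suc.prems(3) by simp
      then obtain Y where Y: "(Z, Y) \<in> N ^^ k" "(Y, X) \<in> N" by auto
      have Yr: "(Z, Y) \<in> N\<^sup>*" using Y(1) by (rule relpow_imp_rtrancl)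
      have YP: "Y \<in> P" using Y(2) by (auto simp: N_def)
      have dY: "dst Y = k"
      proof (rule antisym)
        show "dst Y \<le> k" unfolding dst_def by (rule Least_le) (rule Y(1))
        have "(Z, X) \<in> N ^^ Suc (dst Y)" using dst[OF Yr] Y(2) by auto
        then have "dst X \<le> Suc (dst Y)" unfolding dst_def[of X] by (rule Least_le)
        then show "k \<le> dst Y" using Suc.prems(3) by simp
      qed
      obtain u' where u': "u' \<in> Y" using P(2)[OF YP] by blast
      obtain m' where m': "m' < mm" "small (Suc m') Y" "chain r K f mm (Suc k) u' m' (A' k)"
        using Suc.IH[OF YP Yr dY u'] by blast
      obtain x y where xy: "y \<in> cl r Y" "x \<in> cl r X" "\<forall>c. \<bar>y c - x c\<bar> \<le> int K" using Y(2) by (auto simp: N_def)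
      have ux: "\<bar>u c - x c\<bar> \<le> int m" for c
        by (rule small_abs[OF small_cl[OF finX[OF Suc.prems(1)] two m(1)] subsetD[OF cl_superset Suc.prems(4)] xy(2)])
      have uy: "\<bar>u' c - y c\<bar> \<le> int m'" for c
        by (rule small_abs[OF small_cl[OF finX[OF YP] two m'(2)] subsetD[OF cl_superset u'] xy(1)])
      have "\<bar>u c - u' c\<bar> \<le> int (m + m' + K)" for c
        using spec[OF xy(3), of c] ux[of c] uy[of c] by linarith
      then have nearu: "u' \<in> near (m + m' + K) u" unfolding near_def by (simp add: abs_le_iff algebra_simps)
      let ?W = "{v \<in> A. f v \<in> X}"
      have "seed r K f u m ?W"
        using seed_preimage[OF sub[OF Suc.prems(1)] fin Suc.prems(4) _ m] P(2)[OF Suc.prems(1)] by blast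
      moreover have "?W \<inter> A' k = {}" using disjP Suc.prems(1,3) by (fastforce simp: A'_def)
      moreover have "?W \<union> A' k \<subseteq> A' (Suc k)" using Suc.prems by (auto simp: A'_def intro: le_SucI)
      ultimately have "chain r K f mm (Suc (Suc k)) u m (A' (Suc k))"
        using m'(1,3) nearu unfolding chain.simps(2)[of r K f mm "Suc k"] disj_occ_def
        by (intro exI[of _ ?W] exI[of _ "A' k"]) auto
      then show ?case using mm m by blast
    qed
    obtain u where u: "u \<in> W" using P(2)[OF W(1)] by blast
    obtain m where m: "m < mm" "chain r K f mm (Suc (dst W)) u m (A' (dst W))"
      using main[OF W(1,3) refl u] by blast
    have "b - a \<le> int (dst W)" using height[OF dst[OF W(3)] W(1,2)] zw(3) by simp
    then have "nat (b - a + 1) \<le> Suc (dst W)" by simp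
    then have "chain r K f mm (nat (b - a + 1)) u m (A' (dst W))" using m(2) by (rule chain_le)
    moreover have "A' (dst W) \<subseteq> A" by (auto simp: A'_def)
    ultimately have "chain r K f mm (nat (b - a + 1)) u m A" using increasingD[OF chain_increasing] by blast
    then show ?thesis using m(1) u sub[OF W(1)] by blast
  qed
qed

lemma crossed_bound:
  fixes r :: "'d::finite \<Rightarrow> nat" and f :: "'a \<Rightarrow> 'd \<Rightarrow> int"
  assumes p: "finite V" "0 \<le> p" "p \<le> 1/2" and two: "two_pos r" and K: "\<And>c. 2 * r c \<le> K" and ri: "r i = 0"
    and U: "U \<subseteq> V" and B: "f ` U \<subseteq> B" "finite B"
    and g: "\<And>u m. m < 2 * mm + K \<Longrightarrow> Pr V p (seed r K f u m) \<le> g m" and mm: "1 \<le> mm" and n: "1 \<le> n"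
  shows "Pr V p (\<lambda>A. crossed r K i a (a + int n - 1) (f ` (A \<inter> U))) \<le>
    real (card B) * (chain_rate TYPE('d) K g mm ^ n + (\<Sum>m\<in>{mm..<2 * mm + K}. g m))"
proof -
  let ?e = "chain_rate TYPE('d) K g mm"
  have p1: "p \<le> 1" using p by simp
  have g0: "0 \<le> g m" if "m < 2 * mm + K" for m using order_trans[OF Pr_nonneg[OF p(2) p1] g[OF that]] .
  have e0: "0 \<le> ?e" unfolding chain_rate_def using g0 by (intro sum_nonneg) auto
  have "Pr V p (\<lambda>A. crossed r K i a (a + int n - 1) (f ` (A \<inter> U))) \<le>
    Pr V p (\<lambda>A. (\<exists>u\<in>B. \<exists>m\<in>{..<mm}. chain r K f mm n u m A) \<or> (\<exists>u\<in>B. \<exists>m\<in>{mm..<2 * mm + K}. seed r K f u m A))"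
  proof (rule Pr_mono[OF p(1,2) p1])
    fix A assume A: "A \<subseteq> V" "crossed r K i a (a + int n - 1) (f ` (A \<inter> U))"
    have sub: "f ` (A \<inter> U) \<subseteq> B" using B(1) by blast
    have fin: "finite (A \<inter> U)" using U p(1) by (meson finite_Int finite_subset)
    have le: "a \<le> a + int n - 1" using n by simp
    have nn: "nat (a + int n - 1 - a + 1) = n" by simp
    from chain_of_crossing[OF fin two K ri A(2) le mm, unfolded nn]
    show "(\<exists>u\<in>B. \<exists>m\<in>{..<mm}. chain r K f mm n u m A) \<or> (\<exists>u\<in>B. \<exists>m\<in>{mm..<2 * mm + K}. seed r K f u m A)"
    proof (elim disjE bexE exE conjE)
      fix u m assume *: "u \<in> f ` (A \<inter> U)" "m < mm" "chain r K f mm n u m (A \<inter> U)"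
      have "chain r K f mm n u m A" using increasingD[OF chain_increasing _ *(3)] by blast
      then show ?thesis using * sub by blast
    next
      fix u m assume *: "u \<in> f ` (A \<inter> U)" "m \<in> {mm..<2 * mm + K}" "seed r K f u m (A \<inter> U)"
      have "seed r K f u m A" using increasingD[OF seed_increasing _ *(3)] by blast
      then show ?thesis using * sub by blast
    qed
  qed
  also have "\<dots> \<le> Pr V p (\<lambda>A. \<exists>u\<in>B. \<exists>m\<in>{..<mm}. chain r K f mm n u m A) + Pr V p (\<lambda>A. \<exists>u\<in>B. \<exists>m\<in>{mm..<2 * mm + K}. seed r K f u m A)"
    by (rule Pr_disj_le[OF p(1,2) p1])
  also have "\<dots> \<le> real (card B) * ?e ^ n + real (card B) * (\<Sum>m\<in>{mm..<2 * mm + K}. g m)"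
  proof (rule add_mono)
    have big: "Pr V p (\<lambda>A. \<exists>m\<in>{mm..<2 * mm + K}. seed r K f u m A) \<le> (\<Sum>m\<in>{mm..<2 * mm + K}. g m)" for u
      by (rule order_trans[OF Pr_union_bound[OF p(1,2) p1] sum_mono[OF g]]) auto
    show "Pr V p (\<lambda>A. \<exists>u\<in>B. \<exists>m\<in>{mm..<2 * mm + K}. seed r K f u m A) \<le> real (card B) * (\<Sum>m\<in>{mm..<2 * mm + K}. g m)"
      by (rule Pr_union_bound_card[OF p(1,2) p1 B(2) big])
  next
    obtain n' where n': "n = Suc n'" using n by (cases n) auto
    have few: "Pr V p (\<lambda>A. \<exists>m\<in>{..<mm}. chain r K f mm n u m A) \<le> ?e ^ n" for u
    proof -
      have "Pr V p (\<lambda>A. \<exists>m\<in>{..<mm}. chain r K f mm n u m A) \<le> (\<Sum>m<mm. Pr V p (chain r K f mm n u m))"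
      by (rule Pr_union_bound[OF p(1,2) p1]) simp
    also have "\<dots> \<le> (\<Sum>m<mm. g m * real (m + 1) ^ CARD('d) * ?e ^ n')"
      unfolding n' using g by (intro sum_mono chain_bound[OF p]) auto
    also have "\<dots> = (\<Sum>m<mm. g m * real (m + 1) ^ CARD('d)) * ?e ^ n'" by (simp add: sum_distrib_right)
    also have "\<dots> \<le> ?e * ?e ^ n'"
    proof (rule mult_right_mono)
      \<comment> \<open>Summing over the extent of the first seed costs at most one more factor of
        the rate, so a chain of \<open>n\<close> seeds costs \<open>?e ^ n\<close>.\<close>
      show "(\<Sum>m<mm. g m * real (m + 1) ^ CARD('d)) \<le> ?e" unfolding chain_rate_def
      proof (rule sum_mono)
        fix m assume m: "m \<in> {..<mm}"
        have "1 * real (m + 1) ^ CARD('d) \<le> real (2 * K + 3) ^ CARD('d) * real (m + 1) ^ (2 * CARD('d))"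
          by (intro mult_mono one_le_power power_increasing) auto
        then have "g m * (1 * real (m + 1) ^ CARD('d)) \<le> g m * (real (2 * K + 3) ^ CARD('d) * real (m + 1) ^ (2 * CARD('d)))"
          using g0 m by (intro mult_left_mono) auto
        then show "g m * real (m + 1) ^ CARD('d) \<le> real (2 * K + 3) ^ CARD('d) * real (m + 1) ^ (2 * CARD('d)) * g m"
          by (simp add: mult_ac)
      qed
    qed (use e0 in auto)
    finally show ?thesis by (simp add: n')
    qed
    show "Pr V p (\<lambda>A. \<exists>u\<in>B. \<exists>m\<in>{..<mm}. chain r K f mm n u m A) \<le> real (card B) * ?e ^ n"
      by (rule Pr_union_bound_card[OF p(1,2) p1 B(2) few])
  qed
  finally show ?thesis by (simp add: distrib_left)
qed

section \<open>Crossing a cube\<close>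

lemma bbox_exists:
  fixes B :: "('d \<Rightarrow> int) set"
  assumes "finite B" "B \<noteq> {}"
  obtains lo d where "bbox lo d B"
proof
  let ?lo = "\<lambda>c. Min ((\<lambda>s. s c) ` B)" and ?hi = "\<lambda>c. Max ((\<lambda>s. s c) ` B)"
  have le: "?lo c \<le> s c" "s c \<le> ?hi c" if "s \<in> B" for s c using assms that by auto
  obtain s0 where "s0 \<in> B" using assms(2) by blast
  then have "?lo c \<le> ?hi c" for c using le order_trans by blast
  then have hi: "?lo c + int (nat (?hi c - ?lo c)) = ?hi c" for c by simp
  have "?lo c \<in> (\<lambda>s. s c) ` B" "?hi c \<in> (\<lambda>s. s c) ` B" for c
    using assms by (auto intro!: Min_in Max_in simp del: Min_in Max_in)
  then have "\<exists>s\<in>B. s c = ?lo c" "\<exists>s\<in>B. s c = ?hi c" for c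
    unfolding image_iff by metis+
  then show "bbox ?lo (\<lambda>c. nat (?hi c - ?lo c)) B"
    unfolding bbox_def hi using le by simp
qed

text \<open>Relative to the marker there are at most \<open>m + 1\<close> choices for each
  coordinate of the lower corner and for each side length of the bounding box.\<close>

lemma seed_bound:
  fixes r :: "'d::finite \<Rightarrow> nat" and f :: "'a \<Rightarrow> 'd \<Rightarrow> int"
  assumes p: "finite V" "0 \<le> p" "p \<le> 1" and ri: "r i = 0"
    and b: "\<And>lo d. d i = 0 \<Longrightarrow> (\<And>c. d c \<le> m) \<Longrightarrow> \<exists>c. d c = m \<Longrightarrow> Pr V p (spanned r K f lo d) \<le> \<beta>"
    and b0: "0 \<le> \<beta>"
  shows "Pr V p (seed r K f u m) \<le> real (m + 1) ^ (2 * CARD('d)) * \<beta>"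
proof -
  define LO where "LO = {lo. \<forall>c. lo c \<in> {u c - int m..u c}}"
  define DD where "DD = {d :: 'd \<Rightarrow> nat. \<forall>c. d c \<in> {..m}}"
  define I where "I = {(lo, d). (lo, d) \<in> LO \<times> DD \<and> d i = 0 \<and> (\<exists>c. d c = m)}"
  have fin: "finite LO" "finite DD" unfolding LO_def DD_def by (intro finite_fun_box; simp)+
  have sub: "I \<subseteq> LO \<times> DD" by (auto simp: I_def)
  have finI: "finite I" using fin by (intro finite_subset[OF sub]) simp
  have "card LO = (m + 1) ^ CARD('d)"
  proof -
    have "card {x - int m..x} = m + 1" for x :: int by (simp add: nat_eq_iff)
    then show ?thesis unfolding LO_def card_fun_box by (simp only: prod_constant)
  qed
  moreover have "card DD = (m + 1) ^ CARD('d)" unfolding DD_def card_fun_box by simp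
  ultimately have "card I \<le> (m + 1) ^ (2 * CARD('d))"
    using card_mono[OF _ sub] fin by (simp add: card_cartesian_product mult_2 power_add)
  then have cardI: "real (card I) \<le> real (m + 1) ^ (2 * CARD('d))"
    by (metis of_nat_le_iff of_nat_power)
  have "Pr V p (seed r K f u m) \<le> Pr V p (\<lambda>A. \<exists>x\<in>I. spanned r K f (fst x) (snd x) A)"
  proof (rule Pr_mono[OF p])
    fix A assume "seed r K f u m A"
    then obtain W where W: "W \<subseteq> A" "finite W" "u \<in> f ` W" "conn r (int K) (cl r (f ` W))"
      "small (Suc m) (f ` W)" "\<not> small m (f ` W)" by (auto simp: seed_def)
    obtain lo d where bb: "bbox lo d (f ` W)" using bbox_exists[of "f ` W"] W(2,3) by auto
    have att: "\<exists>x\<in>f ` W. \<exists>y\<in>f ` W. x c = lo c \<and> y c = lo c + int (d c)" for c using bb unfolding bbox_def by blast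
    have rng: "lo c \<le> x c \<and> x c \<le> lo c + int (d c)" if "x \<in> f ` W" for x c using bb that unfolding bbox_def by blast
    have d: "d c \<le> m" for c
    proof -
      obtain x y where xy: "x \<in> f ` W" "y \<in> f ` W" "x c = lo c" "y c = lo c + int (d c)" using att by blast
      show ?thesis using small_abs[OF W(5) xy(2,1), of c] xy(3,4) by simp
    qed
    obtain c x y where c: "x \<in> f ` W" "y \<in> f ` W" "\<not> x c - y c < int m" using W(6) unfolding small_def by blast
    have "d c = m" using rng[OF c(1), of c] rng[OF c(2), of c] c(3) d[of c] by linarith
    moreover have "d i = 0"
    proof -
      obtain x y where xy: "x \<in> f ` W" "y \<in> f ` W" "x i = lo i" "y i = lo i + int (d i)" using att by blast
      then have "x i = y i" using conn_same_layer[OF W(4) ri, of x y] cl_superset[of "f ` W" r] by blast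
      then show ?thesis using xy by simp
    qed
    moreover have "lo \<in> LO" unfolding LO_def
    proof (clarsimp)
      fix c show "u c - int m \<le> lo c \<and> lo c \<le> u c" using rng[OF W(3), of c] d[of c] by linarith
    qed
    ultimately have "(lo, d) \<in> I" using d by (auto simp: I_def DD_def)
    moreover have "spanned r K f lo d A" using W bb by (auto simp: spanned_def)
    ultimately show "\<exists>x\<in>I. spanned r K f (fst x) (snd x) A" by force
  qed
  also have "\<dots> \<le> real (card I) * \<beta>"
    by (rule Pr_union_bound_card[OF p finI]) (auto simp: I_def DD_def intro!: b)
  also have "\<dots> \<le> real (m + 1) ^ (2 * CARD('d)) * \<beta>" by (rule mult_right_mono[OF cardI b0])
  finally show ?thesis .
qed

text \<open>With weight 0 on axis \<open>i\<close>, declaring all sites outside the layers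
  \<open>I\<close> occupied does not help any site inside.\<close>

lemma cl_layers:
  assumes ri: "r i = 0" and s: "s \<in> cl r B" "s i \<in> I"
  shows "s \<in> cl r {b \<in> B. b i \<in> I}"
proof -
  let ?C = "cl r {b \<in> B. b i \<in> I}" and ?T = "cl r {b \<in> B. b i \<in> I} \<union> {s. s i \<notin> I}"
  have "cl r B \<subseteq> ?T"
  proof (rule cl_least)
    show "B \<subseteq> ?T" using cl_superset[of "{b \<in> B. b i \<in> I}" r] by blast
    show "closed_in r UNIV ?T" unfolding closed_in_def
    proof (intro ballI impI, rule ccontr)
      fix s assume s: "sum r UNIV \<le> cnt r ?T s" "s \<notin> ?T"
      have "cnt r ?T s \<le> cnt r ?C s" unfolding cnt_def
      proof (intro sum_mono card_mono finite_steps subsetI)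
        fix c k assume k: "k \<in> {k. k \<noteq> 0 \<and> \<bar>k\<bar> \<le> int (r c) \<and> s(c := s c + k) \<in> ?T}"
        then have "c \<noteq> i" using ri by auto
        then show "k \<in> {k. k \<noteq> 0 \<and> \<bar>k\<bar> \<le> int (r c) \<and> s(c := s c + k) \<in> ?C}" using k s(2) by auto
      qed
      then have "s \<in> ?C" using s(1) by (intro closed_inD[OF cl_closed]) auto
      with s(2) show False by blast
    qed
  qed
  with s show ?thesis by blast
qed

lemma steps_mono: "S \<subseteq> T \<Longrightarrow> steps i K S \<subseteq> steps i K T"
  by (auto simp: steps_def)

lemma crossed_mono:
  assumes "B \<subseteq> B'" "crossed r K i a b B"
  shows "crossed r K i a b B'"
proof -
  obtain z w where zw: "z \<in> cl r B" "z i = a" "w i = b" "(z, w) \<in> (steps i K (cl r B))\<^sup>*"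
    using assms(2) by (auto simp: crossed_def)
  have "z \<in> cl r B'" "(z, w) \<in> (steps i K (cl r B'))\<^sup>*"
    using zw(1,4) cl_mono[OF assms(1)] rtrancl_mono[OF steps_mono[OF cl_mono[OF assms(1)]]] by blast+
  then show ?thesis using zw(2,3) unfolding crossed_def by blast
qed

text \<open>A connected cluster crossing a slab leaves a crossing that is produced by the initial
  sites of that slab alone. This is what makes the crossings of disjoint slabs independent.\<close>

lemma crossed_layers:
  fixes r :: "'d::finite \<Rightarrow> nat"
  assumes t: "2 * r i + 1 \<le> t" "K \<le> t" and K: "1 \<le> K" and con: "conn r (int K) (cl r W)"
    and xy: "y \<in> cl r W" "x \<in> cl r W" and ab: "y i div int t \<le> a" "b \<le> x i div int t" "a \<le> b"
  shows "crossed (r(i := 0)) K i a b {s \<in> proj i (int t) ` W. s i \<in> {a..b}}"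
proof -
  let ?\<pi> = "proj i (int t)" and ?r = "r(i := 0)"
  let ?T = "cl ?r (?\<pi> ` W)" and ?S = "cl ?r {s \<in> ?\<pi> ` W. s i \<in> {a..b}}"
  have piT: "?\<pi> u \<in> ?T" if "u \<in> cl r W" for u
    using cl_proj[of r i "int t" W] t that by auto
  have "(y, x) \<in> (lnk r (int K) (cl r W))\<^sup>*" using con xy by (auto simp: conn_def)
  then have st: "(?\<pi> y, ?\<pi> x) \<in> (steps i K ?T)\<^sup>*"
  proof (rule rtrancl_image)
    fix u v assume uv: "(u, v) \<in> lnk r (int K) (cl r W)"
    then have d: "\<bar>u c - v c\<bar> \<le> int K" for c 
      by (auto simp: lnk_def adj_def split: if_splits dest!: spec[of _ c])
    have d1: "\<bar>u i div int t - v i div int t\<bar> \<le> 1"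
      using d[of i] t K by (intro div_diff_le_1) auto
    show "(?\<pi> u, ?\<pi> v) \<in> steps i K ?T" using uv piT d d1 K
      by (auto simp: steps_def lnk_def) (auto simp: proj_def)
  qed
  from height_crossing[of "steps i K ?T" "\<lambda>s. s i", OF _ this, of a b]
  obtain z w where zw: "(?\<pi> y, z) \<in> (steps i K ?T)\<^sup>*" "z i = a" "w i = b"
    "(z, w) \<in> (steps i K ?T \<inter> {(u, v). u i \<in> {a..b} \<and> v i \<in> {a..b}})\<^sup>*"
    using ab by (auto simp: steps_def proj_def)
  have "z \<in> ?T" using zw(1) piT[OF xy(1)] by (induction rule: rtrancl_induct) (auto simp: steps_def)
  then have "z \<in> ?S" using zw(2) ab(3) by (intro cl_layers) auto
  moreover have "steps i K ?T \<inter> {(u, v). u i \<in> {a..b} \<and> v i \<in> {a..b}} \<subseteq> steps i K ?S"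
    using cl_layers[of ?r i _ "?\<pi> ` W" "{a..b}"] by (auto simp: steps_def)
  then have "(z, w) \<in> (steps i K ?S)\<^sup>*" using zw(4) rtrancl_mono by blast
  ultimately show ?thesis using zw(2,3) unfolding crossed_def by blast
qed

definition box0 :: "nat \<Rightarrow> ('d \<Rightarrow> int) set" where
  "box0 L = {s. \<forall>c. s c \<in> {0..int L}}"

lemma finite_box0 [simp]: "finite (box0 L :: ('d::finite \<Rightarrow> int) set)"
  unfolding box0_def by (rule finite_fun_box) simp

lemma card_box0: "card (box0 L :: ('d::finite \<Rightarrow> int) set) = (L + 1) ^ CARD('d)"
  unfolding box0_def card_fun_box by (simp add: nat_add_distrib)

definition slab :: "'d \<Rightarrow> nat \<Rightarrow> nat \<Rightarrow> nat \<Rightarrow> ('d \<Rightarrow> int) \<Rightarrow> int \<Rightarrow> ('d \<Rightarrow> int) set" where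
  "slab i t n S lo a = {v. v i div int t \<in> {a..a + int n - 1} \<and> (\<forall>c. c \<noteq> i \<longrightarrow> v c \<in> {lo c..lo c + int S})}"

text \<open>Aizenman--Lebowitz keeps the extent below \<open>2 * k + K\<close>, so every slab can be
  cut off sideways and contains boundedly many starting points. The union runs over the long
  direction \<open>i\<close> and the lower corner of the cluster; for each choice
  \<open>k div (t * n)\<close> disjoint slabs are crossed independently.\<close>

lemma large_cluster_bound:
  fixes r :: "'d::finite \<Rightarrow> nat"
  assumes p: "0 \<le> p" "p \<le> 1" and two: "two_pos r" and K: "\<And>c. 2 * r c \<le> K" "1 \<le> K"
    and t: "t = K + 1" and n: "1 \<le> n" and k: "1 \<le> k"
    and e: "\<And>i lo a. Pr (box0 L) p (\<lambda>A. crossed (r(i := 0)) K i a (a + int n - 1)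
        (proj i (int t) ` (A \<inter> (box0 L \<inter> slab i t n (2 * k + K) lo a)))) \<le> \<epsilon>"
  shows "Pr (box0 L) p (\<lambda>A. \<exists>W\<subseteq>A. conn r (int K) (cl r W) \<and> \<not> small k W)
    \<le> real (CARD('d) * (L + 1) ^ CARD('d)) * \<epsilon> ^ (k div (t * n))"
proof -
  define V :: "('d \<Rightarrow> int) set" where "V = box0 L"
  have finV: "finite V" by (simp add: V_def)
  define N where "N = k div (t * n)"
  define aa where "aa i lo q = lo i div int t + 1 + int q * int n" for i and lo :: "'d \<Rightarrow> int" and q :: nat
  define U where "U i lo q = V \<inter> slab i t n (2 * k + K) lo (aa i lo q)" for i lo q
  define E where "E i lo q B = crossed (r(i := 0)) K i (aa i lo q) (aa i lo q + int n - 1) (proj i (int t) ` B)" for i lo q B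
  have "Pr V p (\<lambda>A. \<exists>W\<subseteq>A. conn r (int K) (cl r W) \<and> \<not> small k W) \<le>
    Pr V p (\<lambda>A. \<exists>x\<in>UNIV \<times> V. \<forall>q\<in>{..<N}. E (fst x) (snd x) q (A \<inter> U (fst x) (snd x) q))"
  proof (rule Pr_mono[OF finV p])
    fix A assume A: "A \<subseteq> V" "\<exists>W\<subseteq>A. conn r (int K) (cl r W) \<and> \<not> small k W"
    then obtain W0 where W0: "W0 \<subseteq> A" "conn r (int K) (cl r W0)" "\<not> small k W0" by blast
    have K': "2 * int (r c) \<le> int K" for c using K(1)[of c] by linarith
    have finW0: "finite W0" using W0(1) A(1) finV by (meson finite_subset)
    obtain W where W: "W \<subseteq> W0" "conn r (int K) (cl r W)" "\<not> small k W" "small (2 * k + K) W"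
      using Aizenman_Lebowitz[OF finW0 two K' W0(2,3) k] by blast
    have WV: "W \<subseteq> V" "finite W" using W(1) W0(1) A(1) finW0 finite_subset by auto
    have "W \<noteq> {}" using W(3) by (auto simp: small_def)
    then obtain lo d where bb: "bbox lo d W" using bbox_exists WV(2) by blast
    have att: "\<exists>x\<in>W. x c = lo c" for c using bb unfolding bbox_def by blast
    have rng: "lo c \<le> x c" if "x \<in> W" for x c using bb that unfolding bbox_def by blast
    obtain i x y where ixy: "x \<in> W" "y \<in> W" "\<not> x i - y i < int k" using W(3) unfolding small_def by blast
    obtain y0 where y0: "y0 \<in> W" "y0 i = lo i" using att by blast
    have xk: "lo i + int k \<le> x i" using rng[OF ixy(2), of i] ixy(3) by linarith
    have up: "v c \<le> lo c + int (2 * k + K)" if "v \<in> W" for v c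
    proof -
      obtain z where z: "z \<in> W" "z c = lo c" using att by blast
      have "v c - z c < int (2 * k + K)" using W(4) that z(1) unfolding small_def by blast
      then show ?thesis using z(2) by linarith
    qed
    have "0 \<le> lo c \<and> lo c \<le> int L" for c
    proof -
      obtain z where z: "z \<in> W" "z c = lo c" using att by blast
      have "z \<in> box0 L" using z(1) WV(1) by (auto simp: V_def)
      then show ?thesis using z(2) unfolding box0_def by (auto dest: spec[of _ c])
    qed
    then have loV: "lo \<in> V" by (simp add: V_def box0_def)
    have "E i lo q (A \<inter> U i lo q)" if q: "q < N" for q
    proof -
      have t0: "0 < int t" using t by simp
      have "q + 1 \<le> k div (t * n)" using q by (simp add: N_def)
      then have "(q + 1) * (t * n) \<le> k" using n t by (simp add: less_eq_div_iff_mult_less_eq)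
      then have kk: "(int q + 1) * (int t * int n) \<le> int k"
        by (metis of_nat_le_iff of_nat_mult of_nat_add of_nat_1)
      have "(lo i div int t + (int q + 1) * int n) * int t \<le> lo i + int k"
      proof -
        have "lo i div int t * int t \<le> lo i" using t0
          by (metis add.commute le_add_same_cancel2 mult.commute mult_div_mod_eq pos_mod_sign)
        then show ?thesis using kk by (simp add: algebra_simps)
      qed
      also have "\<dots> \<le> x i" by (rule xk)
      finally have "lo i div int t + (int q + 1) * int n \<le> x i div int t"
        using zdiv_mono1[of _ "x i" "int t"] t0 by (metis nonzero_mult_div_cancel_right less_numeral_extra(3))
      then have b: "aa i lo q + int n - 1 \<le> x i div int t" by (simp add: aa_def algebra_simps)
      have "crossed (r(i := 0)) K i (aa i lo q) (aa i lo q + int n - 1)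
        {s \<in> proj i (int t) ` W. s i \<in> {aa i lo q..aa i lo q + int n - 1}}"
      proof (rule crossed_layers[OF _ _ K(2) W(2), of _ _ y0 x])
        show "2 * r i + 1 \<le> t" "K \<le> t" using K(1)[of i] t by auto
        show "y0 \<in> cl r W" "x \<in> cl r W" using y0(1) ixy(1) cl_superset[of W r] by auto
        show "y0 i div int t \<le> aa i lo q" using y0(2) by (simp add: aa_def)
        show "aa i lo q \<le> aa i lo q + int n - 1" using n by simp
      qed (rule b)
      moreover have "{s \<in> proj i (int t) ` W. s i \<in> {aa i lo q..aa i lo q + int n - 1}} \<subseteq> proj i (int t) ` (A \<inter> U i lo q)"
      proof
        fix s assume s: "s \<in> {s \<in> proj i (int t) ` W. s i \<in> {aa i lo q..aa i lo q + int n - 1}}"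
        then obtain v where v: "v \<in> W" "s = proj i (int t) v" by auto
        then have "v i div int t \<in> {aa i lo q..aa i lo q + int n - 1}" using s by (auto simp: proj_def)
        then have "v \<in> U i lo q" using v(1) WV(1) rng up by (auto simp: U_def slab_def)
        then show "s \<in> proj i (int t) ` (A \<inter> U i lo q)" using v W(1) W0(1) by blast
      qed
      ultimately show ?thesis unfolding E_def using crossed_mono by blast
    qed
    then show "\<exists>x\<in>UNIV \<times> V. \<forall>q\<in>{..<N}. E (fst x) (snd x) q (A \<inter> U (fst x) (snd x) q)"
      using loV by (intro bexI[of _ "(i, lo)"]) auto
  qed
  also have "\<dots> \<le> real (card ((UNIV :: 'd set) \<times> V)) * \<epsilon> ^ N"
  proof (rule Pr_union_bound_card[OF finV p])
    show "finite ((UNIV :: 'd set) \<times> V)" using finV by simp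
    fix x :: "'d \<times> ('d \<Rightarrow> int)"
    obtain i lo where x: "x = (i, lo)" by fastforce
    have "Pr V p (\<lambda>A. \<forall>q\<in>{..<N}. E i lo q (A \<inter> U i lo q)) = (\<Prod>q\<in>{..<N}. Pr V p (\<lambda>A. E i lo q (A \<inter> U i lo q)))"
    proof (rule Pr_indep[OF finV])
      show "disjoint_family_on (U i lo) {..<N}" unfolding disjoint_family_on_def
      proof (intro ballI impI)
        fix q q' :: nat assume ne: "q \<noteq> q'"
        have False if "v \<in> U i lo q" "v \<in> U i lo q'" for v
        proof -
          have "aa i lo q \<le> v i div int t" "v i div int t < aa i lo q + int n"
            "aa i lo q' \<le> v i div int t" "v i div int t < aa i lo q' + int n"
            using that by (auto simp: U_def slab_def)
          then have "int q * int n < (int q' + 1) * int n" "int q' * int n < (int q + 1) * int n"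
            unfolding aa_def distrib_right by linarith+
          then have "int q < int q' + 1" "int q' < int q + 1" using mult_less_cancel_right_pos[of "int n"] n by simp_all
          with ne show False by simp
        qed
        then show "U i lo q \<inter> U i lo q' = {}" by blast
      qed
    qed (auto simp: U_def)
    also have "\<dots> \<le> (\<Prod>q\<in>{..<N}. \<epsilon>)"
      using e[of i "aa i lo _" lo] by (intro prod_mono conjI Pr_nonneg p) (auto simp: E_def U_def V_def)
    finally show "Pr V p (\<lambda>A. \<forall>q\<in>{..<N}. E (fst x) (snd x) q (A \<inter> U (fst x) (snd x) q)) \<le> \<epsilon> ^ N" by (simp add: x)
  qed
  also have "card ((UNIV :: 'd set) \<times> V) = CARD('d) * (L + 1) ^ CARD('d)"
    by (simp add: card_cartesian_product V_def card_box0)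
  finally show ?thesis by (simp add: V_def N_def)
qed

lemma conn_box:
  fixes r :: "'d::finite \<Rightarrow> nat"
  assumes K: "1 \<le> K" and r: "\<And>c. r c = 0 \<Longrightarrow> lo c = hi c"
  shows "conn r K {s. \<forall>c. lo c \<le> s c \<and> s c \<le> hi c}"
proof -
  let ?S = "{s. \<forall>c. lo c \<le> s c \<and> s c \<le> hi c}"
  have "(x, y) \<in> (lnk r K ?S)\<^sup>*" if "x \<in> ?S" "y \<in> ?S" for x y
    using that(1)
  proof (induction "\<Sum>c\<in>UNIV. nat \<bar>x c - y c\<bar>" arbitrary: x rule: less_induct)
    case less
    show ?case
    proof (cases "x = y")
      case False
      then obtain c where c: "x c \<noteq> y c" by auto
      define x' where "x' = x(c := if x c < y c then x c + 1 else x c - 1)"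
      have lh: "lo c \<le> x c" "x c \<le> hi c" "lo c \<le> y c" "y c \<le> hi c" using less.prems that(2) by auto
      have "lo b \<le> x' b \<and> x' b \<le> hi b" for b
      proof (cases "b = c")
        case True
        then show ?thesis using lh c unfolding x'_def by auto
      next
        case False
        then show ?thesis using less.prems unfolding x'_def by auto
      qed
      then have x'S: "x' \<in> ?S" by simp
      have "r c \<noteq> 0" using lh c r[of c] by auto
      then have "(x, x') \<in> lnk r K ?S" using less.prems x'S K by (auto simp: lnk_def adj_def x'_def)
      moreover have "(\<Sum>c\<in>UNIV. nat \<bar>x' c - y c\<bar>) < (\<Sum>c\<in>UNIV. nat \<bar>x c - y c\<bar>)"
        using c by (intro sum_strict_mono_ex1) (auto simp: x'_def intro!: exI[of _ c])
      ultimately show ?thesis using less.hyps x'S by (meson converse_rtrancl_into_rtrancl)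
    qed simp
  qed
  then show ?thesis by (auto simp: conn_def)
qed

text \<open>For cubes too small to contain a large cluster. If the cube is spanned, a single
  projected layer closes up to a full square, which is connected. That is already a seed of extent
  \<open>L\<close>, or contains one of intermediate extent when \<open>L \<ge> mm\<close>.\<close>

lemma spanned_layer:
  fixes r :: "'d::finite \<Rightarrow> nat"
  assumes two: "two_pos (r(i := 0))" and pos: "\<And>c. 0 < r c" and K: "\<And>c. 2 * r c \<le> K" "1 \<le> K"
    and t: "t = K + 1" and A: "A \<subseteq> box0 L" and full: "box0 L \<subseteq> cl r A" and mm: "1 \<le> mm"
  shows "if L < mm then \<exists>u\<in>box0 L. seed (r(i := 0)) K (proj i (int t)) u L A
    else \<exists>u\<in>box0 L. \<exists>m\<in>{mm..<2 * mm + K}. seed (r(i := 0)) K (proj i (int t)) u m A"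
proof -
  let ?\<pi> = "proj i (int t)" and ?r = "r(i := 0)"
  define Q where "Q = {s. \<forall>c. 0 \<le> s c \<and> s c \<le> (if c = i then 0 else int L)}"
  define B where "B = {b \<in> ?\<pi> ` A. b i \<in> {0}}"
  have finA: "finite A" by (rule finite_subset[OF A]) simp
  have finB: "finite B" using finA by (simp add: B_def)
  have BQ: "B \<subseteq> Q" using A by (auto simp: B_def Q_def box0_def proj_def)
  have QL: "Q \<subseteq> box0 L"
  proof
    fix s assume "s \<in> Q"
    then have "0 \<le> s c" "s c \<le> (if c = i then 0 else int L)" for c by (auto simp: Q_def)
    then have "s c \<in> {0..int L}" for c by (smt (verit) atLeastAtMost_iff of_nat_0_le_iff)
    then show "s \<in> box0 L" by (simp add: box0_def)
  qed
  have "cl ?r B = Q"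
  proof
    show "cl ?r B \<subseteq> Q"
    proof
      fix s assume s: "s \<in> cl ?r B"
      have "0 \<le> s c" for c using BQ by (intro cl_ge[OF two _ s]) (auto simp: Q_def)
      moreover have "s c \<le> (if c = i then 0 else int L)" for c
        by (rule cl_le[OF two _ s]) (use BQ in \<open>unfold Q_def, blast\<close>)
      ultimately show "s \<in> Q" by (simp add: Q_def)
    qed
    show "Q \<subseteq> cl ?r B"
    proof
      fix s assume s: "s \<in> Q"
      then have "s i = 0" by (auto simp: Q_def dest!: spec[of _ i])
      then have "?\<pi> s = s" by (auto simp: proj_def)
      moreover have "?\<pi> s \<in> cl ?r (?\<pi> ` A)"
        using cl_proj[of r i "int t" A] K(1)[of i] t s QL full by auto
      ultimately show "s \<in> cl ?r B" unfolding B_def using \<open>s i = 0\<close> by (intro cl_layers) auto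
    qed
  qed
  moreover have "conn ?r (int K) Q"
    unfolding Q_def
  proof (rule conn_box)
    fix c assume "?r c = 0"
    then show "0 = (if c = i then 0 else int L)" using pos[of c] by (auto split: if_splits)
  qed (use K(2) in simp)
  ultimately have con: "conn ?r (int K) (cl ?r B)" by simp
  have "(\<lambda>_. 0) \<in> Q" by (simp add: Q_def)
  then have Bne: "B \<noteq> {}" using \<open>cl ?r B = Q\<close> cl_ge[OF two, of B 1 i "\<lambda>_. 0"] by fastforce
  have sS: "small (Suc L) B" unfolding small_def
  proof (intro allI ballI)
    fix c x y assume "x \<in> B" "y \<in> B"
    then have "x \<in> box0 L" "y \<in> box0 L" using BQ QL by auto
    then have "x c \<le> int L" "0 \<le> y c" by (auto simp: box0_def)
    then show "x c - y c < int (Suc L)" by linarith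
  qed
  have sL: "\<not> small L B"
  proof
    assume "small L B"
    then have sQ: "small L Q" using small_cl[OF finB two] \<open>cl ?r B = Q\<close> by metis
    obtain c where "c \<noteq> i" using two unfolding two_pos_def by metis
    have "(\<lambda>c. if c = i then 0 else int L) \<in> Q" by (simp add: Q_def)
    from sQ[unfolded small_def, rule_format, OF this \<open>(\<lambda>_. 0) \<in> Q\<close>, of c]
    show False using \<open>c \<noteq> i\<close> by simp
  qed
  have BA: "B \<subseteq> ?\<pi> ` A" by (auto simp: B_def)
  have toA: "seed ?r K ?\<pi> u m A" if "X \<subseteq> B" "u \<in> X" "conn ?r (int K) (cl ?r X)" "small (Suc m) X" "\<not> small m X" for X u m
    using increasingD[OF seed_increasing _ seed_preimage[OF _ finA that(2-5)]] that(1) BA by blast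
  show ?thesis
  proof (cases "L < mm")
    case True
    then show ?thesis using Bne toA[OF subset_refl _ con sS sL] BQ QL by auto
  next
    case False
    have K': "2 * int (?r c) \<le> int K" for c using K(1)[of c] by simp
    have "\<not> small mm B" using False sL small_mono[of mm L B] by auto
    from Aizenman_Lebowitz[OF finB two K' con this mm]
    obtain W where W: "W \<subseteq> B" "conn ?r (int K) (cl ?r W)" "\<not> small mm W" "small (2 * mm + K) W" by blast
    have "W \<noteq> {}" using W(3) by (auto simp: small_def)
    then obtain u where u: "u \<in> W" by blast
    have finW: "finite W" using W(1) finB finite_subset by blast
    obtain m where m: "small (Suc m) W" "\<not> small m W" using exact_small[OF finW \<open>W \<noteq> {}\<close>] by blast
    have "mm \<le> m" using W(3) m(1) small_mono[of "Suc m" mm W] by (metis not_less_eq_eq)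
    moreover have "m < 2 * mm + K" using W(4) m(2) small_mono[of "2 * mm + K" m W] by (metis not_less)
    moreover have "seed ?r K ?\<pi> u m A" by (rule toA[OF W(1) u W(2) m])
    moreover have "u \<in> box0 L" using u W(1) BQ QL by blast
    ultimately have "\<exists>u\<in>box0 L. \<exists>m\<in>{mm..<2 * mm + K}. seed ?r K ?\<pi> u m A"
      by (intro bexI[of _ u] bexI[of _ m]) auto
    then show ?thesis using False by simp
  qed
qed

section \<open>Lower bound: from two to three dimensions\<close>

text \<open>All that the passage from two to three dimensions uses: below a critical extent
  \<open>mm\<close> the cost of a chain link is arbitrarily small, and seeds of extent between
  \<open>mm\<close> and \<open>2 * mm + K\<close> have probability at most
  \<open>exp (- c * F p)\<close>. The block thickness \<open>K + 1\<close> satisfies both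
  \<open>2 * r i + 1 \<le> K + 1\<close> and \<open>K \<le> K + 1\<close>.\<close>

definition good_rates :: "('d::finite \<Rightarrow> nat) \<Rightarrow> nat \<Rightarrow> 'd \<Rightarrow> (real \<Rightarrow> real) \<Rightarrow> real \<Rightarrow> bool" where
  "good_rates r K i F c \<longleftrightarrow> (\<forall>e>0. \<forall>\<^sub>F p in at_right 0. \<exists>mm g. 1 \<le> mm \<and>
     (\<forall>L u m. m < 2 * mm + K \<longrightarrow> Pr (box0 L) p (seed (r(i := 0)) K (proj i (int (K + 1))) u m) \<le> g m) \<and>
     chain_rate TYPE('d) K g mm \<le> e \<and> (\<Sum>m\<in>{mm..<2 * mm + K}. g m) \<le> exp (- c * F p))"

lemma good_rates_mono:
  assumes "good_rates r K i F c" "c' * b \<le> c" "\<forall>\<^sub>F p in at_right 0. 0 \<le> F p \<and> F' p \<le> b * F p" "0 \<le> c'"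
  shows "good_rates r K i F' c'"
  unfolding good_rates_def
proof (intro allI impI)
  fix e :: real assume "0 < e"
  with assms(1) have "\<forall>\<^sub>F p in at_right 0. \<exists>mm g. 1 \<le> mm \<and>
     (\<forall>L u m. m < 2 * mm + K \<longrightarrow> Pr (box0 L) p (seed (r(i := 0)) K (proj i (int (K + 1))) u m) \<le> g m) \<and>
     chain_rate TYPE('a) K g mm \<le> e \<and> (\<Sum>m\<in>{mm..<2 * mm + K}. g m) \<le> exp (- c * F p)"
    by (simp add: good_rates_def)
  with assms(3) show "\<forall>\<^sub>F p in at_right 0. \<exists>mm g. 1 \<le> mm \<and>
     (\<forall>L u m. m < 2 * mm + K \<longrightarrow> Pr (box0 L) p (seed (r(i := 0)) K (proj i (int (K + 1))) u m) \<le> g m) \<and>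
     chain_rate TYPE('a) K g mm \<le> e \<and> (\<Sum>m\<in>{mm..<2 * mm + K}. g m) \<le> exp (- c' * F' p)"
  proof eventually_elim
    case (elim p)
    have "c' * F' p \<le> c' * (b * F p)" using elim(1) assms(4) by (intro mult_left_mono) auto
    also have "\<dots> \<le> c * F p" using elim(1) assms(2) by (simp add: mult.assoc[symmetric] mult_right_mono)
    finally have "exp (- c * F p) \<le> exp (- c' * F' p)" by simp
    with elim(2) show ?case by (meson order_trans)
  qed
qed

lemma crossed_slab_bound:
  fixes r :: "'d::finite \<Rightarrow> nat"
  assumes p: "0 \<le> p" "p \<le> 1/2" and two: "two_pos (r(i := 0))" and K: "\<And>c. 2 * r c \<le> K" "1 \<le> K" 
    and t: "t = K + 1" and n: "1 \<le> n" and mm: "1 \<le> mm"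
    and g: "\<And>u m. m < 2 * mm + K \<Longrightarrow> Pr (box0 L) p (seed (r(i := 0)) K (proj i (int t)) u m) \<le> g m"
    and e: "0 \<le> e" "chain_rate TYPE('d) K g mm \<le> e" and s: "(\<Sum>m\<in>{mm..<2 * mm + K}. g m) \<le> s"
  shows "Pr (box0 L) p (\<lambda>A. crossed (r(i := 0)) K i a (a + int n - 1) (proj i (int t) ` (A \<inter> (box0 L \<inter> slab i t n S lo a))))
    \<le> real n * real (S + 1) ^ CARD('d) * (e ^ n + s)"
proof -
  let ?r = "r(i := 0)" and ?\<pi> = "proj i (int t)" and ?U = "box0 L \<inter> slab i t n S lo a"
  define I where "I c = (if c = i then {a..a + int n - 1} else {lo c..lo c + int S})" for c
  define B where "B = {s. \<forall>c. s c \<in> I c}"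
  have p1: "p \<le> 1" using p by simp
  have finB: "finite B" unfolding B_def by (rule finite_fun_box) (simp add: I_def)
  have cardB: "card B \<le> n * (S + 1) ^ CARD('d)"
  proof -
    have "card B = (\<Prod>c\<in>UNIV. card (I c))" unfolding B_def by (rule card_fun_box)
    also have "\<dots> = card (I i) * (\<Prod>c\<in>UNIV - {i}. card (I c))" by (rule prod.remove) auto
    also have "(\<Prod>c\<in>UNIV - {i}. card (I c)) = (\<Prod>c\<in>UNIV - {i}. S + 1)"
      by (rule prod.cong) (auto simp: I_def nat_add_distrib)
    also have "card (I i) = n" by (simp add: I_def)
    also have "n * (\<Prod>c\<in>UNIV - {i}. S + 1) \<le> n * (S + 1) ^ CARD('d)"
      by (auto simp: card_Diff_subset intro!: power_increasing simp del: power_Suc)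
    finally show ?thesis .
  qed
  have g0: "0 \<le> g m" if "m < 2 * mm + K" for m using order_trans[OF Pr_nonneg[OF p(1) p1] g[OF that]] .
  have r0: "0 \<le> chain_rate TYPE('d) K g mm" unfolding chain_rate_def using g0 by (intro sum_nonneg) auto
  have s0: "0 \<le> (\<Sum>m\<in>{mm..<2 * mm + K}. g m)" using g0 by (intro sum_nonneg) auto
  have "Pr (box0 L) p (\<lambda>A. crossed ?r K i a (a + int n - 1) (?\<pi> ` (A \<inter> ?U)))
     \<le> real (card B) * (chain_rate TYPE('d) K g mm ^ n + (\<Sum>m\<in>{mm..<2 * mm + K}. g m))"
  proof (rule crossed_bound[OF finite_box0 p two _ _ _ _ finB g mm n])
    show "2 * ?r c \<le> K" for c using K(1)[of c] by auto
    show "?\<pi> ` ?U \<subseteq> B" by (auto simp: B_def I_def slab_def proj_def)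
  qed auto
  also have "\<dots> \<le> (real n * real (S + 1) ^ CARD('d)) * (e ^ n + s)"
  proof (intro mult_mono add_mono power_mono e s r0)
    show "real (card B) \<le> real n * real (S + 1) ^ CARD('d)"
      using cardB by (metis of_nat_le_iff of_nat_mult of_nat_power)
  qed (use r0 s0 in auto)
  finally show ?thesis .
qed

text \<open>The entries of the maximum are three ranges of \<open>L\<close>: below the critical
  extent one seed fills a layer, up to \<open>k\<close> a layer contains an intermediate seed, and
  beyond \<open>k\<close> a large cluster crosses many slabs.\<close>

lemma lower_bound_pointwise:
  fixes r :: "'d::finite \<Rightarrow> nat"
  assumes p: "0 \<le> p" "p \<le> 1/2" and pos: "\<And>c. 0 < r c" and card3: "3 \<le> CARD('d)"
    and K: "\<And>c. 2 * r c \<le> K" "1 \<le> K" and n: "1 \<le> n" and k: "1 \<le> k"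
    and H: "\<And>i. \<exists>mm g. 1 \<le> mm \<and>
     (\<forall>L u m. m < 2 * mm + K \<longrightarrow> Pr (box0 L) p (seed (r(i := 0)) K (proj i (int (K + 1))) u m) \<le> g m) \<and>
     chain_rate TYPE('d) K g mm \<le> e \<and> (\<Sum>m\<in>{mm..<2 * mm + K}. g m) \<le> s" and e: "0 \<le> e"
    and eps: "real n * real (2 * k + K + 1) ^ CARD('d) * (e ^ n + s) \<le> \<epsilon>"
  shows "Pr (box0 L) p (\<lambda>A. box0 L \<subseteq> cl r A) \<le> max e (max (real (k + 1) ^ CARD('d) * s)
     (real CARD('d) * real (L + 1) ^ CARD('d) * \<epsilon> ^ (k div ((K + 1) * n))))"
proof -
  let ?V = "box0 L :: ('d \<Rightarrow> int) set"
  have p1: "p \<le> 1" using p by simp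
  have two: "two_pos (r(i := 0))" for i
  proof -
    have "card (UNIV - {i}) = CARD('d) - 1" by (simp add: card_Diff_subset)
    then have "2 \<le> card (UNIV - {i})" using card3 by simp
    then obtain X where "X \<subseteq> UNIV - {i}" "card X = 2" by (rule obtain_subset_with_card_n)
    then obtain j l where "j \<noteq> l" "j \<noteq> i" "l \<noteq> i" by (auto simp: card_2_iff)
    then show ?thesis using pos unfolding two_pos_def by (intro exI[of _ j] exI[of _ l]) auto
  qed
  have twor: "two_pos r" using two[of undefined] unfolding two_pos_def by (metis fun_upd_apply less_numeral_extra(3))
  obtain i0 :: 'd where True by simp
  obtain mm g where mg: "1 \<le> mm" "\<And>L u m. m < 2 * mm + K \<Longrightarrow> Pr (box0 L) p (seed (r(i0 := 0)) K (proj i0 (int (K + 1))) u m) \<le> g m"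
     "chain_rate TYPE('d) K g mm \<le> e" "(\<Sum>m\<in>{mm..<2 * mm + K}. g m) \<le> s"
    using H[of i0] by blast
  have g0: "0 \<le> g m" if "m < 2 * mm + K" for m using order_trans[OF Pr_nonneg[OF p(1) p1] mg(2)[OF that]] .
  have s0: "0 \<le> s" using order_trans[OF sum_nonneg mg(4)] g0 by auto
  show ?thesis
  proof (cases "L < k")
    case True
    show ?thesis
    proof (cases "L < mm")
      case L: True
      have "Pr ?V p (\<lambda>A. ?V \<subseteq> cl r A) \<le> Pr ?V p (\<lambda>A. \<exists>u\<in>?V. seed (r(i0 := 0)) K (proj i0 (int (K + 1))) u L A)"
        using spanned_layer[OF two pos K refl _ _ mg(1), where L = L] L by (intro Pr_mono[OF _ p(1) p1]) auto
      also have "\<dots> \<le> real (card ?V) * g L"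
        using L by (intro Pr_union_bound_card[OF _ p(1) p1] mg(2)) auto
      also have "\<dots> = 1 * real (L + 1) ^ CARD('d) * g L" by (simp add: card_box0)
      also have "\<dots> \<le> real (2 * K + 3) ^ CARD('d) * real (L + 1) ^ (2 * CARD('d)) * g L"
        using g0[of L] L by (intro mult_right_mono mult_mono one_le_power power_increasing) auto
      also have "\<dots> \<le> chain_rate TYPE('d) K g mm" unfolding chain_rate_def
        using L g0 by (intro member_le_sum) auto
      also have "\<dots> \<le> e" by (rule mg(3))
      finally show ?thesis by simp
    next
      case L: False
      have "Pr ?V p (\<lambda>A. ?V \<subseteq> cl r A) \<le> Pr ?V p (\<lambda>A. \<exists>u\<in>?V. \<exists>m\<in>{mm..<2 * mm + K}. seed (r(i0 := 0)) K (proj i0 (int (K + 1))) u m A)"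
        using spanned_layer[OF two pos K refl _ _ mg(1), where L = L] L by (intro Pr_mono[OF _ p(1) p1]) auto
      also have "\<dots> \<le> real (card ?V) * s"
      proof (rule Pr_union_bound_card[OF finite_box0 p(1) p1 finite_box0])
        fix u
        have "Pr ?V p (\<lambda>A. \<exists>m\<in>{mm..<2 * mm + K}. seed (r(i0 := 0)) K (proj i0 (int (K + 1))) u m A) \<le> (\<Sum>m\<in>{mm..<2 * mm + K}. g m)"
          by (rule order_trans[OF Pr_union_bound[OF finite_box0 p(1) p1] sum_mono[OF mg(2)]]) auto
        then show "Pr ?V p (\<lambda>A. \<exists>m\<in>{mm..<2 * mm + K}. seed (r(i0 := 0)) K (proj i0 (int (K + 1))) u m A) \<le> s"
          using mg(4) by simp
      qed
      also have "\<dots> \<le> real (k + 1) ^ CARD('d) * s"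
        using True s0 by (intro mult_right_mono) (auto simp: card_box0 intro!: power_mono)
      finally show ?thesis by simp
    qed
  next
    case False
    have "Pr ?V p (\<lambda>A. ?V \<subseteq> cl r A) \<le> Pr ?V p (\<lambda>A. \<exists>W\<subseteq>A. conn r (int K) (cl r W) \<and> \<not> small k W)"
    proof (rule Pr_mono[OF finite_box0 p(1) p1])
      fix A assume A: "A \<subseteq> ?V" "?V \<subseteq> cl r A"
      have "cl r A \<subseteq> ?V"
      proof
        fix s assume s: "s \<in> cl r A"
        have "0 \<le> s c" for c using A(1) by (intro cl_ge[OF twor _ s]) (auto simp: box0_def)
        moreover have "s c \<le> int L" for c using A(1) by (intro cl_le[OF twor _ s]) (auto simp: box0_def)
        ultimately show "s \<in> ?V" by (simp add: box0_def)
      qed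
      with A(2) have eq: "cl r A = ?V" by blast
      have "conn r (int K) {s. \<forall>c. 0 \<le> s c \<and> s c \<le> int L}"
      proof (rule conn_box)
        fix c assume "r c = 0" then show "0 = int L" using pos[of c] by simp
      qed (use K(2) in simp)
      then have "conn r (int K) ?V" by (simp add: box0_def)
      moreover have "\<not> small k A"
      proof
        assume "small k A"
        then have "small k ?V" using small_cl[OF finite_subset[OF A(1) finite_box0] twor] eq by metis
        moreover have "(\<lambda>_. int L) \<in> ?V" "(\<lambda>_. 0) \<in> ?V" by (auto simp: box0_def)
        ultimately have "\<And>i :: 'd. (\<lambda>_. int L) i - (\<lambda>_. 0) i < int k"
          unfolding small_def by metis
        with False show False by simp
      qed
      ultimately show "\<exists>W\<subseteq>A. conn r (int K) (cl r W) \<and> \<not> small k W"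
        by (intro exI[of _ A]) (simp add: eq)
    qed
    also have "\<dots> \<le> real (CARD('d) * (L + 1) ^ CARD('d)) * \<epsilon> ^ (k div ((K + 1) * n))"
    proof (rule large_cluster_bound[OF p(1) p1 twor K refl n k])
      fix i lo a
      obtain mm g where mg: "1 \<le> mm" "\<And>L u m. m < 2 * mm + K \<Longrightarrow> Pr (box0 L) p (seed (r(i := 0)) K (proj i (int (K + 1))) u m) \<le> g m"
         "chain_rate TYPE('d) K g mm \<le> e" "(\<Sum>m\<in>{mm..<2 * mm + K}. g m) \<le> s"
        using H[of i] by blast
      show "Pr ?V p (\<lambda>A. crossed (r(i := 0)) K i a (a + int n - 1)
        (proj i (int (K + 1)) ` (A \<inter> (box0 L \<inter> slab i (K + 1) n (2 * k + K) lo a)))) \<le> \<epsilon>"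
        by (rule order_trans[OF crossed_slab_bound[OF p two K refl n mg(1,2) e mg(3,4)] eps])
    qed
    finally show ?thesis by simp
  qed
qed

lemma nat_ceiling_bounds:
  assumes "0 < (x :: real)"
  shows "1 \<le> nat \<lceil>x\<rceil>" "real (nat \<lceil>x\<rceil>) \<le> x + 1" "x \<le> real (nat \<lceil>x\<rceil>)"
proof -
  have "0 < \<lceil>x\<rceil>" using assms by simp
  then show "1 \<le> nat \<lceil>x\<rceil>" by linarith
  show "real (nat \<lceil>x\<rceil>) \<le> x + 1" "x \<le> real (nat \<lceil>x\<rceil>)" using \<open>0 < \<lceil>x\<rceil>\<close> by linarith+
qed

lemma lower_bound_general:
  fixes r :: "'d::finite \<Rightarrow> nat"
  assumes pos: "\<And>c. 0 < r c" and card3: "CARD('d) = 3"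
    and K: "\<And>c. 2 * r c \<le> K" "1 \<le> K" and c: "0 < c"
    and H: "\<And>i. good_rates r K i F c" and F: "filterlim F at_top (at_right 0)"
    and L: "\<forall>\<^sub>F p in at_right 0. real (L p) < exp (exp (c / 12 * F p))"
  shows "((\<lambda>p. Pr (box0 (L p)) p (\<lambda>A. (box0 (L p) :: ('d \<Rightarrow> int) set) \<subseteq> cl r A)) \<longlongrightarrow> 0) (at_right 0)"
proof -
  text \<open>With \<open>y = c F / 6\<close>: clusters of size \<open>k = exp y\<close> are too large, blocks have \<open>n = 6 y\<close> layers.\<close>
  define y where "y p = c / 6 * F p" for p
  have y: "filterlim y at_top (at_right 0)" unfolding y_def
    using c by (intro filterlim_tendsto_pos_mult_at_top[OF tendsto_const _ F]) auto
  define k n where "k p = nat \<lceil>exp (y p)\<rceil>" and "n p = nat \<lceil>6 * y p\<rceil>" for p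
  define T :: real where "T = real (K + 1)"
  have T: "1 \<le> T" by (simp add: T_def)
  \<comment> \<open>Starting points contribute about \<open>y * exp (3 * y)\<close>, while a chain
    through the slab and an intermediate seed each cost \<open>exp (- 6 * y)\<close>. So a slab is
    crossed with probability at most 1/2.\<close>
  have ev1: "\<forall>\<^sub>F y in at_top. (6 * y + 1) * (2 * (exp y + 1) + real K + 1) ^ 3 * (exp (- 6 * y) + exp (- 6 * y)) \<le> 1 / 2"
    by real_asymp
  have ev2: "((\<lambda>y::real. (exp y + 2) ^ 3 * exp (- 6 * y)) \<longlongrightarrow> 0) at_top"
    by real_asymp
  \<comment> \<open>\<open>exp (exp (y / 2))\<close> bounds \<open>L\<close>, because
    \<open>c / 12 * F = y / 2\<close>. Its cube loses against the crossing of about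
    \<open>exp y / y\<close> slabs.\<close>
  have ev3: "((\<lambda>y. 3 * (exp (exp (y / 2)) + 1) ^ 3 * exp (- (1 / 2) * (exp y / (T * (6 * y + 1)) - 1))) \<longlongrightarrow> 0) at_top"
    using T by real_asymp
  show ?thesis
  proof (rule tendstoI)
    fix \<delta> :: real assume d: "0 < \<delta>"
    \<comment> \<open>The bound \<open>exp (-1)\<close> gives
      \<open>e ^ n \<le> exp (- 6 * y)\<close>; the bound \<open>\<delta> / 2\<close> settles the
      range where \<open>L\<close> is below the critical extent.\<close>
    define e where "e = min (exp (-1)) (\<delta> / 2)"
    have e0: "0 < e" using d by (simp add: e_def)
    have "\<forall>\<^sub>F p in at_right 0. \<forall>i\<in>(UNIV :: 'd set). \<exists>mm g. 1 \<le> mm \<and>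
     (\<forall>L u m. m < 2 * mm + K \<longrightarrow> Pr (box0 L) p (seed (r(i := 0)) K (proj i (int (K + 1))) u m) \<le> g m) \<and>
     chain_rate TYPE('d) K g mm \<le> e \<and> (\<Sum>m\<in>{mm..<2 * mm + K}. g m) \<le> exp (- c * F p)"
      using H e0 by (intro eventually_ball_finite) (auto simp: good_rates_def)
    moreover have "\<forall>\<^sub>F p in at_right 0. 0 < p \<and> p \<le> (1/2 :: real)"
      by (auto simp: eventually_at_right[of 0 1] intro!: exI[of _ "1/2"])
    moreover have "\<forall>\<^sub>F p in at_right 0. 1 \<le> y p"
      using y by (auto simp: filterlim_at_top)
    moreover have "\<forall>\<^sub>F p in at_right 0. (6 * y p + 1) * (2 * (exp (y p) + 1) + real K + 1) ^ 3 * (exp (- 6 * y p) + exp (- 6 * y p)) \<le> 1 / 2"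
      by (rule eventually_compose_filterlim[OF ev1 y])
    moreover have "\<forall>\<^sub>F p in at_right 0. (exp (y p) + 2) ^ 3 * exp (- 6 * y p) < \<delta>"
      using order_tendstoD(2)[OF ev2 d] by (rule eventually_compose_filterlim[OF _ y])
    moreover have "\<forall>\<^sub>F p in at_right 0. 3 * (exp (exp (y p / 2)) + 1) ^ 3 * exp (- (1 / 2) * (exp (y p) / (T * (6 * y p + 1)) - 1)) < \<delta>"
      using order_tendstoD(2)[OF ev3 d] by (rule eventually_compose_filterlim[OF _ y])
    ultimately show "\<forall>\<^sub>F p in at_right 0. dist (Pr (box0 (L p)) p (\<lambda>A. (box0 (L p) :: ('d \<Rightarrow> int) set) \<subseteq> cl r A)) 0 < \<delta>"
      using L
    proof eventually_elim
      case (elim p)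
      note H' = elim(1) and pp = elim(2) and y1 = elim(3) and b1 = elim(4) and b2 = elim(5) and b3 = elim(6) and LL = elim(7)
      have cF: "c * F p = 6 * y p" by (simp add: y_def)
      have k1: "1 \<le> k p" "real (k p) \<le> exp (y p) + 1" "exp (y p) \<le> real (k p)"
        using nat_ceiling_bounds[of "exp (y p)"] by (auto simp: k_def)
      have n1: "1 \<le> n p" "real (n p) \<le> 6 * y p + 1" "6 * y p \<le> real (n p)"
        using y1 nat_ceiling_bounds[of "6 * y p"] by (auto simp: n_def)
      have en: "e ^ n p \<le> exp (- 6 * y p)"
      proof -
        have "e ^ n p \<le> exp (-1) ^ n p" using e0 by (intro power_mono) (auto simp: e_def)
        also have "\<dots> = exp (- real (n p))" by (simp add: exp_of_nat_mult[symmetric])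
        also have "\<dots> \<le> exp (- 6 * y p)" using n1(3) by simp
        finally show ?thesis .
      qed
      have eps: "real (n p) * real (2 * k p + K + 1) ^ CARD('d) * (e ^ n p + exp (- 6 * y p)) \<le> 1 / 2"
      proof -
        have "real (n p) * real (2 * k p + K + 1) ^ CARD('d) * (e ^ n p + exp (- 6 * y p))
           \<le> (6 * y p + 1) * (2 * (exp (y p) + 1) + real K + 1) ^ 3 * (exp (- 6 * y p) + exp (- 6 * y p))"
          unfolding card3 using n1 k1 en y1 e0 by (intro mult_mono power_mono add_mono) auto
        with b1 show ?thesis by linarith
      qed
      have "Pr (box0 (L p)) p (\<lambda>A. (box0 (L p) :: ('d \<Rightarrow> int) set) \<subseteq> cl r A)
        \<le> max e (max (real (k p + 1) ^ CARD('d) * exp (- 6 * y p))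
            (real CARD('d) * real (L p + 1) ^ CARD('d) * (1/2) ^ (k p div ((K + 1) * n p))))"
        using pp H' e0 card3 by (intro lower_bound_pointwise[OF _ _ pos _ K n1(1) k1(1) _ _ eps]) (auto simp: cF)
      also have "\<dots> < \<delta>"
      proof -
        have "real (k p + 1) ^ CARD('d) * exp (- 6 * y p) \<le> (exp (y p) + 2) ^ 3 * exp (- 6 * y p)"
          unfolding card3 using k1 by (intro mult_right_mono power_mono) auto
        moreover have "real CARD('d) * real (L p + 1) ^ CARD('d) * (1/2) ^ (k p div ((K + 1) * n p))
          \<le> 3 * (exp (exp (y p / 2)) + 1) ^ 3 * exp (- (1 / 2) * (exp (y p) / (T * (6 * y p + 1)) - 1))"
        proof -
          have "real (L p) \<le> exp (exp (y p / 2))" using LL by (simp add: y_def)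
          moreover have "(1/2) ^ (k p div ((K + 1) * n p)) \<le> exp (- (1 / 2) * (exp (y p) / (T * (6 * y p + 1)) - 1))"
          proof -
            define N where "N = k p div ((K + 1) * n p)"
            have q: "real (k p) / real ((K + 1) * n p) - 1 \<le> real N"
              unfolding N_def using floor_divide_of_nat_eq[of "k p" "(K + 1) * n p", where ?'a = real] by linarith
            have "exp (y p) / (T * (6 * y p + 1)) \<le> real (k p) / real ((K + 1) * n p)"
              unfolding of_nat_mult T_def using k1 n1 y1
              by (intro frac_le mult_left_mono mult_pos_pos) auto
            with q have "exp (y p) / (T * (6 * y p + 1)) - 1 \<le> real N" by linarith
            then have "exp (- (1 / 2) * real N) \<le> exp (- (1 / 2) * (exp (y p) / (T * (6 * y p + 1)) - 1))"
              unfolding exp_le_cancel_iff by (rule mult_left_mono_neg) simp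
            moreover have "(1/2 :: real) \<le> exp (- 1 / 2)" using exp_ge_add_one_self[of "- 1 / 2"] by simp
            then have "(1/2 :: real) ^ N \<le> exp (- 1 / 2) ^ N" by (intro power_mono) auto
            then have "(1/2 :: real) ^ N \<le> exp (- (1 / 2) * real N)" by (simp add: exp_of_nat_mult[symmetric] mult.commute)
            ultimately show ?thesis unfolding N_def[symmetric] by (rule order_trans[rotated])
          qed
          ultimately show ?thesis unfolding card3 by (intro mult_mono power_mono) auto
        qed
        moreover have "e < \<delta>" using d by (simp add: e_def min_def)
        ultimately show ?thesis using b2 b3 by linarith
      qed
      finally show ?case using Pr_nonneg[of p "box0 (L p)" "\<lambda>A. (box0 (L p) :: ('d \<Rightarrow> int) set) \<subseteq> cl r A"] pp
        by (simp add: dist_real_def)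
    qed
  qed
qed

section \<open>Lower bound: rates of two-dimensional clusters\<close>

lemma proj_fibre:
  fixes V :: "('d::finite \<Rightarrow> int) set"
  assumes "finite V" "0 < t"
  shows "card {v \<in> V. proj i (int t) v = s} \<le> t"
proof -
  define I where "I c = (if c = i then {s i * int t..s i * int t + int t - 1} else {s c})" for c
  have "{v \<in> V. proj i (int t) v = s} \<subseteq> {v. \<forall>c. v c \<in> I c}"
  proof (intro subsetI CollectI allI)
    fix v c assume v: "v \<in> {v \<in> V. proj i (int t) v = s}"
    then have e: "s = v(i := v i div int t)" by (simp add: proj_def)
    have "0 \<le> v i mod int t" "v i mod int t < int t"
      using assms(2) by simp_all
    then have "v i div int t * int t \<le> v i" "v i < v i div int t * int t + int t"
      using div_mult_mod_eq[of "v i" "int t"] by linarith+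
    then show "v c \<in> I c" unfolding I_def e by auto
  qed
  then have "card {v \<in> V. proj i (int t) v = s} \<le> card {v. \<forall>c. v c \<in> I c}"
    by (intro card_mono finite_fun_box) (auto simp: I_def)
  also have "\<dots> = (\<Prod>c\<in>UNIV. card (I c))" by (rule card_fun_box)
  also have "\<dots> = (\<Prod>c\<in>{i}. card (I c))" by (intro prod.mono_neutral_right) (auto simp: I_def)
  also have "\<dots> = t" by (simp add: I_def)
  finally show ?thesis .
qed

lemma proj_proj_fibre:
  fixes V :: "('d::finite \<Rightarrow> int) set"
  assumes "finite V" "0 < t"
  shows "card {v \<in> V. proj j (int t) (proj i (int t) v) = s} \<le> t * t"
proof -
  have "{v \<in> V. proj j (int t) (proj i (int t) v) = s} = {v \<in> V. proj i (int t) v \<in> {w \<in> proj i (int t) ` V. proj j (int t) w = s}}"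
    by auto
  also have "card \<dots> \<le> t * card {w \<in> proj i (int t) ` V. proj j (int t) w = s}"
    using assms by (intro card_preimage_le proj_fibre) auto
  also have "\<dots> \<le> t * t" using assms by (intro mult_left_mono proj_fibre) auto
  finally show ?thesis .
qed

text \<open>Each axis of the plane can be the direction of crossing, and then the weight of the
  other one is the number of sites needed per window. The third bound records only that some site is
  occupied; it is the source of a factor \<open>p\<close>.\<close>

definition strip_bounds :: "('d::finite \<Rightarrow> nat) \<Rightarrow> nat \<Rightarrow> 'd \<Rightarrow> 'd \<Rightarrow> 'd \<Rightarrow> nat \<Rightarrow> nat \<Rightarrow> bool" where
  "strip_bounds r K i j l C T \<longleftrightarrow> (\<forall>L p lo d m. 0 \<le> p \<longrightarrow> p \<le> 1 \<longrightarrow> d i = 0 \<longrightarrow> (\<forall>c. d c \<le> m) \<longrightarrow>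
     Pr (box0 L) p (spanned (r(i := 0)) K (proj i (int (K + 1))) lo d) \<le> (1 - (1 - p ^ r l) ^ (C * (d l + 1))) ^ (d j div T - 1) \<and>
     Pr (box0 L) p (spanned (r(i := 0)) K (proj i (int (K + 1))) lo d) \<le> (1 - (1 - p ^ r j) ^ (C * (d j + 1))) ^ (d l div T - 1) \<and>
     Pr (box0 L) p (spanned (r(i := 0)) K (proj i (int (K + 1))) lo d) \<le> real C * p * real (m + 1) ^ 3)"

text \<open>Two successive projections merge at most \<open>t * t\<close> sites, which is the
  multiplicity in \<open>spanned_bound\<close>. \<open>C\<close> and \<open>T\<close> add the
  constants of both directions, which is allowed because the bounds are monotone in them.\<close>

lemma spanned_bounds:
  fixes r :: "'d::finite \<Rightarrow> nat"
  assumes axes: "UNIV = {i, j, l}" "i \<noteq> j" "i \<noteq> l" "j \<noteq> l" and pos: "\<And>c. 0 < r c"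
    and K: "\<And>c. 2 * r c \<le> K" "1 \<le> K"
  shows "\<exists>C\<ge>1. \<exists>T\<ge>1. strip_bounds r K i j l C T"
proof -
  define t where "t = K + 1"
  let ?r = "r(i := 0)" and ?f = "proj i (int t)"
  define Cj Cl where "Cj = block_const TYPE('d) (t * t) K (r j)" and "Cl = block_const TYPE('d) (t * t) K (r l)"
  define C where "C = Cj + Cl + t"
  define T where "T = t * (r j + r l)"
  have card3: "CARD('d) = 3" by (subst axes(1)) (simp add: axes(2-4))
  have t: "2 * ?r c + 1 \<le> t" "K \<le> t" "0 < t" for c using K(1)[of c] by (auto simp: t_def)
  have cross: "Pr (box0 L) p (spanned ?r K ?f lo d) \<le> (1 - (1 - p ^ r l') ^ (C * (d l' + 1))) ^ (d j' div T - 1)"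
    if p: "0 \<le> p" "p \<le> 1" and d: "d i = 0" and jl: "{j', l'} = {j, l}" for L p lo d j' l'
  proof -
    have jl': "j' \<noteq> l'" "j' \<noteq> i" "l' \<noteq> i" "UNIV = {i, j', l'}" using jl axes by (auto simp: doubleton_eq_iff)
    let ?C = "block_const TYPE('d) (t * t) K (?r l')"
    have "Pr (box0 L) p (spanned ?r K ?f lo d) \<le> (1 - (1 - p ^ ?r l') ^ (?C * (d l' + 1))) ^ (d j' div (t * ?r l') - 1)"
    proof (rule spanned_bound[OF _ p jl'(1) _ _ t(1) t(2) K(2)])
      show "c \<noteq> j' \<Longrightarrow> c \<noteq> l' \<Longrightarrow> ?r c = 0" for c using jl'(4) by auto
      show "c \<noteq> j' \<Longrightarrow> c \<noteq> l' \<Longrightarrow> d c = 0" for c using jl'(4) d by auto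
      show "0 < ?r l'" using pos jl' by simp
      show "card {v \<in> box0 L. proj j' (int t) (proj i (int t) v) = s} \<le> t * t" for s :: "'d \<Rightarrow> int"
        using t(3) by (intro proj_proj_fibre) auto
    qed auto
    also have "\<dots> \<le> (1 - (1 - p ^ r l') ^ (C * (d l' + 1))) ^ (d j' div (t * r l') - 1)"
    proof -
      have "?C \<le> C" using jl jl' unfolding C_def Cj_def Cl_def by (auto simp: doubleton_eq_iff)
      then have "?C * (d l' + 1) \<le> C * (d l' + 1)" by (rule mult_right_mono) simp
      moreover have "0 \<le> p ^ r l'" "p ^ r l' \<le> 1" using p by (auto simp: power_le_one)
      ultimately have "(1 - p ^ r l') ^ (C * (d l' + 1)) \<le> (1 - p ^ r l') ^ (?C * (d l' + 1))"
        by (intro power_decreasing) auto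
      moreover have "(1 - p ^ r l') ^ (?C * (d l' + 1)) \<le> 1" using p by (intro power_le_one) (auto simp: power_le_one)
      moreover have "?r l' = r l'" using jl'(3) by simp
      ultimately show ?thesis by (simp only:) (rule power_mono, simp_all)
    qed
    also have "\<dots> \<le> (1 - (1 - p ^ r l') ^ (C * (d l' + 1))) ^ (d j' div T - 1)"
    proof -
      have "r l' \<le> r j + r l" using jl by (auto simp: doubleton_eq_iff)
      then have "t * r l' \<le> T" by (simp add: T_def)
      moreover have "0 < t * r l'" using t(3) pos by simp
      ultimately have "d j' div T \<le> d j' div (t * r l')" by (intro div_le_mono2)
      moreover have "0 \<le> (1 - p ^ r l') ^ (C * (d l' + 1))" "(1 - p ^ r l') ^ (C * (d l' + 1)) \<le> 1"
        using p by (auto intro!: power_le_one zero_le_power simp: power_le_one)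
      ultimately show ?thesis by (intro power_decreasing) auto
    qed
    finally show ?thesis .
  qed
  have single: "Pr (box0 L) p (spanned ?r K ?f lo d) \<le> real C * p * real (m + 1) ^ 3"
    if p: "0 \<le> p" "p \<le> 1" and d: "\<And>c. d c \<le> m" for L p lo d m
  proof -
    define I where "I = {v \<in> box0 L. ?f v \<in> {s. \<forall>c. s c \<in> {lo c..lo c + int m}}}"
    have fin: "finite I" by (simp add: I_def)
    have "card {s. \<forall>c. s c \<in> {lo c..lo c + int m}} = (m + 1) ^ 3"
      unfolding card_fun_box by (simp add: card3 nat_add_distrib)
    moreover have "card I \<le> t * card {s. \<forall>c. s c \<in> {lo c..lo c + int m}}" unfolding I_def
      using t(3) by (intro card_preimage_le proj_fibre finite_fun_box) auto
    ultimately have "card I \<le> C * (m + 1) ^ 3" unfolding C_def by (simp add: add_mult_distrib)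
    then have cardI: "real (card I) \<le> real C * real (m + 1) ^ 3"
      by (metis of_nat_le_iff of_nat_mult of_nat_power)
    have "Pr (box0 L) p (spanned ?r K ?f lo d) \<le> Pr (box0 L) p (\<lambda>A. \<exists>v\<in>I. {v} \<subseteq> A)"
    proof (rule Pr_mono[OF finite_box0 p])
      fix A assume A: "A \<subseteq> box0 L" "spanned ?r K ?f lo d A"
      then obtain W where W: "W \<subseteq> A" "bbox lo d (?f ` W)" by (auto simp: spanned_def)
      then obtain v where v: "v \<in> W" unfolding bbox_def by blast
      have "lo c \<le> ?f v c \<and> ?f v c \<le> lo c + int m" for c
      proof -
        have "lo c \<le> ?f v c \<and> ?f v c \<le> lo c + int (d c)" using W(2) v unfolding bbox_def by blast
        then show ?thesis using d[of c] by linarith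
      qed
      then have "v \<in> I" using A W v by (auto simp: I_def)
      then show "\<exists>v\<in>I. {v} \<subseteq> A" using v W by blast
    qed
    also have "\<dots> \<le> real (card I) * p"
    proof (rule Pr_union_bound_card[OF finite_box0 p fin])
      fix v assume "v \<in> I"
      then show "Pr (box0 L) p (\<lambda>A. {v} \<subseteq> A) \<le> p"
        using Pr_superset[of "box0 L" "{v}" p] by (simp add: I_def)
    qed
    also have "\<dots> \<le> real C * real (m + 1) ^ 3 * p" by (rule mult_right_mono[OF cardI p(1)])
    finally show ?thesis by (simp add: mult_ac)
  qed
  have "1 \<le> C" "1 \<le> T" using t(3) pos[of j] by (simp_all add: C_def T_def)
  moreover have "strip_bounds r K i j l C T"
    unfolding strip_bounds_def t_def[symmetric] using cross single by (intro allI impI conjI) blast+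
  ultimately show ?thesis by blast
qed

lemma one_minus_power_le:
  assumes "0 \<le> (x::real)" "x \<le> 1"
  shows "1 - (1 - x) ^ n \<le> real n * x"
  using Bernoulli_inequality[of "-x" n] assms by simp

lemma div_sub_1_ge: "real m / real T - 2 \<le> real (m div T - 1)"
  using floor_divide_of_nat_eq[of m T, where ?'a = real] by linarith

text \<open>The term \<open>2 * T\<close> pays for the rounding and for the window subtracted in the
  exponent.\<close>

lemma exp_power_div_le:
  assumes "1 \<le> T" "0 \<le> (x::real)" "x \<le> exp (- real T)"
  shows "x ^ (m div T - 1) \<le> exp (2 * real T - real m)"
proof -
  have "x ^ (m div T - 1) \<le> exp (- real T) ^ (m div T - 1)" using assms by (intro power_mono)
  also have "\<dots> = exp (- (real T * real (m div T - 1)))" by (simp add: exp_of_nat_mult[symmetric] mult.commute)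
  also have "\<dots> \<le> exp (- (real T * (real m / real T - 2)))"
    by (simp only: exp_le_cancel_iff neg_le_iff_le) (intro mult_left_mono div_sub_1_ge, simp)
  also have "real T * (real m / real T - 2) = real m - 2 * real T" using assms(1) by (simp add: field_simps)
  finally show ?thesis by simp
qed

lemma summable_power_exp:
  assumes "0 < (c::real)"
  shows "summable (\<lambda>m. real (m + 1) ^ k * exp (- c * real m))"
proof (rule summable_comparison_test_bigo)
  show "summable (\<lambda>n. norm (1 / real n ^ 2))" using inverse_power_summable[of 2, where ?'a = real] by (simp add: field_simps)
  show "(\<lambda>m. real (m + 1) ^ k * exp (- c * real m)) \<in> O(\<lambda>n. 1 / real n ^ 2)"
    using assms by real_asymp
qed

lemma sum_power_exp_le:
  assumes "0 < (c::real)" "finite A"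
  shows "(\<Sum>m\<in>A. real (m + 1) ^ k * exp (- c * real m)) \<le> (\<Sum>m. real (m + 1) ^ k * exp (- c * real m))"
  by (rule sum_le_suminf[OF summable_power_exp[OF assms(1)] assms(2)]) auto

text \<open>A cluster of diameter \<open>m\<close> contains an occupied site and crosses about \<open>m\<close> strips; the
  geometric mean of the two resulting bounds is small for small \<open>p\<close> and decays in \<open>m\<close>.\<close>

lemma geometric_mean_bound:
  fixes P C T p :: real
  assumes "0 \<le> P" "P \<le> C * p * real (m + 1) ^ 3" "P \<le> exp (2 * T - real m)" "0 \<le> p" "1 \<le> C"
  shows "P \<le> sqrt C * exp T * sqrt p * real (m + 1) ^ 2 * exp (- (1/2) * real m)"
proof (rule power2_le_imp_le)
  have "P\<^sup>2 \<le> (C * p * real (m + 1) ^ 3) * exp (2 * T - real m)"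
    unfolding power2_eq_square using assms by (intro mult_mono) auto
  also have "\<dots> \<le> (C * p * real (m + 1) ^ 4) * exp (2 * T - real m)"
    using assms by (intro mult_right_mono mult_left_mono power_increasing) auto
  also have "\<dots> = (sqrt C * exp T * sqrt p * real (m + 1) ^ 2 * exp (- (1/2) * real m))\<^sup>2"
  proof -
    have "(exp T)\<^sup>2 * (exp (- (1/2) * real m))\<^sup>2 = exp (2 * T - real m)"
      by (simp add: power2_eq_square exp_add[symmetric])
    moreover have "(sqrt C * exp T * sqrt p * real (m + 1) ^ 2 * exp (- (1/2) * real m))\<^sup>2
      = C * p * real (m + 1) ^ 4 * ((exp T)\<^sup>2 * (exp (- (1/2) * real m))\<^sup>2)"
      using assms by (simp add: power_mult_distrib power_mult[symmetric])
    ultimately show ?thesis by simp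
  qed
  finally show "P\<^sup>2 \<le> (sqrt C * exp T * sqrt p * real (m + 1) ^ 2 * exp (- (1/2) * real m))\<^sup>2" .
qed (use assms in auto)

lemma eventually_at_right_0_half: "\<forall>\<^sub>F p in at_right 0. 0 < p \<and> p \<le> (1/2 :: real)"
  by (rule eventually_mono[OF eventually_at_right_real[of 0 "1/2"]]) auto

lemma filterlim_ln_inverse: "filterlim (\<lambda>p::real. ln (1 / p)) at_top (at_right 0)"
  by real_asymp

text \<open>Up to an extent of order \<open>(1 / p) ^ r j\<close> every window is crossed with
  probability at most \<open>exp (- T)\<close> in either direction, so extent \<open>m\<close> costs
  about \<open>exp (- m)\<close>. The critical extent is chosen at the end of this range.\<close>

lemma good_rates_simple:
  fixes r :: "'d::finite \<Rightarrow> nat"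
  assumes axes: "UNIV = {i, j, l}" "i \<noteq> j" "i \<noteq> l" "j \<noteq> l" and pos: "\<And>c. 0 < r c"
    and K: "\<And>c. 2 * r c \<le> K" "1 \<le> K" and le: "r j \<le> r l"
  shows "\<exists>c>0. good_rates r K i (\<lambda>p. (1 / p) ^ r j) c"
proof -
  obtain C T where CT: "1 \<le> C" "1 \<le> T" and sb0: "strip_bounds r K i j l C T"
    using spanned_bounds[of i j l r K, OF axes pos K] by (elim exE conjE) (rule that)
  note sb = sb0[unfolded strip_bounds_def, rule_format]
  have card3: "CARD('d) = 3" by (subst axes(1)) (simp add: axes(2-4))
  define u where "u = r j"
  \<comment> \<open>Chosen so that \<open>C * (3 * X) * p ^ u = exp (- T)\<close> for
    \<open>X = \<delta> * (1 / p) ^ u\<close>; the factor 3 covers extents up to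
    \<open>2 * mm + K\<close>.\<close>
  define \<delta> where "\<delta> = exp (- real T) / (3 * real C)"
  have d0: "0 < \<delta>" using CT by (simp add: \<delta>_def)
  define A where "A = sqrt (real C) * exp (real T)"
  \<comment> \<open>The exponents add 6 from \<open>seed_bound\<close>, 2 from the geometric mean
    and, for the first sum, another 6 from \<open>chain_rate\<close>.\<close>
  define S14 S8 where "S14 = (\<Sum>m. real (m + 1) ^ 14 * exp (- (1/2) * real m))"
    and "S8 = (\<Sum>m. real (m + 1) ^ 8 * exp (- (1/4) * real m))"
  define \<kappa> where "\<kappa> = real (2 * K + 3) ^ 3"
  have upos: "0 < u" using pos by (simp add: u_def)
  have ptop: "filterlim (\<lambda>p::real. \<delta> * (1 / p) ^ u) at_top (at_right 0)"
  proof (intro filterlim_tendsto_pos_mult_at_top[OF tendsto_const d0] filterlim_pow_at_top upos)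
    show "filterlim (\<lambda>p::real. 1 / p) at_top (at_right 0)" by real_asymp
  qed
  have sq: "((\<lambda>p. B * sqrt p) \<longlongrightarrow> 0) (at_right 0)" for B
    by (rule tendsto_eq_intros tendsto_real_sqrt tendsto_ident_at | simp)+
  have "good_rates r K i (\<lambda>p. (1 / p) ^ r j) (\<delta> / 8)" unfolding good_rates_def
  proof (intro allI impI)
    fix e :: real assume e: "0 < e"
    have "\<forall>\<^sub>F p in at_right 0. real K + 3 \<le> \<delta> * (1 / p) ^ u" using ptop by (auto simp: filterlim_at_top)
    moreover have "\<forall>\<^sub>F p in at_right 0. (\<kappa> * A * S14) * sqrt p < e" using order_tendstoD(2)[OF sq e] .
    moreover have "\<forall>\<^sub>F p in at_right 0. (A * S8) * sqrt p < 1" using order_tendstoD(2)[OF sq, of 1] by simp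
    moreover note eventually_at_right_0_half
    ultimately show "\<forall>\<^sub>F p in at_right 0. \<exists>mm g. 1 \<le> mm \<and>
     (\<forall>L u m. m < 2 * mm + K \<longrightarrow> Pr (box0 L) p (seed (r(i := 0)) K (proj i (int (K + 1))) u m) \<le> g m) \<and>
     chain_rate TYPE('d) K g mm \<le> e \<and> (\<Sum>m\<in>{mm..<2 * mm + K}. g m) \<le> exp (- (\<delta> / 8) * (1 / p) ^ r j)"
    proof eventually_elim
      case (elim p)
      have p: "0 < p" "0 \<le> p" "p \<le> 1" using elim(4) by auto
      define X where "X = \<delta> * (1 / p) ^ u"
      define mm where "mm = nat \<lfloor>X\<rfloor>"
      define \<beta> where "\<beta> m = A * sqrt p * real (m + 1) ^ 2 * exp (- (1/2) * real m)" for m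
      define g where "g m = real (m + 1) ^ 6 * \<beta> m" for m
      have X: "real K + 3 \<le> X" using elim(1) by (simp add: X_def)
      have mmX: "real mm \<le> X" "X - 1 \<le> real mm" "1 \<le> mm" using X unfolding mm_def by linarith+
      have small: "real C * real (m + 1) * p ^ u \<le> exp (- real T)" if "m < 2 * mm + K" for m
      proof -
        have "real (m + 1) \<le> 3 * X" using that X mmX(1) by linarith
        then have "real C * real (m + 1) * p ^ u \<le> real C * (3 * X) * p ^ u"
          using p by (intro mult_right_mono mult_left_mono) auto
        also have "\<dots> = exp (- real T)" using p CT by (simp add: X_def \<delta>_def power_one_over)
        finally show ?thesis .
      qed
      have span: "Pr (box0 L) p (spanned (r(i := 0)) K (proj i (int (K + 1))) lo d) \<le> \<beta> m"
        if m: "m < 2 * mm + K" and d: "d i = 0" "\<And>c. d c \<le> m" "\<exists>c. d c = m" for L m lo d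
      proof -
        let ?P = "Pr (box0 L) p (spanned (r(i := 0)) K (proj i (int (K + 1))) lo d)"
        have base: "0 \<le> 1 - (1 - p ^ v) ^ (C * (w + 1))" "1 - (1 - p ^ v) ^ (C * (w + 1)) \<le> exp (- real T)"
          if "w \<le> m" "u \<le> v" for w v
        proof -
          have pv: "0 \<le> p ^ v" "p ^ v \<le> 1" using p by (auto simp: power_le_one)
          show "0 \<le> 1 - (1 - p ^ v) ^ (C * (w + 1))" using pv by (simp add: power_le_one)
          have "1 - (1 - p ^ v) ^ (C * (w + 1)) \<le> real (C * (w + 1)) * p ^ v" by (rule one_minus_power_le[OF pv])
          also have "\<dots> \<le> (real C * real (m + 1)) * p ^ u"
            unfolding of_nat_mult using that p pv by (intro mult_mono power_decreasing) auto
          finally show "1 - (1 - p ^ v) ^ (C * (w + 1)) \<le> exp (- real T)" using small[OF m] by linarith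
        qed
        have "d j = m \<or> d l = m"
        proof -
          obtain c where c: "d c = m" using d(3) by blast
          have "c \<in> {i, j, l}" using axes(1) by blast
          then show ?thesis using c d(1) d(2)[of j] by auto
        qed
        then have "?P \<le> exp (2 * real T - real m)"
        proof
          assume dj: "d j = m"
          have "?P \<le> (1 - (1 - p ^ r l) ^ (C * (d l + 1))) ^ (d j div T - 1)" by (rule sb[where d = d, OF p(2,3) d(1,2), THEN conjunct1])
          also have "\<dots> \<le> exp (2 * real T - real m)" unfolding dj
            using base[of "d l" "r l"] d(2)[of l] le by (intro exp_power_div_le[OF CT(2)]) (auto simp: u_def)
          finally show ?thesis .
        next
          assume dl: "d l = m"
          have "?P \<le> (1 - (1 - p ^ r j) ^ (C * (d j + 1))) ^ (d l div T - 1)" by (rule sb[where d = d, OF p(2,3) d(1,2), THEN conjunct2, THEN conjunct1])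
          also have "\<dots> \<le> exp (2 * real T - real m)" unfolding dl
            using base[of "d j" "r j"] d(2)[of j] by (intro exp_power_div_le[OF CT(2)]) (auto simp: u_def)
          finally show ?thesis .
        qed
        moreover have "?P \<le> real C * p * real (m + 1) ^ 3" by (rule sb[where d = d, OF p(2,3) d(1,2), THEN conjunct2, THEN conjunct2])
        ultimately show ?thesis unfolding \<beta>_def A_def
          using CT p by (intro geometric_mean_bound Pr_nonneg) auto
      qed
      have "Pr (box0 L) p (seed (r(i := 0)) K (proj i (int (K + 1))) w m) \<le> g m" if m: "m < 2 * mm + K" for L w m
      proof -
        have "0 \<le> \<beta> m" using p by (simp add: \<beta>_def A_def)
        then have "Pr (box0 L) p (seed (r(i := 0)) K (proj i (int (K + 1))) w m) \<le> real (m + 1) ^ (2 * CARD('d)) * \<beta> m"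
          using span[OF m] by (intro seed_bound[where i = i, OF finite_box0 p(2,3)]) auto
        then show ?thesis by (simp add: g_def card3)
      qed
      moreover have "chain_rate TYPE('d) K g mm \<le> e"
      proof -
        have "chain_rate TYPE('d) K g mm = (\<kappa> * A * sqrt p) * (\<Sum>m<mm. real (m + 1) ^ 14 * exp (- (1/2) * real m))"
          unfolding chain_rate_def sum_distrib_left card3
          by (intro sum.cong refl) (simp add: g_def \<beta>_def \<kappa>_def power_add[symmetric] mult_ac flip: power_add)
        also have "\<dots> \<le> (\<kappa> * A * sqrt p) * S14" unfolding S14_def
          using p by (intro mult_left_mono sum_power_exp_le) (auto simp: \<kappa>_def A_def)
        finally show ?thesis using elim(2) by (simp add: mult_ac)
      qed
      moreover have "(\<Sum>m\<in>{mm..<2 * mm + K}. g m) \<le> exp (- (\<delta> / 8) * (1 / p) ^ r j)"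
      proof -
        have "g m \<le> (A * sqrt p * exp (- (1/4) * real mm)) * (real (m + 1) ^ 8 * exp (- (1/4) * real m))" if "mm \<le> m" for m
        proof -
          \<comment> \<open>Half of the decay is kept for summation and the other half is evaluated
            at \<open>mm\<close>; with \<open>mm \<ge> X / 2\<close> it yields
            \<open>exp (- X / 8)\<close>.\<close>
          have "exp (- (1/2) * real m) \<le> exp (- (1/4) * real mm) * exp (- (1/4) * real m)"
            using that by (simp add: exp_add[symmetric])
          then have "(A * sqrt p * real (m + 1) ^ 8) * exp (- (1/2) * real m) \<le> (A * sqrt p * real (m + 1) ^ 8) * (exp (- (1/4) * real mm) * exp (- (1/4) * real m))"
            using p by (intro mult_left_mono) (auto simp: A_def)
          moreover have "g m = (A * sqrt p * real (m + 1) ^ 8) * exp (- (1/2) * real m)"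
            by (simp add: g_def \<beta>_def mult_ac flip: power_add)
          ultimately show ?thesis by (simp add: mult_ac)
        qed
        then have "(\<Sum>m\<in>{mm..<2 * mm + K}. g m) \<le> (\<Sum>m\<in>{mm..<2 * mm + K}. (A * sqrt p * exp (- (1/4) * real mm)) * (real (m + 1) ^ 8 * exp (- (1/4) * real m)))"
          by (intro sum_mono) auto
        also have "\<dots> = (A * sqrt p * exp (- (1/4) * real mm)) * (\<Sum>m\<in>{mm..<2 * mm + K}. real (m + 1) ^ 8 * exp (- (1/4) * real m))"
          by (simp add: sum_distrib_left)
        also have "\<dots> \<le> (A * sqrt p * exp (- (1/4) * real mm)) * S8" unfolding S8_def
          using p by (intro mult_left_mono sum_power_exp_le) (auto simp: A_def)
        also have "\<dots> = ((A * S8) * sqrt p) * exp (- (1/4) * real mm)" by (simp add: mult_ac)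
        also have "\<dots> \<le> 1 * exp (- (1/4) * real mm)" using elim(3) by (intro mult_right_mono) auto
        also have "\<dots> \<le> exp (- (1/8) * X)" using mmX(2) X by simp
        finally show ?thesis by (simp add: X_def u_def)
      qed
      ultimately show ?case using mmX(3) by blast
    qed
  qed
  then show ?thesis using d0 by (intro exI[of _ "\<delta> / 8"]) auto
qed

lemma power_le_exp:
  assumes "0 \<le> (x::real)" "x \<le> exp (- y)" "0 \<le> y" "z \<le> real N"
  shows "x ^ N \<le> exp (- (y * z))"
proof -
  have "x ^ N \<le> exp (- y) ^ N" using assms by (intro power_mono)
  also have "\<dots> = exp (- (y * real N))" by (simp add: exp_of_nat_mult[symmetric] mult.commute)
  also have "\<dots> \<le> exp (- (y * z))" using assms by (simp add: mult_left_mono)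
  finally show ?thesis .
qed

lemma exp_le_one_minus:
  assumes "0 \<le> (x::real)" "x \<le> 1/2"
  shows "exp (- 2 * x) \<le> 1 - x"
proof -
  have "x * (2 * x) \<le> x * 1" using assms by (intro mult_left_mono) auto
  then have "1 \<le> (1 + 2 * x) * (1 - x)" by (simp add: algebra_simps)
  also have "\<dots> \<le> exp (2 * x) * (1 - x)" using assms exp_ge_add_one_self[of "2 * x"] by (intro mult_right_mono) auto
  finally have "exp (- 2 * x) * 1 \<le> exp (- 2 * x) * (exp (2 * x) * (1 - x))" by (intro mult_left_mono) auto
  then show ?thesis by (simp add: mult.assoc[symmetric] exp_add[symmetric])
qed

text \<open>Write \<open>p = exp (- h)\<close>.  Clusters narrower than about \<open>p powr (- r j) * h\<close> can hardly grow along
  axis \<open>l\<close> and wider ones pay a factor \<open>p powr (1/4)\<close> for each unit of width.\<close>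

lemma good_rates_strict:
  fixes r :: "'d::finite \<Rightarrow> nat"
  assumes axes: "UNIV = {i, j, l}" "i \<noteq> j" "i \<noteq> l" "j \<noteq> l" and pos: "\<And>c. 0 < r c"
    and K: "\<And>c. 2 * r c \<le> K" "1 \<le> K" and le: "r j < r l"
  shows "\<exists>c>0. good_rates r K i (\<lambda>p. (1 / p) ^ r j * (ln (1 / p))\<^sup>2) c"
proof -
  obtain C T where CT: "1 \<le> C" "1 \<le> T" and sb0: "strip_bounds r K i j l C T"
    using spanned_bounds[of i j l r K, OF axes pos K] by (elim exE conjE) (rule that)
  note sb = sb0[unfolded strip_bounds_def, rule_format]
  have card3: "CARD('d) = 3" by (subst axes(1)) (simp add: axes(2-4))
  define u v where "u = r j" and "v = r l"
  define Tr where "Tr = real T"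
  \<comment> \<open>\<open>\<delta>\<close> makes windows of length up to
    \<open>\<delta> * p ^ (- u)\<close> cost \<open>exp (- T)\<close>. \<open>\<delta>1\<close>
    makes windows of length up to \<open>\<delta>1 * p ^ (- u) * h\<close> fail with probability at
    least \<open>exp (- h / 4)\<close>. \<open>c1\<close> is the exponent per
    \<open>p ^ (- u) * h ^ 2\<close> of a cluster wider than the latter.\<close>
  define \<delta> \<delta>1 c1 where "\<delta> = exp (- Tr) / real C" and "\<delta>1 = 1 / (8 * real C)" and "c1 = \<delta>1 / (8 * Tr)"
  have T1: "1 \<le> Tr" using CT by (simp add: Tr_def)
  have d0: "0 < \<delta>" "0 < \<delta>1" "0 < c1" using CT T1 by (auto simp: \<delta>_def \<delta>1_def c1_def)
  define A where "A = sqrt (real C) * exp Tr"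
  define S14 where "S14 = (\<Sum>m. real (m + 1) ^ 14 * exp (- (1/2) * real m))"
  define \<kappa> where "\<kappa> = real (2 * K + 3) ^ 3"
  have uv: "0 < u" "u < v" using pos le by (auto simp: u_def v_def)
  define V where "V = real v"
  define Cr where "Cr = real C"
  define Kr where "Kr = real K"
  have pos': "0 < V" "0 < Cr" "0 < Kr" using uv CT K by (auto simp: V_def Cr_def Kr_def)
  have "good_rates r K i (\<lambda>p. (1 / p) ^ r j * (ln (1 / p))\<^sup>2) (c1 / 2)" unfolding good_rates_def
  proof (intro allI impI)
    fix e :: real assume e: "0 < e"
    have "((\<lambda>h. \<kappa> * exp (13 * V * h - \<delta> / (8 * Tr) * h * exp h)) \<longlongrightarrow> 0) at_top"
      using pos' d0 T1 by real_asymp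
    then have E4: "\<forall>\<^sub>F h in at_top. \<kappa> * exp (13 * V * h - \<delta> / (8 * Tr) * h * exp h) < e / 2"
      using e by (intro order_tendstoD(2)) auto
    have "((\<lambda>h. \<kappa> * A * S14 * exp (- h / 2)) \<longlongrightarrow> 0) at_top"
      by real_asymp
    then have E5: "\<forall>\<^sub>F h in at_top. \<kappa> * A * S14 * exp (- h / 2) < e / 2"
      using e by (intro order_tendstoD(2)) auto
    have E1: "\<forall>\<^sub>F h in at_top. Kr + 3 + 2 + 4 * Tr \<le> exp (h / 2)" by real_asymp
    have E2: "\<forall>\<^sub>F h in at_top. 3 * Cr * exp (- h / 2) \<le> exp (- (h / 4))" using pos' by real_asymp
    have E3: "\<forall>\<^sub>F h in at_top. 2 + 4 * Tr \<le> \<delta> * exp h" using d0 by real_asymp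
    have E6: "\<forall>\<^sub>F h in at_top. \<delta>1 * h + 1 \<le> exp (h / 2)" using d0 by real_asymp
    have E7: "\<forall>\<^sub>F h in at_top. 2 + 4 * Tr \<le> \<delta>1 * h" using d0 by real_asymp
    have E9: "\<forall>\<^sub>F h in at_top. c1 * h ^ 2 \<le> exp (h / 4) / (2 * Tr)" using d0 T1 by real_asymp
    have E10: "\<forall>\<^sub>F h in at_top. 7 * ln 3 + 7 * V * h \<le> c1 / 2 * (exp h * h ^ 2)" using d0 pos' by real_asymp
    have E0: "\<forall>\<^sub>F h in at_top. (1::real) \<le> h" by real_asymp
    note ev = eventually_conj[OF E0 eventually_conj[OF E1 eventually_conj[OF E2 eventually_conj[OF E3
        eventually_conj[OF E4 eventually_conj[OF E5 eventually_conj[OF E6 eventually_conj[OF E7 eventually_conj[OF E9 E10]]]]]]]]]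
    from eventually_compose_filterlim[OF ev filterlim_ln_inverse] eventually_at_right_0_half
    show "\<forall>\<^sub>F p in at_right 0. \<exists>mm g. 1 \<le> mm \<and>
     (\<forall>L u m. m < 2 * mm + K \<longrightarrow> Pr (box0 L) p (seed (r(i := 0)) K (proj i (int (K + 1))) u m) \<le> g m) \<and>
     chain_rate TYPE('d) K g mm \<le> e \<and> (\<Sum>m\<in>{mm..<2 * mm + K}. g m) \<le> exp (- (c1 / 2) * ((1 / p) ^ r j * (ln (1 / p))\<^sup>2))"
    proof eventually_elim
      case (elim p)
      define h where "h = ln (1 / p)"
      have p: "0 < p" "0 \<le> p" "p \<le> 1" "p \<le> 1/2" using elim(2) by auto
      have ph: "p = exp (- h)" using p by (simp add: h_def ln_div)
      have h: "1 \<le> h" "Kr + 3 + 2 + 4 * Tr \<le> exp (h / 2)" "3 * Cr * exp (- h / 2) \<le> exp (- (h / 4))"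
        "2 + 4 * Tr \<le> \<delta> * exp h" "\<kappa> * exp (13 * V * h - \<delta> / (8 * Tr) * h * exp h) < e / 2"
        "\<kappa> * A * S14 * exp (- h / 2) < e / 2" "\<delta>1 * h + 1 \<le> exp (h / 2)" "2 + 4 * Tr \<le> \<delta>1 * h"
        "c1 * h ^ 2 \<le> exp (h / 4) / (2 * Tr)" "7 * ln 3 + 7 * V * h \<le> c1 / 2 * (exp h * h ^ 2)"
        using elim(1) unfolding h_def[symmetric] by auto
      \<comment> \<open>\<open>U\<close> is the inverse of \<open>p ^ r j\<close>. The critical
        extent \<open>X\<close> is chosen with \<open>p ^ v * X = sqrt p\<close>, so a crossing
        along \<open>j\<close> still pays a power of \<open>p\<close> per window throughout,
        although \<open>X\<close> is far larger than \<open>U\<close>. \<open>\<tau>\<close> is the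
        price of a width beyond \<open>\<delta> * U\<close>.\<close>
      define U X \<tau> where "U = exp (real u * h)" and "X = exp (V * h - h / 2)" and "\<tau> = exp (- (h / 4 * (\<delta> * U / (2 * Tr))))"
      have pu: "p ^ u * U = 1" "p ^ v * X = exp (- h / 2)" "(1 / p) ^ u = U" "sqrt p = exp (- h / 2)"
      proof -
        show "p ^ u * U = 1" "p ^ v * X = exp (- h / 2)"
          unfolding ph U_def X_def V_def exp_of_nat_mult[symmetric] exp_add[symmetric] by (auto simp: algebra_simps)
        show "(1 / p) ^ u = U" unfolding ph U_def exp_of_nat_mult by (simp add: exp_minus field_simps)
        show "sqrt p = exp (- h / 2)" by (rule real_sqrt_unique) (auto simp: ph power2_eq_square exp_add[symmetric])
      qed
      have U: "exp h \<le> U" "1 \<le> U" "0 < U" using uv h(1) by (auto simp: U_def)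
      have XU: "U * exp (h / 2) \<le> X"
      proof -
        have "real u + 1 \<le> V" using uv by (simp add: V_def)
        then have "(real u + 1) * h \<le> V * h" using h(1) by (intro mult_right_mono) auto
        then show ?thesis unfolding U_def X_def exp_add[symmetric] by (simp add: algebra_simps)
      qed
      have X1: "exp (h / 2) \<le> X"
      proof -
        have "exp (h / 2) \<le> U * exp (h / 2)" using U(2) by simp
        then show ?thesis using XU by (rule order_trans)
      qed
      define mm where "mm = nat \<lfloor>X\<rfloor>"
      have X: "Kr + 3 \<le> X" "2 + 4 * Tr \<le> X" "0 < X" using X1 h(2) T1 pos' by linarith+
      have mmX: "real mm \<le> X" "X - 1 \<le> real mm" "1 \<le> mm" using X pos' unfolding mm_def by linarith+
      have m3X: "real (m + 1) \<le> 3 * X" if "m < 2 * mm + K" for m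
        using that X(1) mmX(1) unfolding Kr_def by linarith
      define q where "q = exp (- (h / 4))"
      let ?P = "\<lambda>L lo d. Pr (box0 L) p (spanned (r(i := 0)) K (proj i (int (K + 1))) lo d)"
      have pv01: "0 \<le> p ^ n" "p ^ n \<le> 1" for n using p by (auto simp: power_le_one)
      have base0: "0 \<le> 1 - (1 - p ^ n) ^ k" for n k using pv01 by (simp add: power_le_one)
      have bern: "1 - (1 - p ^ n) ^ (C * (w + 1)) \<le> Cr * real (m + 1) * p ^ n" if "w \<le> m" for n w m
      proof -
        have "1 - (1 - p ^ n) ^ (C * (w + 1)) \<le> real (C * (w + 1)) * p ^ n" by (rule one_minus_power_le[OF pv01])
        also have "\<dots> \<le> Cr * real (m + 1) * p ^ n"
          unfolding of_nat_mult Cr_def using that pv01 by (intro mult_mono) auto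
        finally show ?thesis .
      qed
      \<comment> \<open>Every window crossed along \<open>j\<close> costs at most
        \<open>exp (- h / 4)\<close>: with \<open>m + 1 \<le> 3 * X\<close> the bound
        \<open>3 * C * sqrt p\<close> for a single window is below it.\<close>
      have cj: "?P L lo d \<le> exp (- (h / 4 * z))"
        if m: "m < 2 * mm + K" and d: "d i = 0" "\<And>c. d c \<le> m" and z: "z \<le> real (d j) / Tr - 2" for L m lo d z
      proof -
        have "?P L lo d \<le> (1 - (1 - p ^ v) ^ (C * (d l + 1))) ^ (d j div T - 1)"
          unfolding v_def by (rule sb[where d = d, OF p(2,3) d(1,2), THEN conjunct1])
        also have "\<dots> \<le> exp (- (h / 4 * z))"
        proof (rule power_le_exp[OF base0])
          have "1 - (1 - p ^ v) ^ (C * (d l + 1)) \<le> Cr * real (m + 1) * p ^ v" by (rule bern[OF d(2)])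
          also have "\<dots> \<le> Cr * (3 * X) * p ^ v"
            using m3X[OF m] pv01 pos' by (intro mult_right_mono mult_left_mono) auto
          also have "\<dots> = 3 * Cr * exp (- h / 2)" using pu(2) by (simp add: mult_ac)
          finally show "1 - (1 - p ^ v) ^ (C * (d l + 1)) \<le> exp (- (h / 4))" using h(3) by linarith
          show "z \<le> real (d j div T - 1)" using z div_sub_1_ge[of "d j" T] by (simp add: Tr_def)
        qed (use h(1) in auto)
        finally show ?thesis .
      qed
      have long: "d j = m \<or> d l = m" if d: "d i = 0" "\<And>c. d c \<le> m" "\<exists>c. d c = m" for d :: "'d \<Rightarrow> nat" and m
      proof -
        obtain b where b: "d b = m" using d(3) by blast
        have "b \<in> {i, j, l}" using axes(1) by blast
        then show ?thesis using b d(1) d(2)[of j] by auto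
      qed
      define \<beta> where "\<beta> m = A * sqrt p * real (m + 1) ^ 2 * exp (- (1/2) * real m)" for m
      define g where "g m = (if m < mm then real (m + 1) ^ 6 * (\<beta> m + \<tau>) else real (m + 1) ^ 6 * exp (- (c1 * (U * h ^ 2))))" for m
      have b0: "0 \<le> \<beta> m" for m using p by (simp add: \<beta>_def A_def)
      \<comment> \<open>Below the width \<open>\<delta> * U\<close> windows in either direction cost
        \<open>exp (- T)\<close>, as for a single scale, which gives \<open>\<beta>\<close>. A wider
        cluster is charged for its extent along \<open>j\<close> alone, which gives
        \<open>\<tau>\<close>.\<close>
      have span1: "?P L lo d \<le> \<beta> m + \<tau>"
        if m: "m < 2 * mm + K" and d: "d i = 0" "\<And>c. d c \<le> m" "\<exists>c. d c = m" for L m lo d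
      proof (cases "real (d j + 1) \<le> \<delta> * U")
        case False
        have "\<delta> * U / (2 * Tr) \<le> real (d j) / Tr - 2"
        proof -
          have "\<delta> * exp h \<le> \<delta> * U" using U(1) d0 by simp
          then have "\<delta> * U + 2 * (2 * Tr) \<le> 2 * real (d j)" using False h(4) by simp
          then show ?thesis using T1 by (simp add: field_simps)
        qed
        from cj[OF m d(1,2) this] have "?P L lo d \<le> \<tau>" unfolding \<tau>_def .
        then show ?thesis using b0[of m] by linarith
      next
        case True
        have small: "Cr * real (w + 1) * p ^ n \<le> exp (- real T)" if "real (w + 1) \<le> \<delta> * U" "u \<le> n" for w n
        proof -
          have "Cr * real (w + 1) * p ^ n \<le> Cr * (\<delta> * U) * p ^ u"
            using that p pv01 pos' d0 U by (intro mult_mono power_decreasing) auto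
          also have "\<dots> = exp (- real T)" using pu(1) CT by (simp add: \<delta>_def Cr_def Tr_def mult_ac)
          finally show ?thesis .
        qed
        have "?P L lo d \<le> exp (2 * Tr - real m)"
          using long[OF d]
        proof
          assume dj: "d j = m"
          have "?P L lo d \<le> (1 - (1 - p ^ r l) ^ (C * (d l + 1))) ^ (d j div T - 1)" by (rule sb[where d = d, OF p(2,3) d(1,2), THEN conjunct1])
          also have "\<dots> \<le> exp (2 * Tr - real m)" unfolding dj Tr_def
            using bern[of "d l" m "r l"] d(2)[of l] small[of m "r l"] True dj uv
            by (intro exp_power_div_le[OF CT(2) base0]) (auto simp: v_def)
          finally show ?thesis .
        next
          assume dl: "d l = m"
          have "?P L lo d \<le> (1 - (1 - p ^ r j) ^ (C * (d j + 1))) ^ (d l div T - 1)" by (rule sb[where d = d, OF p(2,3) d(1,2), THEN conjunct2, THEN conjunct1])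
          also have "\<dots> \<le> exp (2 * Tr - real m)" unfolding dl Tr_def
            using bern[of "d j" "d j" "r j"] small[of "d j" "r j"] True
            by (intro exp_power_div_le[OF CT(2) base0]) (auto simp: u_def)
          finally show ?thesis .
        qed
        moreover have "?P L lo d \<le> real C * p * real (m + 1) ^ 3"
          by (rule sb[where d = d, OF p(2,3) d(1,2), THEN conjunct2, THEN conjunct2])
        ultimately have "?P L lo d \<le> \<beta> m" unfolding \<beta>_def A_def
          using CT p by (intro geometric_mean_bound Pr_nonneg) auto
        then show ?thesis by (simp add: \<tau>_def add_increasing2)
      qed
      \<comment> \<open>At intermediate extents a cluster is either wider than
        \<open>\<delta>1 * U * h\<close> and pays along \<open>j\<close>, or narrow and then long
        along \<open>l\<close>. In the second case each of about \<open>X / T\<close> windows fails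
        with probability at least \<open>q = exp (- h / 4)\<close>, and
        \<open>q * X \<ge> U * exp (h / 4)\<close> is far more than
        \<open>U * h ^ 2\<close>.\<close>
      have span2: "?P L lo d \<le> exp (- (c1 * (U * h ^ 2)))"
        if m: "m < 2 * mm + K" "mm \<le> m" and d: "d i = 0" "\<And>c. d c \<le> m" "\<exists>c. d c = m" for L m lo d
      proof (cases "real (d j + 1) \<le> \<delta>1 * U * h")
        case False
        have "\<delta>1 * U * h / (2 * Tr) \<le> real (d j) / Tr - 2"
        proof -
          have "\<delta>1 * h * 1 \<le> \<delta>1 * h * U" using U(2) d0 h(1) by (intro mult_left_mono) auto
          then have "\<delta>1 * U * h + 2 * (2 * Tr) \<le> 2 * real (d j)" using False h(8) by (simp add: mult_ac)
          then show ?thesis using T1 by (simp add: field_simps)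
        qed
        from cj[OF m(1) d(1,2) this] have "?P L lo d \<le> exp (- (h / 4 * (\<delta>1 * U * h / (2 * Tr))))" .
        also have "h / 4 * (\<delta>1 * U * h / (2 * Tr)) = c1 * (U * h ^ 2)" by (simp add: c1_def power2_eq_square)
        finally show ?thesis .
      next
        case True
        have "d j < m"
        proof -
          have "U * (\<delta>1 * h + 1) \<le> U * exp (h / 2)" using h(7) U(3) by (intro mult_left_mono) auto
          then have "\<delta>1 * U * h + 1 \<le> X" using XU U(2) by (simp add: algebra_simps)
          then have "real (d j) + 1 \<le> real mm" using True mmX(2) by simp
          then show ?thesis using m(2) by linarith
        qed
        then have dl: "d l = m" using long[OF d] by simp
        have "?P L lo d \<le> (1 - (1 - p ^ u) ^ (C * (d j + 1))) ^ (m div T - 1)"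
          unfolding u_def dl[symmetric] by (rule sb[where d = d, OF p(2,3) d(1) _ , THEN conjunct2, THEN conjunct1]) (use d(2) dl in auto)
        also have "\<dots> \<le> exp (- (q * (X / (2 * Tr))))"
        proof (rule power_le_exp[OF base0])
          have "q = exp (- 2 * p ^ u * (Cr * (\<delta>1 * U * h)))"
          proof -
            have "2 * p ^ u * (Cr * (\<delta>1 * U * h)) = 2 * Cr * \<delta>1 * h * (p ^ u * U)" by (simp add: mult_ac)
            also have "\<dots> = h / 4" using CT by (simp add: pu(1) \<delta>1_def Cr_def)
            finally show ?thesis by (simp add: q_def)
          qed
          also have "\<dots> \<le> exp (- 2 * p ^ u * real (C * (d j + 1)))"
          proof -
            have "p ^ u * real (C * (d j + 1)) \<le> p ^ u * (Cr * (\<delta>1 * U * h))"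
              unfolding of_nat_mult Cr_def using True pv01 by (intro mult_left_mono) auto
            then show ?thesis by simp
          qed
          also have "\<dots> = exp (- 2 * p ^ u) ^ (C * (d j + 1))"
            by (simp add: exp_of_nat_mult[symmetric] mult_ac)
          also have "\<dots> \<le> (1 - p ^ u) ^ (C * (d j + 1))"
          proof (intro power_mono exp_le_one_minus)
            have "p ^ u \<le> p ^ 1" using p uv by (intro power_decreasing) auto
            then show "p ^ u \<le> 1/2" using p(4) by simp
          qed (use pv01 in auto)
          finally have "1 - (1 - p ^ u) ^ (C * (d j + 1)) \<le> 1 - q" by simp
          also have "\<dots> \<le> exp (- q)" using exp_ge_add_one_self[of "- q"] by simp
          finally show "1 - (1 - p ^ u) ^ (C * (d j + 1)) \<le> exp (- q)" .
          have "X / (2 * Tr) \<le> real m / Tr - 2"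
          proof -
            have "X + 2 * (2 * Tr) \<le> 2 * real m" using mmX(2) m(2) X(2) by simp
            then show ?thesis using T1 by (simp add: field_simps)
          qed
          then show "X / (2 * Tr) \<le> real (m div T - 1)" using div_sub_1_ge[of m T] by (simp add: Tr_def)
        qed (simp add: q_def)
        also have "\<dots> \<le> exp (- (c1 * (U * h ^ 2)))"
        proof -
          have "c1 * (U * h ^ 2) = U * (c1 * h ^ 2)" by simp
          also have "\<dots> \<le> U * (exp (h / 4) / (2 * Tr))" using h(9) U by (intro mult_left_mono) auto
          also have "\<dots> = q * (U * exp (h / 2) / (2 * Tr))"
          proof -
            have "q * exp (h / 2) = exp (h / 4)" unfolding q_def exp_add[symmetric] by simp
            then show ?thesis by (metis (no_types, lifting) mult.left_commute times_divide_eq_right)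
          qed
          also have "\<dots> \<le> q * (X / (2 * Tr))" using XU T1 by (intro mult_left_mono divide_right_mono) (auto simp: q_def)
          finally show ?thesis by simp
        qed
        finally show ?thesis .
      qed
      have "Pr (box0 L) p (seed (r(i := 0)) K (proj i (int (K + 1))) w m) \<le> g m" if m: "m < 2 * mm + K" for L w m
      proof (cases "m < mm")
        case True
        have "0 \<le> \<beta> m + \<tau>" using b0 by (simp add: \<tau>_def add_nonneg_nonneg)
        then have "Pr (box0 L) p (seed (r(i := 0)) K (proj i (int (K + 1))) w m) \<le> real (m + 1) ^ (2 * CARD('d)) * (\<beta> m + \<tau>)"
          using span1[OF m] by (intro seed_bound[where i = i, OF finite_box0 p(2,3)]) auto
        then show ?thesis using True by (simp add: g_def card3)
      next
        case False
        have "Pr (box0 L) p (seed (r(i := 0)) K (proj i (int (K + 1))) w m) \<le> real (m + 1) ^ (2 * CARD('d)) * exp (- (c1 * (U * h ^ 2)))"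
          using span2[OF m] False by (intro seed_bound[where i = i, OF finite_box0 p(2,3)]) auto
        then show ?thesis using False by (simp add: g_def card3)
      qed
      moreover have "chain_rate TYPE('d) K g mm \<le> e"
      proof -
        have "chain_rate TYPE('d) K g mm = (\<Sum>m<mm. (\<kappa> * A * sqrt p) * (real (m + 1) ^ 14 * exp (- (1/2) * real m)) + \<kappa> * \<tau> * real (m + 1) ^ 12)"
          unfolding chain_rate_def card3
        proof (intro sum.cong refl)
          fix m assume "m \<in> {..<mm}"
          then have g: "g m = real (m + 1) ^ 6 * (\<beta> m + \<tau>)" by (simp add: g_def)
          have e14: "real (m + 1) ^ 14 = real (m + 1) ^ 6 * real (m + 1) ^ 6 * real (m + 1) ^ 2"
            and e12: "real (m + 1) ^ 12 = real (m + 1) ^ 6 * real (m + 1) ^ 6" by (simp_all flip: power_add)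
          show "real (2 * K + 3) ^ 3 * real (m + 1) ^ (2 * 3) * g m =
            (\<kappa> * A * sqrt p) * (real (m + 1) ^ 14 * exp (- (1/2) * real m)) + \<kappa> * \<tau> * real (m + 1) ^ 12"
            unfolding g e14 e12 \<beta>_def \<kappa>_def by (simp add: algebra_simps)
        qed
        also have "\<dots> = (\<kappa> * A * sqrt p) * (\<Sum>m<mm. real (m + 1) ^ 14 * exp (- (1/2) * real m)) + \<kappa> * \<tau> * (\<Sum>m<mm. real (m + 1) ^ 12)"
          by (simp only: sum.distrib sum_distrib_left)
        also have "\<dots> \<le> (\<kappa> * A * sqrt p) * S14 + \<kappa> * \<tau> * X ^ 13"
        proof (intro add_mono mult_left_mono)
          show "(\<Sum>m<mm. real (m + 1) ^ 14 * exp (- (1/2) * real m)) \<le> S14" unfolding S14_def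
            by (intro sum_power_exp_le) auto
          have "(\<Sum>m<mm. real (m + 1) ^ 12) \<le> (\<Sum>m<mm. X ^ 12)"
          proof (intro sum_mono power_mono)
            fix m assume "m \<in> {..<mm}"
            then show "real (m + 1) \<le> X" using mmX(1) by simp
          qed simp
          also have "\<dots> = real mm * X ^ 12" by simp
          also have "\<dots> \<le> X * X ^ 12" using mmX(1) X(3) by (intro mult_right_mono) auto
          finally show "(\<Sum>m<mm. real (m + 1) ^ 12) \<le> X ^ 13" by (simp flip: power_Suc)
        qed (use p in \<open>auto simp: \<kappa>_def A_def \<tau>_def\<close>)
        also have "(\<kappa> * A * sqrt p) * S14 = \<kappa> * A * S14 * exp (- h / 2)" using pu(4) by (simp add: mult_ac)
        \<comment> \<open>\<open>X\<close> is exponential in \<open>h\<close>, whereas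
          \<open>\<tau>\<close> is at most \<open>exp (- const * h * exp h)\<close> and absorbs any
          power of it.\<close>
        also have "\<kappa> * \<tau> * X ^ 13 \<le> \<kappa> * exp (13 * V * h - \<delta> / (8 * Tr) * h * exp h)"
        proof -
          have "X ^ 13 \<le> exp (V * h) ^ 13" using h(1) by (intro power_mono) (auto simp: X_def)
          also have "\<dots> = exp (13 * V * h)" by (simp add: exp_of_nat_mult[symmetric] mult_ac)
          finally have 1: "X ^ 13 \<le> exp (13 * V * h)" .
          have "\<delta> / (8 * Tr) * h * exp h \<le> \<delta> / (8 * Tr) * h * U"
            using U d0 T1 h(1) by (intro mult_left_mono) auto
          also have "\<dots> = h / 4 * (\<delta> * U / (2 * Tr))" by simp
          finally have 2: "\<tau> \<le> exp (- (\<delta> / (8 * Tr) * h * exp h))" by (simp add: \<tau>_def)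
          have "\<tau> * X ^ 13 \<le> exp (- (\<delta> / (8 * Tr) * h * exp h)) * exp (13 * V * h)"
            using 1 2 X(3) by (intro mult_mono) auto
          also have "\<dots> = exp (13 * V * h - \<delta> / (8 * Tr) * h * exp h)" by (simp flip: exp_add)
          finally show ?thesis unfolding mult.assoc by (intro mult_left_mono) (auto simp: \<kappa>_def)
        qed
        finally show ?thesis using h(5,6) by simp
      qed
      moreover have "(\<Sum>m\<in>{mm..<2 * mm + K}. g m) \<le> exp (- (c1 / 2) * ((1 / p) ^ r j * (ln (1 / p))\<^sup>2))"
      proof -
        have "(\<Sum>m\<in>{mm..<2 * mm + K}. g m) \<le> (\<Sum>m\<in>{mm..<2 * mm + K}. (3 * X) ^ 6 * exp (- (c1 * (U * h ^ 2))))"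
        proof (rule sum_mono)
          fix m assume m: "m \<in> {mm..<2 * mm + K}"
          then have "real (m + 1) ^ 6 \<le> (3 * X) ^ 6" using m3X[of m] by (intro power_mono) auto
          then show "g m \<le> (3 * X) ^ 6 * exp (- (c1 * (U * h ^ 2)))"
            using m unfolding g_def by (auto intro: mult_right_mono)
        qed
        also have "\<dots> = real (mm + K) * ((3 * X) ^ 6 * exp (- (c1 * (U * h ^ 2))))" by simp
        also have "\<dots> \<le> (3 * X) * ((3 * X) ^ 6 * exp (- (c1 * (U * h ^ 2))))"
          using mmX(1) X(1,3) unfolding Kr_def by (intro mult_right_mono) auto
        also have "\<dots> = (3 * X) ^ 7 * exp (- (c1 * (U * h ^ 2)))" by (simp add: eval_nat_numeral)
        also have "\<dots> \<le> exp (c1 / 2 * (U * h ^ 2)) * exp (- (c1 * (U * h ^ 2)))"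
        proof (rule mult_right_mono)
          have "(3 * X) ^ 7 \<le> exp (ln 3 + V * h) ^ 7"
            using h(1) X(3) by (intro power_mono) (auto simp: X_def exp_add)
          also have "\<dots> = exp (7 * ln 3 + 7 * V * h)" by (simp add: exp_of_nat_mult[symmetric] algebra_simps)
          also have "\<dots> \<le> exp (c1 / 2 * (exp h * h ^ 2))" using h(10) by simp
          also have "\<dots> \<le> exp (c1 / 2 * (U * h ^ 2))"
            unfolding exp_le_cancel_iff using U d0 by (intro mult_left_mono mult_right_mono) auto
          finally show "(3 * X) ^ 7 \<le> exp (c1 / 2 * (U * h ^ 2))" .
        qed simp
        also have "\<dots> = exp (- (c1 / 2) * (U * h ^ 2))" by (simp flip: exp_add)
        finally show ?thesis using pu(3) by (simp add: h_def u_def)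
      qed
      ultimately show ?case using mmX(3) by blast
    qed
  qed
  then show ?thesis using d0 by (intro exI[of _ "c1 / 2"]) auto
qed

section \<open>Upper bound: growth of full boxes\<close>

definition ibox :: "('d \<Rightarrow> int) \<Rightarrow> ('d \<Rightarrow> int) \<Rightarrow> ('d \<Rightarrow> int) set" where
  "ibox lo hi = {s. \<forall>c. lo c \<le> s c \<and> s c \<le> hi c}"

text \<open>Quantifying over all closed \<open>S\<close> avoids a separate closure relative to
  \<open>F\<close>. The event depends only on \<open>A \<inter> F\<close>, hence is independent for
  disjoint regions, and it can be applied to any set that is closed in a larger region.\<close>

definition fills :: "('d::finite \<Rightarrow> nat) \<Rightarrow> ('d \<Rightarrow> int) set \<Rightarrow> ('d \<Rightarrow> int) set \<Rightarrow> bool" where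
  "fills r F A \<longleftrightarrow> (\<forall>S. closed_in r F S \<longrightarrow> A \<inter> F \<subseteq> S \<longrightarrow> F \<subseteq> S)"

definition run :: "'d \<Rightarrow> ('d \<Rightarrow> int) \<Rightarrow> nat \<Rightarrow> nat \<Rightarrow> ('d \<Rightarrow> int) set \<Rightarrow> bool" where
  "run c x w n A \<longleftrightarrow> (\<exists>k. k + n \<le> w \<and> (\<forall>m<n. x(c := x c + int (k + m)) \<in> A))"

definition segment :: "'d \<Rightarrow> ('d \<Rightarrow> int) \<Rightarrow> nat \<Rightarrow> ('d \<Rightarrow> int) set" where
  "segment c x w = {x(c := x c + int m) | m. m < w}"

lemma fills_Int: "fills r F (A \<inter> F) = fills r F A"
  by (simp add: fills_def Int_assoc)

lemma fillsD: "fills r F A \<Longrightarrow> closed_in r F S \<Longrightarrow> A \<inter> F \<subseteq> S \<Longrightarrow> F \<subseteq> S"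
  by (auto simp: fills_def)

lemma fills_full: "F \<subseteq> A \<Longrightarrow> fills r F A"
  by (auto simp: fills_def)

lemma closed_in_subset: "closed_in r V S \<Longrightarrow> F \<subseteq> V \<Longrightarrow> closed_in r F S"
  by (auto simp: closed_in_def)

lemma finite_ibox [simp]: "finite (ibox lo hi :: ('d::finite \<Rightarrow> int) set)"
proof -
  have "ibox lo hi = {s. \<forall>c. s c \<in> {lo c..hi c}}" by (auto simp: ibox_def)
  then show ?thesis using finite_fun_box[of "\<lambda>c. {lo c..hi c}"] by simp
qed

text \<open>If the \<open>r i\<close> sites on one side along axis \<open>i\<close> are occupied,
  the remaining axes only have to supply the threshold of the dynamics without axis
  \<open>i\<close>. This is the counterpart, for growth, of the projection argument.\<close>

lemma closed_in_helped:
  assumes S: "closed_in r V S" and F: "F \<subseteq> V"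
    and nbrs: "\<And>s. s \<in> F \<Longrightarrow> (\<forall>k\<in>{1..int (r i)}. s(i := s i - k) \<in> S) \<or> (\<forall>k\<in>{1..int (r i)}. s(i := s i + k) \<in> S)"
  shows "closed_in (r(i := 0)) F S"
  unfolding closed_in_def
proof (intro ballI impI)
  fix s assume s: "s \<in> F" "sum (r(i := 0)) UNIV \<le> cnt (r(i := 0)) S s"
  let ?D = "{k. k \<noteq> 0 \<and> \<bar>k\<bar> \<le> int (r i) \<and> s(i := s i + k) \<in> S}"
  have "r i \<le> card ?D"
    using nbrs[OF s(1)]
  proof
    assume a: "\<forall>k\<in>{1..int (r i)}. s(i := s i - k) \<in> S"
    have "uminus ` {1..int (r i)} \<subseteq> ?D"
    proof
      fix x assume "x \<in> uminus ` {1..int (r i)}"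
      then obtain k where "k \<in> {1..int (r i)}" "x = - k" by blast
      then show "x \<in> ?D" using bspec[OF a, of k] by auto
    qed
    then have "card (uminus ` {1..int (r i)}) \<le> card ?D" by (intro card_mono finite_steps)
    then show ?thesis by (simp add: card_image)
  next
    assume "\<forall>k\<in>{1..int (r i)}. s(i := s i + k) \<in> S"
    then have "{1..int (r i)} \<subseteq> ?D" by auto
    then have "card {1..int (r i)} \<le> card ?D" by (intro card_mono finite_steps)
    then show ?thesis by simp
  qed
  then have "sum r UNIV \<le> cnt r S s"
    using s(2) sum_upd_zero[of r i] cnt_remove[of r S s i] by linarith
  then show "s \<in> S" using S F s(1) by (auto intro: closed_inD)
qed

text \<open>On a line of weight \<open>r l\<close> the threshold is \<open>r l\<close> too, so that
  many consecutive sites spread in both directions, each new site seeing \<open>r l\<close> occupied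
  ones on the side of the run.\<close>

lemma line_filled:
  fixes r :: "'d::finite \<Rightarrow> nat"
  assumes r: "\<And>c. c \<noteq> l \<Longrightarrow> r c = 0"
    and S: "closed_in r (segment l x w) S" and run: "run l x w (r l) S"
  shows "segment l x w \<subseteq> S"
proof -
  obtain k where k: "k + r l \<le> w" "\<And>m. m < r l \<Longrightarrow> x(l := x l + int (k + m)) \<in> S"
    using run by (auto simp: run_def)
  have sum: "sum r UNIV = r l"
  proof -
    have "sum r UNIV = sum r {l}" using r by (intro sum.mono_neutral_right) auto
    then show ?thesis by simp
  qed
  have add: "x(l := x l + int n) \<in> S" if n: "n < w" and nb: "(\<forall>d\<in>{1..r l}. x(l := x l + int n + int d) \<in> S) \<or>
      (\<forall>d\<in>{1..r l}. x(l := x l + int n - int d) \<in> S)" for n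
  proof (rule closed_inD[OF S])
    let ?s = "x(l := x l + int n)"
    show "?s \<in> segment l x w" using n by (auto simp: segment_def)
    let ?D = "{k. k \<noteq> 0 \<and> \<bar>k\<bar> \<le> int (r l) \<and> ?s(l := ?s l + k) \<in> S}"
    have "r l \<le> card ?D" using nb
    proof
      assume a: "\<forall>d\<in>{1..r l}. x(l := x l + int n + int d) \<in> S"
      then have "int ` {1..r l} \<subseteq> ?D" by auto
      then have "card (int ` {1..r l}) \<le> card ?D" by (intro card_mono finite_steps)
      then show ?thesis by (simp add: card_image)
    next
      assume a: "\<forall>d\<in>{1..r l}. x(l := x l + int n - int d) \<in> S"
      then have "(\<lambda>d. - int d) ` {1..r l} \<subseteq> ?D" by auto
      then have "card ((\<lambda>d. - int d) ` {1..r l}) \<le> card ?D" by (intro card_mono finite_steps)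
      then show ?thesis by (simp add: card_image inj_on_def)
    qed
    also have "\<dots> \<le> cnt r S ?s" using cnt_remove[of r S ?s l] by linarith
    finally show "sum r UNIV \<le> cnt r S ?s" by (simp only: sum)
  qed
  have up: "x(l := x l + int n) \<in> S" if "k \<le> n" "n < w" for n
    using that
  proof (induction n rule: less_induct)
    case (less n)
    show ?case
    proof (cases "n < k + r l")
      case True
      then have "x(l := x l + int (k + (n - k))) \<in> S" using k(2)[of "n - k"] less.prems by simp
      moreover have "k + (n - k) = n" using less.prems by simp
      ultimately show ?thesis by (simp only:)
    next
      case False
      show ?thesis
      proof (rule add[OF less.prems(2)], rule disjI2, rule ballI)
        fix d assume d: "d \<in> {1..r l}"
        then have "x(l := x l + int (n - d)) \<in> S" using False less.prems by (intro less.IH) auto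
        moreover have "int (n - d) = int n - int d" using d False by simp
        ultimately show "x(l := x l + int n - int d) \<in> S" by (simp add: algebra_simps)
      qed
    qed
  qed
  have down: "x(l := x l + int (k - e)) \<in> S" if "e \<le> k" "k < w" for e
    using that
  proof (induction e rule: less_induct)
    case (less e)
    show ?case
    proof (cases "e = 0")
      case True
      then show ?thesis using up[OF le_refl less.prems(2)] by (simp only: diff_zero)
    next
      case False
      show ?thesis
      proof (rule add, use less.prems in simp, rule disjI1, rule ballI)
        fix d assume d: "d \<in> {1..r l}"
        have "x(l := x l + int (k - e + d)) \<in> S"
        proof (cases "d \<le> e")
          case True
          then have "x(l := x l + int (k - (e - d))) \<in> S" using less.prems False d by (intro less.IH) auto
          moreover have "k - (e - d) = k - e + d" using True less.prems by simp
          ultimately show ?thesis by (simp only:)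
        next
          case False
          then show ?thesis using d k(1) less.prems \<open>e \<noteq> 0\<close> by (intro up) auto
        qed
        then show "x(l := x l + int (k - e) + int d) \<in> S" by (simp add: algebra_simps)
      qed
    qed
  qed
  show ?thesis
  proof
    fix s assume "s \<in> segment l x w"
    then obtain m where m: "m < w" "s = x(l := x l + int m)" by (auto simp: segment_def)
    show "s \<in> S"
    proof (cases "k \<le> m")
      case True
      then show ?thesis using up[OF True m(1)] m(2) by (simp only:)
    next
      case False
      show ?thesis
      proof (cases "k < w")
        case kw: True
        have "k - (k - m) = m" using False by simp
        then show ?thesis using down[OF diff_le_self[of k m] kw] m(2) by (simp only:)
      next
        case False
        \<comment> \<open>A run that starts at or beyond the end is empty. Then the threshold is 0
          and every site joins.\<close>
        then have "r l = 0" using k(1) by simp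
        then show ?thesis using m by (intro closed_inD[OF S]) (auto simp: segment_def sum)
      qed
    qed
  qed
qed

text \<open>Induction on the number of missing layers. The corners \<open>lo0\<close> and
  \<open>hi0\<close> fix the original box while \<open>lo\<close> and \<open>hi\<close> move, so in
  the two face assumptions every intermediate box contains the original one; this is how faces are
  known to be wide enough.\<close>

lemma box_growth:
  fixes Lo Hi :: "'d::finite \<Rightarrow> int"
  assumes "ibox lo hi \<subseteq> S" "\<And>c. Lo c \<le> lo c" "\<And>c. hi c \<le> Hi c"
    and ord: "\<And>c. lo c \<le> lo0 c" "\<And>c. hi0 c \<le> hi c"
    and down: "\<And>lo hi i. ibox lo hi \<subseteq> S \<Longrightarrow> (\<And>c. Lo c \<le> lo c \<and> lo c \<le> lo0 c \<and> hi0 c \<le> hi c \<and> hi c \<le> Hi c) \<Longrightarrow>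
      Lo i < lo i \<Longrightarrow> ibox (lo(i := lo i - 1)) (hi(i := lo i - 1)) \<subseteq> S"
    and up: "\<And>lo hi i. ibox lo hi \<subseteq> S \<Longrightarrow> (\<And>c. Lo c \<le> lo c \<and> lo c \<le> lo0 c \<and> hi0 c \<le> hi c \<and> hi c \<le> Hi c) \<Longrightarrow>
      hi i < Hi i \<Longrightarrow> ibox (lo(i := hi i + 1)) (hi(i := hi i + 1)) \<subseteq> S"
  shows "ibox Lo Hi \<subseteq> S"
  using assms(1-5)
proof (induction "\<Sum>c\<in>UNIV. nat (lo c - Lo c) + nat (Hi c - hi c)" arbitrary: lo hi rule: less_induct)
  case less
  have rng: "Lo c \<le> lo c \<and> lo c \<le> lo0 c \<and> hi0 c \<le> hi c \<and> hi c \<le> Hi c" for c using less.prems by blast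
  consider "\<And>c. lo c = Lo c \<and> hi c = Hi c" | i where "Lo i < lo i" | i where "hi i < Hi i"
    using rng by (metis order_le_less)
  then show ?case
  proof cases
    case 1
    then have "lo = Lo" "hi = Hi" by auto
    then show ?thesis using less.prems by simp
  next
    case (2 i)
    let ?lo = "lo(i := lo i - 1)"
    have "ibox ?lo hi \<subseteq> ibox lo hi \<union> ibox (lo(i := lo i - 1)) (hi(i := lo i - 1))"
    proof
      fix s assume "s \<in> ibox ?lo hi"
      then have s: "?lo c \<le> s c" "s c \<le> hi c" for c by (auto simp: ibox_def)
      show "s \<in> ibox lo hi \<union> ibox (lo(i := lo i - 1)) (hi(i := lo i - 1))"
      proof (cases "lo i \<le> s i")
        case True
        have "lo c \<le> s c" for c using s(1)[of c] True by (cases "c = i") auto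
        then show ?thesis using s(2) by (auto simp: ibox_def)
      next
        case False
        have "s c \<le> (hi(i := lo i - 1)) c" for c using s(2)[of c] False by (cases "c = i") auto
        then show ?thesis using s(1) by (auto simp: ibox_def)
      qed
    qed
    then have "ibox ?lo hi \<subseteq> S" using less.prems(1) down[OF less.prems(1) rng 2] by blast
    moreover have "(\<Sum>c\<in>UNIV. nat (?lo c - Lo c) + nat (Hi c - hi c)) < (\<Sum>c\<in>UNIV. nat (lo c - Lo c) + nat (Hi c - hi c))"
      using 2 by (intro sum_strict_mono_ex1) (auto intro!: exI[of _ i])
    moreover have "Lo c \<le> ?lo c" for c using rng[of c] 2 by (cases "c = i") auto
    moreover have "?lo c \<le> lo0 c" for c using rng[of c] by (cases "c = i") auto
    ultimately show ?thesis using rng by (intro less.hyps) auto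
  next
    case (3 i)
    let ?hi = "hi(i := hi i + 1)"
    have "ibox lo ?hi \<subseteq> ibox lo hi \<union> ibox (lo(i := hi i + 1)) (hi(i := hi i + 1))"
    proof
      fix s assume "s \<in> ibox lo ?hi"
      then have s: "lo c \<le> s c" "s c \<le> ?hi c" for c by (auto simp: ibox_def)
      show "s \<in> ibox lo hi \<union> ibox (lo(i := hi i + 1)) (hi(i := hi i + 1))"
      proof (cases "s i \<le> hi i")
        case True
        have "s c \<le> hi c" for c using s(2)[of c] True by (cases "c = i") auto
        then show ?thesis using s(1) by (auto simp: ibox_def)
      next
        case False
        have "(lo(i := hi i + 1)) c \<le> s c" for c using s(1)[of c] False by (cases "c = i") auto
        then show ?thesis using s(2) by (auto simp: ibox_def)
      qed
    qed
    then have "ibox lo ?hi \<subseteq> S" using less.prems(1) up[OF less.prems(1) rng 3] by blast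
    moreover have "(\<Sum>c\<in>UNIV. nat (lo c - Lo c) + nat (Hi c - ?hi c)) < (\<Sum>c\<in>UNIV. nat (lo c - Lo c) + nat (Hi c - hi c))"
      using 3 by (intro sum_strict_mono_ex1) (auto intro!: exI[of _ i])
    moreover have "?hi c \<le> Hi c" for c using rng[of c] 3 by (cases "c = i") auto
    moreover have "hi0 c \<le> ?hi c" for c using rng[of c] by (cases "c = i") auto
    ultimately show ?thesis using rng by (intro less.hyps) auto
  qed
qed

lemma face_helped:
  fixes r :: "'d::finite \<Rightarrow> nat"
  assumes S: "closed_in r V S" and B: "ibox lo hi \<subseteq> S" and w: "lo i + int (r i) \<le> hi i + 1"
    and z: "z = hi i + 1 \<or> z = lo i - 1" and F: "F \<subseteq> ibox (lo(i := z)) (hi(i := z))" "F \<subseteq> V"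
  shows "closed_in (r(i := 0)) F S"
proof (rule closed_in_helped[OF S F(2)])
  fix s assume "s \<in> F"
  then have "s \<in> ibox (lo(i := z)) (hi(i := z))" using F(1) by blast
  then have "(lo(i := z)) c \<le> s c \<and> s c \<le> (hi(i := z)) c" for c unfolding ibox_def by blast
  then have s: "s i = z" "\<And>c. c \<noteq> i \<Longrightarrow> lo c \<le> s c \<and> s c \<le> hi c"
    by (metis fun_upd_same order_antisym, metis fun_upd_other)
  have mem: "s(i := y) \<in> S" if "lo i \<le> y" "y \<le> hi i" for y
    using B s(2) that by (force simp: ibox_def)
  show "(\<forall>k\<in>{1..int (r i)}. s(i := s i - k) \<in> S) \<or> (\<forall>k\<in>{1..int (r i)}. s(i := s i + k) \<in> S)"
    using z
  proof
    assume "z = hi i + 1"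
    then show ?thesis using w s(1) by (intro disjI1 ballI mem) auto
  next
    assume "z = lo i - 1"
    then show ?thesis using w s(1) by (intro disjI2 ballI mem) auto
  qed
qed

text \<open>The side lengths are numbers of sites, so the upper corner has a \<open>- 1\<close>.\<close>

definition rect :: "'d \<Rightarrow> 'd \<Rightarrow> ('d \<Rightarrow> int) \<Rightarrow> nat \<Rightarrow> nat \<Rightarrow> ('d \<Rightarrow> int) set" where
  "rect j l x w h = ibox x (x(j := x j + int w - 1, l := x l + int h - 1))"

lemma rect_swap: "j \<noteq> l \<Longrightarrow> rect j l x w h = rect l j x h w"
  unfolding rect_def by (simp add: fun_upd_twist)

lemma finite_rect [simp]: "finite (rect j l x w h :: ('d::finite \<Rightarrow> int) set)"
  by (simp add: rect_def)

lemma mem_rect: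
  assumes "j \<noteq> l"
  shows "s \<in> rect j l x w h \<longleftrightarrow> x j \<le> s j \<and> s j < x j + int w \<and> x l \<le> s l \<and> s l < x l + int h \<and>
    (\<forall>c. c \<noteq> j \<longrightarrow> c \<noteq> l \<longrightarrow> s c = x c)"
proof
  assume "s \<in> rect j l x w h"
  then have a: "x c \<le> s c" "s c \<le> (x(j := x j + int w - 1, l := x l + int h - 1)) c" for c
    by (simp_all add: rect_def ibox_def)
  have "s c = x c" if "c \<noteq> j" "c \<noteq> l" for c using a[of c] that by simp
  then show "x j \<le> s j \<and> s j < x j + int w \<and> x l \<le> s l \<and> s l < x l + int h \<and> (\<forall>c. c \<noteq> j \<longrightarrow> c \<noteq> l \<longrightarrow> s c = x c)"
    using a[of j] a[of l] assms by simp
next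
  assume a: "x j \<le> s j \<and> s j < x j + int w \<and> x l \<le> s l \<and> s l < x l + int h \<and> (\<forall>c. c \<noteq> j \<longrightarrow> c \<noteq> l \<longrightarrow> s c = x c)"
  have "x c \<le> s c \<and> s c \<le> (x(j := x j + int w - 1, l := x l + int h - 1)) c" for c
    using a assms by (cases "c = j"; cases "c = l") auto
  then show "s \<in> rect j l x w h" by (simp add: rect_def ibox_def)
qed

lemma segment_eq_rect: "j \<noteq> l \<Longrightarrow> segment j x w = rect j l x w 1"
proof (rule set_eqI)
  fix s assume jl: "j \<noteq> l"
  show "s \<in> segment j x w \<longleftrightarrow> s \<in> rect j l x w 1"
  proof
    assume "s \<in> segment j x w"
    then show "s \<in> rect j l x w 1" unfolding mem_rect[OF jl] using jl by (auto simp: segment_def)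
  next
    assume s: "s \<in> rect j l x w 1"
    then have "s = x(j := x j + int (nat (s j - x j)))" "nat (s j - x j) < w"
      unfolding mem_rect[OF jl] by (auto simp: fun_eq_iff)
    then show "s \<in> segment j x w" unfolding segment_def by blast
  qed
qed

text \<open>The full rectangle is at least \<open>r l\<close> rows high and lends \<open>r l\<close>
  to the next row, which then needs only a run of \<open>r j\<close> sites.\<close>

lemma fills_rect_Suc:
  fixes r :: "'d::finite \<Rightarrow> nat"
  assumes jl: "j \<noteq> l" and r: "\<And>c. c \<noteq> j \<Longrightarrow> c \<noteq> l \<Longrightarrow> r c = 0" and h: "r l \<le> h"
    and fl: "fills r (rect j l x w h) A" and rn: "run j (x(l := x l + int h)) w (r j) A"
  shows "fills r (rect j l x w (Suc h)) A"
  unfolding fills_def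
proof (intro allI impI)
  fix S assume S: "closed_in r (rect j l x w (Suc h)) S" "A \<inter> rect j l x w (Suc h) \<subseteq> S"
  let ?y = "x(l := x l + int h)"
  have sub: "rect j l x w h \<subseteq> rect j l x w (Suc h)" by (auto simp: mem_rect[OF jl])
  have R: "rect j l x w h \<subseteq> S"
    using fillsD[OF fl closed_in_subset[OF S(1) sub]] S(2) sub by blast
  have seg: "segment j ?y w \<subseteq> rect j l x w (Suc h)"
    using jl by (auto simp: segment_def mem_rect[OF jl])
  have "closed_in (r(l := 0)) (segment j ?y w) S"
  proof (rule closed_in_helped[OF S(1) seg], rule disjI1, rule ballI)
    fix s k assume "s \<in> segment j ?y w" "k \<in> {1..int (r l)}"
    then show "s(l := s l - k) \<in> S" using jl h by (intro subsetD[OF R]) (auto simp: segment_def mem_rect[OF jl])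
  qed
  moreover have "run j ?y w ((r(l := 0)) j) S"
  proof -
    obtain k where k: "k + r j \<le> w" "\<And>m. m < r j \<Longrightarrow> ?y(j := ?y j + int (k + m)) \<in> A" using rn by (auto simp: run_def)
    have "?y(j := ?y j + int (k + m)) \<in> S" if "m < r j" for m
    proof -
      have "?y(j := ?y j + int (k + m)) \<in> segment j ?y w" unfolding segment_def using that k(1) by fastforce
      then show ?thesis using k(2)[OF that] seg S(2) by blast
    qed
    then show ?thesis using k(1) jl unfolding run_def by auto
  qed
  ultimately have "segment j ?y w \<subseteq> S" using r by (intro line_filled[of j "r(l := 0)"]) auto
  moreover have "rect j l x w (Suc h) \<subseteq> rect j l x w h \<union> segment j ?y w"
  proof
    fix s assume s: "s \<in> rect j l x w (Suc h)"
    show "s \<in> rect j l x w h \<union> segment j ?y w"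
    proof (cases "s l < x l + int h")
      case True
      then show ?thesis using s by (auto simp: mem_rect[OF jl])
    next
      case False
      then have "s l = x l + int h" using s by (auto simp: mem_rect[OF jl])
      then have "s \<in> rect j l ?y w 1" using s jl by (auto simp: mem_rect[OF jl])
      then show ?thesis using segment_eq_rect[OF jl, of ?y w] by blast
    qed
  qed
  ultimately show "rect j l x w (Suc h) \<subseteq> S" using R by blast
qed

lemma run_in_box:
  assumes "run l x s n A" "n' \<le> n" "segment l x s \<subseteq> segment l y w" "A \<inter> segment l y w \<subseteq> S" "x = y"
  shows "run l y w n' S"
proof -
  obtain k where k: "k + n \<le> s" "\<And>m. m < n \<Longrightarrow> x(l := x l + int (k + m)) \<in> A" using assms(1) by (auto simp: run_def)
  show ?thesis
  proof (cases "n' = 0")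
    case False
    have mem: "x(l := x l + int (k + m)) \<in> segment l x s" if "m < n" for m
      using that k(1) unfolding segment_def by (intro CollectI exI[of _ "k + m"]) auto
    have "y(l := y l + int (k + m)) \<in> S" if "m < n'" for m
      using k(2)[of m] mem[of m] that assms(2-5) by auto
    moreover have "k + n' \<le> w"
    proof -
      have "x(l := x l + int (k + (n' - 1))) \<in> segment l y w" using mem[of "n' - 1"] False assms(2,3) by auto
      then obtain m where "m < w" "x(l := x l + int (k + (n' - 1))) = y(l := y l + int m)" by (auto simp: segment_def)
      then have "int (k + (n' - 1)) = int m" using assms(5) by (metis add_left_cancel fun_upd_same)
      then show ?thesis using \<open>m < w\<close> False by linarith
    qed
    ultimately show ?thesis unfolding run_def by blast
  qed (auto simp: run_def)
qed

text \<open>The growing rectangle always contains the starting square, so each side has length at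
  least \<open>s\<close> and contains a run of \<open>v\<close> sites, enough for either
  weight.\<close>

lemma fills_rect_from_square:
  fixes r :: "'d::finite \<Rightarrow> nat"
  assumes jl: "j \<noteq> l" and r: "\<And>c. c \<noteq> j \<Longrightarrow> c \<noteq> l \<Longrightarrow> r c = 0" and v: "r j \<le> v" "r l \<le> v" "v \<le> s"
    and Q: "fills r (rect j l y s s) A" "rect j l y s s \<subseteq> rect j l x w h" and s: "0 < s"
    and runs: "\<And>z c. c \<in> {j, l} \<Longrightarrow> segment c z s \<subseteq> rect j l x w h \<Longrightarrow> run c z s v A"
  shows "fills r (rect j l x w h) A"
  unfolding fills_def
proof (intro allI impI)
  let ?F = "rect j l x w h"
  let ?Hi = "x(j := x j + int w - 1, l := x l + int h - 1)" and ?hi0 = "y(j := y j + int s - 1, l := y l + int s - 1)"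
  fix S assume S: "closed_in r ?F S" "A \<inter> ?F \<subseteq> S"
  have QS: "rect j l y s s \<subseteq> S" using fillsD[OF Q(1) closed_in_subset[OF S(1) Q(2)]] S(2) Q(2) by blast
  have "y \<in> rect j l y s s" "?hi0 \<in> rect j l y s s" using s jl by (simp_all add: mem_rect[OF jl])
  then have yF: "y \<in> ?F" and hiF: "?hi0 \<in> ?F" using Q(2) by blast+
  have face: "ibox (lo(i := z)) (hi(i := z)) \<subseteq> S"
    if B: "ibox lo hi \<subseteq> S" and rng: "\<And>c. x c \<le> lo c \<and> lo c \<le> y c \<and> ?hi0 c \<le> hi c \<and> hi c \<le> ?Hi c"
      and z: "z = hi i + 1 \<or> z = lo i - 1" "x i \<le> z" "z \<le> ?Hi i" for lo hi i z
  proof -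
    have ijl: "i = j \<or> i = l"
    proof (rule ccontr)
      assume "\<not> ?thesis"
      then have "lo i = x i" "hi i = x i" "?Hi i = x i" using rng[of i] yF by (auto simp: mem_rect[OF jl])
      then show False using z by auto
    qed
    \<comment> \<open>\<open>i\<close> is normal to the face that is added, and \<open>c\<close> is
      the axis along it.\<close>
    define c where "c = (if i = j then l else j)"
    have c: "c \<noteq> i" "c \<in> {j, l}" "i \<in> {j, l}" "{i, c} = {j, l}" using ijl jl by (auto simp: c_def)
    have w: "int s \<le> hi e - lo e + 1" if "e \<in> {j, l}" for e
      using rng[of e] that jl by auto
    define x0 where "x0 = lo(i := z)"
    define n where "n = nat (hi c - lo c + 1)"
    have n: "int n = hi c - lo c + 1" "s \<le> n" using w[OF c(2)] s by (auto simp: n_def)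
    have face_eq: "ibox (lo(i := z)) (hi(i := z)) = segment c x0 n"
    proof (rule set_eqI)
      fix u
      have oth: "lo e = x e \<and> hi e = x e" if "e \<notin> {j, l}" for e using rng[of e] yF that by (auto simp: mem_rect[OF jl])
      show "u \<in> ibox (lo(i := z)) (hi(i := z)) \<longleftrightarrow> u \<in> segment c x0 n"
      proof
        assume "u \<in> ibox (lo(i := z)) (hi(i := z))"
        then have u: "(lo(i := z)) e \<le> u e" "u e \<le> (hi(i := z)) e" for e by (auto simp: ibox_def)
        have "u e = (x0(c := x0 c + int (nat (u c - lo c)))) e" for e
        proof -
          consider "e = c" | "e = i" | "e \<notin> {j, l}" using c(4) by blast
          then show ?thesis
          proof cases
            case 1
            then show ?thesis using u[of c] c(1) by (simp add: x0_def)
          next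
            case 2
            then show ?thesis using u[of i] c(1) by (simp add: x0_def)
          next
            case 3
            then have "e \<noteq> c" "e \<noteq> i" using c(2,3) by auto
            then show ?thesis using u[of e] oth[OF 3] by (simp add: x0_def)
          qed
        qed
        moreover have "nat (u c - lo c) < n" using u[of c] c(1) n(1) by auto
        ultimately show "u \<in> segment c x0 n" unfolding segment_def by blast
      next
        assume "u \<in> segment c x0 n"
        then obtain m where m: "m < n" "u = x0(c := x0 c + int m)" by (auto simp: segment_def)
        have "(lo(i := z)) e \<le> u e \<and> u e \<le> (hi(i := z)) e" for e
        proof -
          consider "e = c" | "e = i" | "e \<notin> {j, l}" using c(4) by blast
          then show ?thesis
          proof cases
            case 1
            then show ?thesis using m n(1) c(1) by (simp add: x0_def)
          next
            case 2
            then show ?thesis using m c(1) by (simp add: x0_def)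
          next
            case 3
            then have "e \<noteq> c" "e \<noteq> i" using c(2,3) by auto
            then show ?thesis using m oth[OF 3] by (simp add: x0_def)
          qed
        qed
        then show "u \<in> ibox (lo(i := z)) (hi(i := z))" by (auto simp: ibox_def)
      qed
    qed
    have faceF: "ibox (lo(i := z)) (hi(i := z)) \<subseteq> ?F"
    proof
      fix u assume "u \<in> ibox (lo(i := z)) (hi(i := z))"
      then have u: "(lo(i := z)) e \<le> u e" "u e \<le> (hi(i := z)) e" for e by (auto simp: ibox_def)
      have "x e \<le> u e \<and> u e \<le> ?Hi e" for e using u[of e] rng[of e] z by (cases "e = i") auto
      then show "u \<in> ?F" by (simp add: rect_def ibox_def)
    qed
    have "lo i + int (r i) \<le> hi i + 1" using w[OF c(3)] v ijl by auto
    from face_helped[OF S(1) B this z(1) subset_refl faceF]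
    have cl: "closed_in (r(i := 0)) (segment c x0 n) S" unfolding face_eq .
    have segs: "segment c x0 s \<subseteq> segment c x0 n" unfolding segment_def using n(2) by auto
    then have "run c x0 s v A" using c(2) faceF face_eq by (intro runs) auto
    moreover have "(r(i := 0)) c \<le> v" using v c by (auto simp: c_def)
    moreover have "A \<inter> segment c x0 n \<subseteq> S" using S(2) faceF face_eq by blast
    ultimately have "run c x0 n ((r(i := 0)) c) S" by (rule run_in_box[OF _ _ segs _ refl])
    then have "segment c x0 n \<subseteq> S" using cl r c by (intro line_filled[of c "r(i := 0)"]) auto
    then show ?thesis using face_eq by simp
  qed
  have "ibox x ?Hi \<subseteq> S"
  proof (rule box_growth[of y ?hi0 S x ?Hi y ?hi0])
    show "ibox y ?hi0 \<subseteq> S" using QS by (simp add: rect_def)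
    show "x c \<le> y c" for c using yF by (simp add: rect_def ibox_def)
    show "?hi0 c \<le> ?Hi c" for c using hiF by (simp add: rect_def ibox_def)
  next
    fix lo hi i
    assume a: "ibox lo hi \<subseteq> S" "\<And>c. x c \<le> lo c \<and> lo c \<le> y c \<and> ?hi0 c \<le> hi c \<and> hi c \<le> ?Hi c" "x i < lo i"
    have "lo i - 1 \<le> ?Hi i"
    proof -
      have "y i \<le> ?Hi i" using yF by (simp add: rect_def ibox_def)
      then show ?thesis using a(2)[of i] by linarith
    qed
    then show "ibox (lo(i := lo i - 1)) (hi(i := lo i - 1)) \<subseteq> S"
      using a(3) by (intro face[OF a(1) a(2)]) auto
  next
    fix lo hi i
    assume a: "ibox lo hi \<subseteq> S" "\<And>c. x c \<le> lo c \<and> lo c \<le> y c \<and> ?hi0 c \<le> hi c \<and> hi c \<le> ?Hi c" "hi i < ?Hi i"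
    have "x i \<le> hi i + 1"
    proof -
      have "x i \<le> ?hi0 i" using hiF by (simp add: rect_def ibox_def)
      then show ?thesis using a(2)[of i] by linarith
    qed
    then show "ibox (lo(i := hi i + 1)) (hi(i := hi i + 1)) \<subseteq> S"
      using a(3) by (intro face[OF a(1) a(2)]) auto
  qed auto
  then show "?F \<subseteq> S" by (simp add: rect_def)
qed

section \<open>Upper bound: probabilities of filling\<close>

lemma run_Int:
  "run c x w n (A \<inter> segment c x w) = run c x w n A"
proof -
  have "x(c := x c + int (k + m)) \<in> segment c x w" if "k + n \<le> w" "m < n" for k m
    using that unfolding segment_def by (intro CollectI exI[of _ "k + m"]) auto
  then show ?thesis unfolding run_def by blast
qed

text \<open>The segment offers \<open>w div n\<close> disjoint, hence independent, places for a run.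
  For \<open>n = 0\<close> the exponent is 0 and the bound is 1.\<close>

lemma run_fail:
  fixes V :: "('d \<Rightarrow> int) set"
  assumes V: "finite V" "0 \<le> p" "p \<le> 1" and seg: "segment c x w \<subseteq> V"
  shows "Pr V p (\<lambda>A. \<not> run c x w n A) \<le> (1 - p ^ n) ^ (w div n)"
proof -
  define B where "B q = (\<lambda>m. x(c := x c + int (q * n + m))) ` {..<n}" for q
  have inj: "inj_on (\<lambda>m. x(c := x c + int (q * n + m))) {..<n}" for q
    by (auto simp: inj_on_def dest!: fun_cong[of _ _ c])
  have cardB: "card (B q) = n" for q unfolding B_def by (subst card_image[OF inj]) simp
  have BV: "B q \<subseteq> V" if "q < w div n" for q
  proof -
    have "(q + 1) * n \<le> w div n * n" using that by (intro mult_right_mono) auto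
    also have "\<dots> \<le> w" by simp
    finally have "q * n + m < w" if "m < n" for m using that by simp
    then have "B q \<subseteq> segment c x w" unfolding B_def segment_def by blast
    with seg show ?thesis by blast
  qed
  have "Pr V p (\<lambda>A. \<not> run c x w n A) \<le> Pr V p (\<lambda>A. \<forall>q\<in>{..<w div n}. \<not> B q \<subseteq> A \<inter> B q)"
  proof (rule Pr_mono[OF V], rule ballI)
    fix A q assume nr: "\<not> run c x w n A" and q: "q \<in> {..<w div n}"
    show "\<not> B q \<subseteq> A \<inter> B q"
    proof
      assume "B q \<subseteq> A \<inter> B q"
      then have "\<forall>m<n. x(c := x c + int (q * n + m)) \<in> A" by (auto simp: B_def)
      moreover have "q * n + n \<le> w"
      proof -
        have "(q + 1) * n \<le> w div n * n" using q by (intro mult_right_mono) auto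
        also have "\<dots> \<le> w" by simp
        finally show ?thesis by simp
      qed
      ultimately show False using nr unfolding run_def by blast
    qed
  qed
  also have "\<dots> = (\<Prod>q\<in>{..<w div n}. Pr V p (\<lambda>A. \<not> B q \<subseteq> A \<inter> B q))"
  proof (rule Pr_indep[OF V(1), where E = "\<lambda>q A. \<not> B q \<subseteq> A"])
    show "disjoint_family_on B {..<w div n}" unfolding disjoint_family_on_def
    proof (intro ballI impI)
      fix q q' :: nat assume ne: "q \<noteq> q'"
      have False if "m < n" "m' < n" "x(c := x c + int (q * n + m)) = x(c := x c + int (q' * n + m'))" for m m'
      proof -
        have "q * n + m = q' * n + m'" using fun_cong[OF that(3), of c]
          by (simp only: fun_upd_same add_left_cancel of_nat_eq_iff)
        then have "(q * n + m) div n = (q' * n + m') div n" by simp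
        then show False using that(1,2) ne by simp
      qed
      then show "B q \<inter> B q' = {}" by (auto simp: B_def)
    qed
  qed (use BV in auto)
  also have "\<dots> = (\<Prod>q\<in>{..<w div n}. 1 - p ^ n)"
  proof (rule prod.cong[OF refl])
    fix q assume "q \<in> {..<w div n}"
    then have "Pr V p (\<lambda>A. B q \<subseteq> A) = p ^ n" using Pr_superset[OF V(1) BV] cardB by simp
    moreover have "Pr V p (\<lambda>A. \<not> B q \<subseteq> A \<inter> B q) = Pr V p (\<lambda>A. \<not> B q \<subseteq> A)" by (rule Pr_cong) auto
    ultimately show "Pr V p (\<lambda>A. \<not> B q \<subseteq> A \<inter> B q) = 1 - p ^ n" by (simp add: Pr_Not[OF V(1)])
  qed
  finally show ?thesis by simp
qed

lemma rect_mono: "j \<noteq> l \<Longrightarrow> w \<le> w' \<Longrightarrow> h \<le> h' \<Longrightarrow> rect j l x w h \<subseteq> rect j l x w' h'"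
  by (auto simp: mem_rect)

lemma Pr_fills_Suc:
  fixes r :: "'d::finite \<Rightarrow> nat"
  assumes V: "finite V" "0 \<le> p" "p \<le> 1" and jl: "j \<noteq> l" and r: "\<And>c. c \<noteq> j \<Longrightarrow> c \<noteq> l \<Longrightarrow> r c = 0" and h: "r l \<le> h"
    and sub: "rect j l x w (Suc h) \<subseteq> V"
  shows "Pr V p (fills r (rect j l x w h)) * (1 - (1 - p ^ r j) ^ (w div r j)) \<le> Pr V p (fills r (rect j l x w (Suc h)))"
proof -
  let ?y = "x(l := x l + int h)"
  let ?R = "rect j l x w h" and ?s = "segment j ?y w"
  have s: "?s \<subseteq> V" "?R \<inter> ?s = {}" and R: "?R \<subseteq> V"
    using sub jl by (auto simp: segment_def mem_rect[OF jl] subset_iff)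
  have "Pr V p (\<lambda>A. \<not> run j ?y w (r j) A) \<le> (1 - p ^ r j) ^ (w div r j)" by (rule run_fail[OF V s(1)])
  then have "1 - (1 - p ^ r j) ^ (w div r j) \<le> Pr V p (run j ?y w (r j))" by (simp add: Pr_Not[OF V(1)])
  then have "Pr V p (fills r ?R) * (1 - (1 - p ^ r j) ^ (w div r j)) \<le> Pr V p (fills r ?R) * Pr V p (run j ?y w (r j))"
    by (intro mult_left_mono Pr_nonneg V)
  also have "\<dots> = Pr V p (\<lambda>A. fills r ?R (A \<inter> ?R) \<and> run j ?y w (r j) (A \<inter> ?s))"
    by (subst Pr_indep2[OF V(1) R s]) (simp add: fills_Int run_Int)
  also have "\<dots> \<le> Pr V p (fills r (rect j l x w (Suc h)))"
  proof (rule Pr_mono[OF V])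
    fix A assume "fills r ?R (A \<inter> ?R) \<and> run j ?y w (r j) (A \<inter> ?s)"
    then show "fills r (rect j l x w (Suc h)) A"
      using r h by (intro fills_rect_Suc[OF jl]) (auto simp: fills_Int run_Int)
  qed
  finally show ?thesis .
qed

lemma Pr_fills_grow:
  fixes r :: "'d::finite \<Rightarrow> nat"
  assumes V: "finite V" "0 \<le> p" "p \<le> 1" and jl: "j \<noteq> l" and r: "\<And>c. c \<noteq> j \<Longrightarrow> c \<noteq> l \<Longrightarrow> r c = 0" and h: "r l \<le> h" "h \<le> h'"
    and sub: "rect j l x w h' \<subseteq> V" and q: "0 \<le> q" "q \<le> 1 - (1 - p ^ r j) ^ (w div r j)"
  shows "Pr V p (fills r (rect j l x w h)) * q ^ (h' - h) \<le> Pr V p (fills r (rect j l x w h'))"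
  using h(2) sub
proof (induction h' rule: dec_induct)
  case base
  then show ?case by simp
next
  case (step n)
  have sub: "rect j l x w n \<subseteq> V" using step.prems rect_mono[OF jl, of w w n "Suc n" x] by auto
  have "Pr V p (fills r (rect j l x w h)) * q ^ (Suc n - h) = (Pr V p (fills r (rect j l x w h)) * q ^ (n - h)) * q"
    using step.hyps(1) by (simp add: Suc_diff_le)
  also have "\<dots> \<le> Pr V p (fills r (rect j l x w n)) * (1 - (1 - p ^ r j) ^ (w div r j))"
    using step.IH[OF sub] q Pr_nonneg[OF V(2,3)] by (intro mult_mono) auto
  also have "\<dots> \<le> Pr V p (fills r (rect j l x w (Suc n)))"
    using step.hyps(1) h(1) step.prems by (intro Pr_fills_Suc[OF V jl r]) auto
  finally show ?case .
qed

text \<open>Replaces a weight by a common upper bound \<open>v\<close>, so that squares can be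
  measured in multiples of \<open>v\<close> and treated alike in both directions.\<close>

lemma run_rate_mono:
  assumes "0 \<le> (p::real)" "p \<le> 1" "n \<le> v" "0 < n" "k * v \<le> w"
  shows "1 - (1 - p ^ v) ^ k \<le> 1 - (1 - p ^ n) ^ (w div n)"
proof -
  have "k * n \<le> w" using assms(3,5) by (meson mult_le_mono2 order_trans)
  then have "k \<le> w div n" using assms(4) by (simp add: less_eq_div_iff_mult_less_eq)
  moreover have pn: "0 \<le> p ^ n" "p ^ n \<le> 1" using assms by (auto simp: power_le_one)
  ultimately have "(1 - p ^ n) ^ (w div n) \<le> (1 - p ^ n) ^ k" by (intro power_decreasing) auto
  also have "\<dots> \<le> (1 - p ^ v) ^ k"
    using assms pn by (intro power_mono) (auto intro: power_decreasing)
  finally show ?thesis by simp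
qed

definition two_axes :: "('d::finite \<Rightarrow> nat) \<Rightarrow> 'd \<Rightarrow> 'd \<Rightarrow> nat \<Rightarrow> bool" where
  "two_axes r j l v \<longleftrightarrow> j \<noteq> l \<and> (\<forall>c. c \<noteq> j \<longrightarrow> c \<noteq> l \<longrightarrow> r c = 0) \<and> 0 < r j \<and> 0 < r l \<and> r j \<le> v \<and> r l \<le> v"

text \<open>First \<open>v\<close> rows are added, then \<open>v\<close> columns; each new line has
  at least \<open>k\<close> independent places for a run.\<close>

lemma Pr_fills_square_step:
  fixes r :: "'d::finite \<Rightarrow> nat"
  assumes V: "finite V" "0 \<le> p" "p \<le> 1" and ax: "two_axes r j l v" and k: "1 \<le> k"
    and sub: "rect j l x (Suc k * v) (Suc k * v) \<subseteq> V"
  shows "Pr V p (fills r (rect j l x (k * v) (k * v))) * (1 - (1 - p ^ v) ^ k) ^ (2 * v)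
    \<le> Pr V p (fills r (rect j l x (Suc k * v) (Suc k * v)))"
proof -
  let ?q = "1 - (1 - p ^ v) ^ k"
  have jl: "j \<noteq> l" and r: "c \<noteq> j \<Longrightarrow> c \<noteq> l \<Longrightarrow> r c = 0" and rv: "0 < r j" "0 < r l" "r j \<le> v" "r l \<le> v" for c
    using ax by (auto simp: two_axes_def)
  have q0: "0 \<le> ?q" using V by (simp add: power_le_one)
  have "v \<le> k * v" using k by simp
  then have vk: "r j \<le> k * v" "r l \<le> k * v" using rv order_trans by blast+
  have sub1: "rect j l x (k * v) (Suc k * v) \<subseteq> V"
    using rect_mono[OF jl, of "k * v" "Suc k * v" "Suc k * v" "Suc k * v" x] sub by auto
  have "Pr V p (fills r (rect j l x (k * v) (k * v))) * ?q ^ (Suc k * v - k * v) \<le> Pr V p (fills r (rect j l x (k * v) (Suc k * v)))"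
    using rv vk by (intro Pr_fills_grow[OF V jl r _ _ sub1 q0] run_rate_mono V) auto
  then have 1: "Pr V p (fills r (rect j l x (k * v) (k * v))) * ?q ^ v \<le> Pr V p (fills r (rect j l x (k * v) (Suc k * v)))" by simp
  have "Pr V p (fills r (rect l j x (Suc k * v) (k * v))) * ?q ^ (Suc k * v - k * v) \<le> Pr V p (fills r (rect l j x (Suc k * v) (Suc k * v)))"
    using rv vk r sub by (intro Pr_fills_grow[OF V jl[symmetric] _ _ _ _ q0] run_rate_mono V) (auto simp: rect_swap[OF jl[symmetric]])
  then have 2: "Pr V p (fills r (rect j l x (k * v) (Suc k * v))) * ?q ^ v \<le> Pr V p (fills r (rect j l x (Suc k * v) (Suc k * v)))"
    by (simp add: rect_swap[OF jl])
  have "Pr V p (fills r (rect j l x (k * v) (k * v))) * ?q ^ (2 * v) = (Pr V p (fills r (rect j l x (k * v) (k * v))) * ?q ^ v) * ?q ^ v"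
    by (simp add: mult_2 power_add)
  also have "\<dots> \<le> Pr V p (fills r (rect j l x (k * v) (Suc k * v))) * ?q ^ v" using 1 q0 by (intro mult_right_mono) auto
  also note 2
  finally show ?thesis .
qed

lemma Pr_fills_square_grow:
  fixes r :: "'d::finite \<Rightarrow> nat"
  assumes V: "finite V" "0 \<le> p" "p \<le> 1" and ax: "two_axes r j l v" and k: "1 \<le> k" "k \<le> k'"
    and sub: "rect j l x (k' * v) (k' * v) \<subseteq> V"
  shows "Pr V p (fills r (rect j l x (k * v) (k * v))) * (\<Prod>m\<in>{k..<k'}. (1 - (1 - p ^ v) ^ m)) ^ (2 * v)
    \<le> Pr V p (fills r (rect j l x (k' * v) (k' * v)))"
  using k(2) sub
proof (induction k' rule: dec_induct)
  case base
  then show ?case by simp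
next
  case (step n)
  have jl: "j \<noteq> l" using ax by (simp add: two_axes_def)
  have sub: "rect j l x (n * v) (n * v) \<subseteq> V"
    using rect_mono[OF jl, of "n * v" "Suc n * v" "n * v" "Suc n * v" x] step.prems by auto
  have q0: "0 \<le> 1 - (1 - p ^ v) ^ n" using V by (simp add: power_le_one)
  have "Pr V p (fills r (rect j l x (k * v) (k * v))) * (\<Prod>m\<in>{k..<Suc n}. (1 - (1 - p ^ v) ^ m)) ^ (2 * v)
    = (Pr V p (fills r (rect j l x (k * v) (k * v))) * (\<Prod>m\<in>{k..<n}. (1 - (1 - p ^ v) ^ m)) ^ (2 * v)) * (1 - (1 - p ^ v) ^ n) ^ (2 * v)"
    using step.hyps(1) by (simp add: power_mult_distrib)
  also have "\<dots> \<le> Pr V p (fills r (rect j l x (n * v) (n * v))) * (1 - (1 - p ^ v) ^ n) ^ (2 * v)"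
    using step.IH[OF sub] q0 by (intro mult_right_mono) auto
  also have "\<dots> \<le> Pr V p (fills r (rect j l x (Suc n * v) (Suc n * v)))"
    using k(1) step.hyps(1) by (intro Pr_fills_square_step[OF V ax _ step.prems]) auto
  finally show ?case .
qed

lemma card_rect:
  fixes x :: "'d::finite \<Rightarrow> int"
  assumes jl: "j \<noteq> l"
  shows "card (rect j l x w h) = w * h"
proof -
  define I where "I c = (if c = j then {x j..x j + int w - 1} else if c = l then {x l..x l + int h - 1} else {x c})" for c
  have "rect j l x w h = {s. \<forall>c. s c \<in> I c}"
    using jl by (auto simp: mem_rect[OF jl] I_def)
  then have "card (rect j l x w h) = (\<Prod>c\<in>UNIV. card (I c))" by (simp add: card_fun_box)
  also have "\<dots> = (\<Prod>c\<in>{j, l}. card (I c))" by (intro prod.mono_neutral_right) (auto simp: I_def)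
  finally show ?thesis using jl by (simp add: I_def)
qed

lemma Pr_fills_full:
  assumes V: "finite V" "0 \<le> p" "p \<le> 1" and F: "F \<subseteq> V"
  shows "p ^ card F \<le> Pr V p (fills r F)"
  using Pr_superset[OF V(1) F, of p] Pr_mono[OF V, of "\<lambda>A. F \<subseteq> A" "fills r F"] fills_full by metis

text \<open>If the rectangle does not fill, then either none of the disjoint squares stacked along
  one side fills, or some segment of length \<open>s\<close> lacks a run. There are at most
  \<open>2 * (w * h)\<close> segments, one per starting site and direction.\<close>

lemma rect_fail:
  fixes r :: "'d::finite \<Rightarrow> nat"
  assumes V: "finite V" "0 \<le> p" "p \<le> 1" and ax: "two_axes r j l v" and s: "v \<le> s" "s \<le> w"
    and sub: "rect j l x w h \<subseteq> V" and \<rho>: "\<And>y. rect j l y s s \<subseteq> V \<Longrightarrow> \<rho> \<le> Pr V p (fills r (rect j l y s s))"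
    and \<rho>1: "\<rho> \<le> 1"
  shows "Pr V p (\<lambda>A. \<not> fills r (rect j l x w h) A) \<le> (1 - \<rho>) ^ (h div s) + 2 * real (w * h) * (1 - p ^ v) ^ (s div v)"
proof -
  have jl: "j \<noteq> l" and r: "c \<noteq> j \<Longrightarrow> c \<noteq> l \<Longrightarrow> r c = 0" and rv: "0 < r j" "0 < r l" "r j \<le> v" "r l \<le> v" for c
    using ax by (auto simp: two_axes_def)
  have s0: "0 < s" using rv s by simp
  let ?F = "rect j l x w h"
  define y where "y q = x(l := x l + int (q * s))" for q
  define Q where "Q q = rect j l (y q) s s" for q
  define Z where "Z = {(c, z) \<in> {j, l} \<times> ?F. segment c z s \<subseteq> ?F}"
  have QF: "Q q \<subseteq> ?F" if "q < h div s" for q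
  proof -
    have "(q + 1) * s \<le> h div s * s" using that by (intro mult_right_mono) auto
    also have "\<dots> \<le> h" by simp
    finally have "q * s + s \<le> h" by simp
    then have "int (q * s) + int s \<le> int h" by (metis of_nat_add of_nat_le_iff)
    moreover define e where "e = q * s"
    ultimately have e: "int e + int s \<le> int h" "y q = x(l := x l + int e)" by (simp_all add: y_def)
    show ?thesis using s(2) jl e(1) unfolding Q_def e(2) by (auto simp: mem_rect[OF jl])
  qed
  have finZ: "finite Z" unfolding Z_def by (rule finite_subset[of _ "{j, l} \<times> ?F"]) auto
  have "card Z \<le> card ({j, l} \<times> ?F)" unfolding Z_def by (intro card_mono) auto
  then have "card Z \<le> 2 * (w * h)" using jl by (simp add: card_cartesian_product card_rect[OF jl])
  then have cardZ: "real (card Z) \<le> 2 * real (w * h)" by (metis of_nat_le_iff of_nat_mult of_nat_numeral)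
  have "Pr V p (\<lambda>A. \<not> fills r ?F A) \<le> Pr V p (\<lambda>A. (\<forall>q\<in>{..<h div s}. \<not> fills r (Q q) (A \<inter> Q q)) \<or> (\<exists>cz\<in>Z. \<not> run (fst cz) (snd cz) s v A))"
  proof (rule Pr_mono[OF V], rule ccontr)
    fix A assume nf: "\<not> fills r ?F A"
      and "\<not> ((\<forall>q\<in>{..<h div s}. \<not> fills r (Q q) (A \<inter> Q q)) \<or> (\<exists>cz\<in>Z. \<not> run (fst cz) (snd cz) s v A))"
    then have "\<exists>q<h div s. fills r (Q q) A" and runs0: "\<forall>cz\<in>Z. run (fst cz) (snd cz) s v A"
      by (auto simp: fills_Int)
    then obtain q where q: "q < h div s" "fills r (Q q) A" by blast
    have runs: "run c z s v A" if "(c, z) \<in> Z" for c z using bspec[OF runs0 that] by simp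
    have "fills r ?F A"
    proof (rule fills_rect_from_square[OF jl r rv(3,4) s(1) q(2)[unfolded Q_def] QF[OF q(1), unfolded Q_def] s0])
      fix z c assume c: "c \<in> {j, l}" and seg: "segment c z s \<subseteq> ?F"
      have "z \<in> segment c z s" unfolding segment_def using s0 by (intro CollectI exI[of _ 0]) auto
      then show "run c z s v A" using c seg by (intro runs) (auto simp: Z_def)
    qed
    with nf show False by simp
  qed
  also have "\<dots> \<le> Pr V p (\<lambda>A. \<forall>q\<in>{..<h div s}. \<not> fills r (Q q) (A \<inter> Q q)) + Pr V p (\<lambda>A. \<exists>cz\<in>Z. \<not> run (fst cz) (snd cz) s v A)"
    by (rule Pr_disj_le[OF V])
  also have "\<dots> \<le> (1 - \<rho>) ^ (h div s) + 2 * real (w * h) * (1 - p ^ v) ^ (s div v)"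
  proof (rule add_mono)
    have "Pr V p (\<lambda>A. \<forall>q\<in>{..<h div s}. \<not> fills r (Q q) (A \<inter> Q q)) = (\<Prod>q\<in>{..<h div s}. Pr V p (\<lambda>A. \<not> fills r (Q q) (A \<inter> Q q)))"
    proof (rule Pr_indep[OF V(1), where E = "\<lambda>q A. \<not> fills r (Q q) A"])
      show "disjoint_family_on Q {..<h div s}" unfolding disjoint_family_on_def
      proof (intro ballI impI)
        fix q q' :: nat assume ne: "q \<noteq> q'"
        have False if "u \<in> Q q" "u \<in> Q q'" for u
        proof -
          have "int (q * s) < int (q' * s + s)" "int (q' * s) < int (q * s + s)"
            using that jl by (auto simp: Q_def y_def mem_rect[OF jl])
          then have "q * s < (q' + 1) * s" "q' * s < (q + 1) * s" unfolding of_nat_less_iff by simp_all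
          then have "q < q' + 1" "q' < q + 1" by (simp_all only: mult_less_cancel2)
          then show False using ne by simp
        qed
        then show "Q q \<inter> Q q' = {}" by blast
      qed
    qed (use QF sub in auto)
    also have "\<dots> \<le> (\<Prod>q\<in>{..<h div s}. 1 - \<rho>)"
    proof (intro prod_mono conjI Pr_nonneg V)
      fix q assume "q \<in> {..<h div s}"
      then have "rect j l (y q) s s \<subseteq> V" using QF[of q] sub by (auto simp: Q_def)
      then have "\<rho> \<le> Pr V p (fills r (Q q))" unfolding Q_def by (rule \<rho>)
      then show "Pr V p (\<lambda>A. \<not> fills r (Q q) (A \<inter> Q q)) \<le> 1 - \<rho>" by (simp add: fills_Int Pr_Not[OF V(1)])
    qed
    finally show "Pr V p (\<lambda>A. \<forall>q\<in>{..<h div s}. \<not> fills r (Q q) (A \<inter> Q q)) \<le> (1 - \<rho>) ^ (h div s)" by simp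
    have "Pr V p (\<lambda>A. \<exists>cz\<in>Z. \<not> run (fst cz) (snd cz) s v A) \<le> real (card Z) * (1 - p ^ v) ^ (s div v)"
    proof (rule Pr_union_bound_card[OF V finZ])
      fix cz assume "cz \<in> Z"
      then show "Pr V p (\<lambda>A. \<not> run (fst cz) (snd cz) s v A) \<le> (1 - p ^ v) ^ (s div v)"
        using sub by (intro run_fail[OF V]) (auto simp: Z_def)
    qed
    also have "\<dots> \<le> 2 * real (w * h) * (1 - p ^ v) ^ (s div v)"
      using cardZ V by (intro mult_right_mono) (auto simp: power_le_one)
    finally show "Pr V p (\<lambda>A. \<exists>cz\<in>Z. \<not> run (fst cz) (snd cz) s v A) \<le> 2 * real (w * h) * (1 - p ^ v) ^ (s div v)" .
  qed
  finally show ?thesis .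
qed

section \<open>Upper bound: filling a cube\<close>

lemma grow_up:
  fixes r :: "'d::finite \<Rightarrow> nat"
  assumes S: "closed_in r V S" "A \<inter> V \<subseteq> S" and B: "ibox lo h \<subseteq> S" and w: "lo i + int (r i) \<le> h i + 1"
    and V: "ibox lo (h(i := h i + int n)) \<subseteq> V"
    and f: "\<And>z. h i < z \<Longrightarrow> z \<le> h i + int n \<Longrightarrow> fills (r(i := 0)) (ibox (lo(i := z)) (h(i := z))) A"
  shows "ibox lo (h(i := h i + int n)) \<subseteq> S"
  using V f
proof (induction n)
  case 0
  then show ?case using B by simp
next
  case (Suc n)
  let ?h = "h(i := h i + int n)" and ?z = "h i + int (Suc n)"
  have li: "lo i \<le> h i + 1" using w by linarith
  have sub: "ibox lo ?h \<subseteq> ibox lo (h(i := ?z))"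
  proof
    fix s assume "s \<in> ibox lo ?h"
    then have s: "lo c \<le> s c" "s c \<le> ?h c" for c by (auto simp: ibox_def)
    have "s c \<le> (h(i := ?z)) c" for c using s(2)[of c] by (cases "c = i") auto
    then show "s \<in> ibox lo (h(i := ?z))" using s(1) by (simp add: ibox_def)
  qed
  have IH: "ibox lo ?h \<subseteq> S"
  proof (rule Suc.IH)
    show "ibox lo ?h \<subseteq> V" using sub Suc.prems(1) by (rule order_trans)
    fix z assume "h i < z" "z \<le> h i + int n"
    then show "fills (r(i := 0)) (ibox (lo(i := z)) (h(i := z))) A" by (intro Suc.prems(2)) simp_all
  qed
  let ?F = "ibox (lo(i := ?z)) (h(i := ?z))"
  have FV: "?F \<subseteq> ibox lo (h(i := ?z))"
  proof
    fix s assume "s \<in> ?F"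
    then have s: "(lo(i := ?z)) c \<le> s c" "s c \<le> (h(i := ?z)) c" for c by (auto simp: ibox_def)
    have "lo c \<le> s c" for c using s(1)[of c] li by (cases "c = i") auto
    then show "s \<in> ibox lo (h(i := ?z))" using s(2) by (simp add: ibox_def)
  qed
  have clF: "closed_in (r(i := 0)) ?F S"
  proof (rule face_helped[OF S(1) IH])
    show "lo i + int (r i) \<le> ?h i + 1" using w by simp
    show "?z = ?h i + 1 \<or> ?z = lo i - 1" by simp
    show "?F \<subseteq> ibox (lo(i := ?z)) (?h(i := ?z))" by simp
    show "?F \<subseteq> V" using FV Suc.prems(1) by (rule order_trans)
  qed
  have fF: "fills (r(i := 0)) ?F A" by (rule Suc.prems(2)) simp_all
  have "A \<inter> ?F \<subseteq> S" using order_trans[OF FV Suc.prems(1)] S(2) by blast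
  with fF clF have "?F \<subseteq> S" by (rule fillsD)
  moreover have "ibox lo (h(i := ?z)) \<subseteq> ibox lo ?h \<union> ?F"
  proof
    fix s assume "s \<in> ibox lo (h(i := ?z))"
    then have s: "lo c \<le> s c" "s c \<le> (h(i := ?z)) c" for c by (auto simp: ibox_def)
    show "s \<in> ibox lo ?h \<union> ?F"
    proof (cases "s i = ?z")
      case True
      have "(lo(i := ?z)) c \<le> s c" for c using s(1)[of c] True by (cases "c = i") auto
      then show ?thesis using s(2) by (simp add: ibox_def)
    next
      case False
      have "s c \<le> ?h c" for c using s(2)[of c] s(2)[of i] False by (cases "c = i") auto
      then show ?thesis using s(1) by (simp add: ibox_def)
    qed
  qed
  ultimately show ?case using IH by blast
qed

definition cube_at :: "('d \<Rightarrow> int) \<Rightarrow> nat \<Rightarrow> ('d \<Rightarrow> int) set" where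
  "cube_at x U = ibox x (\<lambda>c. x c + int U - 1)"

lemma card_cube_at: "card (cube_at x U :: ('d::finite \<Rightarrow> int) set) = U ^ CARD('d)"
proof -
  have "cube_at x U = {s. \<forall>c. s c \<in> {x c..x c + int U - 1}}" by (auto simp: cube_at_def ibox_def)
  then have "card (cube_at x U) = (\<Prod>c\<in>UNIV. card {x c..x c + int U - 1})" by (simp only: card_fun_box)
  then show ?thesis by simp
qed

text \<open>Only the first growth, along \<open>i\<close>, uses faces with both sides
  \<open>X\<close>. When \<open>r i\<close> is the largest weight these faces carry the two smallest
  weights. The later faces involve \<open>r i\<close> and need a much longer side, which the earlier
  growth has provided.\<close>

lemma block_filled:
  fixes r :: "'d::finite \<Rightarrow> nat"
  assumes ax: "UNIV = {i, j, l}" "i \<noteq> j" "i \<noteq> l" "j \<noteq> l" and X: "\<And>c. r c \<le> X" "X \<le> U"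
    and N: "cube_at x X \<subseteq> A"
    and 1: "\<And>z. x i + int X \<le> z \<Longrightarrow> z < x i + int U \<Longrightarrow> fills (r(i := 0)) (rect j l (x(i := z)) X X) A"
    and 2: "\<And>z. x j + int X \<le> z \<Longrightarrow> z < x j + int U \<Longrightarrow> fills (r(j := 0)) (rect l i (x(j := z)) X U) A"
    and 3: "\<And>z. x l + int X \<le> z \<Longrightarrow> z < x l + int U \<Longrightarrow> fills (r(l := 0)) (rect i j (x(l := z)) U U) A"
  shows "fills r (cube_at x U) A"
  unfolding fills_def
proof (intro allI impI)
  fix S assume S: "closed_in r (cube_at x U) S" "A \<inter> cube_at x U \<subseteq> S"
  define h0 where "h0 c = x c + int X - 1" for c
  define h1 where "h1 = h0(i := x i + int U - 1)"
  define h2 where "h2 = h1(j := x j + int U - 1)"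
  define h3 where "h3 = h2(l := x l + int U - 1)"
  have h3: "h3 = (\<lambda>c. x c + int U - 1)"
  proof
    fix c have "c \<in> {i, j, l}" using ax(1) by blast
    then show "h3 c = x c + int U - 1" using ax(2-4) by (auto simp: h1_def h2_def h3_def)
  qed
  have U: "int X + int (U - X) = int U" using X(2) by simp
  have "x i + int U - 1 = h0 i + int (U - X)" "x j + int U - 1 = h1 j + int (U - X)" "x l + int U - 1 = h2 l + int (U - X)"
    using U ax(2-4) by (auto simp: h2_def h1_def h0_def)
  then have e1: "h1 = h0(i := h0 i + int (U - X))" and e2: "h2 = h1(j := h1 j + int (U - X))"
    and e3: "h3 = h2(l := h2 l + int (U - X))" using h1_def h2_def h3_def by presburger+
  have le: "h0 c \<le> h1 c" "h1 c \<le> h2 c" "h2 c \<le> h3 c" for c using X(2) by (auto simp: h3_def h2_def h1_def h0_def)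
  have mono: "ibox x h \<subseteq> ibox x h'" if "\<And>c. h c \<le> h' c" for h h' :: "'d \<Rightarrow> int"
    using that unfolding ibox_def by (auto intro: order_trans)
  have V3: "cube_at x U = ibox x h3" by (simp add: cube_at_def h3)
  have V: "ibox x h0 \<subseteq> cube_at x U" "ibox x h1 \<subseteq> cube_at x U" "ibox x h2 \<subseteq> cube_at x U" "ibox x h3 \<subseteq> cube_at x U"
    unfolding V3 using le order_trans[OF le(2,3)] order_trans[OF le(1) order_trans[OF le(2,3)]] by (intro mono; blast)+
  have "ibox x h0 \<subseteq> A" using N by (simp add: cube_at_def h0_def[abs_def])
  then have S0: "ibox x h0 \<subseteq> S" using V(1) S(2) by blast
  have rX: "x c + int (r c) \<le> h0 c + 1" for c using X(1)[of c] by (simp add: h0_def)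
  have "ibox x (h0(i := h0 i + int (U - X))) \<subseteq> S"
  proof (rule grow_up[OF S S0 rX])
    show "ibox x (h0(i := h0 i + int (U - X))) \<subseteq> cube_at x U" using V(2) e1 by simp
    fix z assume z: "h0 i < z" "z \<le> h0 i + int (U - X)"
    have "ibox (x(i := z)) (h0(i := z)) = rect j l (x(i := z)) X X"
    proof -
      have "h0(i := z) = (x(i := z))(j := (x(i := z)) j + int X - 1, l := (x(i := z)) l + int X - 1)" (is "?a = ?b")
      proof
        fix c have "c \<in> {i, j, l}" using ax(1) by blast
        then show "?a c = ?b c" using ax(2-4) by (auto simp: h0_def)
      qed
      then show ?thesis by (simp add: rect_def)
    qed
    then show "fills (r(i := 0)) (ibox (x(i := z)) (h0(i := z))) A" using 1[of z] z U by (simp add: h0_def)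
  qed
  then have S1: "ibox x h1 \<subseteq> S" by (simp only: e1)
  have "ibox x (h1(j := h1 j + int (U - X))) \<subseteq> S"
  proof (rule grow_up[OF S S1])
    show "x j + int (r j) \<le> h1 j + 1" using rX[of j] le(1)[of j] by linarith
    show "ibox x (h1(j := h1 j + int (U - X))) \<subseteq> cube_at x U" using V(3) e2 by simp
    fix z assume z: "h1 j < z" "z \<le> h1 j + int (U - X)"
    have "ibox (x(j := z)) (h1(j := z)) = rect l i (x(j := z)) X U"
    proof -
      have "h1(j := z) = (x(j := z))(l := (x(j := z)) l + int X - 1, i := (x(j := z)) i + int U - 1)" (is "?a = ?b")
      proof
        fix c have "c \<in> {i, j, l}" using ax(1) by blast
        then show "?a c = ?b c" using ax(2-4) by (auto simp: h1_def h0_def)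
      qed
      then show ?thesis by (simp add: rect_def)
    qed
    then show "fills (r(j := 0)) (ibox (x(j := z)) (h1(j := z))) A" using 2[of z] z U ax(2) by (simp add: h1_def h0_def)
  qed
  then have S2: "ibox x h2 \<subseteq> S" by (simp only: e2)
  have "ibox x (h2(l := h2 l + int (U - X))) \<subseteq> S"
  proof (rule grow_up[OF S S2])
    show "x l + int (r l) \<le> h2 l + 1" using rX[of l] le(1,2)[of l] by linarith
    show "ibox x (h2(l := h2 l + int (U - X))) \<subseteq> cube_at x U" using V(4) e3 by simp
    fix z assume z: "h2 l < z" "z \<le> h2 l + int (U - X)"
    have "ibox (x(l := z)) (h2(l := z)) = rect i j (x(l := z)) U U"
    proof -
      have "h2(l := z) = (x(l := z))(i := (x(l := z)) i + int U - 1, j := (x(l := z)) j + int U - 1)" (is "?a = ?b")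
      proof
        fix c have "c \<in> {i, j, l}" using ax(1) by blast
        then show "?a c = ?b c" using ax(2-4) by (auto simp: h2_def h1_def h0_def)
      qed
      then show ?thesis by (simp add: rect_def)
    qed
    then show "fills (r(l := 0)) (ibox (x(l := z)) (h2(l := z))) A" using 3[of z] z U ax by (simp add: h2_def h1_def h0_def)
  qed
  then show "cube_at x U \<subseteq> S" unfolding V3 by (simp only: e3)
qed

text \<open>All faces lie outside the nucleus, so their filling is independent of the nucleus being
  occupied and the two probabilities multiply. The failures of at most \<open>U\<close> faces of
  each kind are summed.\<close>

lemma Pr_block:
  fixes r :: "'d::finite \<Rightarrow> nat"
  assumes V: "finite V" "0 \<le> p" "p \<le> 1" and ax: "UNIV = {i, j, l}" "i \<noteq> j" "i \<noteq> l" "j \<noteq> l"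
    and X: "\<And>c. r c \<le> X" "X \<le> U" and sub: "cube_at x U \<subseteq> V"
    and 1: "\<And>y. rect j l y X X \<subseteq> V \<Longrightarrow> Pr V p (\<lambda>A. \<not> fills (r(i := 0)) (rect j l y X X) A) \<le> f1"
    and 2: "\<And>y. rect l i y X U \<subseteq> V \<Longrightarrow> Pr V p (\<lambda>A. \<not> fills (r(j := 0)) (rect l i y X U) A) \<le> f2"
    and 3: "\<And>y. rect i j y U U \<subseteq> V \<Longrightarrow> Pr V p (\<lambda>A. \<not> fills (r(l := 0)) (rect i j y U U) A) \<le> f3"
    and f0: "0 \<le> f1" "0 \<le> f2" "0 \<le> f3"
  shows "p ^ (X ^ 3) * (1 - real U * (f1 + f2 + f3)) \<le> Pr V p (fills r (cube_at x U))"
proof -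
  let ?N = "cube_at x X" and ?C = "cube_at x U"
  define F1 where "F1 n = rect j l (x(i := x i + int n)) X X" for n
  define F2 where "F2 n = rect l i (x(j := x j + int n)) X U" for n
  define F3 where "F3 n = rect i j (x(l := x l + int n)) U U" for n
  define G where "G A \<longleftrightarrow> (\<forall>n\<in>{X..<U}. fills (r(i := 0)) (F1 n) A \<and> fills (r(j := 0)) (F2 n) A \<and> fills (r(l := 0)) (F3 n) A)" for A
  have in3: "c = i \<or> c = j \<or> c = l" for c using ax(1) by blast
  have all3: "(\<forall>c. Q c) \<longleftrightarrow> Q i \<and> Q j \<and> Q l" for Q :: "'d \<Rightarrow> bool" using in3 by metis
  have card3: "CARD('d) = 3" by (subst ax(1)) (simp add: ax(2-4))
  have mem: "s \<in> cube_at x w \<longleftrightarrow> x i \<le> s i \<and> s i < x i + int w \<and> x j \<le> s j \<and> s j < x j + int w \<and> x l \<le> s l \<and> s l < x l + int w" for s w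
    by (auto simp: cube_at_def ibox_def all3)
  have NC: "?N \<subseteq> ?C" using X(2) by (auto simp: mem)
  have F: "F1 n \<subseteq> ?C - ?N" "F2 n \<subseteq> ?C - ?N" "F3 n \<subseteq> ?C - ?N" if "n \<in> {X..<U}" for n
    using that ax(2-4) X(2) unfolding F1_def F2_def F3_def
    by (auto simp: mem mem_rect[OF ax(4)] mem_rect[OF ax(3)[symmetric]] mem_rect[OF ax(2)])
  have GC: "G (A \<inter> (?C - ?N)) = G A" for A
  proof -
    have e: "fills q B (A \<inter> (?C - ?N)) = fills q B A" if "B \<subseteq> ?C - ?N" for q B
    proof -
      have "A \<inter> (?C - ?N) \<inter> B = A \<inter> B" using that by blast
      then show ?thesis using fills_Int[of q B "A \<inter> (?C - ?N)"] fills_Int[of q B A] by simp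
    qed
    show ?thesis unfolding G_def using e F by (intro ball_cong) auto
  qed
  have "Pr V p (\<lambda>A. \<not> G A) \<le> Pr V p (\<lambda>A. \<exists>n\<in>{X..<U}. \<not> fills (r(i := 0)) (F1 n) A \<or> \<not> fills (r(j := 0)) (F2 n) A \<or> \<not> fills (r(l := 0)) (F3 n) A)"
    by (rule Pr_mono[OF V]) (auto simp: G_def)
  also have "\<dots> \<le> real (card {X..<U}) * (f1 + (f2 + f3))"
  proof (rule Pr_union_bound_card[OF V finite_atLeastLessThan])
    fix n assume n: "n \<in> {X..<U}"
    have FV: "F1 n \<subseteq> V" "F2 n \<subseteq> V" "F3 n \<subseteq> V" using F[OF n] sub by auto
    have "Pr V p (\<lambda>A. \<not> fills (r(i := 0)) (F1 n) A) \<le> f1" "Pr V p (\<lambda>A. \<not> fills (r(j := 0)) (F2 n) A) \<le> f2"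
      "Pr V p (\<lambda>A. \<not> fills (r(l := 0)) (F3 n) A) \<le> f3"
      using FV 1 2 3 unfolding F1_def F2_def F3_def by auto
    then show "Pr V p (\<lambda>A. \<not> fills (r(i := 0)) (F1 n) A \<or> \<not> fills (r(j := 0)) (F2 n) A \<or> \<not> fills (r(l := 0)) (F3 n) A) \<le> f1 + (f2 + f3)"
      using Pr_disj_le[OF V, of "\<lambda>A. \<not> fills (r(i := 0)) (F1 n) A" "\<lambda>A. \<not> fills (r(j := 0)) (F2 n) A \<or> \<not> fills (r(l := 0)) (F3 n) A"]
        Pr_disj_le[OF V, of "\<lambda>A. \<not> fills (r(j := 0)) (F2 n) A" "\<lambda>A. \<not> fills (r(l := 0)) (F3 n) A"] by linarith
  qed
  also have "\<dots> \<le> real U * (f1 + f2 + f3)" using f0 by (auto simp: add.assoc intro!: mult_right_mono)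
  finally have "1 - real U * (f1 + f2 + f3) \<le> Pr V p G" by (simp add: Pr_Not[OF V(1)])
  then have "p ^ (X ^ 3) * (1 - real U * (f1 + f2 + f3)) \<le> p ^ (X ^ 3) * Pr V p G" using V by (intro mult_left_mono) auto
  also have "p ^ (X ^ 3) * Pr V p G = Pr V p (\<lambda>A. ?N \<subseteq> A \<inter> ?N) * Pr V p (\<lambda>A. G (A \<inter> (?C - ?N)))"
  proof -
    have "Pr V p (\<lambda>A. ?N \<subseteq> A \<inter> ?N) = Pr V p (\<lambda>A. ?N \<subseteq> A)" by (rule Pr_cong) auto
    also have "\<dots> = p ^ card ?N" using NC sub by (intro Pr_superset V) auto
    finally have "Pr V p (\<lambda>A. ?N \<subseteq> A \<inter> ?N) = p ^ (X ^ 3)" by (simp add: card_cube_at card3)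
    moreover have "(\<lambda>A. G (A \<inter> (?C - ?N))) = G" by (rule ext) (rule GC)
    ultimately show ?thesis by (simp only:)
  qed
  also have "Pr V p (\<lambda>A. ?N \<subseteq> A \<inter> ?N) * Pr V p (\<lambda>A. G (A \<inter> (?C - ?N))) = Pr V p (\<lambda>A. ?N \<subseteq> A \<inter> ?N \<and> G (A \<inter> (?C - ?N)))"
    using NC sub by (intro Pr_indep2[OF V(1), symmetric, where ?E1.0 = "\<lambda>B. ?N \<subseteq> B"]) auto
  also have "\<dots> \<le> Pr V p (fills r ?C)"
  proof (rule Pr_mono[OF V])
    fix A assume "?N \<subseteq> A \<inter> ?N \<and> G (A \<inter> (?C - ?N))"
    then have A: "?N \<subseteq> A" "G A" by (auto simp: GC)
    have zz: "\<exists>n\<in>{X..<U}. z = y + int n" if "y + int X \<le> z" "z < y + int U" for y z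
      using that by (intro bexI[of _ "nat (z - y)"]) auto
    show "fills r ?C A"
    proof (rule block_filled[OF ax X A(1)])
      fix z assume "x i + int X \<le> z" "z < x i + int U"
      from zz[OF this] show "fills (r(i := 0)) (rect j l (x(i := z)) X X) A" using A(2) by (auto simp: G_def F1_def)
    next
      fix z assume "x j + int X \<le> z" "z < x j + int U"
      from zz[OF this] show "fills (r(j := 0)) (rect l i (x(j := z)) X U) A" using A(2) by (auto simp: G_def F2_def)
    next
      fix z assume "x l + int X \<le> z" "z < x l + int U"
      from zz[OF this] show "fills (r(l := 0)) (rect i j (x(l := z)) U U) A" using A(2) by (auto simp: G_def F3_def)
    qed
  qed
  finally show ?thesis .
qed

text \<open>Determined by its normal axis alone, so that statements can range over all three
  orientations; \<open>rect\<close> has to name the two axes inside.\<close>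

definition square :: "'d \<Rightarrow> ('d \<Rightarrow> int) \<Rightarrow> nat \<Rightarrow> ('d \<Rightarrow> int) set" where
  "square i x U = ibox x (\<lambda>c. if c = i then x c else x c + int U - 1)"

lemma square_eq_rect:
  assumes ax: "UNIV = {i, j, l}" "i \<noteq> j" "i \<noteq> l" "j \<noteq> l"
  shows "square i x U = rect j l x U U"
proof -
  have "(\<lambda>c. if c = i then x c else x c + int U - 1) = x(j := x j + int U - 1, l := x l + int U - 1)" (is "?a = ?b")
  proof
    fix c have "c \<in> {i, j, l}" using ax(1) by blast
    then show "?a c = ?b c" using ax(2-4) by auto
  qed
  then show ?thesis by (simp add: square_def rect_def)
qed

text \<open>Every face of the growing box is at least as wide as the full tile, hence is covered by
  squares of side \<open>U\<close>, all of which fill.\<close>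

lemma cube_filled:
  fixes r :: "'d::finite \<Rightarrow> nat"
  assumes U: "\<And>c. r c \<le> U" and tile: "cube_at y U \<subseteq> ibox Lo Hi" "fills r (cube_at y U) A" and U0: "0 < U"
    and sq: "\<And>i x. square i x U \<subseteq> ibox Lo Hi \<Longrightarrow> fills (r(i := 0)) (square i x U) A"
  shows "fills r (ibox Lo Hi) A"
  unfolding fills_def
proof (intro allI impI)
  let ?V = "ibox Lo Hi" and ?h = "\<lambda>c. y c + int U - 1"
  fix S assume S: "closed_in r ?V S" "A \<inter> ?V \<subseteq> S"
  have tS: "ibox y ?h \<subseteq> S"
    using fillsD[OF tile(2) closed_in_subset[OF S(1) tile(1)]] S(2) tile(1) unfolding cube_at_def by blast
  have "y \<in> cube_at y U" "?h \<in> cube_at y U" using U0 by (auto simp: cube_at_def ibox_def)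
  then have yh: "y \<in> ?V" "?h \<in> ?V" using tile(1) by blast+
  have face: "ibox (lo(i := z)) (hi(i := z)) \<subseteq> S"
    if B: "ibox lo hi \<subseteq> S" and rng: "\<And>c. Lo c \<le> lo c \<and> lo c \<le> y c \<and> ?h c \<le> hi c \<and> hi c \<le> Hi c"
      and z: "z = hi i + 1 \<or> z = lo i - 1" "Lo i \<le> z" "z \<le> Hi i" for lo hi i z
  proof -
    let ?F = "ibox (lo(i := z)) (hi(i := z))"
    have FV: "?F \<subseteq> ?V"
    proof
      fix s assume "s \<in> ?F"
      then have s: "(lo(i := z)) c \<le> s c" "s c \<le> (hi(i := z)) c" for c by (auto simp: ibox_def)
      have "Lo c \<le> s c \<and> s c \<le> Hi c" for c using s[of c] rng[of c] z by (cases "c = i") auto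
      then show "s \<in> ?V" by (simp add: ibox_def)
    qed
    have wd: "lo c + int U \<le> hi c + 1" for c using rng[of c] by linarith
    have "lo i + int (r i) \<le> hi i + 1" using wd[of i] U[of i] by linarith
    from face_helped[OF S(1) B this z(1) subset_refl FV] have cl: "closed_in (r(i := 0)) ?F S" .
    show ?thesis
    proof
      fix s assume "s \<in> ?F"
      then have s: "(lo(i := z)) c \<le> s c" "s c \<le> (hi(i := z)) c" for c by (auto simp: ibox_def)
      \<comment> \<open>The corner of a square through \<open>s\<close>, pushed back where
        \<open>s\<close> is too close to the upper end of the face.\<close>
      define x where "x c = (if c = i then z else min (s c) (hi c - int U + 1))" for c
      have sub: "square i x U \<subseteq> ?F"
      proof
        fix u assume "u \<in> square i x U"
        then have u: "x c \<le> u c" "u c \<le> (if c = i then x c else x c + int U - 1)" for c by (auto simp: square_def ibox_def)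
        have "(lo(i := z)) c \<le> u c \<and> u c \<le> (hi(i := z)) c" for c
          using u[of c] s[of c] wd[of c] by (cases "c = i") (auto simp: x_def min_def split: if_splits)
        then show "u \<in> ?F" by (simp add: ibox_def)
      qed
      have "square i x U \<subseteq> S"
      proof (rule fillsD[OF sq closed_in_subset[OF cl sub]])
        show "square i x U \<subseteq> ?V" using sub FV by blast
        then show "A \<inter> square i x U \<subseteq> S" using S(2) by blast
      qed
      moreover have "x c \<le> s c \<and> s c \<le> (if c = i then x c else x c + int U - 1)" for c
        using s[of c] U0 by (cases "c = i") (auto simp: x_def min_def)
      then have "s \<in> square i x U" by (simp add: square_def ibox_def)
      ultimately show "s \<in> S" by blast
    qed
  qed
  show "?V \<subseteq> S"
  proof (rule box_growth[of y ?h S Lo Hi y ?h])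
    show "Lo c \<le> y c" "?h c \<le> Hi c" for c using yh by (auto simp: ibox_def)
  next
    fix lo hi i
    assume a: "ibox lo hi \<subseteq> S" "\<And>c. Lo c \<le> lo c \<and> lo c \<le> y c \<and> ?h c \<le> hi c \<and> hi c \<le> Hi c" "Lo i < lo i"
    have "lo i - 1 \<le> Hi i" using a(2)[of i] U0 by linarith
    then show "ibox (lo(i := lo i - 1)) (hi(i := lo i - 1)) \<subseteq> S" using a(3) by (intro face[OF a(1,2)]) auto
  next
    fix lo hi i
    assume a: "ibox lo hi \<subseteq> S" "\<And>c. Lo c \<le> lo c \<and> lo c \<le> y c \<and> ?h c \<le> hi c \<and> hi c \<le> Hi c" "hi i < Hi i"
    have "Lo i \<le> hi i + 1" using a(2)[of i] U0 by linarith
    then show "ibox (lo(i := hi i + 1)) (hi(i := hi i + 1)) \<subseteq> S" using a(3) by (intro face[OF a(1,2)]) auto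
  qed (use tS in auto)
qed

lemma box0_eq_ibox: "box0 L = ibox (\<lambda>_. 0) (\<lambda>_. int L)"
  by (auto simp: box0_def ibox_def)

text \<open>Only one row of tiles along an edge is tried; in the application their number already
  far exceeds the inverse of the tile probability. The filling of squares, in contrast, is demanded
  throughout the cube, hence the factor \<open>(L + 1) ^ CARD('d)\<close>.\<close>

lemma Pr_cube:
  fixes r :: "'d::finite \<Rightarrow> nat"
  assumes p: "0 \<le> p" "p \<le> 1" and U: "\<And>c. r c \<le> U" "0 < U" "U \<le> L + 1"
    and \<rho>: "\<And>x. cube_at x U \<subseteq> box0 L \<Longrightarrow> \<rho> \<le> Pr (box0 L) p (fills r (cube_at x U))" and \<rho>1: "\<rho> \<le> 1"
    and f: "\<And>i x. square i x U \<subseteq> box0 L \<Longrightarrow> Pr (box0 L) p (\<lambda>A. \<not> fills (r(i := 0)) (square i x U) A) \<le> f"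
    and f0: "0 \<le> f"
  shows "Pr (box0 L) p (\<lambda>A. \<not> fills r (box0 L) A) \<le> (1 - \<rho>) ^ ((L + 1) div U) + real CARD('d) * real (L + 1) ^ CARD('d) * f"
proof -
  let ?V = "box0 L :: ('d \<Rightarrow> int) set"
  obtain i0 :: 'd where True by simp
  define y :: "nat \<Rightarrow> 'd \<Rightarrow> int" where "y q = (\<lambda>_. 0)(i0 := int (q * U))" for q
  define Z where "Z = {(i, x) \<in> (UNIV :: 'd set) \<times> ?V. square i x U \<subseteq> ?V}"
  have sub: "cube_at (y q) U \<subseteq> ?V" if "q < (L + 1) div U" for q
  proof
    have "(q + 1) * U \<le> (L + 1) div U * U" using that by (intro mult_right_mono) auto
    also have "\<dots> \<le> L + 1" by simp
    finally have "q * U + U \<le> L + 1" by simp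
    then have q: "int (q * U) + int U \<le> int L + 1" by linarith
    fix s assume "s \<in> cube_at (y q) U"
    then have s: "y q c \<le> s c" "s c \<le> y q c + int U - 1" for c by (auto simp: cube_at_def ibox_def)
    have "0 \<le> s c \<and> s c \<le> int L" for c
    proof (cases "c = i0")
      case True
      then have "y q c = int (q * U)" by (simp add: y_def)
      then show ?thesis using s[of c] q of_nat_0_le_iff[of "q * U"] by linarith
    next
      case False
      then show ?thesis using s[of c] U(3) by (simp add: y_def)
    qed
    then show "s \<in> ?V" by (simp add: box0_def)
  qed
  have finZ: "finite Z" unfolding Z_def by (rule finite_subset[of _ "UNIV \<times> ?V"]) auto
  have "card Z \<le> card ((UNIV :: 'd set) \<times> ?V)" unfolding Z_def by (intro card_mono) auto
  also have "\<dots> = CARD('d) * (L + 1) ^ CARD('d)" by (simp only: card_cartesian_product card_box0)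
  finally have cardZ: "real (card Z) \<le> real CARD('d) * real (L + 1) ^ CARD('d)" by (metis of_nat_le_iff of_nat_mult of_nat_power)
  have "Pr ?V p (\<lambda>A. \<not> fills r ?V A) \<le> Pr ?V p (\<lambda>A. (\<forall>q\<in>{..<(L + 1) div U}. \<not> fills r (cube_at (y q) U) (A \<inter> cube_at (y q) U)) \<or>
    (\<exists>ix\<in>Z. \<not> fills (r(fst ix := 0)) (square (fst ix) (snd ix) U) A))"
  proof (rule Pr_mono[OF finite_box0 p], rule ccontr)
    fix A assume nf: "\<not> fills r ?V A" and n: "\<not> ((\<forall>q\<in>{..<(L + 1) div U}. \<not> fills r (cube_at (y q) U) (A \<inter> cube_at (y q) U)) \<or>
      (\<exists>ix\<in>Z. \<not> fills (r(fst ix := 0)) (square (fst ix) (snd ix) U) A))"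
    then have "\<exists>q<(L + 1) div U. fills r (cube_at (y q) U) A"
      and sq0: "\<forall>ix\<in>Z. fills (r(fst ix := 0)) (square (fst ix) (snd ix) U) A" by (auto simp: fills_Int)
    then obtain q where q: "q < (L + 1) div U" "fills r (cube_at (y q) U) A" by blast
    have "fills r (ibox (\<lambda>_. 0) (\<lambda>_. int L)) A"
    proof (rule cube_filled[OF U(1) sub[OF q(1), unfolded box0_eq_ibox] q(2) U(2)])
      fix i :: 'd and x assume s: "square i x U \<subseteq> ibox (\<lambda>_. 0) (\<lambda>_. int L)"
      have "x \<in> square i x U" using U(2) by (auto simp: square_def ibox_def)
      then have "(i, x) \<in> Z" using s by (auto simp: Z_def box0_eq_ibox)
      from bspec[OF sq0 this] show "fills (r(i := 0)) (square i x U) A" by simp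
    qed
    with nf show False by (simp add: box0_eq_ibox)
  qed
  also have "\<dots> \<le> Pr ?V p (\<lambda>A. \<forall>q\<in>{..<(L + 1) div U}. \<not> fills r (cube_at (y q) U) (A \<inter> cube_at (y q) U)) +
    Pr ?V p (\<lambda>A. \<exists>ix\<in>Z. \<not> fills (r(fst ix := 0)) (square (fst ix) (snd ix) U) A)"
    by (rule Pr_disj_le[OF finite_box0 p])
  also have "\<dots> \<le> (1 - \<rho>) ^ ((L + 1) div U) + real CARD('d) * real (L + 1) ^ CARD('d) * f"
  proof (rule add_mono)
    have "Pr ?V p (\<lambda>A. \<forall>q\<in>{..<(L + 1) div U}. \<not> fills r (cube_at (y q) U) (A \<inter> cube_at (y q) U))
      = (\<Prod>q\<in>{..<(L + 1) div U}. Pr ?V p (\<lambda>A. \<not> fills r (cube_at (y q) U) (A \<inter> cube_at (y q) U)))"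
    proof (rule Pr_indep[OF finite_box0, where E = "\<lambda>q A. \<not> fills r (cube_at (y q) U) A"])
      show "disjoint_family_on (\<lambda>q. cube_at (y q) U) {..<(L + 1) div U}" unfolding disjoint_family_on_def
      proof (intro ballI impI)
        fix q q' :: nat assume ne: "q \<noteq> q'"
        have False if "u \<in> cube_at (y q) U" "u \<in> cube_at (y q') U" for u
        proof -
          have "y q i0 \<le> u i0" "u i0 \<le> y q i0 + int U - 1" "y q' i0 \<le> u i0" "u i0 \<le> y q' i0 + int U - 1"
            using that by (auto simp: cube_at_def ibox_def)
          then have "int (q * U) < int (q' * U + U)" "int (q' * U) < int (q * U + U)" by (simp_all add: y_def)
          then have "q * U < (q' + 1) * U" "q' * U < (q + 1) * U" unfolding of_nat_less_iff by simp_all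
          then have "q < q' + 1" "q' < q + 1" by (simp_all only: mult_less_cancel2)
          then show False using ne by simp
        qed
        then show "cube_at (y q) U \<inter> cube_at (y q') U = {}" by blast
      qed
    qed (use sub in auto)
    also have "\<dots> \<le> (\<Prod>q\<in>{..<(L + 1) div U}. 1 - \<rho>)"
    proof (intro prod_mono conjI Pr_nonneg p)
      fix q assume "q \<in> {..<(L + 1) div U}"
      then have "\<rho> \<le> Pr ?V p (fills r (cube_at (y q) U))" using sub by (intro \<rho>) auto
      then show "Pr ?V p (\<lambda>A. \<not> fills r (cube_at (y q) U) (A \<inter> cube_at (y q) U)) \<le> 1 - \<rho>"
        by (simp add: fills_Int Pr_Not[OF finite_box0])
    qed
    finally show "Pr ?V p (\<lambda>A. \<forall>q\<in>{..<(L + 1) div U}. \<not> fills r (cube_at (y q) U) (A \<inter> cube_at (y q) U)) \<le> (1 - \<rho>) ^ ((L + 1) div U)" by simp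
    have "Pr ?V p (\<lambda>A. \<exists>ix\<in>Z. \<not> fills (r(fst ix := 0)) (square (fst ix) (snd ix) U) A) \<le> real (card Z) * f"
      by (rule Pr_union_bound_card[OF finite_box0 p finZ]) (auto simp: Z_def intro!: f)
    also have "\<dots> \<le> real CARD('d) * real (L + 1) ^ CARD('d) * f" using cardZ f0 by (intro mult_right_mono)
    finally show "Pr ?V p (\<lambda>A. \<exists>ix\<in>Z. \<not> fills (r(fst ix := 0)) (square (fst ix) (snd ix) U) A) \<le> real CARD('d) * real (L + 1) ^ CARD('d) * f" .
  qed
  finally show ?thesis .
qed

section \<open>Upper bound: nucleation in a square\<close>

lemma prod_one_minus_ge:
  fixes a :: "'i \<Rightarrow> real"
  assumes "finite I" "\<And>i. i \<in> I \<Longrightarrow> 0 \<le> a i \<and> a i \<le> 1"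
  shows "1 - sum a I \<le> (\<Prod>i\<in>I. 1 - a i)"
  using assms
proof (induction I rule: finite_induct)
  case empty
  then show ?case by simp
next
  case (insert i I)
  have P: "0 \<le> (\<Prod>i\<in>I. 1 - a i)" "(\<Prod>i\<in>I. 1 - a i) \<le> 1"
    using insert.prems by (auto intro!: prod_nonneg prod_le_1)
  have "a i * (\<Prod>i\<in>I. 1 - a i) \<le> a i" using P insert.prems by (intro mult_left_le) auto
  then have "1 - sum a (insert i I) \<le> (\<Prod>i\<in>I. 1 - a i) - a i * (\<Prod>i\<in>I. 1 - a i)"
    using insert by (simp add: algebra_simps)
  then show ?case using insert.hyps by (simp add: algebra_simps)
qed

lemma geometric_tail_le:
  assumes "0 < (e::real)" "e \<le> 1"
  shows "(\<Sum>m\<in>{k..<k'}. (1 - e) ^ m) \<le> (1 - e) ^ k / e"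
proof (cases "k \<le> k'")
  case True
  have "(\<Sum>m\<in>{k..<k'}. (1 - e) ^ m) * e = (1 - e) ^ k - (1 - e) ^ k'"
    using True by (induction k' rule: dec_induct) (auto simp: algebra_simps)
  also have "\<dots> \<le> (1 - e) ^ k" using assms by simp
  finally show ?thesis using assms by (simp add: field_simps)
qed (use assms in auto)

text \<open>A square of \<open>m\<close> units misses a further line with probability at most
  \<open>(1 - e) ^ m\<close>, which is summable. Once the tail from \<open>k\<close> on is small
  against \<open>1 / v\<close>, growth to any larger size succeeds with probability at least
  1/2.\<close>

lemma tail_product_ge_half:
  assumes "0 < (e::real)" "e \<le> 1" "2 * real v * ((1 - e) ^ k / e) \<le> 1/2"
  shows "1/2 \<le> (\<Prod>m\<in>{k..<k'}. (1 - (1 - e) ^ m)) ^ (2 * v)"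
proof -
  let ?P = "\<Prod>m\<in>{k..<k'}. (1 - (1 - e) ^ m)"
  have P: "0 \<le> ?P" "?P \<le> 1" using assms by (auto intro!: prod_nonneg prod_le_1 simp: power_le_one)
  have "1 - (\<Sum>m\<in>{k..<k'}. (1 - e) ^ m) \<le> ?P"
    using assms by (intro prod_one_minus_ge) (auto simp: power_le_one)
  then have "1 - ?P \<le> (1 - e) ^ k / e" using geometric_tail_le[OF assms(1,2), of k k'] by linarith
  then have "real (2 * v) * (1 - ?P) \<le> 1/2"
    using assms(3) mult_left_mono[of "1 - ?P" "(1 - e) ^ k / e" "2 * real v"] by simp
  moreover have "1 + real (2 * v) * (?P - 1) \<le> (1 + (?P - 1)) ^ (2 * v)"
    using P by (intro Bernoulli_inequality) auto
  ultimately show ?thesis by (simp add: algebra_simps)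
qed

lemma ln_one_plus_le_sqrt:
  assumes "0 \<le> (z::real)" shows "1 + z \<le> exp (2 * sqrt z)"
proof -
  have "1 + z \<le> (1 + sqrt z)\<^sup>2" using assms by (simp add: power2_eq_square algebra_simps)
  also have "\<dots> \<le> (exp (sqrt z))\<^sup>2" using assms by (intro power_mono exp_ge_add_one_self) auto
  also have "\<dots> = exp (2 * sqrt z)" by (simp add: power2_eq_square exp_add[symmetric])
  finally show ?thesis .
qed

lemma sum_inverse_sqrt_le: "(\<Sum>m\<in>{1..<Suc n}. 1 / sqrt (real m)) \<le> 2 * sqrt (real n)"
proof (induction n)
  case 0
  then show ?case by simp
next
  case (Suc n)
  have "1 / sqrt (real (Suc n)) \<le> 2 * (sqrt (real (Suc n)) - sqrt (real n))"
  proof -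
    have "sqrt (real n) * sqrt (real (Suc n)) \<le> (real n + real (Suc n)) / 2"
      using arith_geo_mean_sqrt[of "real n" "real (Suc n)"] by (simp add: real_sqrt_mult)
    then have "1 \<le> 2 * (sqrt (real (Suc n)) - sqrt (real n)) * sqrt (real (Suc n))" by (simp add: algebra_simps)
    then show ?thesis by (simp add: divide_le_eq)
  qed
  then show ?case using Suc by simp
qed

text \<open>The factors with \<open>e m \<le> 1\<close> are bounded by \<open>1 - exp (- y) \<ge> y / (1 + y)\<close> and \<open>ln (1 + 1 / y) \<le> 2 / sqrt y\<close>,
  which is summable near zero, the others by the geometric series.\<close>

lemma nucleation_product_ge:
  assumes "0 < (e::real)" "e \<le> 1/2"
  shows "exp (- 12 / e) \<le> (\<Prod>m\<in>{1..<k}. (1 - (1 - e) ^ m))"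
proof -
  define N where "N = nat \<lceil>1 / e\<rceil>"
  have N: "1 / e \<le> real N" "real N \<le> 2 / e" "1 \<le> N"
  proof -
    have "2 \<le> 1 / e" using assms by (simp add: field_simps)
    then show "1 / e \<le> real N" "1 \<le> N" unfolding N_def by linarith+
    have "real N \<le> 1 / e + 1" unfolding N_def using \<open>2 \<le> 1 / e\<close> by linarith
    also have "\<dots> \<le> 2 / e" using \<open>2 \<le> 1 / e\<close> by simp
    finally show "real N \<le> 2 / e" .
  qed
  \<comment> \<open>The exponents up to \<open>N\<close> sum to at most
    \<open>4 * sqrt 2 / e\<close> because \<open>N \<le> 2 / e\<close>, the others to at most
    \<open>2 / e\<close>; 12 is a round bound for the total.\<close>
  define b where "b m = (if m \<le> N then 2 * (1 / sqrt e) * (1 / sqrt (real m)) else 2 * (1 - e) ^ m)" for m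
  have fac: "exp (- b m) \<le> 1 - (1 - e) ^ m" if "1 \<le> m" for m
  proof -
    define y where "y = e * real m"
    have y: "0 < y" using assms that by (simp add: y_def)
    have le: "(1 - e) ^ m \<le> exp (- y)"
    proof -
      have "1 - e \<le> exp (- e)" using exp_ge_add_one_self[of "- e"] by simp
      then have "(1 - e) ^ m \<le> exp (- e) ^ m" using assms by (intro power_mono) auto
      also have "\<dots> = exp (- y)" by (simp add: y_def exp_of_nat_mult[symmetric] mult.commute)
      finally show ?thesis .
    qed
    show ?thesis
    proof (cases "m \<le> N")
      case True
      have "1 + 1 / y \<le> exp (2 * sqrt (1 / y))" using y by (intro ln_one_plus_le_sqrt) simp
      then have "exp (- (2 * sqrt (1 / y))) \<le> 1 / (1 + 1 / y)"
        using y by (simp add: exp_minus divide_simps add_pos_pos mult.commute split: if_splits)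
      also have "\<dots> = 1 - 1 / (1 + y)" using y by (simp add: field_simps)
      also have "\<dots> \<le> 1 - exp (- y)"
      proof -
        have "1 + y \<le> exp y" by (rule exp_ge_add_one_self)
        then have "1 / exp y \<le> 1 / (1 + y)" using y by (intro divide_left_mono) auto
        then show ?thesis by (simp add: exp_minus field_simps)
      qed
      also have "\<dots> \<le> 1 - (1 - e) ^ m" using le by simp
      finally show ?thesis using True assms by (simp add: b_def y_def real_sqrt_divide real_sqrt_mult)
    next
      case False
      then have "1 / e \<le> real m" using N(1) by linarith
      then have "1 \<le> y" using assms by (simp add: y_def field_simps)
      then have "exp (- y) \<le> exp (- 1)" by simp
      also have "exp (-1) \<le> (1/2 :: real)" using exp_ge_add_one_self[of 1] by (simp add: exp_minus field_simps)
      finally have "(1 - e) ^ m \<le> 1/2" using le by linarith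
      then have "exp (- 2 * (1 - e) ^ m) \<le> 1 - (1 - e) ^ m" using assms by (intro exp_le_one_minus) auto
      then show ?thesis using False by (simp add: b_def)
    qed
  qed
  have "(\<Sum>m\<in>{1..<k}. b m) \<le> 12 / e"
  proof -
    have b0: "0 \<le> b m" for m using assms by (simp add: b_def)
    have "(\<Sum>m\<in>{1..<k}. b m) \<le> (\<Sum>m\<in>{1..<Suc N} \<union> {Suc N..<max k (Suc N)}. b m)"
      using b0 by (intro sum_mono2) auto
    also have "\<dots> = (\<Sum>m\<in>{1..<Suc N}. b m) + (\<Sum>m\<in>{Suc N..<max k (Suc N)}. b m)"
      by (rule sum.union_disjoint) auto
    also have "(\<Sum>m\<in>{1..<Suc N}. b m) = 2 * (1 / sqrt e) * (\<Sum>m\<in>{1..<Suc N}. 1 / sqrt (real m))"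
      unfolding sum_distrib_left by (rule sum.cong) (auto simp: b_def)
    also have "\<dots> \<le> 2 * (1 / sqrt e) * (2 * sqrt (real N))"
      using assms by (intro mult_left_mono sum_inverse_sqrt_le) auto
    also have "\<dots> \<le> 2 * (1 / sqrt e) * (2 * sqrt (2 / e))"
      using assms N(2) by (intro mult_left_mono real_sqrt_le_mono) auto
    also have "\<dots> = 4 * sqrt 2 / e" using assms by (simp add: real_sqrt_divide divide_simps flip: real_sqrt_mult)
    also have "(\<Sum>m\<in>{Suc N..<max k (Suc N)}. b m) = 2 * (\<Sum>m\<in>{Suc N..<max k (Suc N)}. (1 - e) ^ m)"
      unfolding sum_distrib_left by (rule sum.cong) (auto simp: b_def)
    also have "\<dots> \<le> 2 * ((1 - e) ^ Suc N / e)" using assms by (intro mult_left_mono geometric_tail_le) auto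
    also have "\<dots> \<le> 2 * (1 / e)" using assms by (intro mult_left_mono divide_right_mono power_le_one) auto
    also have "4 * sqrt 2 / e + 2 * (1 / e) = (4 * sqrt 2 + 2) / e" by (simp add: add_divide_distrib)
    also have "\<dots> \<le> 12 / e" using assms sqrt2_less_2 by (intro divide_right_mono) auto
    finally show ?thesis by simp
  qed
  then have "exp (- 12 / e) \<le> exp (- (\<Sum>m\<in>{1..<k}. b m))" by simp
  also have "\<dots> = (\<Prod>m\<in>{1..<k}. exp (- b m))" by (simp add: exp_sum sum_negf[symmetric])
  also have "\<dots> \<le> (\<Prod>m\<in>{1..<k}. (1 - (1 - e) ^ m))" using fac by (intro prod_mono) auto
  finally show ?thesis .
qed

text \<open>Splits nucleation at the critical size \<open>m\<close>: reaching it has probability at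
  least \<open>q\<close>, and all further growth costs only a factor 1/2.\<close>

lemma square_nucleation_full:
  fixes r :: "'d::finite \<Rightarrow> nat"
  assumes V: "finite V" "0 < p" "p \<le> 1" and ax: "two_axes r j l v" and m: "1 \<le> m" "m \<le> k"
    and tail: "2 * real v * ((1 - p ^ v) ^ m / p ^ v) \<le> 1/2" and sub: "rect j l x (k * v) (k * v) \<subseteq> V"
    and start: "q \<le> Pr V p (fills r (rect j l x (m * v) (m * v)))" "0 \<le> q"
  shows "q / 2 \<le> Pr V p (fills r (rect j l x (k * v) (k * v)))"
proof -
  have p0: "0 \<le> p" using V by simp
  have "q * (1/2) \<le> Pr V p (fills r (rect j l x (m * v) (m * v))) * (\<Prod>n\<in>{m..<k}. (1 - (1 - p ^ v) ^ n)) ^ (2 * v)"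
    using V tail start Pr_nonneg[OF p0 V(3)] by (intro mult_mono tail_product_ge_half) (auto simp: power_le_one)
  also have "\<dots> \<le> Pr V p (fills r (rect j l x (k * v) (k * v)))"
    by (rule Pr_fills_square_grow[OF V(1) p0 V(3) ax m sub])
  finally show ?thesis by simp
qed

text \<open>Starts from a fully occupied square of critical size. This is wasteful, but sufficient
  for faces with a side exponential in \<open>Y\<close>.\<close>

lemma square_nucleation_crude:
  fixes r :: "'d::finite \<Rightarrow> nat"
  assumes V: "finite V" "0 < p" "p \<le> 1" and ax: "two_axes r j l v" and m: "1 \<le> m" "m \<le> k"
    and tail: "2 * real v * ((1 - p ^ v) ^ m / p ^ v) \<le> 1/2" and sub: "rect j l x (k * v) (k * v) \<subseteq> V"
  shows "p ^ ((m * v) * (m * v)) / 2 \<le> Pr V p (fills r (rect j l x (k * v) (k * v)))"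
proof (rule square_nucleation_full[OF V ax m tail sub])
  have jl: "j \<noteq> l" using ax by (simp add: two_axes_def)
  have "rect j l x (m * v) (m * v) \<subseteq> V" using rect_mono[OF jl, of "m * v" "k * v" "m * v" "k * v" x] m(2) sub by auto
  from Pr_fills_full[OF V(1) _ V(3) this, of r] V(2)
  show "p ^ ((m * v) * (m * v)) \<le> Pr V p (fills r (rect j l x (m * v) (m * v)))" by (simp add: card_rect[OF jl])
qed (use V in auto)

text \<open>The efficient nucleation for equal weights: start from a full square of side
  \<open>v\<close> and pay for every further unit. The 24 is the 12 of the product bound, doubled
  because a unit consists of \<open>2 * v\<close> lines.\<close>

lemma square_nucleation_equal:
  fixes r :: "'d::finite \<Rightarrow> nat"
  assumes V: "finite V" "0 < p" "p \<le> 1/2" and ax: "two_axes r j l v" and k: "1 \<le> k"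
    and sub: "rect j l x (k * v) (k * v) \<subseteq> V"
  shows "p ^ (v * v) * exp (- 24 * real v / p ^ v) \<le> Pr V p (fills r (rect j l x (k * v) (k * v)))"
proof -
  have p: "0 \<le> p" "p \<le> 1" using V by auto
  have jl: "j \<noteq> l" and v: "0 < v" using ax by (auto simp: two_axes_def)
  have sub1: "rect j l x (1 * v) (1 * v) \<subseteq> V" using rect_mono[OF jl, of "1 * v" "k * v" "1 * v" "k * v" x] k sub by auto
  have "p ^ v \<le> p ^ 1" using v p by (intro power_decreasing) auto
  then have pv: "p ^ v \<le> 1/2" "0 < p ^ v" using V by auto
  have "exp (- 24 * real v / p ^ v) = exp (- 12 / p ^ v) ^ (2 * v)" by (simp add: exp_of_nat_mult[symmetric])
  also have "\<dots> \<le> (\<Prod>m\<in>{1..<k}. (1 - (1 - p ^ v) ^ m)) ^ (2 * v)"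
    using pv by (intro power_mono nucleation_product_ge) auto
  finally have "p ^ (v * v) * exp (- 24 * real v / p ^ v) \<le> Pr V p (fills r (rect j l x (1 * v) (1 * v))) * (\<Prod>m\<in>{1..<k}. (1 - (1 - p ^ v) ^ m)) ^ (2 * v)"
    using Pr_fills_full[OF V(1) p sub1, of r] Pr_nonneg[OF p] p by (intro mult_mono) (auto simp: card_rect[OF jl])
  also have "\<dots> \<le> Pr V p (fills r (rect j l x (k * v) (k * v)))"
    by (rule Pr_fills_square_grow[OF V(1) p ax _ k sub]) simp
  finally show ?thesis .
qed

text \<open>The efficient nucleation for unequal weights: start from a full strip of
  \<open>v\<close> rows and width \<open>w\<close>. If \<open>w\<close> is about
  \<open>ln (1 / p) / p ^ r j\<close>, new rows, which need only \<open>r j\<close> sites, keep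
  coming with probability at least 1/2 until the strip is long; then the columns of larger weight
  follow. The cost \<open>p ^ (w * v)\<close> explains the squared logarithm.\<close>

lemma square_nucleation_strict:
  fixes r :: "'d::finite \<Rightarrow> nat"
  assumes V: "finite V" "0 < p" "p \<le> 1" and ax: "two_axes r j l v" and m: "1 \<le> m" "m \<le> k" and w: "r j \<le> w" "w \<le> m * v"
    and rows: "real (m * v) * (1 - p ^ r j) ^ (w div r j) \<le> 1/2"
    and cols: "real (m * v) * (1 - p ^ v) ^ m \<le> 1/2"
    and tail: "2 * real v * ((1 - p ^ v) ^ m / p ^ v) \<le> 1/2" and sub: "rect j l x (k * v) (k * v) \<subseteq> V"
  shows "p ^ (w * v) / 4 / 2 \<le> Pr V p (fills r (rect j l x (k * v) (k * v)))"
proof (rule square_nucleation_full[OF V ax m tail sub])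
  have p0: "0 \<le> p" using V by simp
  have jl: "j \<noteq> l" and r: "c \<noteq> j \<Longrightarrow> c \<noteq> l \<Longrightarrow> r c = 0" and rv: "0 < r j" "0 < r l" "r j \<le> v" "r l \<le> v" for c
    using ax by (auto simp: two_axes_def)
  have vm: "v \<le> m * v" using m(1) by simp
  have subm: "rect j l x (m * v) (m * v) \<subseteq> V" using rect_mono[OF jl, of "m * v" "k * v" "m * v" "k * v" x] m(2) sub by auto
  have subw: "rect j l x w (m * v) \<subseteq> V" using rect_mono[OF jl, of w "m * v" "m * v" "m * v" x] w subm by auto
  have subv: "rect j l x w v \<subseteq> V" using rect_mono[OF jl, of w w v "m * v" x] vm subw by auto
  have half: "1/2 \<le> (1 - a) ^ n" if "0 \<le> a" "a \<le> 1" "real N * a \<le> 1/2" "n \<le> N" for a :: real and n N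
  proof -
    have "real n * a \<le> real N * a" using that by (intro mult_right_mono) auto
    then show ?thesis using Bernoulli_inequality[of "- a" n] that by simp
  qed
  have "p ^ (w * v) \<le> Pr V p (fills r (rect j l x w v))" using Pr_fills_full[OF V(1) p0 V(3) subv, of r] by (simp add: card_rect[OF jl])
  then have "p ^ (w * v) * (1/2) \<le> Pr V p (fills r (rect j l x w v)) * (1 - (1 - p ^ r j) ^ (w div r j)) ^ (m * v - v)"
    using rows p0 V(3) by (intro mult_mono half[where N = "m * v"] Pr_nonneg) (auto simp: power_le_one)
  also have "\<dots> \<le> Pr V p (fills r (rect j l x w (m * v)))"
    using rv(4) vm p0 V(3) r by (intro Pr_fills_grow[OF V(1) p0 V(3) jl _ _ _ subw]) (auto simp: power_le_one)
  finally have "p ^ (w * v) * (1/2) * (1/2) \<le> Pr V p (fills r (rect j l x w (m * v))) * (1 - (1 - p ^ v) ^ m) ^ (m * v - w)"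
    using cols p0 V(3) by (intro mult_mono half[where N = "m * v"]) (auto simp: power_le_one intro!: Pr_nonneg)
  also have "\<dots> = Pr V p (fills r (rect l j x (m * v) w)) * (1 - (1 - p ^ v) ^ m) ^ (m * v - w)"
    by (simp add: rect_swap[OF jl])
  also have "\<dots> \<le> Pr V p (fills r (rect l j x (m * v) (m * v)))"
    using rv w p0 V(3) r subm rect_swap[OF jl, of x "m * v" "m * v"]
    by (intro Pr_fills_grow[OF V(1) p0 V(3) jl[symmetric]] run_rate_mono) (auto simp: power_le_one)
  also have "\<dots> = Pr V p (fills r (rect j l x (m * v) (m * v)))" by (simp add: rect_swap[OF jl])
  finally show "p ^ (w * v) / 4 \<le> Pr V p (fills r (rect j l x (m * v) (m * v)))" by simp
qed (use V in auto)

section \<open>Upper bound: choice of scales\<close>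

text \<open>The nucleus has side \<open>Y ^ 7\<close>, tiles have side \<open>2 ^ Y\<close>, and \<open>ln L\<close> is about \<open>Y ^ 24\<close>; the three error
  terms bound the probabilities that the successive kinds of faces fail to fill.\<close>

definition err1 :: "nat \<Rightarrow> real" where
  "err1 Y = exp (- (real Y ^ 2)) + 2 * real Y ^ 14 * exp (- (real Y ^ 2))"

definition err2 :: "nat \<Rightarrow> real" where
  "err2 Y = exp (- (exp (- real Y / 4) * (exp (real Y / 2) / real Y ^ 4 - 1))) + 2 * (real Y ^ 7 * exp (real Y)) * exp (- (real Y ^ 2))"

definition err3 :: "nat \<Rightarrow> real" where
  "err3 Y = exp (- (exp (- real Y / 4) * (exp (real Y / 2) / real Y ^ 27 - 1))) + 2 * (exp (real Y) * exp (real Y)) * exp (- (real Y ^ 25))"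

lemma power_two_bounds: "exp (real Y / 2) \<le> 2 ^ Y" "2 ^ Y \<le> exp (real Y)"
proof -
  have "exp (1/2) \<le> (2::real)"
  proof (rule power2_le_imp_le)
    show "(exp (1/2))\<^sup>2 \<le> (2::real)\<^sup>2" using exp_le by (simp add: power2_eq_square exp_add[symmetric])
  qed simp
  then have "exp (1/2) ^ Y \<le> (2::real) ^ Y" by (intro power_mono) auto
  then show "exp (real Y / 2) \<le> 2 ^ Y" by (simp add: exp_of_nat_mult[symmetric])
  have "(2::real) \<le> exp 1" using exp_ge_add_one_self[of 1] by simp
  then have "(2::real) ^ Y \<le> exp 1 ^ Y" by (intro power_mono) auto
  then show "2 ^ Y \<le> exp (real Y)" by (simp add: exp_of_nat_mult[symmetric])
qed

lemma power_one_minus_le_exp: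
  assumes "0 \<le> (x::real)" "x \<le> 1" "0 \<le> z" "z \<le> real n * x"
  shows "(1 - x) ^ n \<le> exp (- z)"
proof -
  have "(1 - x) ^ n \<le> exp (- x) ^ n" using assms exp_ge_add_one_self[of "- x"] by (intro power_mono) auto
  also have "\<dots> = exp (- (real n * x))" by (simp add: exp_of_nat_mult[symmetric])
  also have "\<dots> \<le> exp (- z)" using assms by simp
  finally show ?thesis .
qed

lemma div_ge_minus_1: "real m / real n - 1 \<le> real (m div n)"
  using floor_divide_of_nat_eq[of m n, where ?'a = real] by linarith

text \<open>How the powers of \<open>Y\<close> fit together. A nucleus has \<open>Y ^ 21\<close>
  sites, each occupied with probability at least \<open>exp (- Y)\<close>, so it costs at most a
  factor \<open>exp (- (Y ^ 22))\<close>, against about \<open>exp (Y ^ 24 - Y)\<close> tiles along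
  an edge. In the last kind of face the squares have side \<open>Y ^ 26 * c\<close>, so that a
  segment lacks a run with probability at most \<open>exp (- (Y ^ 25))\<close>; this survives
  multiplication by \<open>L ^ 3\<close>, since \<open>ln L \<le> (Y + 1) ^ 24\<close>. These
  squares must fit into a tile, hence the condition on \<open>Y ^ 27\<close>.\<close>

lemma upper_bound_pointwise:
  fixes r :: "'d::finite \<Rightarrow> nat"
  assumes p: "0 < p" "p \<le> 1" and ax: "UNIV = {i, j, l}" "i \<noteq> j" "i \<noteq> l" "j \<noteq> l"
    and r: "\<And>c. 0 < r c" "r j \<le> r l" "r l \<le> r i"
    and Y: "1 \<le> Y" "r i \<le> Y" "real Y ^ 27 \<le> exp (real Y / 2)" and pY: "1 / real Y \<le> p ^ r i" "exp (- real Y) \<le> p"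
    and \<rho>: "\<And>L x. rect j l x (Y ^ 3 * r l) (Y ^ 3 * r l) \<subseteq> box0 L \<Longrightarrow>
      1 / real Y \<le> Pr (box0 L) p (fills (r(i := 0)) (rect j l x (Y ^ 3 * r l) (Y ^ 3 * r l)))"
    and m: "1 \<le> m" "m \<le> Y ^ 3" "2 * real (r i) * ((1 - p ^ r i) ^ m / p ^ r i) \<le> 1/2"
      "exp (- real Y / 4) \<le> p ^ ((m * r i) * (m * r i)) / 2"
    and err: "exp (real Y) * (err1 Y + err2 Y + err3 Y) \<le> 1/2"
    and L: "exp (real Y ^ 24) \<le> real L" "real L \<le> exp ((real Y + 1) ^ 24)"
  shows "Pr (box0 L) p (\<lambda>A. \<not> fills r (box0 L) A) \<le>
    exp (- (exp (- (real Y ^ 22)) / 2 * (exp (real Y ^ 24) / exp (real Y) - 1))) + 3 * (exp ((real Y + 1) ^ 24) + 1) ^ 3 * err3 Y"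
proof -
  define c where "c = r i"
  let ?V = "box0 L :: ('d \<Rightarrow> int) set" and ?X = "Y ^ 7" and ?U = "2 ^ Y :: nat"
  have p0: "0 \<le> p" using p by simp
  note V = finite_box0[of L, where ?'d = 'd] p0 p(2)
  have card3: "CARD('d) = 3" by (subst ax(1)) (simp add: ax(2-4))
  have in3: "e = i \<or> e = j \<or> e = l" for e using ax(1) by blast
  have rc: "r e \<le> c" for e using in3[of e] r(2,3) unfolding c_def by auto
  have c0: "0 < c" "c \<le> Y" using r(1) Y(2) by (auto simp: c_def)
  have Yk: "Y ^ a \<le> Y ^ b" if "a \<le> b" for a b using Y(1) that by (intro power_increasing) auto
  have YX: "Y \<le> ?X" using Yk[of 1 7] by simp
  have "real (Y ^ 27) \<le> real ?U" using Y(3) power_two_bounds(1)[of Y] by simp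
  then have Y27: "Y ^ 27 \<le> ?U" unfolding of_nat_le_iff .
  then have XU: "?X \<le> ?U" using Yk[of 7 27] by simp
  have axes: "two_axes (r(i := 0)) j l (r l)" "two_axes (r(j := 0)) l i c" "two_axes (r(i := 0)) j l c"
    "two_axes (r(l := 0)) i j c" "two_axes (r(j := 0)) i l c"
    using ax(2-4) in3 r rc unfolding two_axes_def by (auto; metis)+
  have run: "(1 - p ^ e) ^ (Y ^ Suc k) \<le> exp (- (real Y ^ k))" if "e \<le> c" for e k
  proof (rule power_one_minus_le_exp)
    have "p ^ c \<le> p ^ e" using p that by (intro power_decreasing) auto
    then have "1 / real Y \<le> p ^ e" using pY(1) by (simp add: c_def)
    then have "real (Y ^ Suc k) * (1 / real Y) \<le> real (Y ^ Suc k) * p ^ e" by (intro mult_left_mono) auto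
    then show "real Y ^ k \<le> real (Y ^ Suc k) * p ^ e" using Y(1) by simp
  qed (use p in \<open>auto simp: power_le_one\<close>)
  \<comment> \<open>A lower bound for the crude nucleation in a face containing the largest weight.
    A side \<open>2 ^ Y \<ge> exp (Y / 2)\<close> holds \<open>exp (Y / 2)\<close> squares up to a
    power of \<open>Y\<close>, so many of them are expected to fill.\<close>
  define \<rho>2 where "\<rho>2 = exp (- real Y / 4)"
  have \<rho>2: "\<rho>2 \<le> 1" "0 < \<rho>2" by (auto simp: \<rho>2_def)
  have crude: "\<rho>2 \<le> Pr ?V p (fills q (rect a b x (k * c) (k * c)))"
    if "two_axes q a b c" "m \<le> k" "rect a b x (k * c) (k * c) \<subseteq> ?V" for q a b x k
    using square_nucleation_crude[OF V(1) p that(1) m(1) that(2) _ that(3)] m(3,4) by (simp add: \<rho>2_def c_def)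
  have tile: "(1 - \<rho>2) ^ (?U div (Y ^ k * c)) \<le> exp (- (exp (- real Y / 4) * (exp (real Y / 2) / real Y ^ Suc k - 1)))" if "Suc k \<le> 27" for k
  proof (rule power_one_minus_le_exp)
    have Y0: "0 < real Y ^ Suc k" using Y(1) by simp
    have "real Y ^ Suc k \<le> real Y ^ 27" using Y(1) that by (intro power_increasing) auto
    then have "real Y ^ Suc k \<le> exp (real Y / 2)" using Y(3) by linarith
    then have "1 \<le> exp (real Y / 2) / real Y ^ Suc k" using Y0 by (simp add: le_divide_eq)
    then show "0 \<le> exp (- real Y / 4) * (exp (real Y / 2) / real Y ^ Suc k - 1)" by simp
    have "real (Y ^ k * c) \<le> real (Y ^ k * Y)" using c0 by (intro of_nat_mono mult_left_mono) auto
    then have "exp (real Y / 2) / real Y ^ Suc k \<le> real ?U / real (Y ^ k * c)"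
      using c0 Y(1) power_two_bounds(1)[of Y] by (intro frac_le) (auto simp: mult.commute)
    then have "exp (real Y / 2) / real Y ^ Suc k - 1 \<le> real (?U div (Y ^ k * c))" using div_ge_minus_1[of ?U "Y ^ k * c"] by linarith
    then show "exp (- real Y / 4) * (exp (real Y / 2) / real Y ^ Suc k - 1) \<le> real (?U div (Y ^ k * c)) * \<rho>2"
      unfolding \<rho>2_def by (subst mult.commute) (rule mult_right_mono, auto)
  qed (use \<rho>2 in auto)
  have e0: "0 \<le> err1 Y" "0 \<le> err2 Y" "0 \<le> err3 Y" by (auto simp: err1_def err2_def err3_def)
  \<comment> \<open>Here \<open>Y ^ 7\<close> splits as \<open>Y ^ 3 * Y ^ 3 * Y\<close>: at least
    \<open>Y ^ 3\<close> squares of side \<open>Y ^ 3 * r l\<close>, each filling with probability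
    at least \<open>1 / Y\<close>, all fail with probability at most
    \<open>exp (- (Y ^ 2))\<close>.\<close>
  have f1: "Pr ?V p (\<lambda>A. \<not> fills (r(i := 0)) (rect j l y ?X ?X) A) \<le> err1 Y" if "rect j l y ?X ?X \<subseteq> ?V" for y
  proof -
    have l0: "0 < r l" "r l \<le> Y" using r(1) rc[of l] c0(2) by auto
    have "Y ^ 3 * (Y ^ 3 * r l) \<le> Y ^ 3 * (Y ^ 3 * Y)" using l0(2) by (intro mult_left_mono) auto
    also have "\<dots> = ?X" by (simp add: eval_nat_numeral)
    finally have le: "Y ^ 3 * (Y ^ 3 * r l) \<le> ?X" .
    have "1 * (Y ^ 3 * r l) \<le> Y ^ 3 * (Y ^ 3 * r l)" using Y(1) by (intro mult_right_mono) auto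
    then have "Y ^ 3 * r l \<le> ?X" using le by linarith
    moreover have "1 * r l \<le> Y ^ 3 * r l" using Y(1) by (intro mult_right_mono) auto
    ultimately have s: "r l \<le> Y ^ 3 * r l" "Y ^ 3 * r l \<le> ?X" by simp_all
    have "Pr ?V p (\<lambda>A. \<not> fills (r(i := 0)) (rect j l y ?X ?X) A) \<le> (1 - 1 / real Y) ^ (?X div (Y ^ 3 * r l))
      + 2 * real (?X * ?X) * (1 - p ^ r l) ^ (Y ^ 3 * r l div r l)"
      using Y(1) \<rho> by (intro rect_fail[OF V axes(1) s that]) auto
    also have "\<dots> \<le> exp (- (real Y ^ 2)) + 2 * real (?X * ?X) * exp (- (real Y ^ 2))"
    proof (intro add_mono mult_left_mono)
      have "Y ^ 3 \<le> ?X div (Y ^ 3 * r l)" using le l0(1) Y(1) by (subst less_eq_div_iff_mult_less_eq) auto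
      then have "real Y ^ 3 \<le> real (?X div (Y ^ 3 * r l))" by (metis of_nat_le_iff of_nat_power)
      then have "real Y ^ 3 * (1 / real Y) \<le> real (?X div (Y ^ 3 * r l)) * (1 / real Y)" by (intro mult_right_mono) auto
      moreover have "real Y ^ 3 * (1 / real Y) = real Y ^ 2" using Y(1) by (simp add: eval_nat_numeral)
      ultimately show "(1 - 1 / real Y) ^ (?X div (Y ^ 3 * r l)) \<le> exp (- (real Y ^ 2))"
        using Y(1) by (intro power_one_minus_le_exp) auto
      show "(1 - p ^ r l) ^ (Y ^ 3 * r l div r l) \<le> exp (- (real Y ^ 2))"
        using run[of "r l" 2] rc[of l] l0(1) by (simp add: eval_nat_numeral)
    qed auto
    also have "\<dots> = err1 Y" by (simp add: err1_def power_add[symmetric])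
    finally show ?thesis .
  qed
  have f2: "Pr ?V p (\<lambda>A. \<not> fills (r(j := 0)) (rect l i y ?X ?U) A) \<le> err2 Y" if "rect l i y ?X ?U \<subseteq> ?V" for y
  proof -
    have "Y ^ 3 * c \<le> Y ^ 3 * Y" using c0(2) by simp
    also have "\<dots> \<le> ?X" using Yk[of 4 7] by (simp add: eval_nat_numeral)
    finally have s: "c \<le> Y ^ 3 * c" "Y ^ 3 * c \<le> ?X" using Y(1) by auto
    have "Pr ?V p (\<lambda>A. \<not> fills (r(j := 0)) (rect l i y ?X ?U) A) \<le> (1 - \<rho>2) ^ (?U div (Y ^ 3 * c))
      + 2 * real (?X * ?U) * (1 - p ^ c) ^ (Y ^ 3 * c div c)"
      by (intro rect_fail[OF V axes(2) s that] crude[OF axes(2) m(2)] \<rho>2)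
    also have "\<dots> \<le> exp (- (exp (- real Y / 4) * (exp (real Y / 2) / real Y ^ 4 - 1))) + 2 * (real Y ^ 7 * exp (real Y)) * exp (- (real Y ^ 2))"
    proof (intro add_mono mult_mono)
      show "(1 - \<rho>2) ^ (?U div (Y ^ 3 * c)) \<le> exp (- (exp (- real Y / 4) * (exp (real Y / 2) / real Y ^ 4 - 1)))"
        using tile[of 3] by (simp add: eval_nat_numeral)
      show "(1 - p ^ c) ^ (Y ^ 3 * c div c) \<le> exp (- (real Y ^ 2))" using run[of c 2] c0(1) by (simp add: eval_nat_numeral)
      show "real (?X * ?U) \<le> real Y ^ 7 * exp (real Y)" using power_two_bounds(2)[of Y] by (simp add: mult_left_mono)
    qed (use p in \<open>auto simp: power_le_one\<close>)
    also have "\<dots> = err2 Y" by (simp add: err2_def)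
    finally show ?thesis .
  qed
  have f3: "Pr ?V p (\<lambda>A. \<not> fills q (rect a b y ?U ?U) A) \<le> err3 Y" if q: "two_axes q a b c" and "rect a b y ?U ?U \<subseteq> ?V" for q a b y
  proof -
    have "Y ^ 26 * c \<le> Y ^ 26 * Y" using c0(2) by simp
    also have "\<dots> = Y ^ 27" by (simp flip: power_Suc2)
    also note Y27
    finally have s: "c \<le> Y ^ 26 * c" "Y ^ 26 * c \<le> ?U" using Y(1) by auto
    have mk: "m \<le> Y ^ 26" using m(2) Yk[of 3 26] by simp
    have "Pr ?V p (\<lambda>A. \<not> fills q (rect a b y ?U ?U) A) \<le> (1 - \<rho>2) ^ (?U div (Y ^ 26 * c))
      + 2 * real (?U * ?U) * (1 - p ^ c) ^ (Y ^ 26 * c div c)"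
      by (intro rect_fail[OF V q s that(2)] crude[OF q mk] \<rho>2)
    also have "\<dots> \<le> exp (- (exp (- real Y / 4) * (exp (real Y / 2) / real Y ^ 27 - 1))) + 2 * (exp (real Y) * exp (real Y)) * exp (- (real Y ^ 25))"
    proof (intro add_mono mult_mono)
      show "(1 - \<rho>2) ^ (?U div (Y ^ 26 * c)) \<le> exp (- (exp (- real Y / 4) * (exp (real Y / 2) / real Y ^ 27 - 1)))"
        using tile[of 26] by simp
      show "real (?U * ?U) \<le> exp (real Y) * exp (real Y)"
        unfolding of_nat_mult using power_two_bounds(2)[of Y] by (intro mult_mono) auto
      show "(1 - p ^ c) ^ (Y ^ 26 * c div c) \<le> exp (- (real Y ^ 25))" using run[of c 25] c0(1) by simp
    qed (use p in \<open>auto simp: power_le_one\<close>)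
    also have "\<dots> = err3 Y" by (simp add: err3_def)
    finally show ?thesis .
  qed
  define \<rho>B where "\<rho>B = exp (- (real Y ^ 22)) / 2"
  have block: "\<rho>B \<le> Pr ?V p (fills r (cube_at x ?U))" if "cube_at x ?U \<subseteq> ?V" for x
  proof -
    have "p ^ (?X ^ 3) * (1 - real ?U * (err1 Y + err2 Y + err3 Y)) \<le> Pr ?V p (fills r (cube_at x ?U))"
    proof (rule Pr_block[OF V ax _ XU that f1 f2 f3 e0])
      show "r e \<le> ?X" for e using rc[of e] c0(2) YX by linarith
    qed (use axes(4) in auto)
    moreover have "exp (- (real Y ^ 22)) * (1/2) \<le> p ^ (?X ^ 3) * (1 - real ?U * (err1 Y + err2 Y + err3 Y))"
    proof (rule mult_mono)
      have "exp (- (real Y ^ 22)) = exp (- real Y) ^ (?X ^ 3)"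
        by (simp add: exp_of_nat_mult[symmetric] flip: power_mult power_Suc2)
      also have "\<dots> \<le> p ^ (?X ^ 3)" using pY(2) by (intro power_mono) auto
      finally show "exp (- (real Y ^ 22)) \<le> p ^ (?X ^ 3)" .
      have "real ?U * (err1 Y + err2 Y + err3 Y) \<le> exp (real Y) * (err1 Y + err2 Y + err3 Y)"
        using power_two_bounds(2)[of Y] e0 by (intro mult_right_mono) auto
      with err show "1/2 \<le> 1 - real ?U * (err1 Y + err2 Y + err3 Y)" by linarith
    qed (use p in auto)
    ultimately show ?thesis by (simp add: \<rho>B_def)
  qed
  have \<rho>B1: "\<rho>B \<le> 1" "0 \<le> \<rho>B" by (auto simp: \<rho>B_def intro: order_trans[of _ 1])
  have UL: "real ?U \<le> real L"
  proof -
    have "real ?U \<le> exp (real Y)" using power_two_bounds(2)[of Y] by simp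
    also have "\<dots> \<le> exp (real Y ^ 24)" using Y(1) by (simp add: self_le_power)
    finally show ?thesis using L(1) by linarith
  qed
  have sq: "Pr ?V p (\<lambda>A. \<not> fills (r(e := 0)) (square e x ?U) A) \<le> err3 Y" if "square e x ?U \<subseteq> ?V" for e x
  proof -
    have ax': "UNIV = {j, i, l}" "UNIV = {l, i, j}" using ax(1) by auto
    consider "e = i" | "e = j" | "e = l" using in3 by blast
    then show ?thesis
    proof cases
      case 1
      then show ?thesis using that f3[OF axes(3)] square_eq_rect[OF ax] by simp
    next
      case 2
      then show ?thesis using that f3[OF axes(5)] square_eq_rect[OF ax'(1) ax(2)[symmetric] ax(4) ax(3)] by simp
    next
      case 3
      then show ?thesis using that f3[OF axes(4)] square_eq_rect[OF ax'(2) ax(3)[symmetric] ax(4)[symmetric] ax(2)] by simp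
    qed
  qed
  have "Pr ?V p (\<lambda>A. \<not> fills r ?V A) \<le> (1 - \<rho>B) ^ ((L + 1) div ?U) + real CARD('d) * real (L + 1) ^ CARD('d) * err3 Y"
  proof (rule Pr_cube[OF p0 p(2) _ _ _ block \<rho>B1(1) sq e0(3)])
    show "r e \<le> ?U" for e using rc[of e] c0(2) YX XU by linarith
    show "?U \<le> L + 1" using UL by linarith
  qed auto
  also have "\<dots> \<le> exp (- (\<rho>B * (exp (real Y ^ 24) / exp (real Y) - 1))) + 3 * (exp ((real Y + 1) ^ 24) + 1) ^ 3 * err3 Y"
  proof (intro add_mono)
    have "real L \<le> real (L + 1)" by simp
    then have "exp (real Y ^ 24) / exp (real Y) \<le> real (L + 1) / real ?U"
      using L(1) power_two_bounds(2)[of Y] by (intro frac_le) auto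
    then have N: "exp (real Y ^ 24) / exp (real Y) - 1 \<le> real ((L + 1) div ?U)" using div_ge_minus_1[of "L + 1" ?U] by linarith
    have "exp (real Y) \<le> exp (real Y ^ 24)" using Y(1) by (simp add: self_le_power)
    then have nn: "0 \<le> exp (real Y ^ 24) / exp (real Y) - 1" by (simp add: le_divide_eq)
    show "(1 - \<rho>B) ^ ((L + 1) div ?U) \<le> exp (- (\<rho>B * (exp (real Y ^ 24) / exp (real Y) - 1)))"
      using \<rho>B1 nn N by (intro power_one_minus_le_exp) (auto simp: mult.commute intro: mult_left_mono)
    show "real CARD('d) * real (L + 1) ^ CARD('d) * err3 Y \<le> 3 * (exp ((real Y + 1) ^ 24) + 1) ^ 3 * err3 Y"
      unfolding card3 using L(2) e0(3) by (intro mult_right_mono mult_mono power_mono) auto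
  qed
  finally show ?thesis by (simp add: \<rho>B_def)
qed

lemma err_tendsto:
  "((\<lambda>Y::nat. exp (real Y) * (err1 Y + err2 Y + err3 Y)) \<longlongrightarrow> 0) at_top"
proof -
  have 1: "((\<lambda>Y::nat. exp (real Y) * (exp (- (real Y ^ 2)) + 2 * real Y ^ 14 * exp (- (real Y ^ 2)))) \<longlongrightarrow> 0) at_top"
    by real_asymp
  have 2: "((\<lambda>Y::nat. exp (real Y) * exp (- (exp (- real Y / 4) * (exp (real Y / 2) / real Y ^ 4 - 1)))) \<longlongrightarrow> 0) at_top"
    by real_asymp
  have 3: "((\<lambda>Y::nat. exp (real Y) * (2 * (real Y ^ 7 * exp (real Y)) * exp (- (real Y ^ 2)))) \<longlongrightarrow> 0) at_top"
    by real_asymp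
  have 4: "((\<lambda>Y::nat. exp (real Y) * exp (- (exp (- real Y / 4) * (exp (real Y / 2) / real Y ^ 27 - 1)))) \<longlongrightarrow> 0) at_top"
    by real_asymp
  have 5: "((\<lambda>Y::nat. exp (real Y) * (2 * (exp (real Y) * exp (real Y)) * exp (- (real Y ^ 25)))) \<longlongrightarrow> 0) at_top"
    by real_asymp
  show ?thesis using tendsto_add[OF tendsto_add[OF 1 tendsto_add[OF 2 3]] tendsto_add[OF 4 5]]
    by (simp add: err1_def err2_def err3_def distrib_left add.assoc)
qed

lemma final_err_tendsto:
  "((\<lambda>Y::nat. exp (- (exp (- (real Y ^ 22)) / 2 * (exp (real Y ^ 24) / exp (real Y) - 1))) + 3 * (exp ((real Y + 1) ^ 24) + 1) ^ 3 * err3 Y) \<longlongrightarrow> 0) at_top"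
proof -
  have 1: "((\<lambda>Y::nat. exp (- (exp (- (real Y ^ 22)) / 2 * (exp (real Y ^ 24) / exp (real Y) - 1)))) \<longlongrightarrow> 0) at_top"
    by real_asymp
  have 2: "((\<lambda>Y::nat. 3 * (exp ((real Y + 1) ^ 24) + 1) ^ 3 * exp (- (exp (- real Y / 4) * (exp (real Y / 2) / real Y ^ 27 - 1)))) \<longlongrightarrow> 0) at_top"
    by real_asymp
  have 3: "((\<lambda>Y::nat. 3 * (exp ((real Y + 1) ^ 24) + 1) ^ 3 * (2 * (exp (real Y) * exp (real Y)) * exp (- (real Y ^ 25)))) \<longlongrightarrow> 0) at_top"
    by real_asymp
  show ?thesis using tendsto_add[OF 1 tendsto_add[OF 2 3]]
    by (simp add: err3_def distrib_left)
qed

lemma upper_bound_general: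
  fixes r :: "'d::finite \<Rightarrow> nat"
  assumes ax: "UNIV = {i, j, l}" "i \<noteq> j" "i \<noteq> l" "j \<noteq> l"
    and r: "\<And>c. 0 < r c" "r j \<le> r l" "r l \<le> r i" and C: "0 \<le> C"
    and F: "\<forall>\<^sub>F p in at_right 0. 1 / p \<le> F p"
    and K0: "\<forall>\<^sub>F p in at_right 0. K0 p \<le> exp (1 / p) - 1"
    and sharp: "\<forall>\<^sub>F p in at_right 0. \<forall>L x k. K0 p \<le> real k \<longrightarrow> 1 \<le> k \<longrightarrow> rect j l x (k * r l) (k * r l) \<subseteq> box0 L \<longrightarrow>
      exp (- (C * F p)) \<le> Pr (box0 L) p (fills (r(i := 0)) (rect j l x (k * r l) (k * r l)))"
    and L: "\<forall>\<^sub>F p in at_right 0. exp (exp (24 * (C + 1) * F p)) < real (L p)"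
  shows "((\<lambda>p. Pr (box0 (L p)) p (\<lambda>A. \<not> fills r (box0 (L p)) A)) \<longlongrightarrow> 0) (at_right 0)"
proof -
  \<comment> \<open>Only a lower bound on \<open>L\<close> is given. Taking the 24th root of
    \<open>ln L\<close> traps \<open>ln L\<close> between \<open>Y ^ 24\<close> and
    \<open>(Y + 1) ^ 24\<close>, so the error terms become functions of \<open>Y\<close>
    alone.\<close>
  define Y where "Y p = nat \<lfloor>root 24 (ln (real (L p)))\<rfloor>" for p
  define c where "c = real (r i)"
  have c0: "0 < c" using r by (simp add: c_def)
  \<comment> \<open>A critical size for the crude nucleation: a line of \<open>m\<close> units lacks
    a run with probability at most \<open>exp (- 1 / p)\<close>, while \<open>m\<close> is only a
    power of \<open>1 / p\<close> and thus tiny compared with \<open>Y\<close>.\<close>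
  define m where "m p = nat \<lceil>(1 / p) ^ (r i + 1)\<rceil>" for p :: real
  have half: "\<forall>\<^sub>F p in at_right 0. 0 < p \<and> p \<le> (1/2::real)" by (rule eventually_at_right_0_half)
  have Yb: "\<forall>\<^sub>F p in at_right 0. exp ((C + 1) * F p) - 1 \<le> real (Y p) \<and> 1 \<le> F p \<and> exp (1 / p) - 1 \<le> real (Y p) \<and>
    exp (real (Y p) ^ 24) \<le> real (L p) \<and> real (L p) \<le> exp ((real (Y p) + 1) ^ 24)"
    using F L half
  proof eventually_elim
    case (elim p)
    have F1: "1 \<le> F p"
    proof -
      have "1 \<le> 1 / p" using elim(3) by simp
      then show ?thesis using elim(1) by linarith
    qed
    have L0: "0 < real (L p)" using elim(2) by (smt (verit) exp_gt_zero)
    have lnL: "exp (24 * (C + 1) * F p) < ln (real (L p))" using elim(2) L0 by (metis exp_gt_zero ln_exp ln_less_cancel_iff)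
    then have ln0: "0 < ln (real (L p))" by (smt (verit) exp_gt_zero)
    define R where "R = root 24 (ln (real (L p)))"
    have R0: "0 \<le> R" using ln0 by (simp add: R_def)
    have R24: "R ^ 24 = ln (real (L p))" using ln0 by (simp add: R_def)
    have "exp ((C + 1) * F p) ^ 24 = exp (24 * (C + 1) * F p)" by (simp add: exp_of_nat_mult[symmetric])
    then have "exp ((C + 1) * F p) ^ 24 \<le> R ^ 24" using lnL R24 by simp
    then have ER: "exp ((C + 1) * F p) \<le> R" using R0 by (rule power_le_imp_le_base[of _ 23, unfolded Suc_numeral, simplified])
    have YR: "real (Y p) \<le> R" "R < real (Y p) + 1" using R0 unfolding Y_def R_def[symmetric] by linarith+
    have 1: "exp ((C + 1) * F p) - 1 \<le> real (Y p)" using ER YR by linarith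
    have "1 * (1 / p) \<le> (C + 1) * F p" using elim(1) C F1 elim(3) by (intro mult_mono) auto
    then have "exp (1 / p) \<le> exp ((C + 1) * F p)" by simp
    then have 2: "exp (1 / p) - 1 \<le> real (Y p)" using 1 by linarith
    have "real (Y p) ^ 24 \<le> R ^ 24" using YR by (intro power_mono) auto
    then have 3: "exp (real (Y p) ^ 24) \<le> real (L p)" using R24 L0 by (metis exp_le_cancel_iff exp_ln)
    have "R ^ 24 \<le> (real (Y p) + 1) ^ 24" using YR R0 by (intro power_mono) auto
    then have 4: "real (L p) \<le> exp ((real (Y p) + 1) ^ 24)" using R24 L0 by (metis exp_le_cancel_iff exp_ln)
    show ?case using 1 2 3 4 F1 by blast
  qed
  have Ytop: "filterlim Y at_top (at_right 0)"
  proof -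
    have "filterlim (\<lambda>p::real. exp (1 / p) - 1) at_top (at_right 0)" by real_asymp
    then have "filterlim (\<lambda>p. real (Y p)) at_top (at_right 0)"
      by (rule filterlim_at_top_mono) (use Yb in eventually_elim, simp)
    then show ?thesis by (simp add: filterlim_at_top_iff_inverse_0 filterlim_sequentially_iff_filterlim_real)
  qed
  have evY: "\<forall>\<^sub>F Y in at_top. r i \<le> Y \<and> 1 \<le> Y \<and> real Y ^ 27 \<le> exp (real Y / 2) \<and> exp (real Y) * (err1 Y + err2 Y + err3 Y) \<le> 1/2"
  proof (intro eventually_conj)
    show "\<forall>\<^sub>F Y in at_top. exp (real Y) * (err1 Y + err2 Y + err3 Y) \<le> 1/2"
      using order_tendstoD(2)[OF err_tendsto, of "1/2"] by (auto elim: eventually_mono)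
    show "\<forall>\<^sub>F Y::nat in at_top. real Y ^ 27 \<le> exp (real Y / 2)" by real_asymp
  qed (auto intro: eventually_ge_at_top)
  \<comment> \<open>The comparisons needed between powers of \<open>1 / p = exp h\<close> and the
    lower bound \<open>exp (exp h) - 1\<close> for \<open>Y\<close>.\<close>
  define G where "G h \<longleftrightarrow> exp (c * h) \<le> exp (exp h) - 1 \<and> h \<le> exp (exp h) - 1 \<and> exp ((c + 1) * h) + 1 \<le> exp (exp h) - 1 \<and>
    2 * c * (exp (- exp h) * exp (c * h)) \<le> 1/2 \<and> h * (c * (exp ((c + 1) * h) + 1)) ^ 2 + 1 \<le> (exp (exp h) - 1) / 4" for h
  have evG: "\<forall>\<^sub>F h in at_top. G h" unfolding G_def
  proof (intro eventually_conj)
    show "\<forall>\<^sub>F h in at_top. exp (c * h) \<le> exp (exp h) - 1" using c0 by real_asymp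
    show "\<forall>\<^sub>F h::real in at_top. h \<le> exp (exp h) - 1" by real_asymp
    show "\<forall>\<^sub>F h in at_top. exp ((c + 1) * h) + 1 \<le> exp (exp h) - 1" using c0 by real_asymp
    show "\<forall>\<^sub>F h in at_top. 2 * c * (exp (- exp h) * exp (c * h)) \<le> 1/2" using c0 by real_asymp
    show "\<forall>\<^sub>F h in at_top. h * (c * (exp ((c + 1) * h) + 1)) ^ 2 + 1 \<le> (exp (exp h) - 1) / 4" using c0 by real_asymp
  qed
  let ?g = "\<lambda>Y::nat. exp (- (exp (- (real Y ^ 22)) / 2 * (exp (real Y ^ 24) / exp (real Y) - 1))) + 3 * (exp ((real Y + 1) ^ 24) + 1) ^ 3 * err3 Y"
  have up: "\<forall>\<^sub>F p in at_right 0. Pr (box0 (L p)) p (\<lambda>A. \<not> fills r (box0 (L p)) A) \<le> ?g (Y p)"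
    using Yb half sharp K0 eventually_compose_filterlim[OF evY Ytop] eventually_compose_filterlim[OF evG filterlim_ln_inverse]
  proof eventually_elim
    case (elim p)
    note Yp = elim(1) and pp = elim(2) and sh = elim(3) and k0 = elim(4) and Yc = elim(5) and Gh = elim(6)
    define h where "h = ln (1 / p)"
    have p0: "0 < p" "p \<le> 1" "0 \<le> p" using pp by auto
    have ph: "p = exp (- h)" using p0 by (simp add: h_def ln_div)
    have P: "1 / p = exp h" by (simp add: ph exp_minus field_simps)
    have Pn: "(1 / p) ^ n = exp (real n * h)" for n unfolding P by (simp add: exp_of_nat_mult[symmetric])
    have pn: "p ^ n = exp (- (real n * h))" for n by (simp add: ph exp_of_nat_mult[symmetric])
    have h0: "0 \<le> h" using p0 by (simp add: h_def)
    have G: "exp (c * h) \<le> real (Y p)" "h \<le> real (Y p)" "exp ((c + 1) * h) + 1 \<le> real (Y p)"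
      "2 * c * (exp (- exp h) * exp (c * h)) \<le> 1/2" "h * (c * (exp ((c + 1) * h) + 1)) ^ 2 + 1 \<le> real (Y p) / 4"
    proof -
      have g: "G h" using Gh by (simp only: h_def)
      have y: "exp (exp h) - 1 \<le> real (Y p)" using Yp by (simp add: P)
      show "exp (c * h) \<le> real (Y p)" "h \<le> real (Y p)" "exp ((c + 1) * h) + 1 \<le> real (Y p)"
        "2 * c * (exp (- exp h) * exp (c * h)) \<le> 1/2"
        using g y unfolding G_def by linarith+
      have "h * (c * (exp ((c + 1) * h) + 1)) ^ 2 + 1 \<le> (exp (exp h) - 1) / 4" using g unfolding G_def by (elim conjE)
      also have "\<dots> \<le> real (Y p) / 4" using y by simp
      finally show "h * (c * (exp ((c + 1) * h) + 1)) ^ 2 + 1 \<le> real (Y p) / 4" .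
    qed
    have Y0: "1 \<le> Y p" "0 < real (Y p)" using Yc by auto
    have Y3: "Y p \<le> Y p ^ 3" using Y0(1) by (simp add: self_le_power)
    have mp: "1 \<le> m p" "real (m p) \<le> exp ((c + 1) * h) + 1" "exp ((c + 1) * h) \<le> real (m p)"
      using nat_ceiling_bounds[of "(1 / p) ^ (r i + 1)"] p0 unfolding m_def Pn by (auto simp: c_def add.commute)
    show ?case
    proof (rule upper_bound_pointwise[OF p0(1,2) ax r])
      show "1 \<le> Y p" "r i \<le> Y p" "real (Y p) ^ 27 \<le> exp (real (Y p) / 2)"
        "exp (real (Y p)) * (err1 (Y p) + err2 (Y p) + err3 (Y p)) \<le> 1/2" using Yc by auto
      show "1 / real (Y p) \<le> p ^ r i"
        using G(1) Y0 unfolding pn c_def by (simp add: exp_minus field_simps)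
      show "exp (- real (Y p)) \<le> p" using G(2) by (simp add: ph)
      show "exp (real (Y p) ^ 24) \<le> real (L p)" "real (L p) \<le> exp ((real (Y p) + 1) ^ 24)" using Yp by auto
      show "1 \<le> m p" by (rule mp(1))
      have "real (m p) \<le> real (Y p)" using mp(2) G(3) by linarith
      then show "m p \<le> Y p ^ 3" using Y3 by linarith
      show "2 * real (r i) * ((1 - p ^ r i) ^ m p / p ^ r i) \<le> 1 / 2"
      proof -
        have "(1 - p ^ r i) ^ m p \<le> exp (- exp h)"
        proof (rule power_one_minus_le_exp)
          have "exp h = exp ((c + 1) * h) * p ^ r i" by (simp add: pn c_def exp_add[symmetric] algebra_simps)
          also have "\<dots> \<le> real (m p) * p ^ r i" using mp(3) p0 by (intro mult_right_mono) auto
          finally show "exp h \<le> real (m p) * p ^ r i" .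
        qed (use p0 in \<open>auto simp: power_le_one\<close>)
        then have "(1 - p ^ r i) ^ m p / p ^ r i \<le> exp (- exp h) / p ^ r i" using p0 by (intro divide_right_mono) auto
        also have "\<dots> = exp (- exp h) * exp (c * h)" by (simp add: pn c_def exp_minus field_simps)
        finally have "2 * c * ((1 - p ^ r i) ^ m p / p ^ r i) \<le> 2 * c * (exp (- exp h) * exp (c * h))"
          using c0 by (intro mult_left_mono) auto
        with G(4) show ?thesis by (simp add: c_def)
      qed
      show "exp (- real (Y p) / 4) \<le> p ^ (m p * r i * (m p * r i)) / 2"
      proof -
        have "real (m p * r i) \<le> c * (exp ((c + 1) * h) + 1)"
          using mp(2) c0 by (simp add: c_def mult.commute mult_left_mono)
        then have "real (m p * r i) ^ 2 \<le> (c * (exp ((c + 1) * h) + 1)) ^ 2" by (intro power_mono) auto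
        then have "h * real (m p * r i) ^ 2 \<le> h * (c * (exp ((c + 1) * h) + 1)) ^ 2" using h0 by (intro mult_left_mono)
        then have "h * real (m p * r i) ^ 2 + 1 \<le> real (Y p) / 4" using G(5) by linarith
        then have "exp (- real (Y p) / 4) \<le> exp (- (h * real (m p * r i) ^ 2) - 1)" by simp
        also have "\<dots> = p ^ (m p * r i * (m p * r i)) * exp (- 1)"
          by (simp add: pn exp_add[symmetric] power2_eq_square algebra_simps)
        also have "\<dots> \<le> p ^ (m p * r i * (m p * r i)) * (1/2)"
          using exp_ge_add_one_self[of 1] p0 by (intro mult_left_mono) (auto simp: exp_minus field_simps)
        finally show ?thesis by simp
      qed
      fix L' x assume sub: "rect j l x (Y p ^ 3 * r l) (Y p ^ 3 * r l) \<subseteq> box0 L'"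
      have "real (Y p) \<le> real (Y p ^ 3)" using Y3 by (simp only: of_nat_le_iff)
      then have kk: "K0 p \<le> real (Y p ^ 3)" using k0 Yp by linarith
      have "exp (- (C * F p)) \<le> Pr (box0 L') p (fills (r(i := 0)) (rect j l x (Y p ^ 3 * r l) (Y p ^ 3 * r l)))"
        using sh kk sub Y0(1) by simp
      \<comment> \<open>The \<open>1\<close> in \<open>C + 1\<close> provides a spare factor
        \<open>exp (F p) \<ge> 1 + F p\<close>, which absorbs what is lost by rounding in
        \<open>Y\<close>.\<close>
      moreover have "1 / real (Y p) \<le> exp (- (C * F p))"
      proof -
        have "exp (C * F p) * 1 \<le> exp (C * F p) * F p" using Yp by (intro mult_left_mono) auto
        moreover have "1 \<le> exp (C * F p)" using C Yp by simp
        moreover have "exp (C * F p) * (1 + F p) \<le> exp (C * F p) * exp (F p)" by (intro mult_left_mono exp_ge_add_one_self) auto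
        moreover have "exp (C * F p) * exp (F p) = exp ((C + 1) * F p)" by (simp add: exp_add[symmetric] algebra_simps)
        ultimately have "exp (C * F p) \<le> real (Y p)" using Yp unfolding distrib_left by linarith
        then show ?thesis using Y0(2) by (simp add: exp_minus field_simps)
      qed
      ultimately show "1 / real (Y p) \<le> Pr (box0 L') p (fills (r(i := 0)) (rect j l x (Y p ^ 3 * r l) (Y p ^ 3 * r l)))"
        by linarith
    qed
  qed
  have lim: "((\<lambda>p. ?g (Y p)) \<longlongrightarrow> 0) (at_right 0)"
    by (rule filterlim_compose[OF final_err_tendsto Ytop])
  have low: "\<forall>\<^sub>F p in at_right 0. 0 \<le> Pr (box0 (L p)) p (\<lambda>A. \<not> fills r (box0 (L p)) A)"
    using half by eventually_elim (auto intro: Pr_nonneg)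
  show ?thesis by (rule tendsto_sandwich[OF low up tendsto_const lim])
qed

text \<open>The cost \<open>p ^ (b * b)\<close> of the starting square is
  \<open>exp (- b * b * ln (1 / p))\<close>, and \<open>ln (1 / p) \<le> (1 / p) ^ b\<close> merges
  it into the main term.\<close>

lemma nucleation_rate_equal:
  fixes r :: "'d::finite \<Rightarrow> nat"
  assumes ax: "two_axes q j l b" and p: "0 < p" "p \<le> 1/2" and k: "1 \<le> k" and sub: "rect j l x (k * b) (k * b) \<subseteq> box0 L"
  shows "exp (- ((real (b * b) + 24 * real b) * (1 / p) ^ b)) \<le> Pr (box0 L) p (fills q (rect j l x (k * b) (k * b)))"
proof -
  define h where "h = ln (1 / p)"
  have ph: "p = exp (- h)" using p by (simp add: h_def ln_div)
  have b: "0 < b" using ax by (auto simp: two_axes_def)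
  have "h \<le> 1 / p" unfolding h_def using p by (intro ln_bound) auto
  also have "\<dots> \<le> (1 / p) ^ b" using p b by (intro self_le_power) auto
  finally have "real (b * b) * h \<le> real (b * b) * (1 / p) ^ b" by (intro mult_left_mono) auto
  moreover have "p ^ (b * b) * exp (- 24 * real b / p ^ b) = exp (- (real (b * b) * h) - 24 * real b * (1 / p) ^ b)"
  proof -
    have "p ^ (b * b) = exp (- (real (b * b) * h))" by (simp add: ph exp_of_nat_mult[symmetric])
    moreover have "- 24 * real b / p ^ b = - (24 * real b * (1 / p) ^ b)" by (simp add: power_divide)
    ultimately show ?thesis by (simp add: exp_add[symmetric])
  qed
  ultimately have "exp (- ((real (b * b) + 24 * real b) * (1 / p) ^ b)) \<le> p ^ (b * b) * exp (- 24 * real b / p ^ b)"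
    by (simp add: distrib_right)
  also have "\<dots> \<le> Pr (box0 L) p (fills q (rect j l x (k * b) (k * b)))"
    by (rule square_nucleation_equal[OF finite_box0 p ax k sub])
  finally show ?thesis .
qed

lemma nucleation_rate_strict:
  fixes q :: "'d::finite \<Rightarrow> nat"
  assumes ax: "two_axes q j l b" and ab: "q j < b"
  shows "\<exists>C\<ge>0. \<forall>\<^sub>F p in at_right 0. \<forall>L x k. (1 / p) ^ (b + 1) + 1 \<le> real k \<longrightarrow> 1 \<le> k \<longrightarrow> rect j l x (k * b) (k * b) \<subseteq> box0 L \<longrightarrow>
     exp (- (C * ((1 / p) ^ q j * (ln (1 / p))\<^sup>2))) \<le> Pr (box0 L) p (fills q (rect j l x (k * b) (k * b)))"
proof -
  define a where "a = q j"
  \<comment> \<open>About \<open>b * p ^ (- (b + 1))\<close> rows have to succeed and each fails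
    with probability at most \<open>p ^ D\<close>. With \<open>D = b + 2\<close> the expected number
    of failures is of order \<open>p\<close>.\<close>
  define A B D where "A = real a" and "B = real b" and "D = real b + 2"
  have ab': "0 < a" "a < b" using ax ab by (auto simp: a_def two_axes_def)
  have AB: "0 < A" "A + 1 \<le> B" "0 < B" "0 < D" using ab' by (auto simp: A_def B_def D_def)
  \<comment> \<open>The first term is the cost of the strip, the second its rounding, and the 3 pays
    for the factor 1/8 lost in three halvings.\<close>
  define C where "C = A * B * D + A * B + 3"
  define w m where "w p = a * nat \<lceil>D * (1 / p) ^ a * ln (1 / p)\<rceil>" and "m p = nat \<lceil>(1 / p) ^ (b + 1)\<rceil>" for p :: real
  have E1: "\<forall>\<^sub>F h in at_top. B * (exp ((B + 1) * h) + 1) * exp (- (D * h)) \<le> 1/2"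
  proof -
    have eq: "B * (exp ((B + 1) * h) + 1) * exp (- (D * h)) = B * (exp (- h) + exp (- (D * h)))" for h
      by (simp add: D_def B_def distrib_left distrib_right mult.assoc exp_add[symmetric])
    have "\<forall>\<^sub>F h in at_top. B * exp (- h) \<le> 1/4" "\<forall>\<^sub>F h in at_top. B * exp (- (D * h)) \<le> 1/4"
      using AB by real_asymp+
    then show ?thesis unfolding eq by eventually_elim (simp add: distrib_left)
  qed
  have E2: "\<forall>\<^sub>F h in at_top. B * (exp ((B + 1) * h) + 1) * exp (- exp h) \<le> 1/2" using AB by real_asymp
  have E3: "\<forall>\<^sub>F h in at_top. 2 * B * (exp (- exp h) * exp (B * h)) \<le> 1/2" using AB by real_asymp
  have E4: "\<forall>\<^sub>F h in at_top. D * h + 1 \<le> exp h" using AB by real_asymp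
  have E5: "\<forall>\<^sub>F h in at_top. (1::real) \<le> h" by real_asymp
  note ev = eventually_conj[OF E1 eventually_conj[OF E2 eventually_conj[OF E3 eventually_conj[OF E4 E5]]]]
  have "\<forall>\<^sub>F p in at_right 0. \<forall>L x k. (1 / p) ^ (b + 1) + 1 \<le> real k \<longrightarrow> 1 \<le> k \<longrightarrow> rect j l x (k * b) (k * b) \<subseteq> box0 L \<longrightarrow>
     exp (- (C * ((1 / p) ^ q j * (ln (1 / p))\<^sup>2))) \<le> Pr (box0 L) p (fills q (rect j l x (k * b) (k * b)))"
    using eventually_compose_filterlim[OF ev filterlim_ln_inverse] eventually_at_right_0_half
  proof eventually_elim
    case (elim p)
    define h where "h = ln (1 / p)"
    have p: "0 < p" "p \<le> 1" "0 \<le> p" using elim(2) by auto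
    have hs: "B * (exp ((B + 1) * h) + 1) * exp (- (D * h)) \<le> 1/2" "B * (exp ((B + 1) * h) + 1) * exp (- exp h) \<le> 1/2"
      "2 * B * (exp (- exp h) * exp (B * h)) \<le> 1/2" "D * h + 1 \<le> exp h" "1 \<le> h"
      using elim(1) unfolding h_def[symmetric] by auto
    have ph: "p = exp (- h)" using p by (simp add: h_def ln_div)
    have Pn: "(1 / p) ^ n = exp (real n * h)" for n by (simp add: ph exp_minus exp_of_nat_mult[symmetric] field_simps)
    have pn: "p ^ n = exp (- (real n * h))" for n by (simp add: ph exp_of_nat_mult[symmetric])
    define U where "U = exp (A * h)"
    have U1: "1 \<le> U" using AB hs(5) by (simp add: U_def)
    define n where "n = nat \<lceil>D * U * h\<rceil>"
    have wn: "w p = a * n" unfolding w_def n_def U_def A_def Pn h_def by simp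
    have n: "D * U * h \<le> real n" "real n \<le> D * U * h + 1" "1 \<le> n"
      using nat_ceiling_bounds[of "D * U * h"] AB U1 hs(5) by (auto simp: n_def)
    have m: "1 \<le> m p" "real (m p) \<le> exp ((B + 1) * h) + 1" "exp ((B + 1) * h) \<le> real (m p)"
      using nat_ceiling_bounds[of "(1 / p) ^ (b + 1)"] p unfolding m_def Pn by (auto simp: B_def add.commute)
    have mb: "real (m p * b) \<le> B * (exp ((B + 1) * h) + 1)" using m(2) AB by (simp add: B_def mult.commute mult_left_mono)
    have pm: "(1 - p ^ b) ^ m p \<le> exp (- exp h)"
    proof (rule power_one_minus_le_exp)
      have "exp h = exp ((B + 1) * h) * p ^ b" by (simp add: pn B_def exp_add[symmetric] algebra_simps)
      also have "\<dots> \<le> real (m p) * p ^ b" using m(3) p by (intro mult_right_mono) auto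
      finally show "exp h \<le> real (m p) * p ^ b" .
    qed (use p in \<open>auto simp: power_le_one\<close>)
    have wm: "w p \<le> m p * b"
    proof -
      have "D * U * h + 1 \<le> U * (D * h + 1)" using U1 by (simp add: algebra_simps)
      also have "\<dots> \<le> U * exp h" using hs(4) U1 by (intro mult_left_mono) auto
      also have "\<dots> = exp ((A + 1) * h)" by (simp add: U_def exp_add[symmetric] algebra_simps)
      also have "\<dots> \<le> exp ((B + 1) * h)" using AB hs(5) by (simp add: mult_right_mono)
      finally have "real n \<le> real (m p)" using n(2) m(3) by linarith
      then have "n \<le> m p" by simp
      then have "a * n \<le> b * m p" using ab' by (intro mult_mono) auto
      then show ?thesis by (simp add: wn mult.commute)
    qed
    have rows: "real (m p * b) * (1 - p ^ q j) ^ (w p div q j) \<le> 1/2"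
    proof -
      have "w p div q j = n" using ab' by (simp add: wn a_def)
      moreover have "(1 - p ^ a) ^ n \<le> exp (- (D * h))"
      proof (rule power_one_minus_le_exp)
        have "D * h = D * U * h * p ^ a" by (simp add: pn U_def A_def exp_minus)
        also have "\<dots> \<le> real n * p ^ a" using n(1) p by (intro mult_right_mono) auto
        finally show "D * h \<le> real n * p ^ a" .
      qed (use p AB hs(5) in \<open>auto simp: power_le_one\<close>)
      ultimately have "real (m p * b) * (1 - p ^ q j) ^ (w p div q j) \<le> B * (exp ((B + 1) * h) + 1) * exp (- (D * h))"
        using mb p AB by (intro mult_mono) (auto simp: a_def power_le_one)
      with hs(1) show ?thesis by linarith
    qed
    have cols: "real (m p * b) * (1 - p ^ b) ^ m p \<le> 1/2"
    proof -
      have "real (m p * b) * (1 - p ^ b) ^ m p \<le> B * (exp ((B + 1) * h) + 1) * exp (- exp h)"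
        using mb pm p AB by (intro mult_mono) (auto simp: power_le_one)
      with hs(2) show ?thesis by linarith
    qed
    have tail: "2 * real b * ((1 - p ^ b) ^ m p / p ^ b) \<le> 1/2"
    proof -
      have "(1 - p ^ b) ^ m p / p ^ b \<le> exp (- exp h) / p ^ b" using p pm by (intro divide_right_mono) auto
      also have "\<dots> = exp (- exp h) * exp (B * h)" by (simp add: pn B_def exp_minus field_simps)
      finally have "2 * B * ((1 - p ^ b) ^ m p / p ^ b) \<le> 2 * B * (exp (- exp h) * exp (B * h))"
        using AB by (intro mult_left_mono) auto
      with hs(3) show ?thesis by (simp add: B_def)
    qed
    have cost: "exp (- (C * (U * h\<^sup>2))) \<le> p ^ (w p * b) / 4 / 2"
    proof -
      have Uh: "1 \<le> U * h\<^sup>2" "h \<le> U * h\<^sup>2"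
      proof -
        have hh: "h * 1 \<le> h * h" using hs(5) by (intro mult_left_mono) auto
        then have "1 * h \<le> U * h\<^sup>2" using U1 hs(5) by (intro mult_mono) (auto simp: power2_eq_square)
        then show "h \<le> U * h\<^sup>2" "1 \<le> U * h\<^sup>2" using hs(5) by linarith+
      qed
      have "real (w p * b) * h \<le> A * B * (D * U * h + 1) * h"
      proof -
        have "real (w p * b) = A * B * real n" by (simp add: wn A_def B_def)
        also have "\<dots> \<le> A * B * (D * U * h + 1)" using n(2) AB by (intro mult_left_mono) auto
        finally show ?thesis using hs(5) by (intro mult_right_mono) auto
      qed
      also have "\<dots> = A * B * D * (U * h\<^sup>2) + A * B * h" by (simp add: power2_eq_square algebra_simps)
      also have "\<dots> \<le> A * B * D * (U * h\<^sup>2) + A * B * (U * h\<^sup>2)" using Uh AB by (intro add_left_mono mult_left_mono) auto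
      finally have "real (w p * b) * h + 3 \<le> C * (U * h\<^sup>2)" using Uh(1) by (simp add: C_def distrib_right)
      then have "exp (- (C * (U * h\<^sup>2))) \<le> exp (- (real (w p * b) * h) + - 3)" by simp
      also have "\<dots> = p ^ (w p * b) * exp (- 3)" by (simp only: exp_add pn)
      also have "\<dots> \<le> p ^ (w p * b) * (1/8)"
      proof (rule mult_left_mono)
        have "(2::real) ^ 3 \<le> exp 1 ^ 3" using exp_ge_add_one_self[of 1] by (intro power_mono) auto
        then have "8 \<le> exp (3::real)" by (simp add: exp_of_nat_mult[symmetric])
        then show "exp (- 3) \<le> (1/8 :: real)" by (simp add: exp_minus field_simps)
      qed (use p in auto)
      finally show ?thesis by simp
    qed
    have eq: "(1 / p) ^ q j * (ln (1 / p))\<^sup>2 = U * h\<^sup>2" by (simp only: Pn U_def A_def a_def h_def)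
    show ?case
    proof (intro allI impI)
      fix L x k assume k: "(1 / p) ^ (b + 1) + 1 \<le> real k" "1 \<le> k" and sub: "rect j l x (k * b) (k * b) \<subseteq> box0 L"
      have "real (m p) \<le> real k" using m(2) k(1) unfolding Pn by (simp add: B_def add.commute)
      then have mk: "m p \<le> k" by simp
      have wa: "q j \<le> w p" using n(3) by (simp add: wn a_def)
      from square_nucleation_strict[OF finite_box0 p(1,2) ax m(1) mk wa wm rows cols tail sub] cost
      show "exp (- (C * ((1 / p) ^ q j * (ln (1 / p))\<^sup>2))) \<le> Pr (box0 L) p (fills q (rect j l x (k * b) (k * b)))"
        unfolding eq by linarith
    qed
  qed
  moreover have "0 \<le> C" using AB by (simp add: C_def)
  ultimately show ?thesis by blast
qed

section \<open>The model on triples\<close>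

datatype axis = Ax | Ay | Az

lemma UNIV_axis: "UNIV = {Ax, Ay, Az}"
  by (auto intro: axis.exhaust)

instance axis :: finite
  by standard (simp add: UNIV_axis)

definition emb :: "site \<Rightarrow> axis \<Rightarrow> int" where
  "emb s = (case s of (x, y, z) \<Rightarrow> case_axis x y z)"

definition weights :: "nat \<Rightarrow> nat \<Rightarrow> nat \<Rightarrow> axis \<Rightarrow> nat" where
  "weights a b c = case_axis a b c"

lemma emb_simps [simp]: "emb (x, y, z) Ax = x" "emb (x, y, z) Ay = y" "emb (x, y, z) Az = z"
  by (simp_all add: emb_def)

lemma weights_simps [simp]: "weights a b c Ax = a" "weights a b c Ay = b" "weights a b c Az = c"
  by (simp_all add: weights_def)

lemma all_axis: "(\<forall>i. P i) \<longleftrightarrow> P Ax \<and> P Ay \<and> P Az"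
  by (metis axis.exhaust)

lemma inj_emb: "inj emb"
proof (rule injI)
  fix s t assume "emb s = emb t"
  then have "emb s i = emb t i" for i by simp
  then show "s = t" by (cases s; cases t) (metis emb_simps)
qed

lemma surj_emb: "surj emb"
proof (rule surjI)
  fix s :: "axis \<Rightarrow> int"
  show "emb (s Ax, s Ay, s Az) = s" by (simp add: fun_eq_iff all_axis)
qed

lemma emb_upd: "(emb (x, y, z))(Ax := u) = emb (u, y, z)" "(emb (x, y, z))(Ay := u) = emb (x, u, z)"
  "(emb (x, y, z))(Az := u) = emb (x, y, u)"
  by (auto simp: fun_eq_iff all_axis)

lemma emb_mem [simp]: "emb s \<in> emb ` S \<longleftrightarrow> s \<in> S"
  by (rule inj_image_mem_iff[OF inj_emb])

lemma emb_cube: "emb ` cube L = box0 L"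
proof
  show "emb ` cube L \<subseteq> box0 L" by (auto simp: cube_def box0_def all_axis)
  show "box0 L \<subseteq> emb ` cube L"
  proof
    fix s :: "axis \<Rightarrow> int" assume s: "s \<in> box0 L"
    have "s = emb (s Ax, s Ay, s Az)" by (auto simp: fun_eq_iff all_axis)
    moreover have "(s Ax, s Ay, s Az) \<in> cube L" using s by (auto simp: cube_def box0_def)
    ultimately show "s \<in> emb ` cube L" by blast
  qed
qed

lemma finite_cube: "finite (cube L)"
  by (simp add: cube_def)

lemma card_nbhd: "card (nbhd a b c s \<inter> S) = cnt (weights a b c) (emb ` S) (emb s)"
proof -
  obtain x y z where s: "s = (x, y, z)" by (cases s)
  define X Y Z where "X = {k. k \<noteq> 0 \<and> \<bar>k\<bar> \<le> int a \<and> (x + k, y, z) \<in> S}"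
    and "Y = {k. k \<noteq> 0 \<and> \<bar>k\<bar> \<le> int b \<and> (x, y + k, z) \<in> S}" and "Z = {k. k \<noteq> 0 \<and> \<bar>k\<bar> \<le> int c \<and> (x, y, z + k) \<in> S}"
  have fin: "finite X" "finite Y" "finite Z" by (simp_all add: X_def Y_def Z_def)
  have "nbhd a b c s \<inter> S = (\<lambda>k. (x + k, y, z)) ` X \<union> ((\<lambda>k. (x, y + k, z)) ` Y \<union> (\<lambda>k. (x, y, z + k)) ` Z)"
    unfolding nbhd_def s X_def Y_def Z_def by (auto simp: int_one_le_iff_zero_less)
  also have "card \<dots> = card X + (card Y + card Z)"
  proof (subst card_Un_disjoint)
    have "0 \<notin> X" "0 \<notin> Y" by (simp_all add: X_def Y_def)
    then show "(\<lambda>k. (x + k, y, z)) ` X \<inter> ((\<lambda>k. (x, y + k, z)) ` Y \<union> (\<lambda>k. (x, y, z + k)) ` Z) = {}" by auto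
    have "card ((\<lambda>k. (x, y + k, z)) ` Y \<union> (\<lambda>k. (x, y, z + k)) ` Z) = card ((\<lambda>k. (x, y + k, z)) ` Y) + card ((\<lambda>k. (x, y, z + k)) ` Z)"
      using fin \<open>0 \<notin> Y\<close> by (intro card_Un_disjoint) auto
    then show "card ((\<lambda>k. (x + k, y, z)) ` X) + card ((\<lambda>k. (x, y + k, z)) ` Y \<union> (\<lambda>k. (x, y, z + k)) ` Z) = card X + (card Y + card Z)"
      by (simp add: card_image inj_on_def)
  qed (use fin in auto)
  also have "\<dots> = cnt (weights a b c) (emb ` S) (emb s)"
    unfolding cnt_def UNIV_axis s by (simp add: emb_upd X_def Y_def Z_def)
  finally show ?thesis .
qed

lemma sum_weights: "sum (weights a b c) UNIV = a + b + c"
  by (simp add: UNIV_axis)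

lemma closure_least:
  assumes "A \<subseteq> T" "closed_in (weights a b c) (box0 L) (emb ` T)"
  shows "bp_closure a b c L A \<subseteq> T"
proof -
  have "(bp_step a b c L ^^ n) A \<subseteq> T" for n
  proof (induction n)
    case (Suc n)
    let ?S = "(bp_step a b c L ^^ n) A"
    have "s \<in> T" if "s \<in> cube L" "a + b + c \<le> card (nbhd a b c s \<inter> ?S)" for s
    proof -
      have "a + b + c \<le> cnt (weights a b c) (emb ` T) (emb s)"
        using that(2) cnt_mono[OF image_mono[OF Suc.IH], of "weights a b c" emb "emb s"] by (simp add: card_nbhd)
      then have "emb s \<in> emb ` T" using that(1) emb_cube by (intro closed_inD[OF assms(2)]) (auto simp: sum_weights)
      then show ?thesis by simp
    qed
    then have "bp_step a b c L ?S \<subseteq> T" using Suc.IH unfolding bp_step_def by blast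
    then show ?case by simp
  qed (use assms(1) in simp)
  then show ?thesis by (auto simp: bp_closure_def)
qed

text \<open>A neighbourhood contains finitely many occupied sites, so all of them are present at
  some finite stage and the next stage occupies the site.\<close>

lemma closure_closed: "closed_in (weights a b c) (box0 L) (emb ` bp_closure a b c L A)"
  unfolding closed_in_def
proof (intro ballI impI)
  fix t assume t: "t \<in> box0 L" "sum (weights a b c) UNIV \<le> cnt (weights a b c) (emb ` bp_closure a b c L A) t"
  let ?S = "\<lambda>n. (bp_step a b c L ^^ n) A"
  obtain s where s: "t = emb s" "s \<in> cube L" using t(1) emb_cube by blast
  have le: "a + b + c \<le> card (nbhd a b c s \<inter> bp_closure a b c L A)" using t(2) by (simp add: s card_nbhd sum_weights)
  have mono: "?S m \<subseteq> ?S n" if "m \<le> n" for m n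
    using that by (rule lift_Suc_mono_le[of ?S, rotated]) (auto simp: bp_step_def)
  have fin: "finite X \<Longrightarrow> X \<subseteq> bp_closure a b c L A \<Longrightarrow> \<exists>n. X \<subseteq> ?S n" for X
  proof (induction X rule: finite_induct)
    case (insert x X)
    then obtain m n where "X \<subseteq> ?S m" "x \<in> ?S n" by (auto simp: bp_closure_def)
    then have "insert x X \<subseteq> ?S (max m n)" using mono[of m "max m n"] mono[of n "max m n"] by auto
    then show ?case by blast
  qed simp
  \<comment> \<open>Finiteness is read off the cardinality: infinite sets have \<open>card\<close>
    0, so meeting a positive threshold forces a finite set, and a zero threshold means an empty
    neighbourhood.\<close>
  have "finite (nbhd a b c s \<inter> bp_closure a b c L A)"
  proof (cases "a + b + c = 0")
    case True
    then show ?thesis by (cases s) (auto simp: nbhd_def)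
  next
    case False
    then have "0 < card (nbhd a b c s \<inter> bp_closure a b c L A)" using le by linarith
    then show ?thesis by (rule card_ge_0_finite)
  qed
  then obtain n where "nbhd a b c s \<inter> bp_closure a b c L A \<subseteq> ?S n" using fin by blast
  then have eq: "nbhd a b c s \<inter> bp_closure a b c L A = nbhd a b c s \<inter> ?S n" by (auto simp: bp_closure_def)
  have "s \<in> ?S (Suc n)" using le s(2) unfolding eq by (simp add: bp_step_def)
  then have "s \<in> bp_closure a b c L A" unfolding bp_closure_def by blast
  then show "t \<in> emb ` bp_closure a b c L A" by (simp add: s)
qed

lemma span_prob_eq: "span_prob a b c L p = Pr (cube L) p (internally_spanned a b c L)"
  unfolding span_prob_def Pr_def
proof (rule sum.cong)
  fix A assume "A \<in> {A. A \<subseteq> cube L \<and> internally_spanned a b c L A}"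
  then show "p ^ card A * (1 - p) ^ (card (cube L) - card A) = p ^ card A * (1 - p) ^ card (cube L - A)"
    using card_Diff_subset[of A "cube L"] finite_subset[OF _ finite_cube, of A L] by simp
qed simp

lemma spanned_imp_cl:
  assumes "internally_spanned a b c L A"
  shows "box0 L \<subseteq> cl (weights a b c) (emb ` A)"
proof -
  let ?T = "emb -` cl (weights a b c) (emb ` A)"
  have eT: "emb ` ?T = cl (weights a b c) (emb ` A)" using surj_emb by (rule surj_image_vimage_eq)
  have "A \<subseteq> ?T" using cl_superset by blast
  moreover have "closed_in (weights a b c) (box0 L) (emb ` ?T)" unfolding eT
    using cl_closed by (auto simp: closed_in_def)
  ultimately have "bp_closure a b c L A \<subseteq> ?T" by (rule closure_least)
  then have "cube L \<subseteq> ?T" using assms unfolding internally_spanned_def by blast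
  then have "emb ` cube L \<subseteq> emb ` ?T" by (rule image_mono)
  then show ?thesis unfolding eT emb_cube .
qed

lemma fills_imp_spanned:
  assumes "fills (weights a b c) (box0 L) (emb ` A)"
  shows "internally_spanned a b c L A"
proof -
  have "A \<subseteq> bp_closure a b c L A" unfolding bp_closure_def using UN_upper[of "0::nat" UNIV "\<lambda>n. (bp_step a b c L ^^ n) A"] by simp
  then have "emb ` A \<inter> box0 L \<subseteq> emb ` bp_closure a b c L A" by blast
  then have "box0 L \<subseteq> emb ` bp_closure a b c L A"
    using assms closure_closed unfolding fills_def by blast
  then have "emb ` cube L \<subseteq> emb ` bp_closure a b c L A" unfolding emb_cube .
  then show ?thesis by (simp add: internally_spanned_def inj_image_subset_iff[OF inj_emb])
qed

lemma Pr_emb_image: "Pr (cube L) p (\<lambda>A. E (emb ` A)) = Pr (box0 L) p E"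
  using Pr_image[OF inj_on_subset[OF inj_emb subset_UNIV] finite_cube] by (simp add: emb_cube)

lemma span_prob_le:
  assumes "0 \<le> p" "p \<le> 1"
  shows "span_prob a b c L p \<le> Pr (box0 L) p (\<lambda>A. box0 L \<subseteq> cl (weights a b c) A)"
  unfolding span_prob_eq Pr_emb_image[symmetric]
  by (rule Pr_mono[OF finite_cube assms]) (rule spanned_imp_cl)

lemma span_prob_ge:
  assumes "0 \<le> p" "p \<le> 1"
  shows "1 - Pr (box0 L) p (\<lambda>A. \<not> fills (weights a b c) (box0 L) A) \<le> span_prob a b c L p"
proof -
  have "1 - Pr (box0 L) p (\<lambda>A. \<not> fills (weights a b c) (box0 L) A) = Pr (box0 L) p (fills (weights a b c) (box0 L))"
    by (simp add: Pr_Not)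
  also have "\<dots> \<le> span_prob a b c L p"
    unfolding span_prob_eq Pr_emb_image[symmetric]
    by (rule Pr_mono[OF finite_cube assms]) (rule fills_imp_spanned)
  finally show ?thesis .
qed

section \<open>Assembling the theorem\<close>

definition rate :: "nat \<Rightarrow> nat \<Rightarrow> real \<Rightarrow> real" where
  "rate a b x = (if a = b then x ^ a else x ^ a * (ln x)\<^sup>2)"

lemma rate_ge_inverse:
  assumes "0 < a"
  shows "\<forall>\<^sub>F p in at_right 0. 1 / p \<le> rate a b (1 / p)"
proof -
  have "\<forall>\<^sub>F x::real in at_top. 1 \<le> x \<and> 1 \<le> (ln x)\<^sup>2"
    by (intro eventually_conj eventually_ge_at_top) real_asymp
  then have "\<forall>\<^sub>F x::real in at_top. x \<le> rate a b x"
  proof eventually_elim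
    case (elim x)
    have "x \<le> x ^ a" using elim assms by (intro self_le_power) auto
    moreover have "x ^ a * 1 \<le> x ^ a * (ln x)\<^sup>2" using elim by (intro mult_left_mono) auto
    ultimately have "x \<le> x ^ a" "x \<le> x ^ a * (ln x)\<^sup>2" by linarith+
    then show ?case by (auto simp: rate_def)
  qed
  moreover have "filterlim (\<lambda>p::real. 1 / p) at_top (at_right 0)" by real_asymp
  ultimately show ?thesis by (rule eventually_compose_filterlim)
qed

text \<open>Projecting along the first axis leaves the weights \<open>b\<close> and
  \<open>c\<close>, with rate \<open>(1 / p) ^ b\<close>, which eventually dominates
  \<open>rate a b\<close>. Projecting along another axis leaves \<open>a\<close> and a weight at
  least \<open>b\<close>; if \<open>a = b\<close> the rate without logarithms is all that is asked
  for, and otherwise the inequality of weights is strict.\<close>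

lemma good_rates_weights:
  assumes "0 < a" "a \<le> b" "b \<le> c"
  shows "\<exists>\<kappa>>0. good_rates (weights a b c) (2 * (a + b + c)) i (\<lambda>p. rate a b (1 / p)) \<kappa>"
proof -
  let ?r = "weights a b c" and ?K = "2 * (a + b + c)"
  let ?F = "\<lambda>p. rate a b (1 / p)"
  have pos: "0 < ?r k" for k using assms by (cases k) auto
  have K: "2 * ?r k \<le> ?K" for k by (cases k) auto
  have K1: "1 \<le> ?K" using assms by simp
  have axes: "UNIV = {Az, Ax, Ay}" "UNIV = {Ay, Ax, Az}" by (auto simp: UNIV_axis)
  have ax: "\<exists>\<kappa>>0. good_rates ?r ?K Ax ?F \<kappa>"
  proof -
    obtain \<kappa> where k: "0 < \<kappa>" "good_rates ?r ?K Ax (\<lambda>p. (1 / p) ^ b) \<kappa>"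
      using good_rates_simple[where r = ?r and i = Ax, OF UNIV_axis _ _ _ pos K K1] assms(3) by auto
    have "\<forall>\<^sub>F x in at_top. rate a b x \<le> x ^ b"
    proof (cases "a = b")
      case False
      have "\<forall>\<^sub>F x::real in at_top. 1 \<le> x \<and> (ln x)\<^sup>2 \<le> x"
        by (intro eventually_conj eventually_ge_at_top) real_asymp
      then show ?thesis
      proof eventually_elim
        case (elim x)
        have "x ^ a * (ln x)\<^sup>2 \<le> x ^ a * x" using elim by (intro mult_left_mono) auto
        also have "\<dots> = x ^ Suc a" by simp
        also have "\<dots> \<le> x ^ b" using False assms(2) elim by (intro power_increasing) auto
        finally show ?case using False by (simp add: rate_def)
      qed
    qed (simp add: rate_def)
    moreover have "filterlim (\<lambda>p::real. 1 / p) at_top (at_right 0)" by real_asymp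
    ultimately have "\<forall>\<^sub>F p in at_right 0. rate a b (1 / p) \<le> (1 / p) ^ b" by (rule eventually_compose_filterlim)
    with eventually_at_right_0_half have "\<forall>\<^sub>F p in at_right 0. 0 \<le> (1 / p) ^ b \<and> ?F p \<le> 1 * (1 / p) ^ b"
      by eventually_elim simp
    then have "good_rates ?r ?K Ax ?F \<kappa>" using k(1) by (intro good_rates_mono[OF k(2), of \<kappa> 1]) auto
    with k(1) show ?thesis by blast
  qed
  have other: "\<exists>\<kappa>>0. good_rates ?r ?K k ?F \<kappa>" if k: "UNIV = {k, Ax, l}" "k \<noteq> Ax" "k \<noteq> l" "Ax \<noteq> l" and bl: "b \<le> ?r l" for k l
  proof (cases "a = b")
    case True
    then show ?thesis using good_rates_simple[where r = ?r, OF k pos K K1] bl by (simp add: rate_def)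
  next
    case False
    then show ?thesis using good_rates_strict[where r = ?r, OF k pos K K1] bl assms(2) by (simp add: rate_def)
  qed
  show ?thesis
  proof (cases i)
    case Ax then show ?thesis using ax by simp
  next
    case Ay then show ?thesis using other[OF axes(2)] assms(3) by simp
  next
    case Az then show ?thesis using other[OF axes(1)] by simp
  qed
qed

lemma span_prob_tendsto_0:
  assumes "0 < a" "a \<le> b" "b \<le> c"
  shows "\<exists>\<gamma>>0. \<forall>L :: real \<Rightarrow> nat. (\<forall>\<^sub>F p in at_right 0. real (L p) < exp (exp (\<gamma> * rate a b (1 / p)))) \<longrightarrow>
    ((\<lambda>p. span_prob a b c (L p) p) \<longlongrightarrow> 0) (at_right 0)"
proof -
  let ?r = "weights a b c" and ?K = "2 * (a + b + c)" and ?F = "\<lambda>p. rate a b (1 / p)"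
  obtain \<kappa> where k: "\<And>i. 0 < \<kappa> i" "\<And>i. good_rates ?r ?K i ?F (\<kappa> i)"
    using good_rates_weights[OF assms] by metis
  define \<mu> where "\<mu> = Min (range \<kappa>)"
  have mu: "0 < \<mu>" "\<mu> \<le> \<kappa> i" for i using k(1) by (auto simp: \<mu>_def)
  have ge: "\<forall>\<^sub>F p in at_right 0. 1 / p \<le> ?F p" by (rule rate_ge_inverse[OF assms(1)])
  have nonneg: "\<forall>\<^sub>F p in at_right 0. 0 \<le> ?F p \<and> ?F p \<le> 1 * ?F p"
    using ge eventually_at_right_0_half
  proof eventually_elim
    case (elim p)
    then have "0 \<le> 1 / p" by simp
    with elim show ?case by linarith
  qed
  have good: "good_rates ?r ?K i ?F \<mu>" for i
    using mu by (intro good_rates_mono[OF k(2), of _ 1, OF _ nonneg]) (auto intro: less_imp_le)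
  have top: "filterlim ?F at_top (at_right 0)"
  proof (rule filterlim_at_top_mono[OF _ ge])
    show "filterlim (\<lambda>p::real. 1 / p) at_top (at_right 0)" by real_asymp
  qed
  have pos: "0 < ?r i" for i using assms by (cases i) auto
  have K: "2 * ?r i \<le> ?K" for i by (cases i) auto
  have K1: "1 \<le> ?K" using assms by simp
  have card3: "CARD(axis) = 3" by (simp add: UNIV_axis)
  have "((\<lambda>p. span_prob a b c (L p) p) \<longlongrightarrow> 0) (at_right 0)"
    if L: "\<forall>\<^sub>F p in at_right 0. real (L p) < exp (exp (\<mu> / 12 * ?F p))" for L
  proof (rule tendsto_sandwich[OF _ _ tendsto_const])
    show "((\<lambda>p. Pr (box0 (L p)) p (\<lambda>A. box0 (L p) \<subseteq> cl ?r A)) \<longlongrightarrow> 0) (at_right 0)"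
      by (rule lower_bound_general[OF pos card3 K K1 mu(1) good top L])
    show "\<forall>\<^sub>F p in at_right 0. span_prob a b c (L p) p \<le> Pr (box0 (L p)) p (\<lambda>A. box0 (L p) \<subseteq> cl ?r A)"
      using eventually_at_right_0_half by eventually_elim (auto intro: span_prob_le)
    show "\<forall>\<^sub>F p in at_right 0. 0 \<le> span_prob a b c (L p) p"
      using eventually_at_right_0_half by eventually_elim (auto simp: span_prob_eq intro: Pr_nonneg)
  qed
  then show ?thesis using mu(1) by (intro exI[of _ "\<mu> / 12"]) auto
qed

lemma span_prob_tendsto_1:
  assumes "0 < a" "a \<le> b" "b \<le> c"
  shows "\<exists>\<Gamma>>0. \<forall>L :: real \<Rightarrow> nat. (\<forall>\<^sub>F p in at_right 0. exp (exp (\<Gamma> * rate a b (1 / p))) < real (L p)) \<longrightarrow>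
    ((\<lambda>p. span_prob a b c (L p) p) \<longlongrightarrow> 1) (at_right 0)"
proof -
  let ?r = "weights a b c" and ?F = "\<lambda>p. rate a b (1 / p)"
  have axes: "UNIV = {Az, Ax, Ay}" by (auto simp: UNIV_axis)
  have two: "two_axes (?r(Az := 0)) Ax Ay b" using assms by (auto simp: two_axes_def all_axis)
  \<comment> \<open>\<open>K0\<close> is the number of units a square must have before the sharp
    nucleation bound applies: none for equal weights, and for unequal weights the length to which
    the starting strip has to grow.\<close>
  obtain C and K0 :: "real \<Rightarrow> real" where C: "0 \<le> C" and K0: "\<forall>\<^sub>F p in at_right 0. K0 p \<le> exp (1 / p) - 1"
    and sharp: "\<forall>\<^sub>F p in at_right 0. \<forall>L x k. K0 p \<le> real k \<longrightarrow> 1 \<le> k \<longrightarrow> rect Ax Ay x (k * ?r Ay) (k * ?r Ay) \<subseteq> box0 L \<longrightarrow>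
      exp (- (C * ?F p)) \<le> Pr (box0 L) p (fills (?r(Az := 0)) (rect Ax Ay x (k * ?r Ay) (k * ?r Ay)))"
  proof (cases "a = b")
    case True
    show ?thesis
    proof (rule that[of "real (b * b) + 24 * real b" "\<lambda>_. 0"])
      show "\<forall>\<^sub>F p in at_right 0. (0::real) \<le> exp (1 / p) - 1"
        using eventually_at_right_0_half by eventually_elim auto
      show "\<forall>\<^sub>F p in at_right 0. \<forall>L x k. 0 \<le> real k \<longrightarrow> 1 \<le> k \<longrightarrow> rect Ax Ay x (k * ?r Ay) (k * ?r Ay) \<subseteq> box0 L \<longrightarrow>
        exp (- ((real (b * b) + 24 * real b) * ?F p)) \<le> Pr (box0 L) p (fills (?r(Az := 0)) (rect Ax Ay x (k * ?r Ay) (k * ?r Ay)))"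
        using eventually_at_right_0_half
      proof eventually_elim
        case (elim p)
        then show ?case using nucleation_rate_equal[OF two, of p] True by (auto simp: rate_def)
      qed
    qed simp
  next
    case False
    have Ax_weight: "(?r(Az := 0)) Ax = a" by simp
    then have "(?r(Az := 0)) Ax < b" using False assms(2) by simp
    from nucleation_rate_strict[OF two this] obtain C where C: "0 \<le> C"
      "\<forall>\<^sub>F p in at_right 0. \<forall>L x k. (1 / p) ^ (b + 1) + 1 \<le> real k \<longrightarrow> 1 \<le> k \<longrightarrow> rect Ax Ay x (k * b) (k * b) \<subseteq> box0 L \<longrightarrow>
       exp (- (C * ((1 / p) ^ a * (ln (1 / p))\<^sup>2))) \<le> Pr (box0 L) p (fills (?r(Az := 0)) (rect Ax Ay x (k * b) (k * b)))"
      unfolding Ax_weight by (elim exE conjE)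
    show ?thesis
    proof (rule that[OF C(1)])
      show "\<forall>\<^sub>F p::real in at_right 0. (1 / p) ^ (b + 1) + 1 \<le> exp (1 / p) - 1"
      proof (rule eventually_compose_filterlim[where P = "\<lambda>x. x ^ (b + 1) + 1 \<le> exp x - 1"])
        show "\<forall>\<^sub>F x::real in at_top. x ^ (b + 1) + 1 \<le> exp x - 1" by real_asymp
        show "filterlim (\<lambda>p::real. 1 / p) at_top (at_right 0)" by real_asymp
      qed
      show "\<forall>\<^sub>F p in at_right 0. \<forall>L x k. (1 / p) ^ (b + 1) + 1 \<le> real k \<longrightarrow> 1 \<le> k \<longrightarrow> rect Ax Ay x (k * ?r Ay) (k * ?r Ay) \<subseteq> box0 L \<longrightarrow>
       exp (- (C * ?F p)) \<le> Pr (box0 L) p (fills (?r(Az := 0)) (rect Ax Ay x (k * ?r Ay) (k * ?r Ay)))"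
        using C(2) False by (simp add: rate_def)
    qed
  qed
  have pos: "0 < ?r i" for i using assms by (cases i) auto
  have "((\<lambda>p. span_prob a b c (L p) p) \<longlongrightarrow> 1) (at_right 0)"
    if L: "\<forall>\<^sub>F p in at_right 0. exp (exp (24 * (C + 1) * ?F p)) < real (L p)" for L
  proof (rule tendsto_sandwich[OF _ _ _ tendsto_const])
    have "((\<lambda>p. Pr (box0 (L p)) p (\<lambda>A. \<not> fills ?r (box0 (L p)) A)) \<longlongrightarrow> 0) (at_right 0)"
      using assms by (intro upper_bound_general[OF axes _ _ _ pos _ _ C rate_ge_inverse[OF assms(1)] K0 sharp L]) auto
    from tendsto_diff[OF tendsto_const this]
    show "((\<lambda>p. 1 - Pr (box0 (L p)) p (\<lambda>A. \<not> fills ?r (box0 (L p)) A)) \<longlongrightarrow> 1) (at_right 0)" by simp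
    show "\<forall>\<^sub>F p in at_right 0. 1 - Pr (box0 (L p)) p (\<lambda>A. \<not> fills ?r (box0 (L p)) A) \<le> span_prob a b c (L p) p"
      using eventually_at_right_0_half by eventually_elim (auto intro: span_prob_ge)
    show "\<forall>\<^sub>F p in at_right 0. span_prob a b c (L p) p \<le> 1"
      using eventually_at_right_0_half by eventually_elim (auto simp: span_prob_eq finite_cube intro: Pr_le_1)
  qed
  then show ?thesis using C by (intro exI[of _ "24 * (C + 1)"]) auto
qed

theorem theorem1:
  fixes a b c :: nat
  assumes "0 < a" and "a \<le> b" and "b \<le> c"
  shows "\<exists>(\<gamma>::real) (\<Gamma>::real) (f::real \<Rightarrow> real).
           0 < \<gamma> \<and> 0 < \<Gamma> \<and>
           (a = b \<longrightarrow> f \<sim>[at_top] (\<lambda>x. x ^ a)) \<and>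
           (a < b \<longrightarrow> f \<sim>[at_top] (\<lambda>x. x ^ a * (ln x)\<^sup>2)) \<and>
           (\<forall>L :: real \<Rightarrow> nat.
              (\<forall>\<^sub>F p in at_right 0. real (L p) < exp (exp (\<gamma> * f (1 / p)))) \<longrightarrow>
              ((\<lambda>p. span_prob a b c (L p) p) \<longlongrightarrow> 0) (at_right 0)) \<and>
           (\<forall>L :: real \<Rightarrow> nat.
              (\<forall>\<^sub>F p in at_right 0. real (L p) > exp (exp (\<Gamma> * f (1 / p)))) \<longrightarrow>
              ((\<lambda>p. span_prob a b c (L p) p) \<longlongrightarrow> 1) (at_right 0))"
proof -
  obtain \<gamma> where g: "0 < \<gamma>" "\<forall>L :: real \<Rightarrow> nat. (\<forall>\<^sub>F p in at_right 0. real (L p) < exp (exp (\<gamma> * rate a b (1 / p)))) \<longrightarrow>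
    ((\<lambda>p. span_prob a b c (L p) p) \<longlongrightarrow> 0) (at_right 0)"
    using span_prob_tendsto_0[OF assms] by blast
  obtain \<Gamma> where G: "0 < \<Gamma>" "\<forall>L :: real \<Rightarrow> nat. (\<forall>\<^sub>F p in at_right 0. exp (exp (\<Gamma> * rate a b (1 / p))) < real (L p)) \<longrightarrow>
    ((\<lambda>p. span_prob a b c (L p) p) \<longlongrightarrow> 1) (at_right 0)"
    using span_prob_tendsto_1[OF assms] by blast
  \<comment> \<open>\<open>f\<close> is taken to be the main term itself, so both asymptotic
    equivalences are reflexive.\<close>
  have eq: "a = b \<longrightarrow> rate a b \<sim>[at_top] (\<lambda>x. x ^ a)" "a < b \<longrightarrow> rate a b \<sim>[at_top] (\<lambda>x. x ^ a * (ln x)\<^sup>2)"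
    by (simp_all add: rate_def[abs_def])
  show ?thesis
    by (rule exI[of _ \<gamma>], rule exI[of _ \<Gamma>], rule exI[of _ "rate a b"], intro conjI) (fact g G eq)+
qed

end
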